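(* Let $\mu$ be a Borel measure on $\mathbb{R}^n$ and $(s_t)_{t>0}$ a family of kernels satisfying the standing assumptions (power bound, size and continuity), with associated conical and vertical square functions $S$ and $V$. (S) If $S$ is bounded on $L^2(\mu)$, then $S$ is also a bounded mapping $L^1(\mu)\to L^{1,\infty}(\mu)$ and $L^\infty(\mu)\to\mathrm{RBMO}(\mu)$. Consequently, $S$ is bounded on $L^p(\mu)$ for all $1<p<\infty$. (V) If $V$ is bounded on $L^2(\mu)$, then $V$ is also a bounded mapping $L^1(\mu)\to L^{1,\infty}(\mu)$. Consequently, $V$ is bounded on $L^p(\mu)$ for all $1<p\le 2$. However, $V$ need not map $L^p(\mu)\to L^p(\mu)$ boundedly for any $p>2$, even for Lebesgue measure: there exist kernels satisfying the standing assumptions with respect to Lebesgue measure $\mu=dx$ on $\mathbb{R}$ such that $V$ is bounded on $L^2(dx)$ but $V$ does not map $L^p(dx)$ to $L^p(dx)$ boundedly for any $p>2$.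
   Context: Standing assumptions: fix $n\ge 1$, $m>0$, $\alpha>0$. The Borel measure $\mu$ on $\mathbb{R}^n$ (not necessarily doubling) satisfies $\mu(B(x,r))\lesssim r^m$ for all $x\in\mathbb{R}^n$, $r>0$. The (measurable, complex-valued) kernels $s_t(x,y)$, $t>0$, satisfy $|s_t(x,y)|\lesssim \frac{t^\alpha}{(t+|x-y|)^{m+\alpha}}$ for all $x,y$, and $|s_t(x,y)-s_t(x,z)|\lesssim\frac{|y-z|^\alpha}{(t+|x-y|)^{m+\alpha}}$ whenever $|y-z|<t/2$. No regularity in the first variable is assumed. (For Lebesgue measure on $\mathbb{R}$, $n=m=1$.) Set $\theta_tf(x)=\int_{\mathbb{R}^n}s_t(x,y)f(y)\,d\mu(y)$, $$Sf(x)=\left(\iint_{\Gamma(x)}|\theta_tf(y)|^2\,\frac{d\mu(y)\,dt}{t^{m+1}}\right)^{1/2},\qquad Vf(x)=\left(\int_0^\infty|\theta_tf(x)|^2\frac{dt}{t}\right)^{1/2},$$ where $\Gamma(x)=\{(y,t)\in\mathbb{R}^n\times(0,\infty):|x-y|<t\}$. $A\lesssim B$ means $A\le CB$ for a finite constant $C$ independent of the variable quantities. $\mathrm{RBMO}(\mu)$ (Tolsa's regularized BMO): a locally $\mu$-integrable function $g$ belongs to $\mathrm{RBMO}(\mu)$ if, for a fixed dilation constant $\kappa>1$ (different choices give the same space with comparable norms), there are a constant $A$ and a number $g_B$ for every ball $B\subset\mathbb{R}^n$ such that $\int_B|g-g_B|\,d\mu\le A\,\mu(\kappa B)$ for every ball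 $B$, and $|g_R-g_B|\le A\left(1+\int_{\kappa R\setminus B}\frac{d\mu(y)}{|y-a|^m}\right)$ for all balls $B\subset R$, where $a$ is the center of $B$. The norm $\|g\|_{\mathrm{RBMO}(\mu)}$ is the infimum of admissible $A$. Boundedness $L^\infty(\mu)\to\mathrm{RBMO}(\mu)$ means $\|Sf\|_{\mathrm{RBMO}(\mu)}\lesssim\|f\|_{L^\infty(\mu)}$.
   Formalization: Sf may be identically infinite for bounded f, so L^∞→RBMO boundedness is stated as: for each bounded f, either Sf=∞ a.e., or Sf is finite a.e. and satisfies the RBMO bound with a uniform constant. The counterexample for V is given for every exponent 0<α≤1 (for α>1 the kernels vanish). *)

theory Defs
  imports "HOL-Analysis.Analysis" "HOL-Probability.Essential_Supremum"
begin

definition power_bounded :: "real \<Rightarrow> 'a::euclidean_space measure \<Rightarrow> bool" where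
  "power_bounded m \<mu> \<longleftrightarrow> sets \<mu> = sets borel \<and>
     (\<exists>C. \<forall>x. \<forall>r>0. emeasure \<mu> (ball x r) \<le> ennreal (C * r powr m))"

text \<open>Kernels \<open>s t x y\<close> matter only for \<open>t > 0\<close>. Measurability is joint in \<open>(t, x, y)\<close>, which makes
  the functions \<open>\<theta>\<close>, \<open>conical\<close> and \<open>vertical\<close> below Borel measurable.
  If \<open>\<alpha> > 1\<close>, the smoothness condition in \<open>y\<close> makes each \<open>s t x\<close> locally constant, hence constant,
  and the size condition then gives \<open>s t x y = 0\<close>; nontrivial examples need \<open>\<alpha> \<le> 1\<close>.\<close>

definition standard_kernels ::
    "real \<Rightarrow> real \<Rightarrow> (real \<Rightarrow> 'a::euclidean_space \<Rightarrow> 'a \<Rightarrow> complex) \<Rightarrow> bool" where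
  "standard_kernels m \<alpha> s \<longleftrightarrow>
     set_borel_measurable borel ({0<..} \<times> UNIV) (\<lambda>(t, x, y). s t x y) \<and>
     (\<exists>C. \<forall>t>0. \<forall>x y. norm (s t x y) \<le> C * (t powr \<alpha> / (t + dist x y) powr (m + \<alpha>))) \<and>
     (\<exists>C. \<forall>t>0. \<forall>x y z. dist y z < t / 2 \<longrightarrow>
        norm (s t x y - s t x z) \<le> C * (dist y z powr \<alpha> / (t + dist x y) powr (m + \<alpha>)))"

definition standing_assumptions ::
    "real \<Rightarrow> real \<Rightarrow> 'a::euclidean_space measure \<Rightarrow> (real \<Rightarrow> 'a \<Rightarrow> 'a \<Rightarrow> complex) \<Rightarrow> bool" where
  "standing_assumptions m \<alpha> \<mu> s \<longleftrightarrow>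
     0 < m \<and> 0 < \<alpha> \<and> power_bounded m \<mu> \<and> standard_kernels m \<alpha> s"

text \<open>Square functions take values in \<open>[0, \<infinity>]\<close>.\<close>

definition epowr :: "ennreal \<Rightarrow> real \<Rightarrow> ennreal" where
  "epowr x a = (if x = \<infinity> then \<infinity> else ennreal (enn2real x powr a))"

text \<open>For \<open>f\<close> in some \<open>L\<^sup>p\<close> with \<open>1 \<le> p \<le> \<infinity>\<close>, the size condition and the power bound make the following
  integral absolutely convergent, so that the default value of the Bochner integral plays no role.\<close>

definition \<theta> :: "'a::euclidean_space measure \<Rightarrow> (real \<Rightarrow> 'a \<Rightarrow> 'a \<Rightarrow> complex) \<Rightarrow>
    real \<Rightarrow> ('a \<Rightarrow> complex) \<Rightarrow> 'a \<Rightarrow> complex" where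
  "\<theta> \<mu> s t f x = (\<integral>y. s t x y * f y \<partial>\<mu>)"

definition cone_over :: "'a::euclidean_space \<Rightarrow> ('a \<times> real) set" where
  "cone_over x = {(y, t). 0 < t \<and> dist x y < t}"

definition conical :: "real \<Rightarrow> 'a::euclidean_space measure \<Rightarrow> (real \<Rightarrow> 'a \<Rightarrow> 'a \<Rightarrow> complex) \<Rightarrow>
    ('a \<Rightarrow> complex) \<Rightarrow> 'a \<Rightarrow> ennreal" where
  "conical m \<mu> s f x = epowr
     (\<integral>\<^sup>+(y, t)\<in>cone_over x. ennreal ((norm (\<theta> \<mu> s t f y))\<^sup>2 / t powr (m + 1)) \<partial>(\<mu> \<Otimes>\<^sub>M lborel)) (1 / 2)"

definition vertical :: "'a::euclidean_space measure \<Rightarrow> (real \<Rightarrow> 'a \<Rightarrow> 'a \<Rightarrow> complex) \<Rightarrow>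
    ('a \<Rightarrow> complex) \<Rightarrow> 'a \<Rightarrow> ennreal" where
  "vertical \<mu> s f x = epowr
     (\<integral>\<^sup>+t\<in>{0<..}. ennreal ((norm (\<theta> \<mu> s t f x))\<^sup>2 / t) \<partial>lborel) (1 / 2)"

text \<open>The exponent is extended: \<open>p = \<infinity>\<close> is the essential supremum.\<close>

definition Lp_norm :: "'a measure \<Rightarrow> ennreal \<Rightarrow> ('a \<Rightarrow> ennreal) \<Rightarrow> ennreal" where
  "Lp_norm \<mu> p g = (if p = \<infinity> then esssup \<mu> g
     else epowr (\<integral>\<^sup>+x. epowr (g x) (enn2real p) \<partial>\<mu>) (1 / enn2real p))"

definition Lp :: "'a measure \<Rightarrow> ennreal \<Rightarrow> ('a \<Rightarrow> complex) set" where
  "Lp \<mu> p = {f \<in> borel_measurable \<mu>. Lp_norm \<mu> p (\<lambda>x. ennreal (norm (f x))) < \<infinity>}"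

definition bounded_on_Lp ::
    "ennreal \<Rightarrow> 'a measure \<Rightarrow> (('a \<Rightarrow> complex) \<Rightarrow> 'a \<Rightarrow> ennreal) \<Rightarrow> bool" where
  "bounded_on_Lp p \<mu> T \<longleftrightarrow> (\<exists>C::real. \<forall>f\<in>Lp \<mu> p.
     Lp_norm \<mu> p (T f) \<le> ennreal C * Lp_norm \<mu> p (\<lambda>x. ennreal (norm (f x))))"

definition bounded_L1_weak_L1 ::
    "'a measure \<Rightarrow> (('a \<Rightarrow> complex) \<Rightarrow> 'a \<Rightarrow> ennreal) \<Rightarrow> bool" where
  "bounded_L1_weak_L1 \<mu> T \<longleftrightarrow> (\<exists>C::real. \<forall>f\<in>Lp \<mu> 1. \<forall>\<tau>>0.
     ennreal \<tau> * emeasure \<mu> {x \<in> space \<mu>. ennreal \<tau> < T f x}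
       \<le> ennreal C * Lp_norm \<mu> 1 (\<lambda>x. ennreal (norm (f x))))"

text \<open>The numbers \<open>g\<^sub>B\<close> are indexed by the centre and the radius of \<open>B\<close>.\<close>

definition RBMO_admissible ::
    "real \<Rightarrow> real \<Rightarrow> 'a::euclidean_space measure \<Rightarrow> ('a \<Rightarrow> real) \<Rightarrow> real \<Rightarrow> bool" where
  "RBMO_admissible m \<kappa> \<mu> g A \<longleftrightarrow> 0 \<le> A \<and> (\<exists>avg :: 'a \<Rightarrow> real \<Rightarrow> real.
     (\<forall>a. \<forall>r>0. (\<integral>\<^sup>+x\<in>ball a r. ennreal \<bar>g x - avg a r\<bar> \<partial>\<mu>)
        \<le> ennreal A * emeasure \<mu> (ball a (\<kappa> * r))) \<and>
     (\<forall>a b. \<forall>r>0. \<forall>R>0. ball a r \<subseteq> ball b R \<longrightarrow>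
        ennreal \<bar>avg b R - avg a r\<bar> \<le> ennreal A *
          (1 + (\<integral>\<^sup>+y\<in>ball b (\<kappa> * R) - ball a r. ennreal (1 / dist y a powr m) \<partial>\<mu>))))"

definition RBMO_norm ::
    "real \<Rightarrow> real \<Rightarrow> 'a::euclidean_space measure \<Rightarrow> ('a \<Rightarrow> real) \<Rightarrow> ennreal" where
  "RBMO_norm m \<kappa> \<mu> g = Inf (ennreal ` {A. RBMO_admissible m \<kappa> \<mu> g A})"

definition RBMO :: "real \<Rightarrow> real \<Rightarrow> 'a::euclidean_space measure \<Rightarrow> ('a \<Rightarrow> real) set" where
  "RBMO m \<kappa> \<mu> = {g. (\<forall>a r. set_integrable \<mu> (ball a r) g) \<and> (\<exists>A. RBMO_admissible m \<kappa> \<mu> g A)}"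

text \<open>As usual for square functions of bounded functions, \<open>T f\<close> may be identically infinite, and then
  it does not represent an element of \<open>RBMO\<close>. This happens under the assumptions made here: on the
  real line with Lebesgue measure, take \<open>s t x y = \<phi> ((x - y) / t) / t\<close> if \<open>t / 2 < \<bar>x\<bar> < 2 * t\<close> and
  \<open>s t x y = 0\<close> otherwise, where \<open>\<phi>\<close> is a bump function with integral one. The conical square function
  is bounded on \<open>L\<^sup>2\<close>, but that of the constant function one is infinite everywhere. Boundedness from
  \<open>L\<^sup>\<infinity>\<close> to \<open>RBMO\<close> therefore carries the usual dichotomy: \<open>T f\<close> is infinite almost everywhere, or it is
  finite almost everywhere and lies in \<open>RBMO\<close> with the norm estimate.\<close>

definition bounded_Linf_RBMO ::
    "real \<Rightarrow> real \<Rightarrow> 'a::euclidean_space measure \<Rightarrow> (('a \<Rightarrow> complex) \<Rightarrow> 'a \<Rightarrow> ennreal) \<Rightarrow> bool" where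
  "bounded_Linf_RBMO m \<kappa> \<mu> T \<longleftrightarrow> (\<exists>C::real. \<forall>f\<in>Lp \<mu> \<infinity>.
     (AE x in \<mu>. T f x = \<infinity>) \<or>
     ((AE x in \<mu>. T f x < \<infinity>) \<and> (\<lambda>x. enn2real (T f x)) \<in> RBMO m \<kappa> \<mu> \<and>
      RBMO_norm m \<kappa> \<mu> (\<lambda>x. enn2real (T f x))
        \<le> ennreal C * Lp_norm \<mu> \<infinity> (\<lambda>x. ennreal (norm (f x)))))"

end

theory Submission
  imports Defs
begin

text \<open>
  The positive results are proved for measures \<open>\<mu>\<close> of power growth, without the doubling property, along
  the lines of Calderon--Zygmund theory. Both square functions have the form \<open>norm2 (\<omega> x) (T f)\<close>, where
  \<open>\<omega> x\<close> is a measure on the cone over \<open>x\<close> whose marginal in \<open>t\<close> is dominated by \<open>dt / t\<close>; a square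
  function of this kind satisfies the triangle inequality and is controlled by radial bounds on the
  integrand (\<open>sq_radial_le\<close>).

  Weak type (1,1). It suffices to consider finite sums of point masses, which approximate integrable
  functions because the kernel is continuous in its second variable (\<open>approximate_by_point_masses\<close>).
  Around each point \<open>x\<close> one stops at the scale \<open>\<rho>\<close> at which the masses cease to be dense compared with
  the height \<open>\<tau>\<close>, and among the larger balls around \<open>x\<close> one chooses one that nearly maximises
  \<open>\<mu>(B(x,r)) / r\<^sup>m\<^sup>+\<^sup>1\<close>. This ball dominates the measure of all larger ones polynomially, as if \<open>\<mu>\<close> were
  doubling, and the measure of all smaller ones with a gain, which makes the integral of
  \<open>|x - y|\<^sup>-\<^sup>m\<close> over the shell between the two scales bounded. The point masses are spread over subsets of
  these balls greedily such that the resulting density stays below a multiple of \<open>\<tau>\<close>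
  (\<open>CZ_decomposition\<close>). The spread masses are handled on \<open>L\<^sup>2\<close>, the differences are integrable off a small
  set (\<open>atom_estimate\<close>), and this gives \<open>weak_type_L1\<close>. The range \<open>1 < p < 2\<close> follows by interpolation
  (\<open>strong_type_below_2\<close>).

  RBMO. For the conical square function of a bounded function, the number that belongs to a ball
  \<open>B(a,r)\<close> is the square function at the centre \<open>a\<close> truncated to heights above \<open>r\<close>. Cones over points at
  distance at most \<open>r\<close> differ above height \<open>r\<close> by a set of bounded measure (\<open>cone_shift\<close>), and the layer
  between two heights has the measure that appears in the definition of RBMO (\<open>cone_layer\<close>).

  Exponents above two. The same comparison of cones gives a good lambda inequality between the
  conical square function and a maximal function of \<open>|f|\<^sup>2\<close> in which the integral over \<open>B(y,r)\<close> is divided by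
  \<open>\<mu>(B(y,5r))\<close> (\<open>good_lambda\<close>). In the place of the bounded overlap of Whitney balls,
  a continuous average over Lebesgue balls is used (\<open>whitney_integral_le\<close>).

  Failure for the vertical square function. The standard estimates demand smoothness only in the
  variable \<open>y\<close>, so that a kernel of averages can be switched on and off by the indicator function of a set
  of pairs \<open>(t, x)\<close>. If this set satisfies a Carleson condition, the vertical square function is bounded on
  \<open>L\<^sup>2\<close>. The set is taken to consist, in the unit interval that starts at \<open>N\<close>, of the heights between
  \<open>2\<^sup>-\<^sup>N\<close> and \<open>1\<close> over a fine comb of density \<open>1 / N\<close>. On the comb, the square function of the indicator of an
  interval of length three is at least a multiple of \<open>\<surd>N\<close>, so that its \<open>L\<^sup>p\<close> norm is at least a multiple of \<open>N\<close> to the power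
  \<open>1 / 2 - 1 / p\<close>, which is unbounded for \<open>p > 2\<close> (\<open>gated_unbounded\<close>).
\<close>

section \<open>Square roots and the triangle inequality in the extended half line\<close>

lemma epowr_mono:
  assumes "x \<le> y" "0 \<le> a" shows "epowr x a \<le> epowr y a"
proof (cases "y = \<infinity>")
  case False
  then have "x \<noteq> \<infinity>" using assms by (auto simp: top_unique)
  with False assms show ?thesis
    by (auto simp: epowr_def intro!: ennreal_leI powr_mono2 enn2real_mono simp: less_top)
qed (simp add: epowr_def)

lemma epowr_ennreal: "0 \<le> r \<Longrightarrow> epowr (ennreal r) a = ennreal (r powr a)"
  by (simp add: epowr_def)

lemma epowr_two: "epowr x 2 = x\<^sup>2"
proof (cases x)
  case (real r) then show ?thesis by (simp add: epowr_ennreal ennreal_power)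
next
  case top then show ?thesis by (simp add: epowr_def power2_eq_square)
qed

lemma epowr_half_power2: "(epowr x (1/2))\<^sup>2 = x"
proof (cases x)
  case (real r)
  then have "(epowr x (1/2))\<^sup>2 = ennreal ((r powr (1/2))\<^sup>2)" by (simp add: epowr_ennreal ennreal_power)
  also have "(r powr (1/2))\<^sup>2 = r" using real by (simp add: powr_half_sqrt)
  finally show ?thesis using real by simp
next
  case top then show ?thesis by (simp add: epowr_def power2_eq_square)
qed

lemma ennreal_power2_le_iff: "x\<^sup>2 \<le> y\<^sup>2 \<longleftrightarrow> x \<le> (y::ennreal)"
proof
  assume *: "x\<^sup>2 \<le> y\<^sup>2"
  show "x \<le> y"
  proof (cases x; cases y)
    fix a b assume "x = ennreal a" "y = ennreal b" "0 \<le> a" "0 \<le> b"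
    then show ?thesis using * by (simp add: ennreal_power ennreal_leI)
  qed (use * in \<open>auto simp: power2_eq_square ennreal_mult[symmetric] top_unique\<close>)
qed (rule power_mono, auto)

lemma ennreal_power2_less_iff: "x\<^sup>2 < y\<^sup>2 \<longleftrightarrow> x < (y::ennreal)"
  using ennreal_power2_le_iff[of y x] by (simp add: not_le[symmetric])

lemma less_epowr_half_iff: "c < epowr x (1/2) \<longleftrightarrow> c\<^sup>2 < x"
  by (metis ennreal_power2_less_iff epowr_half_power2)

lemma epowr_half_of_power2: "epowr (c\<^sup>2) (1/2) = c"
  by (metis ennreal_power2_le_iff epowr_half_power2 order_antisym order_refl)

lemma borel_measurable_epowr [measurable]:
  assumes [measurable]: "f \<in> borel_measurable M"
  shows "(\<lambda>x. epowr (f x) a) \<in> borel_measurable M"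
  unfolding epowr_def by measurable

definition norm2 :: "'b measure \<Rightarrow> ('b \<Rightarrow> complex) \<Rightarrow> ennreal" where
  "norm2 M F = epowr (\<integral>\<^sup>+z. (ennreal (norm (F z)))\<^sup>2 \<partial>M) (1/2)"

lemma norm2_power2: "(norm2 M F)\<^sup>2 = (\<integral>\<^sup>+z. (ennreal (norm (F z)))\<^sup>2 \<partial>M)"
  by (simp add: norm2_def epowr_half_power2)

lemma norm2_mono_AE:
  assumes "AE z in M. norm (F z) \<le> norm (G z)" shows "norm2 M F \<le> norm2 M G"
  unfolding norm2_def
  by (rule epowr_mono, rule nn_integral_mono_AE, rule eventually_mono[OF assms]) (auto intro: power_mono ennreal_leI)

lemma norm2_zero [simp]: "norm2 M (\<lambda>_. 0) = 0"
  by (simp add: norm2_def epowr_def)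

lemma norm2_cmult:
  assumes [measurable]: "F \<in> borel_measurable M"
  shows "norm2 M (\<lambda>z. c * F z) = ennreal (norm c) * norm2 M F"
proof -
  have "(norm2 M (\<lambda>z. c * F z))\<^sup>2 = (\<integral>\<^sup>+z. (ennreal (norm c))\<^sup>2 * (ennreal (norm (F z)))\<^sup>2 \<partial>M)"
    by (simp add: norm2_power2 norm_mult ennreal_mult power_mult_distrib)
  also have "\<dots> = (ennreal (norm c) * norm2 M F)\<^sup>2"
    by (subst nn_integral_cmult) (auto simp: norm2_power2 power_mult_distrib)
  finally show ?thesis by (metis epowr_half_of_power2)
qed

lemma norm2_triangle:
  assumes [measurable]: "F \<in> borel_measurable M" "G \<in> borel_measurable M"
  shows "norm2 M (\<lambda>z. F z + G z) \<le> norm2 M F + norm2 M G"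
proof -
  let ?f = "\<lambda>z. ennreal (norm (F z))" and ?g = "\<lambda>z. ennreal (norm (G z))"
  have "(\<integral>\<^sup>+z. ?f z * ?g z \<partial>M)\<^sup>2 \<le> (norm2 M F * norm2 M G)\<^sup>2"
    using Cauchy_Schwarz_nn_integral[of ?f M ?g] by (simp add: power_mult_distrib norm2_power2)
  then have fg: "(\<integral>\<^sup>+z. ?f z * ?g z \<partial>M) \<le> norm2 M F * norm2 M G"
    by (simp only: ennreal_power2_le_iff)
  have "(norm2 M (\<lambda>z. F z + G z))\<^sup>2 \<le> (\<integral>\<^sup>+z. (?f z + ?g z)\<^sup>2 \<partial>M)"
    unfolding norm2_power2
    by (intro nn_integral_mono power_mono) (auto simp: norm_triangle_ineq ennreal_plus[symmetric] simp del: ennreal_plus)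
  also have "\<dots> = (\<integral>\<^sup>+z. (?f z)\<^sup>2 + ((?g z)\<^sup>2 + 2 * (?f z * ?g z)) \<partial>M)"
    by (intro nn_integral_cong) (simp add: power2_eq_square algebra_simps mult_2)
  also have "\<dots> = (norm2 M F)\<^sup>2 + ((norm2 M G)\<^sup>2 + 2 * (\<integral>\<^sup>+z. ?f z * ?g z \<partial>M))"
    by (simp add: nn_integral_add nn_integral_cmult norm2_power2)
  also have "\<dots> \<le> (norm2 M F)\<^sup>2 + ((norm2 M G)\<^sup>2 + 2 * (norm2 M F * norm2 M G))"
    by (intro add_mono mult_left_mono fg order_refl) auto
  also have "\<dots> = (norm2 M F + norm2 M G)\<^sup>2"
    by (simp add: power2_eq_square algebra_simps mult_2)
  finally show ?thesis by (simp only: ennreal_power2_le_iff)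
qed

lemma norm2_sum:
  assumes "finite I" "\<And>i. i \<in> I \<Longrightarrow> F i \<in> borel_measurable M"
  shows "norm2 M (\<lambda>z. \<Sum>i\<in>I. F i z) \<le> (\<Sum>i\<in>I. norm2 M (F i))"
  using assms
proof (induction I rule: finite_induct)
  case (insert i I)
  then have "norm2 M (\<lambda>z. F i z + (\<Sum>i\<in>I. F i z)) \<le> norm2 M (F i) + norm2 M (\<lambda>z. \<Sum>i\<in>I. F i z)"
    by (intro norm2_triangle) auto
  with insert show ?case by (auto intro: order_trans add_left_mono)
qed simp

section \<open>Integrals of powers of the distance\<close>

text \<open>The integrals of powers of the distance below are cut into dyadic shells \<open>S j\<close>. On each of them the
  integrand is at most \<open>c j\<close>, and the resulting contribution \<open>q j\<close> is geometric in \<open>j\<close>.\<close>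

lemma nn_integral_le_dyadic:
  fixes c q :: "nat \<Rightarrow> real"
  assumes "\<And>z. z \<in> space M \<Longrightarrow> h z \<noteq> 0 \<Longrightarrow> \<exists>j. z \<in> S j \<and> h z \<le> ennreal (c j)"
    and S: "\<And>j. S j \<in> sets M"
    and q: "\<And>j. ennreal (c j) * emeasure M (S j) \<le> ennreal (q j)" "\<And>j. 0 \<le> q j" "q sums Q"
  shows "(\<integral>\<^sup>+z. h z \<partial>M) \<le> ennreal Q"
proof -
  note [measurable] = S
  have "(\<integral>\<^sup>+z. h z \<partial>M) \<le> (\<integral>\<^sup>+z. (\<Sum>j. ennreal (c j) * indicator (S j) z) \<partial>M)"
  proof (rule nn_integral_mono)
    fix z assume z: "z \<in> space M"
    show "h z \<le> (\<Sum>j. ennreal (c j) * indicator (S j) z)"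
    proof (cases "h z = 0")
      case False
      then obtain j where j: "z \<in> S j" "h z \<le> ennreal (c j)" using assms(1)[OF z] by blast
      then have "h z \<le> (\<Sum>j\<in>{j}. ennreal (c j) * indicator (S j) z)" by simp
      also have "\<dots> \<le> (\<Sum>j. ennreal (c j) * indicator (S j) z)" by (intro sum_le_suminf) auto
      finally show ?thesis .
    qed simp
  qed
  also have "\<dots> = (\<Sum>j. ennreal (c j) * emeasure M (S j))"
    by (subst nn_integral_suminf) (auto simp: nn_integral_cmult)
  also have "\<dots> \<le> (\<Sum>j. ennreal (q j))" by (intro suminf_le q) auto
  also have "\<dots> = ennreal Q" using q by (simp add: sums_iff suminf_ennreal2)
  finally show ?thesis .
qed

definition tail_const :: "real \<Rightarrow> real \<Rightarrow> real" where
  "tail_const m \<delta> = 2 powr (m + \<delta>) / (1 - 2 powr (-\<delta>))"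

lemma tail_const_pos: "0 < \<delta> \<Longrightarrow> 0 < tail_const m \<delta>"
  by (simp add: tail_const_def powr_less_one)

text \<open>Where \<open>dist x z\<close> is about \<open>2\<^sup>j \<rho>\<close>, the integrand is at most a multiple of the power \<open>-m - \<delta>\<close> of this
  radius and the mass is at most a multiple of its power \<open>m\<close>. What remains is a geometric series of
  ratio \<open>2\<close> to the power \<open>-\<delta>\<close>.\<close>

lemma tail_integral:
  fixes \<eta> :: "'a::euclidean_space measure"
  assumes sets: "sets \<eta> = sets borel" and "0 < \<rho>" "0 < m" "0 < \<delta>" "0 \<le> L"
    and growth: "\<And>u. \<rho> \<le> u \<Longrightarrow> emeasure \<eta> (ball x u) \<le> ennreal (L * u powr m)"
  shows "(\<integral>\<^sup>+z. ennreal (1 / (\<rho> + dist x z) powr (m + \<delta>)) \<partial>\<eta>)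
    \<le> ennreal (L * tail_const m \<delta> * \<rho> powr (-\<delta>))"
proof (rule nn_integral_le_dyadic[where S = "\<lambda>j. ball x (2 ^ j * \<rho>)"
      and c = "\<lambda>j. 1 / (2 ^ j * \<rho> / 2) powr (m + \<delta>)"
      and q = "\<lambda>j. L * 2 powr (m + \<delta>) * \<rho> powr (-\<delta>) * (2 powr (-\<delta>)) ^ j"])
  fix z
  define j where "j = (LEAST j. dist x z < 2 ^ j * \<rho>)"
  have "\<exists>j. dist x z < 2 ^ j * \<rho>"
    using real_arch_pow[of 2 "dist x z / \<rho>"] \<open>0 < \<rho>\<close> by (auto simp: divide_simps)
  then have j: "dist x z < 2 ^ j * \<rho>" unfolding j_def by (rule LeastI_ex)
  have le: "2 ^ j * \<rho> / 2 \<le> \<rho> + dist x z"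
  proof (cases j)
    case (Suc i)
    then have "\<not> dist x z < 2 ^ i * \<rho>" unfolding j_def by (metis lessI not_less_Least)
    then show ?thesis using Suc \<open>0 < \<rho>\<close> by simp
  next
    case 0
    then show ?thesis using \<open>0 < \<rho>\<close> zero_le_dist[of x z] by (simp del: zero_le_dist)
  qed
  show "\<exists>j. z \<in> ball x (2 ^ j * \<rho>) \<and>
      ennreal (1 / (\<rho> + dist x z) powr (m + \<delta>)) \<le> ennreal (1 / (2 ^ j * \<rho> / 2) powr (m + \<delta>))"
  proof (intro exI conjI ennreal_leI divide_left_mono powr_mono2 le)
    show "z \<in> ball x (2 ^ j * \<rho>)" using j by simp
  qed (use le \<open>0 < \<rho>\<close> \<open>0 < m\<close> \<open>0 < \<delta>\<close> in \<open>auto intro!: mult_pos_pos add_pos_nonneg simp: add_nonneg_eq_0_iff powr_gt_zero\<close>)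
next
  fix j
  let ?u = "2 ^ j * \<rho>"
  have u: "\<rho> \<le> ?u" "0 < ?u" using \<open>0 < \<rho>\<close> by auto
  have "ennreal (1 / (?u / 2) powr (m + \<delta>)) * emeasure \<eta> (ball x ?u)
      \<le> ennreal (1 / (?u / 2) powr (m + \<delta>)) * ennreal (L * ?u powr m)"
    by (intro mult_left_mono growth u) auto
  also have "\<dots> = ennreal (1 / (?u / 2) powr (m + \<delta>) * (L * ?u powr m))"
    by (rule ennreal_mult''[symmetric]) (use \<open>0 \<le> L\<close> in auto)
  also have "1 / (?u / 2) powr (m + \<delta>) * (L * ?u powr m) = L * 2 powr (m + \<delta>) * ?u powr (- \<delta>)"
    using u by (simp add: powr_divide powr_add powr_minus field_simps)
  also have "?u powr (-\<delta>) = \<rho> powr (-\<delta>) * (2 powr (-\<delta>)) ^ j"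
    using \<open>0 < \<rho>\<close> by (simp add: powr_mult powr_power powr_realpow[symmetric] powr_powr mult.commute)
  finally show "ennreal (1 / (?u / 2) powr (m + \<delta>)) * emeasure \<eta> (ball x ?u)
      \<le> ennreal (L * 2 powr (m + \<delta>) * \<rho> powr (-\<delta>) * (2 powr (-\<delta>)) ^ j)" by (simp add: mult_ac)
next
  show "(\<lambda>j. L * 2 powr (m + \<delta>) * \<rho> powr (-\<delta>) * (2 powr (-\<delta>)) ^ j) sums (L * tail_const m \<delta> * \<rho> powr (-\<delta>))"
    using sums_mult[OF geometric_sums[of "2 powr (-\<delta>)"], of "L * 2 powr (m + \<delta>) * \<rho> powr (-\<delta>)"] \<open>0 < \<delta>\<close>
    by (simp add: tail_const_def powr_less_one mult_ac)
qed (use sets \<open>0 \<le> L\<close> in auto)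

text \<open>If the mass of concentric balls grows faster than the power \<open>m\<close> by a full power of the
  radius, the integral of the critical power of the distance over a shell has a bound that does not
  depend on the inner radius.\<close>

lemma shell_integral:
  fixes \<eta> :: "'a::euclidean_space measure"
  assumes sets: "sets \<eta> = sets borel" and "0 < c" "0 < r" "0 < m" "0 \<le> L"
    and growth: "\<And>u. c \<le> u \<Longrightarrow> u \<le> r \<Longrightarrow> emeasure \<eta> (ball x u) \<le> ennreal (L * (u / r) * u powr m)"
  shows "(\<integral>\<^sup>+z\<in>ball x r - ball x c. ennreal (1 / dist x z powr m) \<partial>\<eta>) \<le> ennreal (L * 2 powr (m + 1))"
proof (rule nn_integral_le_dyadic[where S = "\<lambda>j. ball x (r / 2 ^ j) - ball x c"
      and c = "\<lambda>j. 1 / (r / 2 ^ j / 2) powr m" and q = "\<lambda>j. L * 2 powr m * (1 / 2) ^ j"])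
  fix z assume "ennreal (1 / dist x z powr m) * indicator (ball x r - ball x c) z \<noteq> 0"
  then have z: "z \<in> ball x r" "z \<notin> ball x c" by (auto split: split_indicator_asm)
  then have d: "c \<le> dist x z" "dist x z < r" by auto
  define j where "j = (LEAST j. r / 2 ^ Suc j \<le> dist x z)"
  have "\<exists>j. r / 2 ^ j < c"
    using real_arch_pow[of 2 "r / c"] \<open>0 < c\<close> by (auto simp: divide_simps mult.commute)
  then obtain i where "r / 2 ^ i < c" by blast
  moreover have "r / 2 ^ Suc i \<le> r / 2 ^ i" using \<open>0 < r\<close> by (simp add: field_simps)
  ultimately have "\<exists>j. r / 2 ^ Suc j \<le> dist x z" using d by (intro exI[of _ i]) simp
  then have j: "r / 2 ^ Suc j \<le> dist x z" unfolding j_def by (rule LeastI_ex)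
  have lt: "dist x z < r / 2 ^ j"
  proof (cases j)
    case (Suc i)
    then have "\<not> r / 2 ^ Suc i \<le> dist x z" unfolding j_def by (metis lessI not_less_Least)
    then show ?thesis using Suc by simp
  qed (use d in simp)
  show "\<exists>j. z \<in> ball x (r / 2 ^ j) - ball x c \<and>
      ennreal (1 / dist x z powr m) * indicator (ball x r - ball x c) z \<le> ennreal (1 / (r / 2 ^ j / 2) powr m)"
  proof (intro exI[of _ j] conjI)
    have "1 / dist x z powr m \<le> 1 / (r / 2 ^ j / 2) powr m"
      using j \<open>0 < r\<close> \<open>0 < m\<close> d \<open>0 < c\<close>
      by (intro divide_left_mono powr_mono2 mult_pos_pos) (auto simp: mult.commute)
    then show "ennreal (1 / dist x z powr m) * indicator (ball x r - ball x c) z \<le> ennreal (1 / (r / 2 ^ j / 2) powr m)"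
      using z by (simp add: ennreal_leI)
  qed (use lt z in auto)
next
  fix j
  let ?u = "r / 2 ^ j"
  have u: "0 < ?u" "?u \<le> r" using \<open>0 < r\<close> by (auto simp: field_simps)
  show "ennreal (1 / (?u / 2) powr m) * emeasure \<eta> (ball x ?u - ball x c) \<le> ennreal (L * 2 powr m * (1 / 2) ^ j)"
  proof (cases "c \<le> ?u")
    case True
    have "ennreal (1 / (?u / 2) powr m) * emeasure \<eta> (ball x ?u - ball x c)
        \<le> ennreal (1 / (?u / 2) powr m) * ennreal (L * (?u / r) * ?u powr m)"
      using sets by (intro mult_left_mono order_trans[OF emeasure_mono growth] True u) auto
    also have "\<dots> = ennreal (1 / (?u / 2) powr m * (L * (?u / r) * ?u powr m))"
      using \<open>0 \<le> L\<close> \<open>0 < r\<close> by (subst ennreal_mult) auto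
    also have "1 / (?u / 2) powr m * (L * (?u / r) * ?u powr m) = L * 2 powr m * (1 / 2) ^ j"
    proof -
      have "?u powr m > 0" using u by simp
      moreover have "(?u / 2) powr m = ?u powr m / 2 powr m" by (rule powr_divide)
      moreover have "?u / r = (1 / 2) ^ j" using \<open>0 < r\<close> by (simp add: power_one_over)
      ultimately show ?thesis by simp
    qed
    finally show ?thesis .
  next
    case False
    then have empty: "ball x ?u - ball x c = {}" by auto
    show ?thesis unfolding empty using \<open>0 \<le> L\<close> by simp
  qed
next
  show "(\<lambda>j. L * 2 powr m * (1 / 2) ^ j) sums (L * 2 powr (m + 1))"
    using sums_mult[OF geometric_sums[of "1/2::real"], of "L * 2 powr m"] by (simp add: powr_add mult_ac)
qed (use sets \<open>0 \<le> L\<close> in auto)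

lemma nn_integral_powr_from_0:
  fixes a d :: real
  assumes "0 < a" "0 \<le> d"
  shows "(\<integral>\<^sup>+t\<in>{0..d}. ennreal (t powr (a - 1)) \<partial>lborel) = ennreal (d powr a / a)"
  using nn_integral_has_integral_lebesgue'[OF _ has_integral_powr_from_0[of "a - 1" d]] assms by simp

lemma nn_integral_powr_to_inf:
  fixes a d :: real
  assumes "0 < a" "0 < d"
  shows "(\<integral>\<^sup>+t\<in>{d..}. ennreal (t powr (- a - 1)) \<partial>lborel) = ennreal (d powr (- a) / a)"
  using nn_integral_has_integral_lebesgue'[OF _ has_integral_powr_to_inf[of "- a - 1" d]] assms
  by simp

lemma norm_integral_le_nn_integral:
  fixes f :: "'b \<Rightarrow> complex"
  shows "ennreal (norm (integral\<^sup>L M f)) \<le> (\<integral>\<^sup>+x. ennreal (norm (f x)) \<partial>M)"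
  using integral_norm_bound_ennreal[of M f] not_integrable_integral_eq[of M f] by (cases "integrable M f") auto

section \<open>Measures of power growth and standard kernels\<close>

lemma fst_snd_borel [measurable]:
  "snd \<in> borel_measurable (borel :: ('a::euclidean_space \<times> real) measure)" "fst \<in> borel_measurable (borel :: ('a::euclidean_space \<times> real) measure)"
  unfolding borel_prod[symmetric] by measurable

locale growth_measure =
  fixes \<mu> :: "'a::euclidean_space measure" and m A :: real
  assumes sets_mu [measurable_cong, simp]: "sets \<mu> = sets borel"
    and m_pos: "0 < m" and A_pos: "0 < A"
    and growth: "\<And>x r. 0 < r \<Longrightarrow> emeasure \<mu> (ball x r) \<le> ennreal (A * r powr m)"
begin

lemma space_mu [simp]: "space \<mu> = UNIV"
  using sets_eq_imp_space_eq[OF sets_mu] by simp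

lemma measurable_mu_eq [simp]: "measurable \<mu> N = measurable borel N"
  by (rule measurable_cong_sets) auto

lemma emeasure_ball_finite: "emeasure \<mu> (ball x r) < \<infinity>"
  using growth[of r x] by (cases "0 < r") (auto simp: less_top[symmetric] top_unique ball_empty)

sublocale sigma_finite_measure \<mu>
proof
  show "\<exists>F. countable F \<and> F \<subseteq> sets \<mu> \<and> \<Union> F = space \<mu> \<and> (\<forall>a\<in>F. emeasure \<mu> a \<noteq> \<infinity>)"
  proof (intro exI[of _ "range (\<lambda>n::nat. ball 0 (real n))"] conjI)
    show "(\<Union>n. ball 0 (real n)) = space \<mu>"
      using reals_Archimedean2 by (auto simp: dist_norm)
  qed (use emeasure_ball_finite in \<open>auto simp: less_top\<close>)
qed

lemma tail_mu:
  assumes "0 < \<rho>" "0 < \<delta>"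
  shows "(\<integral>\<^sup>+z. ennreal (1 / (\<rho> + dist x z) powr (m + \<delta>)) \<partial>\<mu>) \<le> ennreal (A * tail_const m \<delta> * \<rho> powr (-\<delta>))"
  using assms m_pos A_pos growth by (intro tail_integral) auto

end

locale standard_kernel = growth_measure \<mu> m A
  for \<mu> :: "'a::euclidean_space measure" and m A :: real +
  fixes k :: "real \<Rightarrow> 'a \<Rightarrow> 'a \<Rightarrow> complex" and \<alpha> K :: real
  assumes alpha_pos: "0 < \<alpha>" and K_pos: "0 < K"
    and k_measurable: "(\<lambda>(t, x, y). k t x y) \<in> borel_measurable borel"
    and k_size: "\<And>t x y. 0 < t \<Longrightarrow> norm (k t x y) \<le> K * (t powr \<alpha> / (t + dist x y) powr (m + \<alpha>))"
    and k_smooth: "\<And>t x y z. 0 < t \<Longrightarrow> dist y z < t / 2 \<Longrightarrow>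
      norm (k t x y - k t x z) \<le> K * (dist y z powr \<alpha> / (t + dist x y) powr (m + \<alpha>))"
begin

lemma k_measurable' [measurable (raw)]:
  assumes [measurable]: "f \<in> borel_measurable M" "g \<in> borel_measurable M" "h \<in> borel_measurable M"
  shows "(\<lambda>w. k (f w) (g w) (h w)) \<in> borel_measurable M"
proof -
  have "(\<lambda>w. (f w, g w, h w)) \<in> measurable M (borel :: (real \<times> 'a \<times> 'a) measure)"
    unfolding borel_prod[symmetric] by measurable
  from measurable_compose[OF this k_measurable] show ?thesis by simp
qed

lemma k_le:
  assumes "0 < t"
  shows "norm (k t x y) \<le> K * t powr (- m)"
proof -
  have "t powr \<alpha> / (t + dist x y) powr (m + \<alpha>) \<le> t powr \<alpha> / t powr (m + \<alpha>)"
    using assms m_pos alpha_pos by (intro divide_left_mono powr_mono2) (auto intro!: mult_pos_pos simp: add_pos_nonneg add_nonneg_eq_0_iff)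
  also have "\<dots> = t powr (- m)" using assms by (simp add: powr_diff[symmetric])
  finally have "K * (t powr \<alpha> / (t + dist x y) powr (m + \<alpha>)) \<le> K * t powr (- m)"
    using K_pos by (intro mult_left_mono) auto
  then show ?thesis using k_size[OF assms, of x y] by linarith
qed

definition T :: "('a \<Rightarrow> complex) \<Rightarrow> 'a \<times> real \<Rightarrow> complex" where
  "T f z = (\<integral>y. k (snd z) (fst z) y * f y \<partial>\<mu>)"

lemma T_measurable [measurable]:
  assumes [measurable]: "f \<in> borel_measurable borel"
  shows "T f \<in> borel_measurable borel"
proof -
  have "(\<lambda>(z, y). k (snd z) (fst z) y * f y) \<in> borel_measurable ((borel :: ('a \<times> real) measure) \<Otimes>\<^sub>M \<mu>)"
    unfolding borel_prod[symmetric] by measurable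
  from borel_measurable_lebesgue_integral[OF this] show ?thesis by (simp add: T_def[abs_def])
qed

text \<open>The size condition turns a bound for the averages of \<open>f\<close> over all balls of radius at least \<open>t\<close>
  into a bound for \<open>T f\<close> at height \<open>t\<close>.\<close>

lemma kernel_integral_le:
  assumes [measurable]: "f \<in> borel_measurable borel" and "0 < t" "0 \<le> L"
    and avg: "\<And>u. t \<le> u \<Longrightarrow> (\<integral>\<^sup>+y\<in>ball x u. ennreal (norm (f y)) \<partial>\<mu>) \<le> ennreal (L * u powr m)"
  shows "(\<integral>\<^sup>+y. ennreal (norm (k t x y * f y)) \<partial>\<mu>) \<le> ennreal (K * tail_const m \<alpha> * L)"
proof -
  let ?\<eta> = "density \<mu> (\<lambda>y. ennreal (norm (f y)))"
  have "(\<integral>\<^sup>+y. ennreal (norm (k t x y * f y)) \<partial>\<mu>)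
      \<le> (\<integral>\<^sup>+y. ennreal (K * t powr \<alpha>) * (ennreal (norm (f y)) * ennreal (1 / (t + dist x y) powr (m + \<alpha>))) \<partial>\<mu>)"
  proof (rule nn_integral_mono)
    fix y
    have "norm (k t x y * f y) \<le> (K * t powr \<alpha>) * (norm (f y) * (1 / (t + dist x y) powr (m + \<alpha>)))"
      using mult_right_mono[OF k_size[OF \<open>0 < t\<close>, of x y], of "norm (f y)"] by (simp add: norm_mult mult_ac)
    then show "ennreal (norm (k t x y * f y))
        \<le> ennreal (K * t powr \<alpha>) * (ennreal (norm (f y)) * ennreal (1 / (t + dist x y) powr (m + \<alpha>)))"
      using K_pos by (simp add: ennreal_mult[symmetric] ennreal_leI)
  qed
  also have "\<dots> = ennreal (K * t powr \<alpha>) * (\<integral>\<^sup>+y. ennreal (1 / (t + dist x y) powr (m + \<alpha>)) \<partial>?\<eta>)"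
    by (subst nn_integral_cmult) (auto simp: nn_integral_density)
  also have "\<dots> \<le> ennreal (K * t powr \<alpha>) * ennreal (L * tail_const m \<alpha> * t powr (- \<alpha>))"
  proof (intro mult_left_mono tail_integral)
    fix u assume "t \<le> u"
    then show "emeasure ?\<eta> (ball x u) \<le> ennreal (L * u powr m)"
      using avg[of u] by (simp add: emeasure_density)
  qed (use \<open>0 < t\<close> \<open>0 \<le> L\<close> m_pos alpha_pos in auto)
  also have "\<dots> = ennreal (K * t powr \<alpha> * (L * tail_const m \<alpha> * t powr (- \<alpha>)))"
    using K_pos by (intro ennreal_mult'[symmetric]) auto
  also have "K * t powr \<alpha> * (L * tail_const m \<alpha> * t powr (- \<alpha>)) = K * tail_const m \<alpha> * L"
    using \<open>0 < t\<close> by (simp add: powr_minus field_simps)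
  finally show ?thesis .
qed

lemma T_le:
  assumes "f \<in> borel_measurable borel" "0 < t" "0 \<le> L"
    and "\<And>u. t \<le> u \<Longrightarrow> (\<integral>\<^sup>+y\<in>ball x u. ennreal (norm (f y)) \<partial>\<mu>) \<le> ennreal (L * u powr m)"
  shows "norm (T f (x, t)) \<le> K * tail_const m \<alpha> * L"
proof -
  have "ennreal (norm (T f (x, t))) \<le> ennreal (K * tail_const m \<alpha> * L)"
    unfolding T_def using kernel_integral_le[OF assms]
    by (auto intro: order_trans[OF norm_integral_le_nn_integral])
  then show ?thesis
    using K_pos less_imp_le[OF tail_const_pos[OF alpha_pos, of m]] \<open>0 \<le> L\<close> by (subst (asm) ennreal_le_iff) auto
qed

lemma kernel_integrable:
  assumes "0 < t"
  shows "integrable \<mu> (k t x)"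
proof (rule integrableI_bounded)
  have "(\<integral>\<^sup>+y. ennreal (norm (k t x y * 1)) \<partial>\<mu>) \<le> ennreal (K * tail_const m \<alpha> * A)"
    using assms A_pos growth by (intro kernel_integral_le) auto
  then show "(\<integral>\<^sup>+y. ennreal (norm (k t x y)) \<partial>\<mu>) < \<infinity>" by (auto simp: top_unique less_top[symmetric])
qed measurable

lemma kernel_mult_integrable:
  assumes "0 < t" and [measurable]: "f \<in> borel_measurable borel" and "1 \<le> p"
    and fin: "(\<integral>\<^sup>+y. ennreal (norm (f y) powr p) \<partial>\<mu>) < \<infinity>"
  shows "integrable \<mu> (\<lambda>y. k t x y * f y)"
proof (rule integrableI_bounded)
  have "(\<integral>\<^sup>+y. ennreal (norm (k t x y * f y)) \<partial>\<mu>)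
      \<le> (\<integral>\<^sup>+y. ennreal (norm (k t x y)) + ennreal (K * t powr (- m)) * ennreal (norm (f y) powr p) \<partial>\<mu>)"
  proof (rule nn_integral_mono)
    fix y
    have "norm (f y) \<le> 1 + norm (f y) powr p"
    proof (cases "norm (f y) \<le> 1")
      case True then show ?thesis by (simp add: add_increasing2)
    next
      case False
      then show ?thesis using powr_mono[of 1 p "norm (f y)"] \<open>1 \<le> p\<close> by simp
    qed
    then have "norm (k t x y * f y) \<le> norm (k t x y) * (1 + norm (f y) powr p)"
      by (simp add: norm_mult mult_left_mono)
    also have "\<dots> \<le> norm (k t x y) + (K * t powr (- m)) * norm (f y) powr p"
      using k_le[OF \<open>0 < t\<close>, of x y] by (simp add: distrib_left mult_right_mono)
    finally show "ennreal (norm (k t x y * f y))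
        \<le> ennreal (norm (k t x y)) + ennreal (K * t powr (- m)) * ennreal (norm (f y) powr p)"
      using K_pos by (simp add: ennreal_mult[symmetric] ennreal_plus[symmetric] ennreal_leI del: ennreal_plus)
  qed
  also have "\<dots> = (\<integral>\<^sup>+y. ennreal (norm (k t x y)) \<partial>\<mu>) + ennreal (K * t powr (- m)) * (\<integral>\<^sup>+y. ennreal (norm (f y) powr p) \<partial>\<mu>)"
    by (subst nn_integral_add) (auto simp: nn_integral_cmult)
  also have "\<dots> < \<infinity>"
    using kernel_integrable[OF \<open>0 < t\<close>, of x] fin by (auto simp: integrable_iff_bounded ennreal_mult_less_top)
  finally show "(\<integral>\<^sup>+y. ennreal (norm (k t x y * f y)) \<partial>\<mu>) < \<infinity>" .
qed measurable

end

section \<open>Square functions\<close>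

text \<open>The conical and the vertical square function are both of the form
  \<open>x \<mapsto> norm2 (\<omega> x) (T f)\<close>: for the first, \<open>\<omega> x\<close> is the measure \<open>d\<mu>(y) dt / t\<^sup>m\<^sup>+\<^sup>1\<close> on the cone over
  \<open>x\<close>, for the second it is the measure \<open>dt / t\<close> on the ray over \<open>x\<close>. The weak type estimate only needs
  that \<open>\<omega> x\<close> lives on the cone and that its marginal in \<open>t\<close> is dominated by \<open>dt / t\<close>.\<close>

locale square_function = standard_kernel \<mu> m A k \<alpha> K
  for \<mu> :: "'a::euclidean_space measure" and m A :: real and k \<alpha> K +
  fixes \<omega> :: "'a \<Rightarrow> ('a \<times> real) measure" and D :: real
  assumes sets_omega [measurable_cong, simp]: "\<And>x. sets (\<omega> x) = sets borel"
    and D_pos: "0 < D"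
    and omega_cone: "\<And>x. AE z in \<omega> x. 0 < snd z \<and> dist x (fst z) < snd z"
    and omega_marginal: "\<And>x h. h \<in> borel_measurable borel \<Longrightarrow>
      (\<integral>\<^sup>+z. h (snd z) \<partial>\<omega> x) \<le> ennreal D * (\<integral>\<^sup>+t\<in>{0<..}. h t * ennreal (1 / t) \<partial>lborel)"
    and omega_measurable: "\<And>F. F \<in> borel_measurable borel \<Longrightarrow> (\<lambda>x. \<integral>\<^sup>+z. F z \<partial>\<omega> x) \<in> borel_measurable borel"
begin

lemma space_omega [simp]: "space (\<omega> x) = UNIV"
  using sets_eq_imp_space_eq[OF sets_omega] by simp

lemma measurable_omega_eq [simp]: "measurable (\<omega> x) N = measurable borel N"
  by (rule measurable_cong_sets) auto

definition sq :: "('a \<times> real \<Rightarrow> complex) \<Rightarrow> 'a \<Rightarrow> ennreal" where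
  "sq F x = norm2 (\<omega> x) F"

lemma sq_measurable [measurable]:
  assumes [measurable]: "F \<in> borel_measurable borel"
  shows "sq F \<in> borel_measurable borel"
  unfolding sq_def[abs_def] norm2_def by (intro borel_measurable_epowr omega_measurable) measurable

definition radial_const :: "real \<Rightarrow> real \<Rightarrow> real" where
  "radial_const a b = sqrt (D * (1 / (2 * a) + 1 / (2 * b - 2 * a)))"

lemma radial_const_pos: "0 < a \<Longrightarrow> a < b \<Longrightarrow> 0 < radial_const a b"
  using D_pos by (auto simp: radial_const_def intro!: add_pos_pos mult_pos_pos)

text \<open>The square of the bound is integrated against \<open>dt / t\<close>. For \<open>t \<le> d\<close> the denominator is at least \<open>d\<^sup>b\<close>
  and the positive power \<open>2 a\<close> of \<open>t\<close> is integrable at zero; for \<open>t \<ge> d\<close> it is at least \<open>t\<^sup>b\<close>, and the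
  negative power \<open>2 a - 2 b\<close> is integrable at infinity. The two integrals give the two summands of
  \<open>radial_const\<close>.\<close>

lemma sq_radial_le:
  assumes "0 < a" "a < b" "0 < d" "0 \<le> Q"
    and bound: "\<And>y t. 0 < t \<Longrightarrow> dist x y < t \<Longrightarrow> norm (F (y, t)) \<le> Q * (t powr a / (t + d) powr b)"
  shows "sq F x \<le> ennreal (radial_const a b * Q * d powr (a - b))"
proof -
  define h where "h t = ennreal ((Q * (t powr a / (t + d) powr b))\<^sup>2)" for t :: real
  have [measurable]: "h \<in> borel_measurable borel" unfolding h_def by measurable
  let ?c = "ennreal (Q\<^sup>2 * d powr (- 2 * b))" and ?e = "ennreal (Q\<^sup>2)"
  have "(sq F x)\<^sup>2 \<le> (\<integral>\<^sup>+z. h (snd z) \<partial>\<omega> x)"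
    unfolding sq_def norm2_power2
  proof (rule nn_integral_mono_AE, rule eventually_mono[OF omega_cone])
    fix z :: "'a \<times> real" assume "0 < snd z \<and> dist x (fst z) < snd z"
    then have "norm (F z) \<le> Q * (snd z powr a / (snd z + d) powr b)"
      using bound[of "snd z" "fst z"] by simp
    then show "(ennreal (norm (F z)))\<^sup>2 \<le> h (snd z)"
      unfolding h_def by (subst ennreal_power) (auto intro!: ennreal_leI power_mono)
  qed
  also have "\<dots> \<le> ennreal D * (\<integral>\<^sup>+t\<in>{0<..}. h t * ennreal (1 / t) \<partial>lborel)"
    by (rule omega_marginal) measurable
  also have "(\<integral>\<^sup>+t\<in>{0<..}. h t * ennreal (1 / t) \<partial>lborel)
     \<le> (\<integral>\<^sup>+t. ?c * (ennreal (t powr (2 * a - 1)) * indicator {0..d} t)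
         + ?e * (ennreal (t powr (- (2 * b - 2 * a) - 1)) * indicator {d..} t) \<partial>lborel)"
  proof (rule nn_integral_mono)
    fix t :: real
    show "h t * ennreal (1 / t) * indicator {0<..} t \<le> ?c * (ennreal (t powr (2 * a - 1)) * indicator {0..d} t)
         + ?e * (ennreal (t powr (- (2 * b - 2 * a) - 1)) * indicator {d..} t)"
    proof (cases "0 < t")
      case True
      have sq: "(Q * (t powr a / (t + d) powr b))\<^sup>2 * (1 / t) = Q\<^sup>2 * t powr (2 * a - 1) * (t + d) powr (- 2 * b)"
        using True \<open>0 < d\<close>
        by (simp add: power2_eq_square powr_diff powr_minus field_simps powr_add[symmetric])
      have e: "h t * ennreal (1 / t) = ennreal (Q\<^sup>2 * t powr (2 * a - 1) * (t + d) powr (- 2 * b))"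
        unfolding h_def using True by (subst ennreal_mult[symmetric]) (auto simp only: sq, auto)
      show ?thesis
      proof (cases "t \<le> d")
        case le: True
        have "(t + d) powr (- 2 * b) \<le> d powr (- 2 * b)"
          using True \<open>0 < d\<close> \<open>0 < a\<close> \<open>a < b\<close> by (intro powr_mono2') auto
        then have "Q\<^sup>2 * t powr (2 * a - 1) * (t + d) powr (- 2 * b) \<le> Q\<^sup>2 * d powr (- 2 * b) * t powr (2 * a - 1)"
          using mult_left_mono[of "(t + d) powr (- 2 * b)" "d powr (- 2 * b)" "Q\<^sup>2 * t powr (2 * a - 1)"]
          by (simp add: mult_ac)
        then have "h t * ennreal (1 / t) \<le> ?c * ennreal (t powr (2 * a - 1))"
          unfolding e by (subst ennreal_mult[symmetric]) (auto intro: ennreal_leI)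
        then show ?thesis using True le by (simp add: add_increasing2)
      next
        case False
        have "(t + d) powr (- 2 * b) \<le> t powr (- 2 * b)"
          using True \<open>0 < d\<close> \<open>0 < a\<close> \<open>a < b\<close> by (intro powr_mono2') auto
        then have "Q\<^sup>2 * t powr (2 * a - 1) * (t + d) powr (- 2 * b) \<le> Q\<^sup>2 * t powr (2 * a - 1) * t powr (- 2 * b)"
          by (intro mult_left_mono) auto
        also have "\<dots> = Q\<^sup>2 * t powr (- (2 * b - 2 * a) - 1)"
          using powr_add[of t "2 * a - 1" "- 2 * b"] by (simp add: algebra_simps)
        finally have "h t * ennreal (1 / t) \<le> ?e * ennreal (t powr (- (2 * b - 2 * a) - 1))"
          unfolding e by (subst ennreal_mult[symmetric]) (auto intro: ennreal_leI)
        then show ?thesis using True False by (simp add: add_increasing)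
      qed
    qed simp
  qed
  also have "\<dots> = ?c * ennreal (d powr (2 * a) / (2 * a)) + ?e * ennreal (d powr (- (2 * b - 2 * a)) / (2 * b - 2 * a))"
    using assms nn_integral_powr_from_0[of "2 * a" d] nn_integral_powr_to_inf[of "2 * b - 2 * a" d]
    by (subst nn_integral_add) (auto simp: nn_integral_cmult)
  also have "\<dots> = ennreal (Q\<^sup>2 * d powr (2 * (a - b)) * (1 / (2 * a) + 1 / (2 * b - 2 * a)))"
    using assms by (subst ennreal_mult[symmetric], simp, simp, subst ennreal_mult[symmetric], simp, simp, subst ennreal_plus[symmetric])
      (auto simp: powr_add[symmetric] algebra_simps)
  also have "ennreal D * \<dots> = ennreal ((radial_const a b * Q * d powr (a - b))\<^sup>2)"
  proof -
    have "0 \<le> D * (1 / (2 * a) + 1 / (2 * b - 2 * a))" using assms D_pos by auto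
    then have "(radial_const a b * Q * d powr (a - b))\<^sup>2 = D * (Q\<^sup>2 * d powr (2 * (a - b)) * (1 / (2 * a) + 1 / (2 * b - 2 * a)))"
      by (simp add: radial_const_def power_mult_distrib power2_eq_square[of "d powr _"] powr_add[symmetric] algebra_simps)
    then show ?thesis using D_pos by (simp add: ennreal_mult')
  qed
  finally have "(sq F x)\<^sup>2 \<le> (ennreal (radial_const a b * Q * d powr (a - b)))\<^sup>2"
    using assms radial_const_pos[of a b] by (simp add: ennreal_power mult_left_mono)
  then show ?thesis by (simp only: ennreal_power2_le_iff)
qed

end

section \<open>A Calderon--Zygmund decomposition of finite sums of point masses\<close>

context growth_measure
begin

lemma emeasure_ball_eq: "emeasure \<mu> (ball x r) = ennreal (measure \<mu> (ball x r))"
  using emeasure_ball_finite[of x r] by (simp add: emeasure_eq_ennreal_measure less_top)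

lemma measure_ball_le: "0 < r \<Longrightarrow> measure \<mu> (ball x r) \<le> A * r powr m"
  using growth[of r x] A_pos by (simp add: emeasure_ball_eq)

lemma measure_ball_mono: "ball x r \<subseteq> ball y u \<Longrightarrow> measure \<mu> (ball x r) \<le> measure \<mu> (ball y u)"
  using emeasure_mono[of "ball x r" "ball y u" \<mu>] by (simp add: emeasure_ball_eq)

text \<open>The radius at which a ball around \<open>x\<close> stops being dense for the point masses. The density
  threshold is exceeded at arbitrarily small radii, because small balls have small measure, and not
  at large ones, because the total mass is too small.\<close>

lemma stopping_radius:
  fixes N :: "real \<Rightarrow> real"
  assumes "0 < \<tau>" "0 < w" "\<And>u. 0 < u \<Longrightarrow> w \<le> N u" "\<And>u. N u \<le> W"
    and total: "ennreal W < ennreal \<tau> * emeasure \<mu> UNIV"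
  obtains \<rho> where "0 < \<rho>" "\<tau> * measure \<mu> (ball x (10 * \<rho>)) < N \<rho>"
    "\<And>u. 2 * \<rho> \<le> u \<Longrightarrow> N u \<le> \<tau> * measure \<mu> (ball x (10 * u))"
proof -
  define P where "P = {u. 0 < u \<and> \<tau> * measure \<mu> (ball x (10 * u)) < N u}"
  let ?u = "(w / (2 * \<tau> * A)) powr (1 / m) / 10"
  have u: "0 < ?u" using assms A_pos by simp
  have "\<tau> * measure \<mu> (ball x (10 * ?u)) \<le> \<tau> * (A * (10 * ?u) powr m)"
    using u \<open>0 < \<tau>\<close> measure_ball_le[of "10 * ?u" x] by (intro mult_left_mono) auto
  also have "\<dots> = w / 2" using assms A_pos m_pos by (simp add: powr_powr)
  also have "\<dots> < N ?u" using assms(3)[OF u] \<open>0 < w\<close> by simp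
  finally have "?u \<in> P" using u by (simp add: P_def)
  have inc: "incseq (\<lambda>n. ball x (real n))" by (auto simp: incseq_def)
  have rng: "range (\<lambda>n. ball x (real n)) \<subseteq> sets \<mu>" by auto
  have un: "(\<Union>n. ball x (real n)) = UNIV"
    using reals_Archimedean2 by (auto simp: dist_norm)
  have "emeasure \<mu> UNIV = (SUP n. emeasure \<mu> (ball x (real n)))"
    using SUP_emeasure_incseq[OF rng inc] un by simp
  then have "ennreal W < (SUP n. ennreal \<tau> * emeasure \<mu> (ball x (real n)))"
    using total by (simp add: SUP_mult_left_ennreal)
  then obtain n where n: "ennreal W < ennreal \<tau> * emeasure \<mu> (ball x (real n))"
    by (auto simp: less_SUP_iff)
  then have n: "W < \<tau> * measure \<mu> (ball x (real n))"
    using \<open>0 < \<tau>\<close> by (simp add: emeasure_ball_eq ennreal_mult[symmetric] ennreal_less_iff ennreal_lessI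
      split: if_splits) (metis ennreal_leI linorder_not_le)
  have bdd: "u \<le> real n" if "u \<in> P" for u
  proof (rule ccontr)
    assume "\<not> u \<le> real n"
    then have "measure \<mu> (ball x (real n)) \<le> measure \<mu> (ball x (10 * u))"
      using that by (intro measure_ball_mono subset_ball) (auto simp: P_def)
    then have "W < \<tau> * measure \<mu> (ball x (10 * u))"
      using n \<open>0 < \<tau>\<close> by (meson less_le_trans mult_left_mono less_imp_le)
    with that assms(4)[of u] show False by (simp add: P_def)
  qed
  have bddP: "bdd_above P" using bdd by (auto simp: bdd_above_def)
  have "0 < Sup P" using \<open>?u \<in> P\<close> u cSup_upper[OF _ bddP] by (meson less_le_trans)
  then have "Sup P / 2 < Sup P" by simp
  then obtain \<rho> where \<rho>: "\<rho> \<in> P" "Sup P / 2 < \<rho>"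
    using less_cSup_iff[OF _ bddP] \<open>?u \<in> P\<close> by blast
  show ?thesis
  proof
    show "0 < \<rho>" "\<tau> * measure \<mu> (ball x (10 * \<rho>)) < N \<rho>" using \<rho> by (auto simp: P_def)
    fix u assume "2 * \<rho> \<le> u"
    then have "Sup P < u" using \<rho> by simp
    then have "u \<notin> P" using cSup_upper[OF _ bddP] by force
    moreover have "0 < u" using \<open>0 < Sup P\<close> \<open>Sup P < u\<close> by simp
    ultimately show "N u \<le> \<tau> * measure \<mu> (ball x (10 * u))" by (auto simp: P_def)
  qed
qed

text \<open>Measures without doubling still have, around every point, a ball that controls all others: one
  that nearly maximises \<open>\<mu>(B(x,u)) / u\<^sup>m\<^sup>+\<^sup>1\<close>. Larger balls are controlled because of the polynomial
  comparison, and smaller ones are so light that the critical power of the distance has a bounded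
  integral.\<close>

lemma maximal_density_radius:
  assumes "0 < c" "c \<le> u0" "0 < measure \<mu> (ball x u0)"
  obtains r where "c \<le> r" "0 < measure \<mu> (ball x r)"
    "\<And>u. c \<le> u \<Longrightarrow> measure \<mu> (ball x u) \<le> 2 * (u / r) powr (m + 1) * measure \<mu> (ball x r)"
proof -
  define f where "f u = measure \<mu> (ball x u) / u powr (m + 1)" for u
  have bound: "f u \<le> A / c" if "c \<le> u" for u
  proof -
    have "f u \<le> A * u powr m / u powr (m + 1)"
      unfolding f_def using that \<open>0 < c\<close> by (intro divide_right_mono measure_ball_le) auto
    also have "\<dots> = A / u" using that \<open>0 < c\<close> by (simp add: powr_add)
    also have "\<dots> \<le> A / c" using that \<open>0 < c\<close> A_pos by (intro divide_left_mono) auto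
    finally show ?thesis .
  qed
  have bdd: "bdd_above (f ` {c..})" using bound by (auto simp: bdd_above_def)
  define S where "S = Sup (f ` {c..})"
  have le: "f u \<le> S" if "c \<le> u" for u unfolding S_def using that by (intro cSup_upper bdd) auto
  have "0 < f u0" using assms by (simp add: f_def)
  with le[OF \<open>c \<le> u0\<close>] have "S / 2 < S" by simp
  then obtain r where r: "c \<le> r" "S / 2 < f r"
    unfolding S_def using less_cSup_iff[OF _ bdd, of "Sup (f ` {c..}) / 2"] by auto
  show ?thesis
  proof
    show "c \<le> r" by fact
    have "0 < f r" using r \<open>S / 2 < S\<close> by simp
    then show "0 < measure \<mu> (ball x r)" using r \<open>0 < c\<close> by (simp add: f_def zero_less_divide_iff)
    fix u assume "c \<le> u"
    then have "f u \<le> 2 * f r" using le[of u] r by simp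
    then show "measure \<mu> (ball x u) \<le> 2 * (u / r) powr (m + 1) * measure \<mu> (ball x r)"
      using \<open>c \<le> u\<close> \<open>c \<le> r\<close> \<open>0 < c\<close> by (simp add: f_def powr_divide field_simps)
  qed
qed

definition doubling_const :: real where "doubling_const = 2 * 20 powr (m + 1)"

lemma doubling_const_pos: "0 < doubling_const" by (simp add: doubling_const_def)

text \<open>Spreading the point masses over the controlling balls. The balls are treated in the order of
  increasing radius: the earlier masses that reach a ball \<open>R\<close> lie in its double, so that their total
  is at most a multiple of \<open>\<tau> \<mu>(R)\<close>, and by Chebyshev's inequality their spread densities are
  small on at least half of \<open>R\<close>.\<close>

lemma spread_masses:
  fixes I :: "nat set" and x :: "nat \<Rightarrow> 'a" and w r :: "nat \<Rightarrow> real"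
  assumes "finite I" "0 < \<tau>" "\<And>i. i \<in> I \<Longrightarrow> 0 < w i" "\<And>i. i \<in> I \<Longrightarrow> 0 < r i"
    and pos: "\<And>i. i \<in> I \<Longrightarrow> 0 < measure \<mu> (ball (x i) (r i))"
    and mass: "\<And>i. i \<in> I \<Longrightarrow> sum w {j \<in> I. x j \<in> ball (x i) (2 * r i)} \<le> doubling_const * \<tau> * measure \<mu> (ball (x i) (r i))"
  shows "\<exists>E. (\<forall>i\<in>I. E i \<in> sets borel \<and> E i \<subseteq> ball (x i) (r i) \<and>
        measure \<mu> (ball (x i) (r i)) \<le> 2 * measure \<mu> (E i)) \<and>
      (\<forall>y. (\<Sum>i\<in>I. w i / measure \<mu> (E i) * indicator (E i) y) \<le> 4 * doubling_const * \<tau>)"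
proof -
  have "S \<subseteq> I \<Longrightarrow> \<exists>E. (\<forall>i\<in>S. E i \<in> sets borel \<and> E i \<subseteq> ball (x i) (r i) \<and>
        measure \<mu> (ball (x i) (r i)) \<le> 2 * measure \<mu> (E i)) \<and>
      (\<forall>y. (\<Sum>i\<in>S. w i / measure \<mu> (E i) * indicator (E i) y) \<le> 4 * doubling_const * \<tau>)"
    if "finite S" for S
    using that
  proof (induction S rule: finite_ranking_induct[where f = r])
    case empty
    show ?case using \<open>0 < \<tau>\<close> doubling_const_pos by auto
  next
    case (insert k S)
    then obtain E where E: "\<And>i. i \<in> S \<Longrightarrow> E i \<in> sets borel" "\<And>i. i \<in> S \<Longrightarrow> E i \<subseteq> ball (x i) (r i)"
      "\<And>i. i \<in> S \<Longrightarrow> measure \<mu> (ball (x i) (r i)) \<le> 2 * measure \<mu> (E i)"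
      and bd: "\<And>y. (\<Sum>i\<in>S. w i / measure \<mu> (E i) * indicator (E i) y) \<le> 4 * doubling_const * \<tau>"
      by blast
    show ?case
    proof (cases "k \<in> S")
      case True
      then show ?thesis using E bd by (intro exI[of _ E]) (auto simp: insert_absorb)
    next
      case False
      have kI: "k \<in> I" and SI: "S \<subseteq> I" using insert.prems by auto
      define \<Psi> where "\<Psi> y = (\<Sum>i\<in>S. w i / measure \<mu> (E i) * indicator (E i) y)" for y
      have \<Psi>_meas [measurable]: "\<Psi> \<in> borel_measurable borel" unfolding \<Psi>_def using E(1) by measurable
      have \<Psi>_nonneg: "0 \<le> \<Psi> y" for y
        unfolding \<Psi>_def using SI assms(3) by (intro sum_nonneg mult_nonneg_nonneg divide_nonneg_nonneg) (auto intro: less_imp_le)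
      let ?R = "ball (x k) (r k)"
      let ?mR = "measure \<mu> ?R"
      define Ek where "Ek = {y \<in> ?R. \<Psi> y \<le> 2 * doubling_const * \<tau>}"
      define bad where "bad = {y \<in> ?R. \<not> \<Psi> y \<le> 2 * doubling_const * \<tau>}"
      have Ek_sets [measurable]: "Ek \<in> sets borel" "bad \<in> sets borel" unfolding Ek_def bad_def by measurable
      have "ennreal (2 * doubling_const * \<tau>) * emeasure \<mu> bad = (\<integral>\<^sup>+y. ennreal (2 * doubling_const * \<tau>) * indicator bad y \<partial>\<mu>)"
        by (simp add: nn_integral_cmult_indicator)
      also have "\<dots> \<le> (\<integral>\<^sup>+y. ennreal (\<Psi> y) * indicator ?R y \<partial>\<mu>)"
        by (intro nn_integral_mono) (auto simp: bad_def indicator_def intro: ennreal_leI)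
      also have "\<dots> = (\<integral>\<^sup>+y. (\<Sum>i\<in>S. ennreal (w i / measure \<mu> (E i)) * indicator (E i \<inter> ?R) y) \<partial>\<mu>)"
      proof (intro nn_integral_cong)
        fix y
        have "ennreal (\<Psi> y) * indicator ?R y = ennreal (\<Sum>i\<in>S. w i / measure \<mu> (E i) * indicator (E i \<inter> ?R) y)"
          by (auto simp: \<Psi>_def indicator_def intro!: arg_cong[where f=ennreal] sum.cong)
        also have "\<dots> = (\<Sum>i\<in>S. ennreal (w i / measure \<mu> (E i) * indicator (E i \<inter> ?R) y))"
          using SI less_imp_le[OF assms(3)] by (intro sum_ennreal[symmetric]) (auto intro!: mult_nonneg_nonneg divide_nonneg_nonneg)
        finally show "ennreal (\<Psi> y) * indicator ?R y = (\<Sum>i\<in>S. ennreal (w i / measure \<mu> (E i)) * indicator (E i \<inter> ?R) y)"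
          by (auto simp: indicator_def intro!: sum.cong split: if_splits)
      qed
      also have "\<dots> = (\<Sum>i\<in>S. ennreal (w i / measure \<mu> (E i)) * emeasure \<mu> (E i \<inter> ?R))"
        using E(1) by (subst nn_integral_sum) (auto simp: nn_integral_cmult_indicator intro!: borel_measurable_times_ennreal borel_measurable_indicator)
      also have "\<dots> \<le> (\<Sum>i\<in>S. if x i \<in> ball (x k) (2 * r k) then ennreal (w i) else 0)"
      proof (intro sum_mono)
        fix i assume i: "i \<in> S"
        then have iI: "i \<in> I" using SI by auto
        have Ei: "emeasure \<mu> (E i) = ennreal (measure \<mu> (E i))" "0 < measure \<mu> (E i)"
        proof -
          have "emeasure \<mu> (E i) \<le> emeasure \<mu> (ball (x i) (r i))" using E(2)[OF i] by (intro emeasure_mono) auto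
          then show "emeasure \<mu> (E i) = ennreal (measure \<mu> (E i))"
            using emeasure_ball_finite[of "x i" "r i"] by (intro emeasure_eq_ennreal_measure) (auto simp: top_unique)
          show "0 < measure \<mu> (E i)" using E(3)[OF i] pos[OF iI] by simp
        qed
        show "ennreal (w i / measure \<mu> (E i)) * emeasure \<mu> (E i \<inter> ?R) \<le> (if x i \<in> ball (x k) (2 * r k) then ennreal (w i) else 0)"
        proof (cases "E i \<inter> ?R = {}")
          case False
          then obtain z where z: "z \<in> ball (x i) (r i)" "z \<in> ?R" using E(2)[OF i] by blast
          have "dist (x k) (x i) < 2 * r k"
            using z insert.hyps(2)[OF i] dist_triangle2[of "x k" "x i" z] by simp
          moreover have "ennreal (w i / measure \<mu> (E i)) * emeasure \<mu> (E i \<inter> ?R) \<le> ennreal (w i / measure \<mu> (E i)) * emeasure \<mu> (E i)"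
            using E(1)[OF i] by (intro mult_left_mono emeasure_mono) auto
          moreover have "ennreal (w i / measure \<mu> (E i)) * emeasure \<mu> (E i) = ennreal (w i)"
            using Ei assms(3)[OF iI] by (simp add: ennreal_mult[symmetric])
          ultimately show ?thesis by simp
        qed simp
      qed
      also have "\<dots> = (\<Sum>i\<in>{i\<in>S. x i \<in> ball (x k) (2 * r k)}. ennreal (w i))"
        using \<open>finite S\<close> by (simp add: sum.inter_filter)
      also have "\<dots> = ennreal (sum w {i\<in>S. x i \<in> ball (x k) (2 * r k)})"
        using SI assms(3) by (intro sum_ennreal) (auto intro: less_imp_le)
      also have "\<dots> \<le> ennreal (sum w {j\<in>I. x j \<in> ball (x k) (2 * r k)})"
        using SI assms(1,3) by (intro ennreal_leI sum_mono2) (auto intro: less_imp_le)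
      also have "\<dots> \<le> ennreal (doubling_const * \<tau> * ?mR)" by (intro ennreal_leI mass kI)
      finally have "ennreal (2 * doubling_const * \<tau>) * emeasure \<mu> bad \<le> ennreal (doubling_const * \<tau> * ?mR)" .
      moreover have "emeasure \<mu> bad \<le> emeasure \<mu> ?R" by (intro emeasure_mono) (auto simp: bad_def)
      then have bad_fin: "emeasure \<mu> bad = ennreal (measure \<mu> bad)"
        using emeasure_ball_finite[of "x k" "r k"] by (intro emeasure_eq_ennreal_measure) (auto simp: top_unique)
      ultimately have "2 * doubling_const * \<tau> * measure \<mu> bad \<le> doubling_const * \<tau> * ?mR"
        using doubling_const_pos \<open>0 < \<tau>\<close> by (simp add: ennreal_mult[symmetric])
      then have "2 * measure \<mu> bad \<le> ?mR"
        using doubling_const_pos \<open>0 < \<tau>\<close> by (simp add: mult_ac)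
      moreover have "?mR = measure \<mu> Ek + measure \<mu> bad"
      proof -
        have "emeasure \<mu> ?R = emeasure \<mu> Ek + emeasure \<mu> bad"
          by (subst plus_emeasure) (auto simp: Ek_def bad_def intro!: arg_cong[where f="emeasure \<mu>"])
        moreover have "emeasure \<mu> Ek \<le> emeasure \<mu> ?R" by (intro emeasure_mono) (auto simp: Ek_def)
        then have "emeasure \<mu> Ek = ennreal (measure \<mu> Ek)"
          using emeasure_ball_finite[of "x k" "r k"] by (intro emeasure_eq_ennreal_measure) (auto simp: top_unique)
        ultimately show ?thesis using bad_fin by (simp add: emeasure_ball_eq ennreal_plus[symmetric] del: ennreal_plus)
      qed
      ultimately have half: "?mR \<le> 2 * measure \<mu> Ek" by simp
      have wk: "w k / measure \<mu> Ek \<le> 2 * doubling_const * \<tau>"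
      proof -
        have "w k = sum w {k}" by simp
        also have "\<dots> \<le> sum w {j\<in>I. x j \<in> ball (x k) (2 * r k)}"
          using kI assms(1,3,4) by (intro sum_mono2) (auto intro: less_imp_le)
        also have "\<dots> \<le> doubling_const * \<tau> * ?mR" by (rule mass[OF kI])
        also have "\<dots> \<le> doubling_const * \<tau> * (2 * measure \<mu> Ek)" using half doubling_const_pos \<open>0 < \<tau>\<close> by (intro mult_left_mono) auto
        finally show ?thesis using half pos[OF kI] by (simp add: pos_divide_le_eq mult_ac)
      qed
      let ?E = "E(k := Ek)"
      have eq: "(\<Sum>i\<in>insert k S. w i / measure \<mu> (?E i) * indicator (?E i) y) = w k / measure \<mu> Ek * indicator Ek y + \<Psi> y" for y
        using False \<open>finite S\<close> unfolding \<Psi>_def by (subst sum.insert) (auto intro!: sum.cong)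
      have "w k / measure \<mu> Ek * indicator Ek y + \<Psi> y \<le> 4 * doubling_const * \<tau>" for y
      proof (cases "y \<in> Ek")
        case True
        then have "\<Psi> y \<le> 2 * doubling_const * \<tau>" by (simp add: Ek_def)
        then show ?thesis using wk True by simp
      next
        case False
        then show ?thesis using bd[of y] by (simp add: \<Psi>_def)
      qed
      moreover have "Ek \<subseteq> ?R" by (auto simp: Ek_def)
      then have "\<forall>i\<in>insert k S. ?E i \<in> sets borel \<and> ?E i \<subseteq> ball (x i) (r i) \<and>
          measure \<mu> (ball (x i) (r i)) \<le> 2 * measure \<mu> (?E i)"
        using E half Ek_sets(1) by (simp only: fun_upd_apply ball_simps simp_thms split: if_split) blast
      ultimately show ?thesis by (intro exI[of _ ?E] conjI allI) (simp_all only: eq)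
    qed
  qed
  from this[OF \<open>finite I\<close> order_refl] show ?thesis .
qed

text \<open>The masses \<open>w i\<close> at \<open>x i\<close> are spread over sets \<open>E i\<close> such that the sum of the densities is at most a
  multiple of the height \<open>\<tau>\<close>. The exceptional set, on which nothing is claimed about a point mass and its
  spread, is the union of the balls of radius \<open>2 \<rho> i\<close>. By Vitali's covering lemma it is small, because
  the masses are dense at the scale \<open>\<rho> i\<close>. Above that scale they are not dense, and this bounds the
  mass inside the double of the controlling ball of radius \<open>r i\<close>. That ball also controls the measure
  of all balls of radius \<open>u \<ge> 2 \<rho> i\<close> around \<open>x i\<close>; this replaces the doubling property.\<close>

lemma CZ_decomposition:
  fixes I :: "nat set" and x :: "nat \<Rightarrow> 'a" and w :: "nat \<Rightarrow> real"
  assumes "finite I" "0 < \<tau>" "\<And>i. i \<in> I \<Longrightarrow> 0 < w i"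
    and total: "ennreal (sum w I) < ennreal \<tau> * emeasure \<mu> UNIV"
  obtains \<rho> r E where
    "\<And>i. i \<in> I \<Longrightarrow> 0 < \<rho> i" "\<And>i. i \<in> I \<Longrightarrow> 2 * \<rho> i \<le> r i"
    "ennreal \<tau> * emeasure \<mu> (\<Union>i\<in>I. ball (x i) (2 * \<rho> i)) \<le> ennreal (sum w I)"
    "\<And>i. i \<in> I \<Longrightarrow> 0 < measure \<mu> (ball (x i) (r i))"
    "\<And>i u. i \<in> I \<Longrightarrow> 2 * \<rho> i \<le> u \<Longrightarrow>
      measure \<mu> (ball (x i) u) \<le> 2 * (u / r i) powr (m + 1) * measure \<mu> (ball (x i) (r i))"
    "\<And>i. i \<in> I \<Longrightarrow> E i \<in> sets borel" "\<And>i. i \<in> I \<Longrightarrow> E i \<subseteq> ball (x i) (r i)"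
    "\<And>i. i \<in> I \<Longrightarrow> measure \<mu> (ball (x i) (r i)) \<le> 2 * measure \<mu> (E i)"
    "\<And>y. (\<Sum>i\<in>I. w i / measure \<mu> (E i) * indicator (E i) y) \<le> 4 * doubling_const * \<tau>"
proof -
  define N where "N i u = sum w {j \<in> I. x j \<in> ball (x i) u}" for i u
  have N_le: "N i u \<le> sum w I" for i u
    unfolding N_def using assms by (intro sum_mono2) (auto intro: less_imp_le)
  have w_le: "w i \<le> N i u" if "i \<in> I" "0 < u" for i u
    using sum_mono2[of "{j \<in> I. x j \<in> ball (x i) u}" "{i}" w] that assms by (auto simp: N_def intro: less_imp_le)
  have "\<exists>\<rho>. 0 < \<rho> \<and> \<tau> * measure \<mu> (ball (x i) (10 * \<rho>)) < N i \<rho> \<and>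
      (\<forall>u\<ge>2 * \<rho>. N i u \<le> \<tau> * measure \<mu> (ball (x i) (10 * u)))" if "i \<in> I" for i
    using stopping_radius[where x = "x i" and N = "N i" and W = "sum w I", OF assms(2) assms(3)[OF that] w_le[OF that] N_le total] by metis
  then obtain \<rho> where \<rho>: "\<And>i. i \<in> I \<Longrightarrow> 0 < \<rho> i"
    "\<And>i. i \<in> I \<Longrightarrow> \<tau> * measure \<mu> (ball (x i) (10 * \<rho> i)) < N i (\<rho> i)"
    "\<And>i u. i \<in> I \<Longrightarrow> 2 * \<rho> i \<le> u \<Longrightarrow> N i u \<le> \<tau> * measure \<mu> (ball (x i) (10 * u))"
    by metis
  have "\<exists>r. 2 * \<rho> i \<le> r \<and> 0 < measure \<mu> (ball (x i) r) \<and>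
      (\<forall>u\<ge>2 * \<rho> i. measure \<mu> (ball (x i) u) \<le> 2 * (u / r) powr (m + 1) * measure \<mu> (ball (x i) r))" if "i \<in> I" for i
  proof -
    have "0 < N i (2 * \<rho> i)"
      using assms(3)[OF that] w_le[OF that, of "2 * \<rho> i"] \<rho>(1)[OF that] by simp
    also have "\<dots> \<le> \<tau> * measure \<mu> (ball (x i) (10 * (2 * \<rho> i)))" by (rule \<rho>(3)[OF that]) simp
    finally have "0 < measure \<mu> (ball (x i) (20 * \<rho> i))" using \<open>0 < \<tau>\<close> by (simp add: zero_less_mult_iff)
    moreover have "0 < 2 * \<rho> i" "2 * \<rho> i \<le> 20 * \<rho> i" using \<rho>(1)[OF that] by auto
    ultimately show ?thesis using maximal_density_radius[of "2 * \<rho> i" "20 * \<rho> i" "x i"] by metis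
  qed
  then obtain r where r: "\<And>i. i \<in> I \<Longrightarrow> 2 * \<rho> i \<le> r i" "\<And>i. i \<in> I \<Longrightarrow> 0 < measure \<mu> (ball (x i) (r i))"
    "\<And>i u. i \<in> I \<Longrightarrow> 2 * \<rho> i \<le> u \<Longrightarrow>
      measure \<mu> (ball (x i) u) \<le> 2 * (u / r i) powr (m + 1) * measure \<mu> (ball (x i) (r i))"
    by metis
  have rpos: "0 < r i" if "i \<in> I" for i using r(1) \<rho>(1) that by force
  have mass: "sum w {j \<in> I. x j \<in> ball (x i) (2 * r i)} \<le> doubling_const * \<tau> * measure \<mu> (ball (x i) (r i))" if "i \<in> I" for i
  proof -
    have "sum w {j \<in> I. x j \<in> ball (x i) (2 * r i)} \<le> \<tau> * measure \<mu> (ball (x i) (10 * (2 * r i)))"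
      using \<rho>(3)[OF that, of "2 * r i"] r(1)[OF that] rpos[OF that] by (simp add: N_def)
    also have "\<dots> \<le> \<tau> * (2 * (10 * (2 * r i) / r i) powr (m + 1) * measure \<mu> (ball (x i) (r i)))"
      using r(1)[OF that] rpos[OF that] \<open>0 < \<tau>\<close> by (intro mult_left_mono r(3) that) auto
    finally show ?thesis using rpos[OF that] by (simp add: doubling_const_def mult_ac)
  qed
  from spread_masses[OF assms(1-3) rpos r(2) mass] obtain E where
    E0: "(\<forall>i\<in>I. E i \<in> sets borel \<and> E i \<subseteq> ball (x i) (r i) \<and>
        measure \<mu> (ball (x i) (r i)) \<le> 2 * measure \<mu> (E i)) \<and>
      (\<forall>y. (\<Sum>i\<in>I. w i / measure \<mu> (E i) * indicator (E i) y) \<le> 4 * doubling_const * \<tau>)" ..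
  then have E: "\<And>i. i \<in> I \<Longrightarrow> E i \<in> sets borel" "\<And>i. i \<in> I \<Longrightarrow> E i \<subseteq> ball (x i) (r i)"
    "\<And>i. i \<in> I \<Longrightarrow> measure \<mu> (ball (x i) (r i)) \<le> 2 * measure \<mu> (E i)"
    "\<And>y. (\<Sum>i\<in>I. w i / measure \<mu> (E i) * indicator (E i) y) \<le> 4 * doubling_const * \<tau>"
    by blast+
  have exc: "ennreal \<tau> * emeasure \<mu> (\<Union>i\<in>I. ball (x i) (2 * \<rho> i)) \<le> ennreal (sum w I)"
  proof -
    have Bd: "2 * \<rho> i \<le> (\<Sum>i\<in>I. 2 * \<rho> i)" if "i \<in> I" for i
      using \<rho>(1) assms(1) that by (intro member_le_sum) (auto intro: less_imp_le)
    obtain C where C: "C \<subseteq> I" "pairwise (\<lambda>i j. disjnt (ball (x i) (2 * \<rho> i)) (ball (x j) (2 * \<rho> j))) C"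
      "(\<Union>i\<in>I. ball (x i) (2 * \<rho> i)) \<subseteq> (\<Union>i\<in>C. ball (x i) (5 * (2 * \<rho> i)))"
      by (rule Vitali_covering_lemma_balls[OF order_refl, of I "\<lambda>i. 2 * \<rho> i" "\<Sum>i\<in>I. 2 * \<rho> i" x])
        (use \<rho>(1) Bd in \<open>auto simp del: sum_distrib_left\<close>)
    have finC: "finite C" using C(1) assms(1) finite_subset by auto
    have "ennreal \<tau> * emeasure \<mu> (\<Union>i\<in>I. ball (x i) (2 * \<rho> i)) \<le> ennreal \<tau> * emeasure \<mu> (\<Union>i\<in>C. ball (x i) (10 * \<rho> i))"
      using C(3) finC by (intro mult_left_mono emeasure_mono) auto
    also have "\<dots> \<le> ennreal \<tau> * (\<Sum>i\<in>C. emeasure \<mu> (ball (x i) (10 * \<rho> i)))"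
      using finC by (intro mult_left_mono emeasure_subadditive_finite) auto
    also have "\<dots> = (\<Sum>i\<in>C. ennreal (\<tau> * measure \<mu> (ball (x i) (10 * \<rho> i))))"
      unfolding sum_distrib_left using \<open>0 < \<tau>\<close> by (intro sum.cong refl) (simp add: emeasure_ball_eq ennreal_mult')
    also have "\<dots> = ennreal (\<Sum>i\<in>C. \<tau> * measure \<mu> (ball (x i) (10 * \<rho> i)))"
      using \<open>0 < \<tau>\<close> by (intro sum_ennreal) auto
    also have "\<dots> \<le> ennreal (sum w I)"
    proof (rule ennreal_leI)
      have "(\<Sum>i\<in>C. \<tau> * measure \<mu> (ball (x i) (10 * \<rho> i))) \<le> (\<Sum>i\<in>C. N i (\<rho> i))"
        using \<rho>(2) C(1) by (intro sum_mono) (auto intro: less_imp_le)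
      also have "\<dots> = sum w (\<Union>i\<in>C. {j \<in> I. x j \<in> ball (x i) (\<rho> i)})"
        unfolding N_def
      proof (rule sum.UNION_disjoint[symmetric, OF finC])
        show "\<forall>i\<in>C. \<forall>j\<in>C. i \<noteq> j \<longrightarrow> {l \<in> I. x l \<in> ball (x i) (\<rho> i)} \<inter> {l \<in> I. x l \<in> ball (x j) (\<rho> j)} = {}"
        proof (intro ballI impI)
          fix i j assume ij: "i \<in> C" "j \<in> C" "i \<noteq> j"
          then have "disjnt (ball (x i) (2 * \<rho> i)) (ball (x j) (2 * \<rho> j))" using C(2) by (auto simp: pairwise_def)
          moreover have "ball (x i) (\<rho> i) \<subseteq> ball (x i) (2 * \<rho> i)" "ball (x j) (\<rho> j) \<subseteq> ball (x j) (2 * \<rho> j)"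
            using \<rho>(1)[of i] \<rho>(1)[of j] ij C(1) by (auto intro!: subset_ball)
          ultimately show "{l \<in> I. x l \<in> ball (x i) (\<rho> i)} \<inter> {l \<in> I. x l \<in> ball (x j) (\<rho> j)} = {}"
            unfolding disjnt_def by blast
        qed
      qed (use assms(1) in auto)
      also have "\<dots> \<le> sum w I" using assms by (intro sum_mono2) (auto intro: less_imp_le)
      finally show "(\<Sum>i\<in>C. \<tau> * measure \<mu> (ball (x i) (10 * \<rho> i))) \<le> sum w I" .
    qed
    finally show ?thesis .
  qed
  show ?thesis using that[OF \<rho>(1) r(1) exc r(2) r(3) E] by blast
qed

end

section \<open>The weak type estimate\<close>

lemma ball_measurable [measurable]: "ball x r \<in> sets borel"
  by simp

lemma chebyshev_nn_integral:
  assumes [measurable]: "f \<in> borel_measurable M"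
  shows "c * emeasure M {x \<in> space M. c < f x} \<le> (\<integral>\<^sup>+x. f x \<partial>M)"
proof -
  have "c * emeasure M {x \<in> space M. c < f x} = (\<integral>\<^sup>+x. c * indicator {x \<in> space M. c < f x} x \<partial>M)"
    by (simp add: nn_integral_cmult_indicator)
  also have "\<dots> \<le> (\<integral>\<^sup>+x. f x \<partial>M)" by (intro nn_integral_mono) (auto simp: indicator_def)
  finally show ?thesis .
qed

lemma inverse_powr_le_cmult:
  fixes u v :: real
  assumes "0 < u" "u \<le> c * v" "0 < c" "0 \<le> q"
  shows "1 / v powr q \<le> c powr q / u powr q"
proof -
  have "0 < v" using assms by (meson less_le_trans zero_less_mult_pos)
  have "u powr q \<le> (c * v) powr q" using assms by (intro powr_mono2) auto
  also have "\<dots> = c powr q * v powr q" using assms \<open>0 < v\<close> by (simp add: powr_mult)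
  finally show ?thesis using \<open>0 < v\<close> \<open>0 < u\<close> by (simp add: field_simps)
qed

context square_function
begin

lemma sq_mono_AE:
  assumes "AE z in \<omega> x. norm (F z) \<le> norm (G z)" shows "sq F x \<le> sq G x"
  unfolding sq_def by (rule norm2_mono_AE[OF assms])

lemma sq_cong_cone:
  assumes "\<And>z. 0 < snd z \<Longrightarrow> dist x (fst z) < snd z \<Longrightarrow> F z = G z" shows "sq F x = sq G x"
  by (intro antisym sq_mono_AE; rule eventually_mono[OF omega_cone]) (auto simp: assms)

lemma sq_triangle:
  assumes "F \<in> borel_measurable borel" "G \<in> borel_measurable borel"
  shows "sq (\<lambda>z. F z + G z) x \<le> sq F x + sq G x"
  unfolding sq_def using assms by (intro norm2_triangle) auto

lemma sq_diff_triangle: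
  assumes "F \<in> borel_measurable borel" "G \<in> borel_measurable borel"
  shows "sq (\<lambda>z. F z - G z) x \<le> sq F x + sq G x"
  using sq_triangle[of F "\<lambda>z. - G z" x] assms by (simp add: sq_def norm2_def)

text \<open>The size condition bounds the kernel by \<open>t\<^sup>\<alpha> / (t + |x - p|)\<^sup>m\<^sup>+\<^sup>\<alpha>\<close> on the cone over \<open>x\<close>.\<close>

lemma sq_point_mass_le:
  assumes "x \<noteq> p"
  shows "sq (\<lambda>z. k (snd z) (fst z) p) x
    \<le> ennreal (radial_const \<alpha> (m + \<alpha>) * (K * 2 powr (m + \<alpha>)) * dist p x powr (- m))"
proof -
  let ?d = "dist p x"
  have "sq (\<lambda>z. k (snd z) (fst z) p) x
    \<le> ennreal (radial_const \<alpha> (m + \<alpha>) * (K * 2 powr (m + \<alpha>)) * ?d powr (\<alpha> - (m + \<alpha>)))"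
  proof (rule sq_radial_le)
    fix y t assume t: "0 < t" "dist x y < t"
    have "t + ?d \<le> 2 * t + dist y p" using t dist_triangle[of x p y] unfolding dist_commute[of p x] by linarith
    also have "\<dots> \<le> 2 * (t + dist y p)" by simp
    finally have "1 / (t + dist y p) powr (m + \<alpha>) \<le> 2 powr (m + \<alpha>) / (t + ?d) powr (m + \<alpha>)"
      using t alpha_pos m_pos by (intro inverse_powr_le_cmult) (auto intro: add_pos_nonneg)
    then have "K * t powr \<alpha> * (1 / (t + dist y p) powr (m + \<alpha>)) \<le> K * t powr \<alpha> * (2 powr (m + \<alpha>) / (t + ?d) powr (m + \<alpha>))"
      using K_pos by (intro mult_left_mono) auto
    then show "norm (k (snd (y, t)) (fst (y, t)) p) \<le> K * 2 powr (m + \<alpha>) * (t powr \<alpha> / (t + ?d) powr (m + \<alpha>))"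
      using k_size[OF t(1), of y p] by (simp add: mult_ac)
  qed (use alpha_pos m_pos K_pos assms in auto)
  then show ?thesis by simp
qed

text \<open>The density of the unit mass that is spread evenly over \<open>E\<close>.\<close>

definition bump :: "'a set \<Rightarrow> 'a \<Rightarrow> complex" where
  "bump E y = complex_of_real (indicator E y / measure \<mu> E)"

lemma bump_measurable [measurable]:
  assumes [measurable]: "E \<in> sets borel"
  shows "bump E \<in> borel_measurable borel"
proof -
  have "(\<lambda>y. complex_of_real (indicator E y / c)) \<in> borel_measurable borel" for c :: real by measurable
  then show ?thesis by (simp only: bump_def[abs_def])
qed

lemma norm_bump: "norm (bump E y) = indicator E y / measure \<mu> E"
  by (simp add: bump_def norm_divide)

lemma nn_integral_bump:
  assumes "E \<in> sets borel" "0 < measure \<mu> E"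
  shows "(\<integral>\<^sup>+y. ennreal (norm (bump E y)) \<partial>\<mu>) = 1"
    and "(\<integral>\<^sup>+y. (ennreal (norm (bump E y)))\<^sup>2 \<partial>\<mu>) = ennreal (1 / measure \<mu> E)"
proof -
  have fin: "emeasure \<mu> E = ennreal (measure \<mu> E)"
    using assms(2) by (metis emeasure_eq_ennreal_measure measure_zero_top less_irrefl)
  have "(\<integral>\<^sup>+y. ennreal (norm (bump E y)) \<partial>\<mu>) = (\<integral>\<^sup>+y. ennreal (1 / measure \<mu> E) * indicator E y \<partial>\<mu>)"
    by (intro nn_integral_cong) (auto simp: norm_bump indicator_def)
  also have "\<dots> = 1" using assms by (simp add: nn_integral_cmult_indicator fin ennreal_mult[symmetric])
  finally show "(\<integral>\<^sup>+y. ennreal (norm (bump E y)) \<partial>\<mu>) = 1" .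
  have "(\<integral>\<^sup>+y. (ennreal (norm (bump E y)))\<^sup>2 \<partial>\<mu>) = (\<integral>\<^sup>+y. ennreal ((1 / measure \<mu> E)\<^sup>2) * indicator E y \<partial>\<mu>)"
    by (intro nn_integral_cong) (auto simp: norm_bump indicator_def ennreal_power power_divide)
  also have "\<dots> = ennreal (1 / measure \<mu> E)"
    using assms by (simp add: nn_integral_cmult_indicator fin ennreal_mult[symmetric] power2_eq_square)
  finally show "(\<integral>\<^sup>+y. (ennreal (norm (bump E y)))\<^sup>2 \<partial>\<mu>) = ennreal (1 / measure \<mu> E)" .
qed

lemma kernel_bump_integrable:
  assumes "0 < t" "E \<in> sets borel" "0 < measure \<mu> E"
  shows "integrable \<mu> (\<lambda>y. k t x y * bump E y)"
  using assms nn_integral_bump(1)[of E] by (intro kernel_mult_integrable[where p = 1]) auto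

definition far_const :: real where
  "far_const = radial_const (\<alpha> / 2) (m + \<alpha>) * (K * (2 * 4 powr (m + \<alpha>) * 2 powr (\<alpha> / 2)))"

text \<open>Far from an atom \<open>\<delta>\<^sub>p - bump E\<close>, the smoothness of the kernel gives decay when \<open>t\<close> exceeds the
  radius \<open>r\<close> of the atom, and the size condition does when \<open>t\<close> is smaller. Half of the exponent
  \<open>\<alpha>\<close> is spent on each, so that a single radial bound covers both ranges.\<close>

lemma kernel_difference_le:
  assumes t: "0 < t" "dist x y < t" and z: "dist p z < r" and far: "5 * r \<le> dist p x"
  shows "norm (k t y p - k t y z)
    \<le> K * (2 * 4 powr (m + \<alpha>) * 2 powr (\<alpha> / 2)) * r powr (\<alpha> / 2) * (t powr (\<alpha> / 2) / (t + dist p x) powr (m + \<alpha>))"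
proof -
  let ?d = "dist p x" and ?q = "m + \<alpha>"
  have q: "0 < ?q" using m_pos alpha_pos by simp
  have r: "0 < r" using z by (meson le_less_trans zero_le_dist)
  have half: "s powr \<alpha> = s powr (\<alpha> / 2) * s powr (\<alpha> / 2)" for s :: real by (simp add: powr_add[symmetric])
  have td: "0 < t + ?d" using t by (simp add: add_pos_nonneg)
  have "t + ?d \<le> 2 * t + dist y p" using t dist_triangle[of x p y] unfolding dist_commute[of p x] by linarith
  also have "\<dots> \<le> 2 * (t + dist y p)" by simp
  finally have p: "1 / (t + dist y p) powr ?q \<le> 2 powr ?q / (t + ?d) powr ?q"
    using t td q by (intro inverse_powr_le_cmult) auto
  have "t + ?d \<le> 9/4 * t + 5/4 * dist y z"
    using t dist_triangle[of x p y] dist_triangle[of y p z] far z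
    unfolding dist_commute[of p x] dist_commute[of z p] by linarith
  also have "\<dots> \<le> 4 * t + 4 * dist y z" using t by (intro add_mono mult_right_mono) auto
  finally have z': "1 / (t + dist y z) powr ?q \<le> 4 powr ?q / (t + ?d) powr ?q"
    using t td q by (intro inverse_powr_le_cmult) auto
  have two: "2 powr ?q \<le> (4::real) powr ?q" "1 \<le> (2::real) powr (\<alpha> / 2)"
    using q alpha_pos by (auto intro: powr_mono2 ge_one_powr_ge_zero)
  show ?thesis
  proof (cases "dist p z < t / 2")
    case True
    have "norm (k t y p - k t y z) \<le> K * (dist p z powr \<alpha> / (t + dist y p) powr ?q)"
      by (rule k_smooth[OF t(1) True])
    also have "\<dots> = K * (dist p z powr (\<alpha> / 2) * dist p z powr (\<alpha> / 2)) * (1 / (t + dist y p) powr ?q)"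
      by (simp add: half[symmetric])
    also have "\<dots> \<le> K * (r powr (\<alpha> / 2) * t powr (\<alpha> / 2)) * (2 powr ?q / (t + ?d) powr ?q)"
      using z True t K_pos alpha_pos by (intro mult_mono p powr_mono2) auto
    also have "\<dots> \<le> K * (r powr (\<alpha> / 2) * t powr (\<alpha> / 2)) * ((2 * 4 powr ?q * 2 powr (\<alpha> / 2)) / (t + ?d) powr ?q)"
    proof -
      have "2 powr ?q * 1 \<le> 2 * 4 powr ?q * (2::real) powr (\<alpha> / 2)" using two order_trans[OF two(1), of "2 * 4 powr ?q"] by (intro mult_mono) auto
      then show ?thesis using K_pos by (intro mult_left_mono divide_right_mono) auto
    qed
    finally show ?thesis by (simp add: mult_ac)
  next
    case False
    have "norm (k t y p - k t y z) \<le> norm (k t y p) + norm (k t y z)" by (rule norm_triangle_ineq4)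
    also have "\<dots> \<le> K * t powr \<alpha> * (1 / (t + dist y p) powr ?q) + K * t powr \<alpha> * (1 / (t + dist y z) powr ?q)"
      using k_size[OF t(1), of y p] k_size[OF t(1), of y z] by simp
    also have "\<dots> \<le> K * t powr \<alpha> * (4 powr ?q / (t + ?d) powr ?q) + K * t powr \<alpha> * (4 powr ?q / (t + ?d) powr ?q)"
      using K_pos two by (intro add_mono mult_left_mono order_trans[OF p] z' divide_right_mono) auto
    also have "\<dots> = K * (t powr (\<alpha> / 2) * t powr (\<alpha> / 2)) * (2 * 4 powr ?q / (t + ?d) powr ?q)"
      by (simp add: half[symmetric])
    also have "\<dots> \<le> K * (t powr (\<alpha> / 2) * (2 * r) powr (\<alpha> / 2)) * (2 * 4 powr ?q / (t + ?d) powr ?q)"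
      using False z t K_pos alpha_pos by (intro mult_right_mono mult_left_mono powr_mono2) auto
    also have "(2 * r) powr (\<alpha> / 2) = 2 powr (\<alpha> / 2) * r powr (\<alpha> / 2)" using r by (simp add: powr_mult)
    finally show ?thesis by (simp add: mult_ac)
  qed
qed

lemma sq_atom_far_le:
  assumes E: "E \<in> sets borel" "E \<subseteq> ball p r" "0 < measure \<mu> E" and far: "5 * r \<le> dist p x" and "0 < r"
  shows "sq (\<lambda>z. k (snd z) (fst z) p - T (bump E) z) x
    \<le> ennreal (far_const * r powr (\<alpha> / 2) * dist p x powr (- (m + \<alpha> / 2)))"
proof -
  let ?d = "dist p x"
  let ?Q = "K * (2 * 4 powr (m + \<alpha>) * 2 powr (\<alpha> / 2)) * r powr (\<alpha> / 2)"
  have "sq (\<lambda>z. k (snd z) (fst z) p - T (bump E) z) x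
    \<le> ennreal (radial_const (\<alpha> / 2) (m + \<alpha>) * ?Q * ?d powr (\<alpha> / 2 - (m + \<alpha>)))"
  proof (rule sq_radial_le)
    fix y t assume t: "0 < t" "dist x y < t"
    let ?b = "?Q * (t powr (\<alpha> / 2) / (t + ?d) powr (m + \<alpha>))"
    have b: "0 \<le> ?b" using K_pos by simp
    have int: "integrable \<mu> (bump E)"
      using E nn_integral_bump(1)[of E] by (intro integrableI_bounded) auto
    have one: "(\<integral>u. bump E u \<partial>\<mu>) = 1"
    proof -
      have "emeasure \<mu> E < \<infinity>" using E(3) by (metis less_top measure_zero_top less_irrefl infinity_ennreal_def)
      then have "(\<integral>u. indicator E u / measure \<mu> E \<partial>\<mu>) = 1" using E by simp
      then show ?thesis unfolding bump_def by (simp only: integral_complex_of_real of_real_1)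
    qed
    have "k t y p - T (bump E) (y, t) = (\<integral>u. k t y p * bump E u - k t y u * bump E u \<partial>\<mu>)"
      using int kernel_bump_integrable[OF t(1) E(1,3), of y] one by (simp add: T_def)
    then have "ennreal (norm (k t y p - T (bump E) (y, t))) \<le> (\<integral>\<^sup>+u. ennreal (norm (k t y p * bump E u - k t y u * bump E u)) \<partial>\<mu>)"
      by (simp only: norm_integral_le_nn_integral)
    also have "\<dots> \<le> (\<integral>\<^sup>+u. ennreal ?b * ennreal (norm (bump E u)) \<partial>\<mu>)"
    proof (rule nn_integral_mono)
      fix u
      show "ennreal (norm (k t y p * bump E u - k t y u * bump E u)) \<le> ennreal ?b * ennreal (norm (bump E u))"
      proof (cases "u \<in> E")
        case True
        then have "norm (k t y p - k t y u) \<le> ?b" using E t far by (intro kernel_difference_le) auto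
        then have "norm (k t y p - k t y u) * norm (bump E u) \<le> ?b * norm (bump E u)" by (intro mult_right_mono) auto
        then show ?thesis
          using b by (simp only: ennreal_mult[symmetric, OF b norm_ge_zero] left_diff_distrib[symmetric] norm_mult ennreal_leI)
      qed (simp add: bump_def)
    qed
    also have "\<dots> = ennreal ?b" using E nn_integral_bump(1)[of E] by (subst nn_integral_cmult) auto
    finally show "norm (k (snd (y, t)) (fst (y, t)) p - T (bump E) (y, t)) \<le> ?b"
      using b by (simp only: ennreal_le_iff fst_conv snd_conv)
  qed (use alpha_pos m_pos K_pos \<open>0 < r\<close> far in auto)
  also have "\<alpha> / 2 - (m + \<alpha>) = - (m + \<alpha> / 2)" by simp
  finally show ?thesis by (simp only: far_const_def mult.assoc)
qed

end

locale L2_square_function = square_function \<mu> m A k \<alpha> K \<omega> D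
  for \<mu> :: "'a::euclidean_space measure" and m A :: real and k \<alpha> K \<omega> D +
  fixes B :: real
  assumes B_pos: "0 < B"
    and L2: "\<And>g. g \<in> borel_measurable borel \<Longrightarrow> (\<integral>\<^sup>+y. (ennreal (norm (g y)))\<^sup>2 \<partial>\<mu>) < \<infinity> \<Longrightarrow>
      (\<integral>\<^sup>+x. (sq (T g) x)\<^sup>2 \<partial>\<mu>) \<le> ennreal B * (\<integral>\<^sup>+y. (ennreal (norm (g y)))\<^sup>2 \<partial>\<mu>)"
begin

lemma sq_bump_near_le:
  assumes E: "E \<in> sets borel" "0 < measure \<mu> E" and "measure \<mu> (ball p u) \<le> c * measure \<mu> E" "0 \<le> c"
  shows "(\<integral>\<^sup>+x\<in>ball p u. sq (T (bump E)) x \<partial>\<mu>) \<le> ennreal (sqrt (c * B))"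
proof -
  have "(\<integral>\<^sup>+x\<in>ball p u. sq (T (bump E)) x \<partial>\<mu>)\<^sup>2
      \<le> (\<integral>\<^sup>+x. (sq (T (bump E)) x)\<^sup>2 \<partial>\<mu>) * (\<integral>\<^sup>+x. (indicator (ball p u) x)\<^sup>2 \<partial>\<mu>)"
    using E by (intro Cauchy_Schwarz_nn_integral) (auto intro!: borel_measurable_indicator)
  also have "(\<integral>\<^sup>+x. (indicator (ball p u) x)\<^sup>2 \<partial>\<mu>) = (\<integral>\<^sup>+x. indicator (ball p u) x \<partial>\<mu>)"
    by (intro nn_integral_cong) (auto simp: indicator_def)
  also have "\<dots> = ennreal (measure \<mu> (ball p u))" by (simp add: emeasure_ball_eq)
  also have "(\<integral>\<^sup>+x. (sq (T (bump E)) x)\<^sup>2 \<partial>\<mu>) * ennreal (measure \<mu> (ball p u))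
      \<le> (ennreal B * ennreal (1 / measure \<mu> E)) * ennreal (c * measure \<mu> E)"
    using L2[of "bump E"] E assms(3) nn_integral_bump(2)[of E] by (intro mult_mono ennreal_leI) auto
  also have "\<dots> = (ennreal (sqrt (c * B)))\<^sup>2"
    using B_pos E \<open>0 \<le> c\<close> by (simp add: ennreal_power ennreal_mult[symmetric])
  finally show ?thesis by (simp only: ennreal_power2_le_iff)
qed

definition near_const :: real where
  "near_const = radial_const \<alpha> (m + \<alpha>) * (K * 2 powr (m + \<alpha>)) * (2 * A * 2 powr (m + 1) + A * 5 powr m)"

definition atom_const :: real where
  "atom_const = near_const + sqrt (4 * 5 powr (m + 1) * B)
     + far_const * 2 powr (m + \<alpha> / 2) * (A * tail_const m (\<alpha> / 2))"

text \<open>The difference between a point mass at \<open>p\<close> and its spread over \<open>E\<close> has a square function that is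
  integrable off the exceptional ball, with a bound that does not depend on the scales \<open>\<rho>\<close> and \<open>r\<close>. Up to
  distance \<open>5 r\<close> the two parts are estimated separately. The point mass leads to the critical power
  of the distance; its integral over the shell between \<open>2 \<rho>\<close> and \<open>r\<close> is bounded, because the choice of
  the ball of radius \<open>r\<close> makes the measure of smaller balls lighter by a factor \<open>u / r\<close>. The spread mass is
  bounded in \<open>L\<^sup>2\<close>, which suffices on a ball whose measure is comparable to that of \<open>E\<close>. Beyond
  distance \<open>5 r\<close> the smoothness of the kernel is used.\<close>

lemma atom_estimate:
  assumes \<rho>: "0 < \<rho>" "2 * \<rho> \<le> r"
    and growth_u: "\<And>u. 2 * \<rho> \<le> u \<Longrightarrow> measure \<mu> (ball p u) \<le> 2 * (u / r) powr (m + 1) * measure \<mu> (ball p r)"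
    and E: "E \<in> sets borel" "E \<subseteq> ball p r" and pos: "0 < measure \<mu> (ball p r)"
    and half: "measure \<mu> (ball p r) \<le> 2 * measure \<mu> E"
  shows "(\<integral>\<^sup>+x\<in>- ball p (2 * \<rho>). sq (\<lambda>z. k (snd z) (fst z) p - T (bump E) z) x \<partial>\<mu>) \<le> ennreal atom_const"
proof -
  let ?F = "\<lambda>z. k (snd z) (fst z) p - T (bump E) z"
  let ?P = "\<lambda>z :: 'a \<times> real. k (snd z) (fst z) p"
  let ?C1 = "radial_const \<alpha> (m + \<alpha>) * (K * 2 powr (m + \<alpha>))"
  note [measurable] = E(1)
  have r: "0 < r" using \<rho> by simp
  have mE: "0 < measure \<mu> E" using pos half by simp
  have C1: "0 \<le> ?C1" using radial_const_pos[of \<alpha> "m + \<alpha>"] alpha_pos m_pos K_pos by simp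
  have [measurable]: "?P \<in> borel_measurable borel" by measurable
  have [measurable]: "?F \<in> borel_measurable borel" by measurable
  have split: "sq ?F x * indicator (- ball p (2 * \<rho>)) x
     \<le> ennreal ?C1 * (ennreal (1 / dist x p powr m) * indicator (ball p r - ball p (2 * \<rho>)) x)
       + ennreal ?C1 * (ennreal (1 / r powr m) * indicator (ball p (5 * r)) x)
       + sq (T (bump E)) x * indicator (ball p (5 * r)) x
       + ennreal (far_const * r powr (\<alpha> / 2) * 2 powr (m + \<alpha> / 2)) * ennreal (1 / (r + dist p x) powr (m + \<alpha> / 2))" for x
  proof -
    \<comment> \<open>The exceptional ball, the range of the separate estimates, and the range of cancellation.\<close>
    consider "dist p x < 2 * \<rho>" | "2 * \<rho> \<le> dist p x" "dist p x < 5 * r" | "5 * r \<le> dist p x" by linarith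
    then show ?thesis
    proof cases
      case 2
      then have "x \<noteq> p" using \<rho> by auto
      have "sq ?F x \<le> sq ?P x + sq (T (bump E)) x" by (rule sq_diff_triangle) measurable
      also have "sq ?P x \<le> ennreal ?C1 * ennreal (1 / dist x p powr m)"
        using sq_point_mass_le[OF \<open>x \<noteq> p\<close>] C1
        by (simp add: ennreal_mult[symmetric] powr_minus_divide dist_commute)
      also have "\<dots> \<le> ennreal ?C1 * (ennreal (1 / dist x p powr m) * indicator (ball p r - ball p (2 * \<rho>)) x)
        + ennreal ?C1 * (ennreal (1 / r powr m) * indicator (ball p (5 * r)) x)"
      proof (cases "dist p x < r")
        case True then show ?thesis using 2 by simp
      next
        case False
        then have "1 / dist x p powr m \<le> 1 / r powr m"
          using r m_pos by (intro divide_left_mono powr_mono2) (auto simp: dist_commute intro!: mult_pos_pos)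
        then show ?thesis using 2 False by (simp add: mult_left_mono ennreal_leI)
      qed
      finally have "sq ?F x \<le> ennreal ?C1 * (ennreal (1 / dist x p powr m) * indicator (ball p r - ball p (2 * \<rho>)) x)
        + ennreal ?C1 * (ennreal (1 / r powr m) * indicator (ball p (5 * r)) x) + sq (T (bump E)) x" by simp
      then show ?thesis using 2 by (simp add: add_increasing2)
    next
      case 3
      have "sq ?F x \<le> ennreal (far_const * r powr (\<alpha> / 2) * dist p x powr (- (m + \<alpha> / 2)))"
        by (rule sq_atom_far_le[OF E mE 3 r])
      also have "\<dots> \<le> ennreal (far_const * r powr (\<alpha> / 2) * 2 powr (m + \<alpha> / 2)) * ennreal (1 / (r + dist p x) powr (m + \<alpha> / 2))"
      proof -
        have fc: "0 \<le> far_const" using radial_const_pos[of "\<alpha> / 2" "m + \<alpha>"] alpha_pos m_pos K_pos by (simp add: far_const_def)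
        have "1 / dist p x powr (m + \<alpha> / 2) \<le> 2 powr (m + \<alpha> / 2) / (r + dist p x) powr (m + \<alpha> / 2)"
          using 3 r m_pos alpha_pos by (intro inverse_powr_le_cmult) auto
        then have "far_const * r powr (\<alpha> / 2) * dist p x powr (- (m + \<alpha> / 2))
          \<le> far_const * r powr (\<alpha> / 2) * (2 powr (m + \<alpha> / 2) / (r + dist p x) powr (m + \<alpha> / 2))"
          using fc unfolding powr_minus_divide by (intro mult_left_mono) auto
        then show ?thesis using fc by (subst ennreal_mult[symmetric]) (auto intro: ennreal_leI)
      qed
      finally have "sq ?F x * indicator (- ball p (2 * \<rho>)) x
          \<le> ennreal (far_const * r powr (\<alpha> / 2) * 2 powr (m + \<alpha> / 2)) * ennreal (1 / (r + dist p x) powr (m + \<alpha> / 2))"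
        by (cases "x \<in> ball p (2 * \<rho>)") (simp_all del: mem_ball)
      then show ?thesis by (rule add_increasing[OF zero_le])
    qed simp
  qed
  have "(\<integral>\<^sup>+x\<in>- ball p (2 * \<rho>). sq ?F x \<partial>\<mu>)
     \<le> (\<integral>\<^sup>+x. ennreal ?C1 * (ennreal (1 / dist x p powr m) * indicator (ball p r - ball p (2 * \<rho>)) x)
       + ennreal ?C1 * (ennreal (1 / r powr m) * indicator (ball p (5 * r)) x)
       + sq (T (bump E)) x * indicator (ball p (5 * r)) x
       + ennreal (far_const * r powr (\<alpha> / 2) * 2 powr (m + \<alpha> / 2)) * ennreal (1 / (r + dist p x) powr (m + \<alpha> / 2)) \<partial>\<mu>)"
    by (intro nn_integral_mono split)
  also have "\<dots> = ennreal ?C1 * (\<integral>\<^sup>+x\<in>ball p r - ball p (2 * \<rho>). ennreal (1 / dist x p powr m) \<partial>\<mu>)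
      + ennreal ?C1 * (ennreal (1 / r powr m) * emeasure \<mu> (ball p (5 * r)))
      + (\<integral>\<^sup>+x\<in>ball p (5 * r). sq (T (bump E)) x \<partial>\<mu>)
      + ennreal (far_const * r powr (\<alpha> / 2) * 2 powr (m + \<alpha> / 2)) * (\<integral>\<^sup>+x. ennreal (1 / (r + dist p x) powr (m + \<alpha> / 2)) \<partial>\<mu>)"
  proof -
    have "(\<integral>\<^sup>+x. a * f x + b * (c * indicator S x) + g x + d * h x \<partial>\<mu>)
        = a * (\<integral>\<^sup>+x. f x \<partial>\<mu>) + b * (c * emeasure \<mu> S) + (\<integral>\<^sup>+x. g x \<partial>\<mu>) + d * (\<integral>\<^sup>+x. h x \<partial>\<mu>)"
      if [measurable]: "f \<in> borel_measurable borel" "g \<in> borel_measurable borel" "h \<in> borel_measurable borel" "S \<in> sets borel"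
      for a b c d :: ennreal and f g h S
      by (simp add: nn_integral_add nn_integral_cmult nn_integral_cmult_indicator)
    from this show ?thesis by this measurable
  qed
  also have "\<dots> \<le> ennreal ?C1 * ennreal (2 * A * 2 powr (m + 1)) + ennreal ?C1 * ennreal (A * 5 powr m)
      + ennreal (sqrt (4 * 5 powr (m + 1) * B))
      + ennreal (far_const * r powr (\<alpha> / 2) * 2 powr (m + \<alpha> / 2)) * ennreal (A * tail_const m (\<alpha> / 2) * r powr (- (\<alpha> / 2)))"
  proof (intro add_mono mult_left_mono)
    show "(\<integral>\<^sup>+x\<in>ball p r - ball p (2 * \<rho>). ennreal (1 / dist x p powr m) \<partial>\<mu>) \<le> ennreal (2 * A * 2 powr (m + 1))"
      unfolding dist_commute[of _ p]
    proof (rule shell_integral)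
      fix u assume u: "2 * \<rho> \<le> u" "u \<le> r"
      have u0: "0 < u" using u \<rho> by simp
      have "measure \<mu> (ball p u) \<le> 2 * (u / r) powr (m + 1) * (A * r powr m)"
        using growth_u[OF u(1)] measure_ball_le[OF r, of p] by (meson mult_left_mono order_trans powr_ge_zero mult_nonneg_nonneg zero_le_numeral)
      also have "\<dots> = 2 * A * (u / r) * u powr m"
        using u0 r by (simp add: powr_divide powr_add)
      finally show "emeasure \<mu> (ball p u) \<le> ennreal (2 * A * (u / r) * u powr m)"
        by (simp only: emeasure_ball_eq ennreal_leI)
    qed (use \<rho> r m_pos A_pos in auto)
    have "ennreal (1 / r powr m) * emeasure \<mu> (ball p (5 * r)) \<le> ennreal (1 / r powr m) * ennreal (A * (5 * r) powr m)"
      using r by (intro mult_left_mono growth) auto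
    also have "\<dots> = ennreal (A * 5 powr m)"
      using r A_pos by (subst ennreal_mult[symmetric]) (auto simp: powr_mult)
    finally show "ennreal (1 / r powr m) * emeasure \<mu> (ball p (5 * r)) \<le> ennreal (A * 5 powr m)" .
    show "(\<integral>\<^sup>+x\<in>ball p (5 * r). sq (T (bump E)) x \<partial>\<mu>) \<le> ennreal (sqrt (4 * 5 powr (m + 1) * B))"
    proof (rule sq_bump_near_le[OF E(1) mE])
      have "measure \<mu> (ball p (5 * r)) \<le> 2 * (5 * r / r) powr (m + 1) * measure \<mu> (ball p r)"
        using r \<rho> by (intro growth_u) auto
      also have "\<dots> \<le> 2 * (5 * r / r) powr (m + 1) * (2 * measure \<mu> E)" using half by (intro mult_left_mono) auto
      finally show "measure \<mu> (ball p (5 * r)) \<le> 4 * 5 powr (m + 1) * measure \<mu> E" using r by simp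
    qed simp
    show "(\<integral>\<^sup>+x. ennreal (1 / (r + dist p x) powr (m + \<alpha> / 2)) \<partial>\<mu>) \<le> ennreal (A * tail_const m (\<alpha> / 2) * r powr (- (\<alpha> / 2)))"
      using r alpha_pos by (intro tail_mu) auto
  qed auto
  also have "\<dots> = ennreal atom_const"
  proof -
    have fc: "0 \<le> far_const" using radial_const_pos[of "\<alpha> / 2" "m + \<alpha>"] alpha_pos m_pos K_pos by (simp add: far_const_def)
    have tc: "0 \<le> tail_const m (\<alpha> / 2)" using tail_const_pos[of "\<alpha> / 2" m] alpha_pos by simp
    have "far_const * r powr (\<alpha> / 2) * 2 powr (m + \<alpha> / 2) * (A * tail_const m (\<alpha> / 2) * r powr (- (\<alpha> / 2)))
       = far_const * 2 powr (m + \<alpha> / 2) * (A * tail_const m (\<alpha> / 2))"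
      using r by (simp add: powr_minus)
    then have "ennreal (far_const * r powr (\<alpha> / 2) * 2 powr (m + \<alpha> / 2)) * ennreal (A * tail_const m (\<alpha> / 2) * r powr (- (\<alpha> / 2)))
       = ennreal (far_const * 2 powr (m + \<alpha> / 2) * (A * tail_const m (\<alpha> / 2)))"
      using fc by (subst ennreal_mult'[symmetric]) (simp_all only: mult_nonneg_nonneg powr_ge_zero)
    moreover have "ennreal ?C1 * ennreal (2 * A * 2 powr (m + 1)) + ennreal ?C1 * ennreal (A * 5 powr m) = ennreal near_const"
      using C1 A_pos by (simp add: near_const_def ennreal_mult'[symmetric] ennreal_plus[symmetric] distrib_left del: ennreal_plus)
    moreover have "0 \<le> near_const" unfolding near_const_def by (rule mult_nonneg_nonneg[OF C1]) (use A_pos in auto)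
    ultimately show ?thesis
      using fc tc A_pos B_pos by (simp add: atom_const_def)
  qed
  finally show ?thesis .
qed

lemma atom_const_pos: "0 < atom_const"
proof -
  have "0 < near_const"
    unfolding near_const_def using radial_const_pos[of \<alpha> "m + \<alpha>"] alpha_pos m_pos K_pos A_pos
    by (intro mult_pos_pos add_pos_pos) auto
  moreover have "0 \<le> far_const"
    using radial_const_pos[of "\<alpha> / 2" "m + \<alpha>"] alpha_pos m_pos K_pos by (simp add: far_const_def)
  ultimately show ?thesis
    using tail_const_pos[of "\<alpha> / 2" m] alpha_pos A_pos B_pos by (simp add: atom_const_def add_pos_nonneg)
qed

text \<open>The function \<open>g\<close> obtained by spreading the masses is bounded by a multiple of \<open>\<tau>\<close> and has integral at most
  \<open>W\<close>, so that the bound on \<open>L\<^sup>2\<close> and Chebyshev's inequality control its level sets. The remaining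
  atoms have integrable square functions off the exceptional set. If \<open>\<tau> \<mu>(UNIV) \<le> W\<close>, the estimate is
  trivial; otherwise the decomposition is available.\<close>

lemma weak_type_point_masses:
  fixes I :: "nat set" and x :: "nat \<Rightarrow> 'a" and a :: "nat \<Rightarrow> complex"
  assumes "finite I" "0 < \<tau>" and nz: "\<And>i. i \<in> I \<Longrightarrow> a i \<noteq> 0"
  shows "ennreal \<tau> * emeasure \<mu> {y. ennreal \<tau> < sq (\<lambda>z. \<Sum>i\<in>I. a i * k (snd z) (fst z) (x i)) y}
    \<le> ennreal ((1 + 16 * doubling_const * B + 2 * atom_const) * (\<Sum>i\<in>I. norm (a i)))"
proof -
  define W where "W = (\<Sum>i\<in>I. norm (a i))"
  have W: "0 \<le> W" by (simp add: W_def sum_nonneg)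
  let ?G = "\<lambda>z :: 'a \<times> real. \<Sum>i\<in>I. a i * k (snd z) (fst z) (x i)"
  have [measurable]: "?G \<in> borel_measurable borel" by measurable
  show ?thesis
  proof (cases "ennreal W < ennreal \<tau> * emeasure \<mu> UNIV")
    case False
    have "ennreal \<tau> * emeasure \<mu> {y. ennreal \<tau> < sq ?G y} \<le> ennreal \<tau> * emeasure \<mu> UNIV"
      by (intro mult_left_mono emeasure_mono) auto
    also have "\<dots> \<le> ennreal W" using False by simp
    also have "\<dots> \<le> ennreal ((1 + 16 * doubling_const * B + 2 * atom_const) * W)"
      using mult_right_mono[of 1 "1 + 16 * doubling_const * B + 2 * atom_const" W] W doubling_const_pos B_pos atom_const_pos by (simp add: ennreal_leI)
    finally show ?thesis by (simp add: W_def)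
  next
    case True
    obtain \<rho> r E where \<rho>: "\<And>i. i \<in> I \<Longrightarrow> 0 < \<rho> i" "\<And>i. i \<in> I \<Longrightarrow> 2 * \<rho> i \<le> r i"
      and exc: "ennreal \<tau> * emeasure \<mu> (\<Union>i\<in>I. ball (x i) (2 * \<rho> i)) \<le> ennreal W"
      and pos: "\<And>i. i \<in> I \<Longrightarrow> 0 < measure \<mu> (ball (x i) (r i))"
      and gr: "\<And>i u. i \<in> I \<Longrightarrow> 2 * \<rho> i \<le> u \<Longrightarrow>
        measure \<mu> (ball (x i) u) \<le> 2 * (u / r i) powr (m + 1) * measure \<mu> (ball (x i) (r i))"
      and E: "\<And>i. i \<in> I \<Longrightarrow> E i \<in> sets borel" "\<And>i. i \<in> I \<Longrightarrow> E i \<subseteq> ball (x i) (r i)"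
        "\<And>i. i \<in> I \<Longrightarrow> measure \<mu> (ball (x i) (r i)) \<le> 2 * measure \<mu> (E i)"
      and bd: "\<And>y. (\<Sum>i\<in>I. norm (a i) / measure \<mu> (E i) * indicator (E i) y) \<le> 4 * doubling_const * \<tau>"
      unfolding W_def
      by (rule CZ_decomposition[where I = I and \<tau> = \<tau> and w = "\<lambda>i. norm (a i)" and x = x])
        (use assms True in \<open>auto simp: W_def\<close>)
    define \<Omega> where "\<Omega> = (\<Union>i\<in>I. ball (x i) (2 * \<rho> i))"
    define g where "g y = (\<Sum>i\<in>I. a i * bump (E i) y)" for y
    define F where "F i z = k (snd z) (fst z) (x i) - T (bump (E i)) z" for i z
    have mE: "0 < measure \<mu> (E i)" if "i \<in> I" for i using pos[OF that] E(3)[OF that] by simp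
    have [measurable]: "\<Omega> \<in> sets borel" unfolding \<Omega>_def using assms by (intro sets.finite_UN) auto
    have g_meas [measurable]: "g \<in> borel_measurable borel"
      unfolding g_def[abs_def] using E(1) by (intro borel_measurable_sum borel_measurable_times) auto
    have F_meas [measurable]: "F i \<in> borel_measurable borel" if "i \<in> I" for i
      unfolding F_def[abs_def] using E(1)[OF that] by measurable
    have le: "sq ?G y \<le> sq (T g) y + (\<Sum>i\<in>I. ennreal (norm (a i)) * sq (F i) y)" for y
    proof -
      have "sq ?G y = sq (\<lambda>z. T g z + (\<Sum>i\<in>I. a i * F i z)) y"
      proof (rule sq_cong_cone)
        fix z :: "'a \<times> real" assume z: "0 < snd z"
        have "T g z = (\<integral>y. (\<Sum>i\<in>I. a i * (k (snd z) (fst z) y * bump (E i) y)) \<partial>\<mu>)"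
          by (simp add: T_def g_def sum_distrib_left mult_ac)
        also have "\<dots> = (\<Sum>i\<in>I. a i * T (bump (E i)) z)"
          using kernel_bump_integrable[OF z E(1) mE] by (simp add: T_def)
        finally show "?G z = T g z + (\<Sum>i\<in>I. a i * F i z)"
          by (simp add: F_def right_diff_distrib sum_subtractf)
      qed
      also have "\<dots> \<le> sq (T g) y + sq (\<lambda>z. \<Sum>i\<in>I. a i * F i z) y"
        by (intro sq_triangle borel_measurable_sum borel_measurable_times F_meas) auto
      also have "sq (\<lambda>z. \<Sum>i\<in>I. a i * F i z) y \<le> (\<Sum>i\<in>I. sq (\<lambda>z. a i * F i z) y)"
        unfolding sq_def using assms F_meas by (intro norm2_sum) auto
      also have "\<dots> = (\<Sum>i\<in>I. ennreal (norm (a i)) * sq (F i) y)"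
        unfolding sq_def using F_meas by (intro sum.cong refl norm2_cmult) auto
      finally show ?thesis by simp
    qed
    let ?H = "\<lambda>y. \<Sum>i\<in>I. ennreal (norm (a i)) * sq (F i) y"
    have H_meas [measurable]: "?H \<in> borel_measurable borel"
      using F_meas by (intro borel_measurable_sum borel_measurable_times_ennreal sq_measurable) auto
    let ?half = "ennreal (\<tau> / 2)"
    have sub: "{y. ennreal \<tau> < sq ?G y} \<subseteq> \<Omega> \<union> {y. ?half < sq (T g) y} \<union> {y. ?half < ?H y * indicator (- \<Omega>) y}"
    proof
      fix y assume y: "y \<in> {y. ennreal \<tau> < sq ?G y}"
      show "y \<in> \<Omega> \<union> {y. ?half < sq (T g) y} \<union> {y. ?half < ?H y * indicator (- \<Omega>) y}"
      proof (rule ccontr)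
        assume "\<not> ?thesis"
        then have "sq (T g) y \<le> ?half" "?H y \<le> ?half" by (auto simp: not_less)
        then have "sq ?G y \<le> ?half + ?half" using le[of y] by (meson add_mono order_trans)
        also have "\<dots> = ennreal \<tau>" using assms by (simp add: ennreal_plus[symmetric] del: ennreal_plus)
        finally show False using y by simp
      qed
    qed
    have good: "ennreal \<tau> * emeasure \<mu> {y. ?half < sq (T g) y} \<le> ennreal (16 * doubling_const * B * W)"
    proof -
      have g_le: "norm (g y) \<le> (\<Sum>i\<in>I. norm (a i) / measure \<mu> (E i) * indicator (E i) y)" for y
        unfolding g_def by (rule order_trans[OF norm_sum]) (simp add: norm_mult norm_bump)
      have "(\<integral>\<^sup>+y. (ennreal (norm (g y)))\<^sup>2 \<partial>\<mu>)
          \<le> (\<integral>\<^sup>+y. ennreal (4 * doubling_const * \<tau>) * (\<Sum>i\<in>I. ennreal (norm (a i)) * ennreal (norm (bump (E i) y))) \<partial>\<mu>)"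
      proof (rule nn_integral_mono)
        fix y
        have "ennreal (norm (g y)) \<le> ennreal (\<Sum>i\<in>I. norm (a i) * norm (bump (E i) y))"
          using g_le[of y] by (simp add: norm_bump ennreal_leI)
        also have "\<dots> = (\<Sum>i\<in>I. ennreal (norm (a i)) * ennreal (norm (bump (E i) y)))"
          by (subst sum_ennreal[symmetric]) (auto simp: ennreal_mult)
        finally have "ennreal (norm (g y)) \<le> (\<Sum>i\<in>I. ennreal (norm (a i)) * ennreal (norm (bump (E i) y)))" .
        moreover have "ennreal (norm (g y)) \<le> ennreal (4 * doubling_const * \<tau>)"
          using g_le[of y] bd[of y] by (intro ennreal_leI) simp
        ultimately show "(ennreal (norm (g y)))\<^sup>2 \<le> ennreal (4 * doubling_const * \<tau>) * (\<Sum>i\<in>I. ennreal (norm (a i)) * ennreal (norm (bump (E i) y)))"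
          unfolding power2_eq_square by (intro mult_mono) auto
      qed
      also have "\<dots> = ennreal (4 * doubling_const * \<tau>) * (\<Sum>i\<in>I. ennreal (norm (a i)))"
      proof -
        have [measurable]: "(\<lambda>y. ennreal (norm (bump (E i) y))) \<in> borel_measurable borel" if "i \<in> I" for i
          using E(1)[OF that] by measurable
        have "(\<integral>\<^sup>+y. (\<Sum>i\<in>I. ennreal (norm (a i)) * ennreal (norm (bump (E i) y))) \<partial>\<mu>)
            = (\<Sum>i\<in>I. \<integral>\<^sup>+y. ennreal (norm (a i)) * ennreal (norm (bump (E i) y)) \<partial>\<mu>)"
          by (rule nn_integral_sum) simp
        also have "\<dots> = (\<Sum>i\<in>I. ennreal (norm (a i)))"
          using E(1) nn_integral_bump(1)[OF E(1) mE] by (intro sum.cong refl, subst nn_integral_cmult) auto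
        finally show ?thesis by (subst nn_integral_cmult) auto
      qed
      also have "\<dots> = ennreal (4 * doubling_const * \<tau> * W)"
        using doubling_const_pos assms W by (simp add: W_def ennreal_mult)
      finally have g2: "(\<integral>\<^sup>+y. (ennreal (norm (g y)))\<^sup>2 \<partial>\<mu>) \<le> ennreal (4 * doubling_const * \<tau> * W)" .
      have "?half\<^sup>2 * emeasure \<mu> {y. ?half\<^sup>2 < (sq (T g) y)\<^sup>2} \<le> (\<integral>\<^sup>+y. (sq (T g) y)\<^sup>2 \<partial>\<mu>)"
        using chebyshev_nn_integral[of "\<lambda>y. (sq (T g) y)\<^sup>2" \<mu> "?half\<^sup>2"] by simp
      also have "\<dots> \<le> ennreal B * (\<integral>\<^sup>+y. (ennreal (norm (g y)))\<^sup>2 \<partial>\<mu>)"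
        using g2 by (intro L2) (auto intro: le_less_trans)
      also have "\<dots> \<le> ennreal B * ennreal (4 * doubling_const * \<tau> * W)" by (intro mult_left_mono g2) auto
      finally have ch: "?half\<^sup>2 * emeasure \<mu> {y. ?half < sq (T g) y} \<le> ennreal (B * (4 * doubling_const * \<tau> * W))"
        using B_pos by (simp add: ennreal_power2_less_iff ennreal_mult'[symmetric])
      have "ennreal \<tau> * emeasure \<mu> {y. ?half < sq (T g) y} = ennreal (4 / \<tau>) * (?half\<^sup>2 * emeasure \<mu> {y. ?half < sq (T g) y})"
        using assms by (simp add: ennreal_power mult.assoc[symmetric] ennreal_mult[symmetric] power2_eq_square)
      also have "\<dots> \<le> ennreal (4 / \<tau>) * ennreal (B * (4 * doubling_const * \<tau> * W))" by (intro mult_left_mono ch) auto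
      also have "\<dots> = ennreal (16 * doubling_const * B * W)"
        using assms by (subst ennreal_mult'[symmetric]) (auto simp: field_simps)
      finally show ?thesis .
    qed
    have bad: "ennreal \<tau> * emeasure \<mu> {y. ?half < ?H y * indicator (- \<Omega>) y} \<le> ennreal (2 * atom_const * W)"
    proof -
      have "?half * emeasure \<mu> {y. ?half < ?H y * indicator (- \<Omega>) y} \<le> (\<integral>\<^sup>+y. ?H y * indicator (- \<Omega>) y \<partial>\<mu>)"
        using chebyshev_nn_integral[of "\<lambda>y. ?H y * indicator (- \<Omega>) y" \<mu> ?half] by simp
      also have "\<dots> \<le> (\<integral>\<^sup>+y. (\<Sum>i\<in>I. ennreal (norm (a i)) * (sq (F i) y * indicator (- ball (x i) (2 * \<rho> i)) y)) \<partial>\<mu>)"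
        unfolding sum_distrib_right
        by (intro nn_integral_mono sum_mono) (auto simp: indicator_def \<Omega>_def)
      also have "\<dots> = (\<Sum>i\<in>I. ennreal (norm (a i)) * (\<integral>\<^sup>+y\<in>- ball (x i) (2 * \<rho> i). sq (F i) y \<partial>\<mu>))"
      proof -
        have [measurable]: "(\<lambda>y. sq (F i) y * indicator (- ball (x i) (2 * \<rho> i)) y) \<in> borel_measurable borel" if "i \<in> I" for i
          using F_meas[OF that] by measurable
        show ?thesis by (subst nn_integral_sum) (auto simp: nn_integral_cmult intro!: sum.cong)
      qed
      also have "\<dots> \<le> (\<Sum>i\<in>I. ennreal (norm (a i)) * ennreal atom_const)"
      proof (intro sum_mono mult_left_mono)
        fix i assume i: "i \<in> I"
        show "(\<integral>\<^sup>+y\<in>- ball (x i) (2 * \<rho> i). sq (F i) y \<partial>\<mu>) \<le> ennreal atom_const"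
          unfolding F_def
          using \<rho>(1)[OF i] \<rho>(2)[OF i] gr[OF i] E(1)[OF i] E(2)[OF i] pos[OF i] E(3)[OF i] by (rule atom_estimate)
      qed simp
      also have "\<dots> = ennreal (atom_const * W)"
        using atom_const_pos by (simp add: sum_distrib_right[symmetric] W_def ennreal_mult mult.commute sum_nonneg)
      finally have ch: "?half * emeasure \<mu> {y. ?half < ?H y * indicator (- \<Omega>) y} \<le> ennreal (atom_const * W)" .
      have "ennreal \<tau> * emeasure \<mu> {y. ?half < ?H y * indicator (- \<Omega>) y} = ennreal 2 * (?half * emeasure \<mu> {y. ?half < ?H y * indicator (- \<Omega>) y})"
        using assms by (simp add: mult.assoc[symmetric] ennreal_mult'[symmetric] del: ennreal_numeral)
      also have "\<dots> \<le> ennreal 2 * ennreal (atom_const * W)" by (intro mult_left_mono ch) auto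
      finally show ?thesis by (simp add: ennreal_mult'[symmetric] mult.assoc del: ennreal_numeral)
    qed
    have "ennreal \<tau> * emeasure \<mu> {y. ennreal \<tau> < sq ?G y}
      \<le> ennreal \<tau> * (emeasure \<mu> \<Omega> + emeasure \<mu> {y. ?half < sq (T g) y} + emeasure \<mu> {y. ?half < ?H y * indicator (- \<Omega>) y})"
      by (intro mult_left_mono order_trans[OF emeasure_mono[OF sub]] order_trans[OF emeasure_subadditive] add_mono order_refl) auto
    also have "\<dots> \<le> ennreal W + ennreal (16 * doubling_const * B * W) + ennreal (2 * atom_const * W)"
      unfolding distrib_left using exc good bad by (intro add_mono) (auto simp: \<Omega>_def)
    also have "\<dots> = ennreal ((1 + 16 * doubling_const * B + 2 * atom_const) * W)"
      using W doubling_const_pos B_pos atom_const_pos by (simp add: ennreal_plus[symmetric] algebra_simps del: ennreal_plus)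
    finally show ?thesis by (simp add: W_def)
  qed
qed

end

lemma finite_ball_cover:
  fixes R \<delta> :: real
  assumes "0 < \<delta>"
  shows "\<exists>(p :: nat \<Rightarrow> 'a::euclidean_space) N. cball 0 R \<subseteq> (\<Union>i<N. ball (p i) \<delta>)"
proof -
  have "compact (cball (0::'a) R)" by (rule compact_cball)
  then have "\<exists>S. finite S \<and> cball (0::'a) R \<subseteq> (\<Union>x\<in>S. ball x \<delta>)"
    using assms unfolding compact_eq_totally_bounded by simp
  then obtain S :: "'a set" where S: "finite S" "cball 0 R \<subseteq> (\<Union>x\<in>S. ball x \<delta>)"
    by (elim exE conjE) (rule that)
  obtain N :: nat and p where "S = p ` {i. i < N}" using finite_imp_nat_seg_image_inj_on[OF S(1)] by metis
  with S(2) show ?thesis by (intro exI[of _ p] exI[of _ N]) auto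
qed

context L2_square_function
begin

text \<open>An integrable function is the limit of the sums of point masses that are obtained by
  concentrating it on the centres of small cells. Because the kernel is continuous in the second
  variable, \<open>T\<close> converges pointwise along these sums.\<close>

lemma approximate_by_point_masses:
  assumes [measurable]: "f \<in> borel_measurable borel" and fin: "(\<integral>\<^sup>+y. ennreal (norm (f y)) \<partial>\<mu>) < \<infinity>"
  shows "\<exists>(I :: nat \<Rightarrow> nat set) (a :: nat \<Rightarrow> nat \<Rightarrow> complex) (p :: nat \<Rightarrow> nat \<Rightarrow> 'a).
    (\<forall>n. finite (I n)) \<and> (\<forall>n. \<forall>i\<in>I n. a n i \<noteq> 0) \<and>
    (\<forall>n. ennreal (\<Sum>i\<in>I n. norm (a n i)) \<le> (\<integral>\<^sup>+y. ennreal (norm (f y)) \<partial>\<mu>)) \<and>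
    (\<forall>z. 0 < snd z \<longrightarrow> (\<lambda>n. \<Sum>i\<in>I n. a n i * k (snd z) (fst z) (p n i)) \<longlonglongrightarrow> T f z)"
proof -
  define \<delta> where "\<delta> n = inverse (real (Suc n))" for n
  have "\<exists>(p :: nat \<Rightarrow> 'a) N. cball 0 (real n) \<subseteq> (\<Union>i<N. ball (p i) (\<delta> n))" for n
    by (rule finite_ball_cover) (simp add: \<delta>_def)
  then obtain p :: "nat \<Rightarrow> nat \<Rightarrow> 'a" and N :: "nat \<Rightarrow> nat"
    where cover: "\<And>n. cball 0 (real n) \<subseteq> (\<Union>i<N n. ball (p n i) (\<delta> n))" by metis
  define Q where "Q n i = (ball (p n i) (\<delta> n) - (\<Union>j<i. ball (p n j) (\<delta> n))) \<inter> cball 0 (real n)" for n i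
  have Q_meas [measurable]: "Q n i \<in> sets borel" for n i unfolding Q_def by auto
  define a where "a n i = (\<integral>y. indicator (Q n i) y * f y \<partial>\<mu>)" for n i
  define I where "I n = {i. i < N n \<and> a n i \<noteq> 0}" for n
  have Q_disj: "i = j" if "y \<in> Q n i" "y \<in> Q n j" for y n i j
    using that by (cases i j rule: linorder_cases) (auto simp: Q_def)
  have Q_sum: "(\<Sum>i<N n. indicator (Q n i) y) \<le> (1::ennreal)" for n y
  proof (cases "\<exists>i<N n. y \<in> Q n i")
    case True
    then obtain i where i: "i < N n" "y \<in> Q n i" by blast
    then have "(\<Sum>j<N n. indicator (Q n j) y) = (\<Sum>j\<in>{..<N n}. if j = i then (1::ennreal) else 0)"
      using Q_disj by (intro sum.cong) (auto simp: indicator_def)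
    then show ?thesis using i by simp
  qed (simp add: indicator_def)
  have f_int: "integrable \<mu> f" using fin by (intro integrableI_bounded) auto
  have Qf_int: "integrable \<mu> (\<lambda>y. indicator (Q n i) y * f y)" for n i
    by (rule Bochner_Integration.integrable_bound[OF f_int]) (auto simp: indicator_def)
  show ?thesis
  proof (intro exI[of _ I] exI[of _ a] exI[of _ p] conjI allI ballI impI)
    show "finite (I n)" "i \<in> I n \<Longrightarrow> a n i \<noteq> 0" for n i by (auto simp: I_def)
    show "ennreal (\<Sum>i\<in>I n. norm (a n i)) \<le> (\<integral>\<^sup>+y. ennreal (norm (f y)) \<partial>\<mu>)" for n
    proof -
      have "ennreal (\<Sum>i\<in>I n. norm (a n i)) = (\<Sum>i\<in>I n. ennreal (norm (a n i)))" by (simp add: sum_ennreal)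
      also have "\<dots> \<le> (\<Sum>i<N n. ennreal (norm (a n i)))" by (intro sum_mono2) (auto simp: I_def)
      also have "\<dots> \<le> (\<Sum>i<N n. \<integral>\<^sup>+y. ennreal (norm (indicator (Q n i) y * f y)) \<partial>\<mu>)"
        unfolding a_def by (intro sum_mono norm_integral_le_nn_integral)
      also have "\<dots> = (\<integral>\<^sup>+y. (\<Sum>i<N n. indicator (Q n i) y) * ennreal (norm (f y)) \<partial>\<mu>)"
      proof -
        have "ennreal (norm (indicator (Q n i) y * f y)) = indicator (Q n i) y * ennreal (norm (f y))" for i y
          by (auto simp: indicator_def)
        then show ?thesis
          unfolding sum_distrib_right by (simp only:) (rule nn_integral_sum[symmetric], measurable)
      qed
      also have "\<dots> \<le> (\<integral>\<^sup>+y. 1 * ennreal (norm (f y)) \<partial>\<mu>)"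
        by (intro nn_integral_mono mult_right_mono Q_sum) auto
      finally show ?thesis by simp
    qed
    fix z :: "'a \<times> real" assume z: "0 < snd z"
    obtain x t where zt: "z = (x, t)" by (cases z)
    with z have t: "0 < t" by simp
    define F where "F n y = (\<Sum>i<N n. k t x (p n i) * (indicator (Q n i) y * f y))" for n y
    have F_le: "norm (F n y) \<le> K * t powr (- m) * norm (f y)" for n y
    proof (cases "\<exists>i<N n. y \<in> Q n i")
      case True
      then obtain i where i: "i < N n" "y \<in> Q n i" by blast
      then have "F n y = (\<Sum>j\<in>{..<N n}. if j = i then k t x (p n i) * f y else 0)"
        unfolding F_def using Q_disj by (intro sum.cong) (auto simp: indicator_def)
      then show ?thesis using i k_le[OF t, of x "p n i"] by (simp add: norm_mult mult_right_mono)
    qed (use K_pos in \<open>simp add: indicator_def F_def\<close>)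
    have "(\<lambda>n. \<integral>y. F n y \<partial>\<mu>) \<longlonglongrightarrow> (\<integral>y. k t x y * f y \<partial>\<mu>)"
    proof (rule integral_dominated_convergence[where w = "\<lambda>y. K * t powr (- m) * norm (f y)"])
      show "integrable \<mu> (\<lambda>y. K * t powr (- m) * norm (f y))" using f_int by simp
      show "F n \<in> borel_measurable \<mu>" for n unfolding F_def[abs_def] by measurable
      show "AE y in \<mu>. norm (F n y) \<le> K * t powr (- m) * norm (f y)" for n using F_le by simp
      show "AE y in \<mu>. (\<lambda>n. F n y) \<longlonglongrightarrow> k t x y * f y"
      proof (rule AE_I2)
        fix y
        have lim0: "(\<lambda>n. K * (\<delta> n powr \<alpha> / t powr (m + \<alpha>)) * norm (f y)) \<longlonglongrightarrow> 0"
        proof -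
          have "(\<lambda>n. \<delta> n powr \<alpha>) \<longlonglongrightarrow> 0"
            unfolding \<delta>_def using alpha_pos LIMSEQ_inverse_real_of_nat
            by (intro tendsto_zero_powrI[where b = \<alpha>]) auto
          then have "(\<lambda>n. K * (\<delta> n powr \<alpha> / t powr (m + \<alpha>)) * norm (f y)) \<longlonglongrightarrow> K * (0 / t powr (m + \<alpha>)) * norm (f y)"
            using t by (intro tendsto_intros) auto
          then show ?thesis by simp
        qed
        have "\<forall>\<^sub>F n in sequentially. \<delta> n < t / 2"
          using order_tendstoD(2)[OF LIMSEQ_inverse_real_of_nat, of "t / 2"] t by (simp add: \<delta>_def)
        moreover have "\<forall>\<^sub>F n in sequentially. norm y \<le> real n"
          by (meson eventually_at_top_linorder le_trans of_nat_mono order_trans real_arch_simple)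
        ultimately have "\<forall>\<^sub>F n in sequentially. norm (F n y - k t x y * f y) \<le> K * (\<delta> n powr \<alpha> / t powr (m + \<alpha>)) * norm (f y)"
        proof eventually_elim
          case (elim n)
          then have y: "y \<in> cball 0 (real n)" by simp
          define i where "i = (LEAST i. y \<in> ball (p n i) (\<delta> n))"
          obtain i' where i': "i' < N n" "y \<in> ball (p n i') (\<delta> n)" using cover[of n] y by blast
          have i: "y \<in> ball (p n i) (\<delta> n)" unfolding i_def by (rule LeastI[of _ i']) (rule i')
          have "i \<le> i'" unfolding i_def by (rule Least_le) (rule i')
          then have iN: "i < N n" using i' by simp
          have "y \<notin> ball (p n j) (\<delta> n)" if "j < i" for j using that unfolding i_def by (rule not_less_Least)
          then have yQ: "y \<in> Q n i" using i y by (auto simp: Q_def)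
          have "F n y = (\<Sum>j\<in>{..<N n}. if j = i then k t x (p n i) * f y else 0)"
            unfolding F_def using Q_disj yQ by (intro sum.cong) (auto simp: indicator_def)
          then have "norm (F n y - k t x y * f y) = norm (k t x y - k t x (p n i)) * norm (f y)"
            using iN by (simp add: left_diff_distrib[symmetric] norm_mult norm_minus_commute)
          also have "\<dots> \<le> K * (\<delta> n powr \<alpha> / t powr (m + \<alpha>)) * norm (f y)"
          proof (intro mult_right_mono norm_ge_zero)
            have d: "dist y (p n i) < \<delta> n" using i by (simp add: dist_commute)
            have "norm (k t x y - k t x (p n i)) \<le> K * (dist y (p n i) powr \<alpha> / (t + dist x y) powr (m + \<alpha>))"
              using elim d by (intro k_smooth t) auto
            also have "\<dots> \<le> K * (\<delta> n powr \<alpha> / t powr (m + \<alpha>))"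
              using d t K_pos alpha_pos m_pos by (intro mult_left_mono frac_le powr_mono2) auto
            finally show "norm (k t x y - k t x (p n i)) \<le> K * (\<delta> n powr \<alpha> / t powr (m + \<alpha>))" .
          qed
          finally show ?case .
        qed
        from Lim_null_comparison[OF this lim0] show "(\<lambda>n. F n y) \<longlonglongrightarrow> k t x y * f y"
          by (simp add: LIM_zero_iff)
      qed
    qed simp_all
    moreover have "(\<integral>y. F n y \<partial>\<mu>) = (\<Sum>i\<in>I n. a n i * k t x (p n i))" for n
    proof -
      have "(\<integral>y. F n y \<partial>\<mu>) = (\<Sum>i<N n. a n i * k t x (p n i))"
        unfolding F_def using Qf_int by (simp add: a_def mult.commute)
      also have "\<dots> = (\<Sum>i\<in>I n. a n i * k t x (p n i))"
        by (intro sum.mono_neutral_right) (auto simp: I_def)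
      finally show ?thesis .
    qed
    ultimately show "(\<lambda>n. \<Sum>i\<in>I n. a n i * k (snd z) (fst z) (p n i)) \<longlonglongrightarrow> T f z"
      by (simp add: T_def zt)
  qed
qed

definition weak_const :: real where
  "weak_const = 1 + 16 * doubling_const * B + 2 * atom_const"

lemma weak_const_pos: "0 < weak_const"
  using doubling_const_pos B_pos atom_const_pos by (simp add: weak_const_def add_pos_pos)

text \<open>The estimate for point masses passes to the limit: by Fatou's lemma on the measure \<open>\<omega> x\<close>, a point where
  the square function of \<open>f\<close> exceeds \<open>\<tau>\<close> lies in almost all of the level sets of the approximations.\<close>

theorem weak_type_L1:
  assumes [measurable]: "f \<in> borel_measurable borel" and fin: "(\<integral>\<^sup>+y. ennreal (norm (f y)) \<partial>\<mu>) < \<infinity>" and "0 < \<tau>"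
  shows "ennreal \<tau> * emeasure \<mu> {x. ennreal \<tau> < sq (T f) x} \<le> ennreal weak_const * (\<integral>\<^sup>+y. ennreal (norm (f y)) \<partial>\<mu>)"
proof -
  from approximate_by_point_masses[OF assms(1,2)]
  obtain I :: "nat \<Rightarrow> nat set" and a :: "nat \<Rightarrow> nat \<Rightarrow> complex" and p :: "nat \<Rightarrow> nat \<Rightarrow> 'a"
    where I: "\<forall>n. finite (I n)" "\<forall>n. \<forall>i\<in>I n. a n i \<noteq> 0"
    and sum: "\<forall>n. ennreal (\<Sum>i\<in>I n. norm (a n i)) \<le> (\<integral>\<^sup>+y. ennreal (norm (f y)) \<partial>\<mu>)"
    and lim: "\<forall>z. 0 < snd z \<longrightarrow> (\<lambda>n. \<Sum>i\<in>I n. a n i * k (snd z) (fst z) (p n i)) \<longlonglongrightarrow> T f z"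
    by (elim exE conjE) (rule that)
  define F where "F n z = (\<Sum>i\<in>I n. a n i * k (snd z) (fst z) (p n i))" for n and z :: "'a \<times> real"
  have F_meas [measurable]: "F n \<in> borel_measurable borel" for n unfolding F_def[abs_def] by measurable
  define G where "G N = (\<Inter>n\<in>{N..}. {x. ennreal \<tau> < sq (F n) x})" for N
  have G_meas [measurable]: "G N \<in> sets borel" for N
  proof -
    have "{x. ennreal \<tau> < sq (F n) x} \<in> sets borel" for n by measurable
    then show ?thesis unfolding G_def by (intro sets.countable_INT'') auto
  qed
  have G_le: "ennreal \<tau> * emeasure \<mu> (G N) \<le> ennreal weak_const * (\<integral>\<^sup>+y. ennreal (norm (f y)) \<partial>\<mu>)" for N
  proof -
    have "ennreal \<tau> * emeasure \<mu> (G N) \<le> ennreal \<tau> * emeasure \<mu> {x. ennreal \<tau> < sq (F N) x}"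
      by (intro mult_left_mono emeasure_mono) (auto simp: G_def)
    also have "\<dots> \<le> ennreal (weak_const * (\<Sum>i\<in>I N. norm (a N i)))"
      unfolding F_def weak_const_def using I \<open>0 < \<tau>\<close> by (intro weak_type_point_masses) auto
    also have "\<dots> = ennreal weak_const * ennreal (\<Sum>i\<in>I N. norm (a N i))"
      using weak_const_pos by (intro ennreal_mult') auto
    also have "\<dots> \<le> ennreal weak_const * (\<integral>\<^sup>+y. ennreal (norm (f y)) \<partial>\<mu>)" using sum by (intro mult_left_mono) auto
    finally show ?thesis .
  qed
  have "{x. ennreal \<tau> < sq (T f) x} \<subseteq> (\<Union>N. G N)"
  proof
    fix x assume "x \<in> {x. ennreal \<tau> < sq (T f) x}"
    then have "(ennreal \<tau>)\<^sup>2 < (sq (T f) x)\<^sup>2" by (simp add: ennreal_power2_less_iff)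
    also have "(sq (T f) x)\<^sup>2 = (\<integral>\<^sup>+z. liminf (\<lambda>n. (ennreal (norm (F n z)))\<^sup>2) \<partial>\<omega> x)"
      unfolding sq_def norm2_power2
    proof (rule nn_integral_cong_AE, rule eventually_mono[OF omega_cone])
      fix z :: "'a \<times> real" assume "0 < snd z \<and> dist x (fst z) < snd z"
      then have "(\<lambda>n. F n z) \<longlonglongrightarrow> T f z" using lim[rule_format, of z] by (simp add: F_def)
      then have "(\<lambda>n. ennreal ((norm (F n z))\<^sup>2)) \<longlonglongrightarrow> ennreal ((norm (T f z))\<^sup>2)" by (intro tendsto_intros)
      from lim_imp_Liminf[OF sequentially_bot this]
      show "(ennreal (norm (T f z)))\<^sup>2 = liminf (\<lambda>n. (ennreal (norm (F n z)))\<^sup>2)"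
        by (simp add: ennreal_power)
    qed
    also have "\<dots> \<le> liminf (\<lambda>n. \<integral>\<^sup>+z. (ennreal (norm (F n z)))\<^sup>2 \<partial>\<omega> x)"
      by (rule nn_integral_liminf) simp
    finally have "\<forall>\<^sub>F n in sequentially. (ennreal \<tau>)\<^sup>2 < (sq (F n) x)\<^sup>2"
      unfolding sq_def norm2_power2 by (rule less_LiminfD)
    then show "x \<in> (\<Union>N. G N)"
      by (auto simp: G_def eventually_sequentially ennreal_power2_less_iff)
  qed
  then have "ennreal \<tau> * emeasure \<mu> {x. ennreal \<tau> < sq (T f) x} \<le> ennreal \<tau> * emeasure \<mu> (\<Union>N. G N)"
    by (intro mult_left_mono emeasure_mono) auto
  also have "emeasure \<mu> (\<Union>N. G N) = (SUP N. emeasure \<mu> (G N))"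
    by (rule SUP_emeasure_incseq[symmetric]) (auto simp: incseq_def G_def)
  also have "ennreal \<tau> * (SUP N. emeasure \<mu> (G N)) = (SUP N. ennreal \<tau> * emeasure \<mu> (G N))"
    by (simp add: SUP_mult_left_ennreal)
  also have "\<dots> \<le> ennreal weak_const * (\<integral>\<^sup>+y. ennreal (norm (f y)) \<partial>\<mu>)" by (intro SUP_least G_le)
  finally show ?thesis .
qed

end

section \<open>Real interpolation\<close>

lemma emeasure_level_add_le:
  assumes [measurable]: "u \<in> borel_measurable M" "v \<in> borel_measurable M"
    and "0 \<le> t" and le: "\<And>x. x \<in> space M \<Longrightarrow> w x \<le> u x + v x"
  shows "emeasure M {x \<in> space M. ennreal t < w x}
    \<le> emeasure M {x \<in> space M. ennreal (t / 2) < u x} + emeasure M {x \<in> space M. ennreal (t / 2) < v x}"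
proof -
  have "{x \<in> space M. ennreal t < w x} \<subseteq> {x \<in> space M. ennreal (t / 2) < u x} \<union> {x \<in> space M. ennreal (t / 2) < v x}"
  proof
    fix x assume x: "x \<in> {x \<in> space M. ennreal t < w x}"
    show "x \<in> {x \<in> space M. ennreal (t / 2) < u x} \<union> {x \<in> space M. ennreal (t / 2) < v x}"
    proof (rule ccontr)
      assume "\<not> ?thesis"
      then have "u x + v x \<le> ennreal (t / 2) + ennreal (t / 2)"
        using x by (intro add_mono) auto
      also have "\<dots> = ennreal t" using \<open>0 \<le> t\<close> by (simp add: ennreal_plus[symmetric] del: ennreal_plus)
      finally show False using x le[of x] by auto
    qed
  qed
  then have "emeasure M {x \<in> space M. ennreal t < w x}
      \<le> emeasure M ({x \<in> space M. ennreal (t / 2) < u x} \<union> {x \<in> space M. ennreal (t / 2) < v x})"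
    by (rule emeasure_mono) measurable
  also have "\<dots> \<le> emeasure M {x \<in> space M. ennreal (t / 2) < u x} + emeasure M {x \<in> space M. ennreal (t / 2) < v x}"
    by (rule emeasure_subadditive) measurable
  finally show ?thesis .
qed

lemma epowr_layer_cake:
  assumes "0 < p"
  shows "epowr v p = (\<integral>\<^sup>+t\<in>{0<..}. ennreal (p * t powr (p - 1)) * (if ennreal t < v then 1 else 0) \<partial>lborel)"
proof -
  have eq: "ennreal (c powr p) = (\<integral>\<^sup>+t\<in>{0<..}. ennreal (p * t powr (p - 1)) * (if ennreal t < ennreal c then 1 else 0) \<partial>lborel)"
    if "0 \<le> c" for c
  proof -
    have "ennreal (c powr p) = ennreal p * ennreal (c powr p / p)"
      using assms by (simp add: ennreal_mult[symmetric])
    also have "\<dots> = ennreal p * (\<integral>\<^sup>+t\<in>{0..c}. ennreal (t powr (p - 1)) \<partial>lborel)"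
      using nn_integral_powr_from_0[of p c] assms that by simp
    also have "\<dots> = (\<integral>\<^sup>+t. ennreal p * (ennreal (t powr (p - 1)) * indicator {0..c} t) \<partial>lborel)"
      by (rule nn_integral_cmult[symmetric]) measurable
    also have "\<dots> = (\<integral>\<^sup>+t\<in>{0<..}. ennreal (p * t powr (p - 1)) * (if ennreal t < ennreal c then 1 else 0) \<partial>lborel)"
    proof (rule nn_integral_cong_AE)
      have "AE t in lborel. t \<noteq> (0::real)" "AE t in lborel. t \<noteq> c" by (rule AE_lborel_singleton)+
      then show "AE t in lborel. ennreal p * (ennreal (t powr (p - 1)) * indicator {0..c} t) =
        ennreal (p * t powr (p - 1)) * (if ennreal t < ennreal c then 1 else 0) * indicator {0<..} t"
        by eventually_elim (use assms that in \<open>auto simp: indicator_def ennreal_mult ennreal_less_iff\<close>)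
    qed
    finally show ?thesis .
  qed
  show ?thesis
  proof (cases v)
    case (real c)
    then show ?thesis using eq[of c] by (simp add: epowr_ennreal)
  next
    case top
    let ?I = "(\<integral>\<^sup>+t\<in>{0<..}. ennreal (p * t powr (p - 1)) * (if ennreal t < v then 1 else 0) \<partial>lborel)"
    have "of_nat n \<le> ?I" for n :: nat
    proof -
      have "of_nat n = ennreal ((real n powr (1 / p)) powr p)"
        using assms by (cases "n = 0") (simp_all add: powr_powr ennreal_of_nat_eq_real_of_nat)
      also have "\<dots> \<le> ?I"
        unfolding eq[OF powr_ge_zero] using top by (intro nn_integral_mono) (auto simp: indicator_def)
      finally show ?thesis .
    qed
    then have "(SUP n. of_nat n) \<le> ?I" by (intro SUP_least)
    then have "?I = top" unfolding ennreal_SUP_of_nat_eq_top by (simp only: top_unique)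
    then show ?thesis using top by (simp add: epowr_def)
  qed
qed

lemma (in sigma_finite_measure) nn_integral_epowr_eq:
  assumes "0 < p" and [measurable]: "u \<in> borel_measurable M"
  shows "(\<integral>\<^sup>+x. epowr (u x) p \<partial>M)
    = (\<integral>\<^sup>+t\<in>{0<..}. ennreal (p * t powr (p - 1)) * emeasure M {x \<in> space M. ennreal t < u x} \<partial>lborel)"
proof -
  interpret pair_sigma_finite M lborel by standard
  have "(\<integral>\<^sup>+x. epowr (u x) p \<partial>M) = (\<integral>\<^sup>+x. (\<integral>\<^sup>+t. ennreal (p * t powr (p - 1)) * (if ennreal t < u x then 1 else 0) * indicator {0<..} t \<partial>lborel) \<partial>M)"
    by (simp only: epowr_layer_cake[OF assms(1)])
  also have "\<dots> = (\<integral>\<^sup>+t. (\<integral>\<^sup>+x. ennreal (p * t powr (p - 1)) * (if ennreal t < u x then 1 else 0) * indicator {0<..} t \<partial>M) \<partial>lborel)"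
    by (rule Fubini'[symmetric]) measurable
  also have "\<dots> = (\<integral>\<^sup>+t\<in>{0<..}. ennreal (p * t powr (p - 1)) * emeasure M {x \<in> space M. ennreal t < u x} \<partial>lborel)"
  proof (rule nn_integral_cong)
    fix t :: real
    have "(\<integral>\<^sup>+x. ennreal (p * t powr (p - 1)) * (if ennreal t < u x then 1 else 0) * indicator {0<..} t \<partial>M)
       = (\<integral>\<^sup>+x. (ennreal (p * t powr (p - 1)) * indicator {0<..} t) * indicator {x \<in> space M. ennreal t < u x} x \<partial>M)"
      by (intro nn_integral_cong) (auto simp: indicator_def)
    also have "\<dots> = (ennreal (p * t powr (p - 1)) * indicator {0<..} t) * emeasure M {x \<in> space M. ennreal t < u x}"
      by (rule nn_integral_cmult_indicator) measurable
    finally show "(\<integral>\<^sup>+x. ennreal (p * t powr (p - 1)) * (if ennreal t < u x then 1 else 0) * indicator {0<..} t \<partial>M)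
      = ennreal (p * t powr (p - 1)) * emeasure M {x \<in> space M. ennreal t < u x} * indicator {0<..} t"
      by (simp add: mult_ac)
  qed
  finally show ?thesis .
qed

lemma (in sigma_finite_measure) nn_integral_upper_truncations:
  assumes "1 < p" and [measurable]: "h \<in> borel_measurable M" and nonneg: "\<And>x. 0 \<le> h x"
  shows "(\<integral>\<^sup>+t\<in>{0<..}. ennreal (t powr (p - 2)) * (\<integral>\<^sup>+x. ennreal (h x) * indicator {x. t < h x} x \<partial>M) \<partial>lborel)
    = ennreal (1 / (p - 1)) * (\<integral>\<^sup>+x. ennreal (h x powr p) \<partial>M)"
proof -
  interpret pair_sigma_finite M lborel by standard
  have "(\<integral>\<^sup>+t\<in>{0<..}. ennreal (t powr (p - 2)) * (\<integral>\<^sup>+x. ennreal (h x) * indicator {x. t < h x} x \<partial>M) \<partial>lborel)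
    = (\<integral>\<^sup>+t. (\<integral>\<^sup>+x. ennreal (t powr (p - 2)) * indicator {0<..} t * (ennreal (h x) * (if t < h x then 1 else 0)) \<partial>M) \<partial>lborel)"
    by (subst nn_integral_cmult) (auto simp: mult_ac indicator_def of_bool_def intro!: nn_integral_cong)
  also have "\<dots> = (\<integral>\<^sup>+x. (\<integral>\<^sup>+t. ennreal (t powr (p - 2)) * indicator {0<..} t * (ennreal (h x) * (if t < h x then 1 else 0)) \<partial>lborel) \<partial>M)"
    by (rule Fubini') measurable
  also have "\<dots> = (\<integral>\<^sup>+x. ennreal (1 / (p - 1)) * ennreal (h x powr p) \<partial>M)"
  proof (rule nn_integral_cong)
    fix x
    have "(\<integral>\<^sup>+t. ennreal (t powr (p - 2)) * indicator {0<..} t * (ennreal (h x) * (if t < h x then 1 else 0)) \<partial>lborel)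
      = (\<integral>\<^sup>+t. ennreal (h x) * (ennreal (t powr (p - 2)) * indicator {0..h x} t) \<partial>lborel)"
    proof (rule nn_integral_cong_AE)
      have "AE t in lborel. t \<noteq> (0::real)" "AE t in lborel. t \<noteq> h x" by (rule AE_lborel_singleton)+
      then show "AE t in lborel. ennreal (t powr (p - 2)) * indicator {0<..} t * (ennreal (h x) * (if t < h x then 1 else 0))
        = ennreal (h x) * (ennreal (t powr (p - 2)) * indicator {0..h x} t)"
        by eventually_elim (auto simp: indicator_def mult_ac)
    qed
    also have "\<dots> = ennreal (h x) * ennreal (h x powr (p - 1) / (p - 1))"
      using nn_integral_powr_from_0[of "p - 1" "h x"] assms by (subst nn_integral_cmult) auto
    also have "\<dots> = ennreal (1 / (p - 1)) * ennreal (h x powr p)"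
    proof (cases "h x = 0")
      case False
      then have "h x * (h x powr (p - 1)) = h x powr p" using nonneg[of x] by (simp add: powr_diff)
      then show ?thesis using assms nonneg[of x] by (simp add: ennreal_mult[symmetric])
    qed simp
    finally show "(\<integral>\<^sup>+t. ennreal (t powr (p - 2)) * indicator {0<..} t * (ennreal (h x) * (if t < h x then 1 else 0)) \<partial>lborel)
      = ennreal (1 / (p - 1)) * ennreal (h x powr p)" .
  qed
  also have "\<dots> = ennreal (1 / (p - 1)) * (\<integral>\<^sup>+x. ennreal (h x powr p) \<partial>M)" by (rule nn_integral_cmult) measurable
  finally show ?thesis .
qed

lemma (in sigma_finite_measure) nn_integral_lower_truncations:
  assumes "0 < p" "p < 2" and [measurable]: "h \<in> borel_measurable M" and nonneg: "\<And>x. 0 \<le> h x"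
  shows "(\<integral>\<^sup>+t\<in>{0<..}. ennreal (t powr (p - 3)) * (\<integral>\<^sup>+x. (ennreal (h x))\<^sup>2 * indicator {x. h x \<le> t} x \<partial>M) \<partial>lborel)
    = ennreal (1 / (2 - p)) * (\<integral>\<^sup>+x. ennreal (h x powr p) \<partial>M)"
proof -
  interpret pair_sigma_finite M lborel by standard
  have "(\<integral>\<^sup>+t\<in>{0<..}. ennreal (t powr (p - 3)) * (\<integral>\<^sup>+x. (ennreal (h x))\<^sup>2 * indicator {x. h x \<le> t} x \<partial>M) \<partial>lborel)
    = (\<integral>\<^sup>+t. (\<integral>\<^sup>+x. ennreal (t powr (p - 3)) * indicator {0<..} t * ((ennreal (h x))\<^sup>2 * (if h x \<le> t then 1 else 0)) \<partial>M) \<partial>lborel)"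
    by (subst nn_integral_cmult) (auto simp: mult_ac indicator_def of_bool_def intro!: nn_integral_cong)
  also have "\<dots> = (\<integral>\<^sup>+x. (\<integral>\<^sup>+t. ennreal (t powr (p - 3)) * indicator {0<..} t * ((ennreal (h x))\<^sup>2 * (if h x \<le> t then 1 else 0)) \<partial>lborel) \<partial>M)"
    by (rule Fubini') measurable
  also have "\<dots> = (\<integral>\<^sup>+x. ennreal (1 / (2 - p)) * ennreal (h x powr p) \<partial>M)"
  proof (rule nn_integral_cong)
    fix x
    show "(\<integral>\<^sup>+t. ennreal (t powr (p - 3)) * indicator {0<..} t * ((ennreal (h x))\<^sup>2 * (if h x \<le> t then 1 else 0)) \<partial>lborel)
      = ennreal (1 / (2 - p)) * ennreal (h x powr p)"
    proof (cases "h x = 0")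
      case False
      then have hx: "0 < h x" using nonneg[of x] by simp
      have "(\<integral>\<^sup>+t. ennreal (t powr (p - 3)) * indicator {0<..} t * ((ennreal (h x))\<^sup>2 * (if h x \<le> t then 1 else 0)) \<partial>lborel)
        = (\<integral>\<^sup>+t. (ennreal (h x))\<^sup>2 * (ennreal (t powr (- (2 - p) - 1)) * indicator {h x..} t) \<partial>lborel)"
        using hx by (intro nn_integral_cong) (auto simp: indicator_def mult_ac)
      also have "\<dots> = (ennreal (h x))\<^sup>2 * ennreal (h x powr (- (2 - p)) / (2 - p))"
        using nn_integral_powr_to_inf[of "2 - p" "h x"] assms hx by (subst nn_integral_cmult) auto
      also have "\<dots> = ennreal (1 / (2 - p)) * ennreal (h x powr p)"
        using hx assms by (simp add: ennreal_power ennreal_mult[symmetric] powr_diff)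
      finally show ?thesis .
    qed (simp add: power2_eq_square)
  qed
  also have "\<dots> = ennreal (1 / (2 - p)) * (\<integral>\<^sup>+x. ennreal (h x powr p) \<partial>M)" by (rule nn_integral_cmult) measurable
  finally show ?thesis .
qed

context L2_square_function
begin

lemma T_add:
  assumes "0 < snd z" "integrable \<mu> (\<lambda>y. k (snd z) (fst z) y * f y)" "integrable \<mu> (\<lambda>y. k (snd z) (fst z) y * g y)"
  shows "T (\<lambda>y. f y + g y) z = T f z + T g z"
  using assms by (simp add: T_def distrib_left)

lemma weak_type_L2:
  assumes [measurable]: "f \<in> borel_measurable borel" and fin: "(\<integral>\<^sup>+y. (ennreal (norm (f y)))\<^sup>2 \<partial>\<mu>) < \<infinity>"
  shows "(ennreal \<tau>)\<^sup>2 * emeasure \<mu> {x. ennreal \<tau> < sq (T f) x} \<le> ennreal B * (\<integral>\<^sup>+y. (ennreal (norm (f y)))\<^sup>2 \<partial>\<mu>)"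
proof -
  have "(ennreal \<tau>)\<^sup>2 * emeasure \<mu> {x. (ennreal \<tau>)\<^sup>2 < (sq (T f) x)\<^sup>2} \<le> (\<integral>\<^sup>+x. (sq (T f) x)\<^sup>2 \<partial>\<mu>)"
    using chebyshev_nn_integral[of "\<lambda>x. (sq (T f) x)\<^sup>2" \<mu> "(ennreal \<tau>)\<^sup>2"] by simp
  also have "\<dots> \<le> ennreal B * (\<integral>\<^sup>+y. (ennreal (norm (f y)))\<^sup>2 \<partial>\<mu>)" using fin by (intro L2) auto
  finally show ?thesis by (simp add: ennreal_power2_less_iff)
qed

text \<open>Marcinkiewicz interpolation between the weak type (1,1) and the bound on \<open>L\<^sup>2\<close>: at each level \<open>t\<close> the
  function is cut at the height \<open>t\<close>, and the weak type estimates of the large and of the small part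
  are integrated over \<open>t\<close>.\<close>

theorem strong_type_below_2:
  assumes p: "1 < p" "p < 2" and [measurable]: "f \<in> borel_measurable borel"
    and fin: "(\<integral>\<^sup>+y. ennreal (norm (f y) powr p) \<partial>\<mu>) < \<infinity>"
  shows "(\<integral>\<^sup>+x. epowr (sq (T f) x) p \<partial>\<mu>)
    \<le> ennreal (p * (2 * weak_const / (p - 1) + 4 * B / (2 - p))) * (\<integral>\<^sup>+y. ennreal (norm (f y) powr p) \<partial>\<mu>)"
proof -
  let ?h = "\<lambda>y. norm (f y)"
  let ?N = "\<integral>\<^sup>+y. ennreal (norm (f y) powr p) \<partial>\<mu>"
  let ?U = "\<lambda>t. \<integral>\<^sup>+x. ennreal (?h x) * indicator {x. t < ?h x} x \<partial>\<mu>"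
  let ?L = "\<lambda>t. \<integral>\<^sup>+x. (ennreal (?h x))\<^sup>2 * indicator {x. ?h x \<le> t} x \<partial>\<mu>"
  have level: "emeasure \<mu> {x. ennreal t < sq (T f) x} \<le> ennreal (2 * weak_const / t) * ?U t + ennreal (4 * B / t\<^sup>2) * ?L t"
    if t: "0 < t" for t
  proof -
    define g where "g y = (if t < ?h y then f y else 0)" for y
    define b where "b y = (if t < ?h y then 0 else f y)" for y
    have [measurable]: "g \<in> borel_measurable borel" "b \<in> borel_measurable borel"
      unfolding g_def b_def by measurable
    have gU: "(\<integral>\<^sup>+y. ennreal (norm (g y)) \<partial>\<mu>) = ?U t"
      by (intro nn_integral_cong) (auto simp: g_def indicator_def)
    have bL: "(\<integral>\<^sup>+y. (ennreal (norm (b y)))\<^sup>2 \<partial>\<mu>) = ?L t"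
      by (intro nn_integral_cong) (auto simp: b_def indicator_def power2_eq_square)
    have U_fin: "?U t < \<infinity>"
    proof -
      have "?U t \<le> (\<integral>\<^sup>+y. ennreal (t powr (1 - p)) * ennreal (?h y powr p) \<partial>\<mu>)"
      proof (rule nn_integral_mono)
        fix y
        show "ennreal (?h y) * indicator {x. t < ?h x} y \<le> ennreal (t powr (1 - p)) * ennreal (?h y powr p)"
        proof (cases "t < ?h y")
          case True
          have "?h y = ?h y powr (1 - p) * ?h y powr p" using True t by (simp add: powr_add[symmetric])
          also have "\<dots> \<le> t powr (1 - p) * ?h y powr p" using True t p by (intro mult_right_mono powr_mono2') auto
          finally show ?thesis using True by (simp add: ennreal_mult[symmetric] ennreal_leI)
        qed simp
      qed
      also have "\<dots> < \<infinity>" using fin by (simp add: nn_integral_cmult ennreal_mult_less_top)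
      finally show ?thesis .
    qed
    have L_fin: "?L t < \<infinity>"
    proof -
      have "?L t \<le> (\<integral>\<^sup>+y. ennreal (t powr (2 - p)) * ennreal (?h y powr p) \<partial>\<mu>)"
      proof (rule nn_integral_mono)
        fix y
        show "(ennreal (?h y))\<^sup>2 * indicator {x. ?h x \<le> t} y \<le> ennreal (t powr (2 - p)) * ennreal (?h y powr p)"
        proof (cases "?h y \<le> t \<and> 0 < ?h y")
          case True
          then have "(?h y)\<^sup>2 = ?h y powr (2 - p) * ?h y powr p" by (simp add: powr_add[symmetric])
          also have "\<dots> \<le> t powr (2 - p) * ?h y powr p" using True p by (intro mult_right_mono powr_mono2) auto
          finally show ?thesis using True by (simp add: ennreal_power ennreal_mult[symmetric] ennreal_leI)
        qed (auto simp: indicator_def power2_eq_square)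
      qed
      also have "\<dots> < \<infinity>" using fin by (simp add: nn_integral_cmult ennreal_mult_less_top)
      finally show ?thesis .
    qed
    have le: "sq (T f) x \<le> sq (T g) x + sq (T b) x" for x
    proof -
      have "sq (T f) x = sq (\<lambda>z. T g z + T b z) x"
      proof (rule sq_cong_cone)
        fix z :: "'a \<times> real" assume z: "0 < snd z"
        have "integrable \<mu> (\<lambda>y. k (snd z) (fst z) y * g y)"
          using U_fin gU by (intro kernel_mult_integrable[OF z, where p = 1]) auto
        moreover have "integrable \<mu> (\<lambda>y. k (snd z) (fst z) y * b y)"
          using L_fin bL by (intro kernel_mult_integrable[OF z, where p = 2]) (auto simp: ennreal_power)
        moreover have "f = (\<lambda>y. g y + b y)" by (auto simp: g_def b_def)
        ultimately show "T f z = T g z + T b z" using T_add[OF z, of g b] by simp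
      qed
      also have "\<dots> \<le> sq (T g) x + sq (T b) x" by (rule sq_triangle) measurable
      finally show ?thesis .
    qed
    have "emeasure \<mu> {x. ennreal t < sq (T f) x} \<le> emeasure \<mu> {x. ennreal (t / 2) < sq (T g) x} + emeasure \<mu> {x. ennreal (t / 2) < sq (T b) x}"
      using emeasure_level_add_le[of "sq (T g)" \<mu> "sq (T b)" t "sq (T f)"] le t by simp
    also have "\<dots> \<le> ennreal (2 * weak_const / t) * ?U t + ennreal (4 * B / t\<^sup>2) * ?L t"
    proof (rule add_mono)
      have "emeasure \<mu> {x. ennreal (t / 2) < sq (T g) x} = ennreal (2 / t) * (ennreal (t / 2) * emeasure \<mu> {x. ennreal (t / 2) < sq (T g) x})"
        using t by (simp add: mult.assoc[symmetric] ennreal_mult[symmetric])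
      also have "\<dots> \<le> ennreal (2 / t) * (ennreal weak_const * ?U t)"
        using weak_type_L1[of g "t / 2"] t gU U_fin by (intro mult_left_mono) auto
      also have "\<dots> = ennreal (2 * weak_const / t) * ?U t"
        using t by (simp add: mult.assoc[symmetric] ennreal_mult'[symmetric])
      finally show "emeasure \<mu> {x. ennreal (t / 2) < sq (T g) x} \<le> ennreal (2 * weak_const / t) * ?U t" .
      have "emeasure \<mu> {x. ennreal (t / 2) < sq (T b) x} = ennreal (4 / t\<^sup>2) * ((ennreal (t / 2))\<^sup>2 * emeasure \<mu> {x. ennreal (t / 2) < sq (T b) x})"
        using t by (simp add: mult.assoc[symmetric] ennreal_power ennreal_mult[symmetric] power_divide)
      also have "\<dots> \<le> ennreal (4 / t\<^sup>2) * (ennreal B * ?L t)"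
        using weak_type_L2[of b "t / 2"] bL L_fin by (intro mult_left_mono) auto
      also have "\<dots> = ennreal (4 * B / t\<^sup>2) * ?L t"
        using t by (simp add: mult.assoc[symmetric] ennreal_mult'[symmetric])
      finally show "emeasure \<mu> {x. ennreal (t / 2) < sq (T b) x} \<le> ennreal (4 * B / t\<^sup>2) * ?L t" .
    qed
    finally show ?thesis .
  qed
  have [measurable]: "?U \<in> borel_measurable borel" "?L \<in> borel_measurable borel"
  proof -
    have "(\<lambda>(t, x). ennreal (?h x) * indicator {x. t < ?h x} x) \<in> borel_measurable (borel \<Otimes>\<^sub>M \<mu>)"
      "(\<lambda>(t, x). (ennreal (?h x))\<^sup>2 * indicator {x. ?h x \<le> t} x) \<in> borel_measurable (borel \<Otimes>\<^sub>M \<mu>)"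
      unfolding indicator_def mem_Collect_eq by measurable
    from this[THEN borel_measurable_nn_integral] show "?U \<in> borel_measurable borel" "?L \<in> borel_measurable borel" by simp_all
  qed
  have "(\<integral>\<^sup>+x. epowr (sq (T f) x) p \<partial>\<mu>)
      = (\<integral>\<^sup>+t\<in>{0<..}. ennreal (p * t powr (p - 1)) * emeasure \<mu> {x. ennreal t < sq (T f) x} \<partial>lborel)"
    using p nn_integral_epowr_eq[of p "sq (T f)"] by simp
  also have "\<dots> \<le> (\<integral>\<^sup>+t. ennreal (p * (2 * weak_const)) * (ennreal (t powr (p - 2)) * ?U t * indicator {0<..} t)
      + ennreal (p * (4 * B)) * (ennreal (t powr (p - 3)) * ?L t * indicator {0<..} t) \<partial>lborel)"
  proof (rule nn_integral_mono)
    fix t :: real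
    show "ennreal (p * t powr (p - 1)) * emeasure \<mu> {x. ennreal t < sq (T f) x} * indicator {0<..} t
      \<le> ennreal (p * (2 * weak_const)) * (ennreal (t powr (p - 2)) * ?U t * indicator {0<..} t)
      + ennreal (p * (4 * B)) * (ennreal (t powr (p - 3)) * ?L t * indicator {0<..} t)"
    proof (cases "0 < t")
      case True
      have "t powr (p - 1) / t = t powr (p - 2)" "t powr (p - 1) / t\<^sup>2 = t powr (p - 3)"
        using True by (simp_all add: powr_diff power2_eq_square power3_eq_cube)
      then have e: "p * t powr (p - 1) * (2 * weak_const / t) = p * (2 * weak_const) * t powr (p - 2)"
        "p * t powr (p - 1) * (4 * B / t\<^sup>2) = p * (4 * B) * t powr (p - 3)"
        by (simp_all flip: \<open>t powr (p - 1) / t = t powr (p - 2)\<close> \<open>t powr (p - 1) / t\<^sup>2 = t powr (p - 3)\<close>)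
      have "ennreal (p * t powr (p - 1)) * emeasure \<mu> {x. ennreal t < sq (T f) x}
        \<le> ennreal (p * t powr (p - 1)) * (ennreal (2 * weak_const / t) * ?U t + ennreal (4 * B / t\<^sup>2) * ?L t)"
        by (intro mult_left_mono level True) auto
      also have "\<dots> = ennreal (p * (2 * weak_const) * t powr (p - 2)) * ?U t + ennreal (p * (4 * B) * t powr (p - 3)) * ?L t"
      proof -
        have nn: "0 \<le> p * t powr (p - 1)" using p by simp
        show ?thesis
          unfolding distrib_left mult.assoc[symmetric, of _ _ "?U t"] mult.assoc[symmetric, of _ _ "?L t"]
            ennreal_mult'[OF nn, symmetric] e ..
      qed
      finally show ?thesis
        using True p weak_const_pos B_pos by (simp add: ennreal_mult mult.assoc)
    qed simp
  qed
  also have "\<dots> = ennreal (p * (2 * weak_const)) * (ennreal (1 / (p - 1)) * ?N) + ennreal (p * (4 * B)) * (ennreal (1 / (2 - p)) * ?N)"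
    using nn_integral_upper_truncations[of p ?h] nn_integral_lower_truncations[of p ?h] p
    by (subst nn_integral_add) (simp_all add: nn_integral_cmult)
  also have "\<dots> = ennreal (p * (2 * weak_const / (p - 1) + 4 * B / (2 - p))) * ?N"
  proof -
    have nn: "0 \<le> p * (2 * weak_const)" "0 \<le> p * (4 * B)" using p weak_const_pos B_pos by auto
    have "0 \<le> p * (2 * weak_const) * (1 / (p - 1))" "0 \<le> p * (4 * B) * (1 / (2 - p))"
      using nn p by auto
    note plus = ennreal_plus[OF this, symmetric]
    have e: "p * (2 * weak_const) * (1 / (p - 1)) + p * (4 * B) * (1 / (2 - p)) = p * (2 * weak_const / (p - 1) + 4 * B / (2 - p))"
      by (simp add: distrib_left)
    show ?thesis
      unfolding mult.assoc[symmetric, of _ _ ?N] distrib_right[symmetric]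
        ennreal_mult'[OF nn(1), symmetric] ennreal_mult'[OF nn(2), symmetric] plus e ..
  qed
  finally show ?thesis .
qed

end

section \<open>The conical and the vertical square function\<close>

context standard_kernel
begin

definition cone_measure :: "'a \<Rightarrow> ('a \<times> real) measure" where
  "cone_measure x = density (\<mu> \<Otimes>\<^sub>M lborel) (\<lambda>z. indicator (cone_over x) z * ennreal (1 / snd z powr (m + 1)))"

definition ray_measure :: "'a \<Rightarrow> ('a \<times> real) measure" where
  "ray_measure x = distr (density lborel (\<lambda>t. indicator {0<..} t * ennreal (1 / t))) borel (\<lambda>t. (x, t))"

lemma sets_pair_mu [measurable_cong, simp]: "sets (\<mu> \<Otimes>\<^sub>M lborel) = sets (borel :: ('a \<times> real) measure)"
  unfolding borel_prod[symmetric] by (rule sets_pair_measure_cong) auto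

lemma measurable_pair_mu_eq [simp]: "measurable (\<mu> \<Otimes>\<^sub>M lborel) N = measurable (borel :: ('a \<times> real) measure) N"
  by (rule measurable_cong_sets[OF sets_pair_mu refl])

lemma mem_cone_over_iff: "z \<in> cone_over x \<longleftrightarrow> 0 < snd z \<and> dist x (fst z) < snd z"
  by (cases z) (auto simp: cone_over_def)

lemma cone_over_measurable [measurable]: "cone_over x \<in> sets (borel :: ('a \<times> real) measure)"
proof -
  have "{z \<in> space (borel :: ('a \<times> real) measure). 0 < snd z \<and> dist x (fst z) < snd z} \<in> sets borel" by measurable
  then show ?thesis by (simp add: mem_cone_over_iff[symmetric])
qed

lemma nn_integral_cone_measure:
  assumes [measurable]: "h \<in> borel_measurable borel"
  shows "(\<integral>\<^sup>+z. h z \<partial>cone_measure x)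
    = (\<integral>\<^sup>+z. indicator (cone_over x) z * ennreal (1 / snd z powr (m + 1)) * h z \<partial>(\<mu> \<Otimes>\<^sub>M lborel))"
  unfolding cone_measure_def by (subst nn_integral_density) auto

lemma nn_integral_ray_measure:
  assumes [measurable]: "h \<in> borel_measurable borel"
  shows "(\<integral>\<^sup>+z. h z \<partial>ray_measure x) = (\<integral>\<^sup>+t. indicator {0<..} t * ennreal (1 / t) * h (x, t) \<partial>lborel)"
proof -
  have [measurable]: "(\<lambda>t. (x, t)) \<in> measurable borel (borel :: ('a \<times> real) measure)"
    unfolding borel_prod[symmetric] by measurable
  show ?thesis
    unfolding ray_measure_def by (subst nn_integral_distr) (auto simp: nn_integral_density)
qed

text \<open>The section of the cone at height \<open>t\<close> is a ball of measure at most \<open>A t\<^sup>m\<close>. This cancels all but one power of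
  \<open>t\<close> in the weight, so that the marginal is dominated by \<open>A dt / t\<close>.\<close>

sublocale conical: square_function \<mu> m A k \<alpha> K cone_measure A
proof
  show sets_cone: "sets (cone_measure x) = sets borel" for x
    unfolding cone_measure_def sets_density by (rule sets_pair_mu)
  show "0 < A" by (rule A_pos)
  show "AE z in cone_measure x. 0 < snd z \<and> dist x (fst z) < snd z" for x
    unfolding cone_measure_def by (subst AE_density) (auto simp: mem_cone_over_iff[symmetric] indicator_def)
  show "(\<integral>\<^sup>+z. h (snd z) \<partial>cone_measure x) \<le> ennreal A * (\<integral>\<^sup>+t\<in>{0<..}. h t * ennreal (1 / t) \<partial>lborel)"
    if [measurable]: "h \<in> borel_measurable borel" for x and h :: "real \<Rightarrow> ennreal"
  proof -
    interpret pair_sigma_finite \<mu> lborel by standard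
    have "(\<integral>\<^sup>+z. h (snd z) \<partial>cone_measure x)
        = (\<integral>\<^sup>+z. indicator (cone_over x) z * ennreal (1 / snd z powr (m + 1)) * h (snd z) \<partial>(\<mu> \<Otimes>\<^sub>M lborel))"
      by (rule nn_integral_cone_measure) measurable
    also have "\<dots> = (\<integral>\<^sup>+t. (\<integral>\<^sup>+y. indicator (cone_over x) (y, t) * ennreal (1 / t powr (m + 1)) * h t \<partial>\<mu>) \<partial>lborel)"
      by (subst nn_integral_snd[symmetric]) auto
    also have "\<dots> \<le> (\<integral>\<^sup>+t. ennreal A * (h t * ennreal (1 / t) * indicator {0<..} t) \<partial>lborel)"
    proof (rule nn_integral_mono)
      fix t :: real
      show "(\<integral>\<^sup>+y. indicator (cone_over x) (y, t) * ennreal (1 / t powr (m + 1)) * h t \<partial>\<mu>)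
          \<le> ennreal A * (h t * ennreal (1 / t) * indicator {0<..} t)"
      proof (cases "0 < t")
        case True
        have "(\<integral>\<^sup>+y. indicator (cone_over x) (y, t) * ennreal (1 / t powr (m + 1)) * h t \<partial>\<mu>)
            = (\<integral>\<^sup>+y. (ennreal (1 / t powr (m + 1)) * h t) * indicator (ball x t) y \<partial>\<mu>)"
          using True by (intro nn_integral_cong) (auto simp: mem_cone_over_iff indicator_def)
        also have "\<dots> = ennreal (1 / t powr (m + 1)) * h t * emeasure \<mu> (ball x t)"
          by (simp add: nn_integral_cmult_indicator)
        also have "\<dots> \<le> ennreal (1 / t powr (m + 1)) * h t * ennreal (A * t powr m)"
          by (intro mult_left_mono growth True) auto
        also have "\<dots> = (ennreal (1 / t powr (m + 1)) * ennreal (A * t powr m)) * h t" by (simp only: mult_ac)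
        also have "ennreal (1 / t powr (m + 1)) * ennreal (A * t powr m) = ennreal A * ennreal (1 / t)"
          using True A_pos by (simp add: ennreal_mult'[symmetric] powr_add)
        finally show ?thesis using True by (simp add: mult_ac)
      qed (simp add: mem_cone_over_iff)
    qed
    also have "\<dots> = ennreal A * (\<integral>\<^sup>+t\<in>{0<..}. h t * ennreal (1 / t) \<partial>lborel)" by (rule nn_integral_cmult) measurable
    finally show ?thesis .
  qed
  show "(\<lambda>x. \<integral>\<^sup>+z. F z \<partial>cone_measure x) \<in> borel_measurable borel"
    if [measurable]: "F \<in> borel_measurable borel" for F :: "'a \<times> real \<Rightarrow> ennreal"
  proof -
    interpret pair_sigma_finite \<mu> lborel by standard
    interpret P: sigma_finite_measure "\<mu> \<Otimes>\<^sub>M lborel"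
      by (rule sigma_finite_pair_measure) unfold_locales
    have [measurable]: "(\<lambda>w. snd w) \<in> borel_measurable ((borel :: 'a measure) \<Otimes>\<^sub>M (\<mu> \<Otimes>\<^sub>M (lborel :: real measure)))"
      by (rule measurable_compose[OF measurable_snd measurable_ident_sets[OF sets_pair_mu]])
    have "(\<lambda>(x, z). (if 0 < snd z \<and> dist x (fst z) < snd z then 1 else 0) * ennreal (1 / snd z powr (m + 1)) * F z)
        \<in> borel_measurable ((borel :: 'a measure) \<Otimes>\<^sub>M (\<mu> \<Otimes>\<^sub>M lborel))"
      unfolding case_prod_beta by measurable
    from P.borel_measurable_nn_integral[OF this]
    show ?thesis
      by (simp add: nn_integral_cone_measure[OF that] indicator_def mem_cone_over_iff of_bool_def)
  qed
qed

sublocale vertical: square_function \<mu> m A k \<alpha> K ray_measure 1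
proof
  show sets_ray: "sets (ray_measure x) = sets borel" for x by (simp add: ray_measure_def)
  have [measurable]: "(\<lambda>t. (x, t)) \<in> measurable borel (borel :: ('a \<times> real) measure)" for x :: 'a
    unfolding borel_prod[symmetric] by measurable
  show "AE z in ray_measure x. 0 < snd z \<and> dist x (fst z) < snd z" for x
    unfolding ray_measure_def by (subst AE_distr_iff) (auto simp: AE_density indicator_def)
  show "(\<integral>\<^sup>+z. h (snd z) \<partial>ray_measure x) \<le> ennreal 1 * (\<integral>\<^sup>+t\<in>{0<..}. h t * ennreal (1 / t) \<partial>lborel)"
    if [measurable]: "h \<in> borel_measurable borel" for x and h :: "real \<Rightarrow> ennreal"
    by (subst nn_integral_ray_measure) (auto simp: mult_ac)
  show "(\<lambda>x. \<integral>\<^sup>+z. F z \<partial>ray_measure x) \<in> borel_measurable borel"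
    if [measurable]: "F \<in> borel_measurable borel" for F :: "'a \<times> real \<Rightarrow> ennreal"
  proof -
    have "sets ((borel :: 'a measure) \<Otimes>\<^sub>M (lborel :: real measure)) = sets (borel \<Otimes>\<^sub>M borel)"
      by (rule sets_pair_measure_cong) simp_all
    also have "\<dots> = sets (borel :: ('a \<times> real) measure)" by (simp only: borel_prod)
    finally have sets_eq: "sets ((borel :: 'a measure) \<Otimes>\<^sub>M (lborel :: real measure)) = sets (borel :: ('a \<times> real) measure)" .
    have [measurable]: "F \<in> borel_measurable (borel \<Otimes>\<^sub>M lborel)"
      unfolding measurable_cong_sets[OF sets_eq refl] by (rule that)
    have "(\<lambda>(x, t). indicator {0<..} t * ennreal (1 / t) * F (x, t)) \<in> borel_measurable ((borel :: 'a measure) \<Otimes>\<^sub>M lborel)"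
      by measurable
    from lborel.borel_measurable_nn_integral[OF this] show ?thesis
      by (simp add: nn_integral_ray_measure[OF that])
  qed
qed simp

end

text \<open>The kernel is only given for \<open>t > 0\<close>; extending it by zero makes it measurable everywhere.\<close>

definition extend_zero :: "(real \<Rightarrow> 'a \<Rightarrow> 'a \<Rightarrow> complex) \<Rightarrow> real \<Rightarrow> 'a \<Rightarrow> 'a \<Rightarrow> complex" where
  "extend_zero s t x y = (if 0 < t then s t x y else 0)"

lemma standing_assumptions_imp_standard_kernel:
  fixes \<mu> :: "'a::euclidean_space measure"
  assumes "standing_assumptions m \<alpha> \<mu> s"
  obtains A K where "standard_kernel \<mu> m A (extend_zero s) \<alpha> K"
proof -
  obtain C0 where C0: "\<And>x r. 0 < r \<Longrightarrow> emeasure \<mu> (ball x r) \<le> ennreal (C0 * r powr m)"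
    using assms by (auto simp: standing_assumptions_def power_bounded_def)
  obtain C1 where C1: "\<And>t x y. 0 < t \<Longrightarrow> norm (s t x y) \<le> C1 * (t powr \<alpha> / (t + dist x y) powr (m + \<alpha>))"
    using assms by (auto simp: standing_assumptions_def standard_kernels_def)
  obtain C2 where C2: "\<And>t x y z. 0 < t \<Longrightarrow> dist y z < t / 2 \<Longrightarrow>
      norm (s t x y - s t x z) \<le> C2 * (dist y z powr \<alpha> / (t + dist x y) powr (m + \<alpha>))"
    using assms unfolding standing_assumptions_def standard_kernels_def by blast
  define A where "A = max C0 1"
  define K where "K = max (max C1 C2) 1"
  have "standard_kernel \<mu> m A (extend_zero s) \<alpha> K"
  proof
    show "sets \<mu> = sets borel" "0 < m" "0 < \<alpha>"
      using assms by (auto simp: standing_assumptions_def power_bounded_def)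
    show "0 < A" "0 < K" by (auto simp: A_def K_def)
    show "emeasure \<mu> (ball x r) \<le> ennreal (A * r powr m)" if "0 < r" for x r
      by (rule order_trans[OF C0[OF that]], rule ennreal_leI) (simp add: A_def mult_right_mono)
    have "(\<lambda>w. indicator ({0<..} \<times> UNIV) w *\<^sub>R (case w of (t, x, y) \<Rightarrow> s t x y)) \<in> borel_measurable borel"
      using assms by (simp add: standing_assumptions_def standard_kernels_def set_borel_measurable_def)
    moreover have "(\<lambda>w. indicator ({0<..} \<times> UNIV) w *\<^sub>R (case w of (t, x, y) \<Rightarrow> s t x y)) = (\<lambda>(t, x, y). extend_zero s t x y)"
      by (auto simp: fun_eq_iff extend_zero_def indicator_def)
    ultimately show "(\<lambda>(t, x, y). extend_zero s t x y) \<in> borel_measurable borel" by simp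
    show "norm (extend_zero s t x y) \<le> K * (t powr \<alpha> / (t + dist x y) powr (m + \<alpha>))" if "0 < t" for t x y
    proof -
      have "C1 * (t powr \<alpha> / (t + dist x y) powr (m + \<alpha>)) \<le> K * (t powr \<alpha> / (t + dist x y) powr (m + \<alpha>))"
        by (rule mult_right_mono) (auto simp: K_def)
      then show ?thesis using C1[OF that, of x y] that by (simp add: extend_zero_def)
    qed
    show "norm (extend_zero s t x y - extend_zero s t x z) \<le> K * (dist y z powr \<alpha> / (t + dist x y) powr (m + \<alpha>))"
      if "0 < t" "dist y z < t / 2" for t x y z
    proof -
      have "C2 * (dist y z powr \<alpha> / (t + dist x y) powr (m + \<alpha>)) \<le> K * (dist y z powr \<alpha> / (t + dist x y) powr (m + \<alpha>))"
        by (rule mult_right_mono) (auto simp: K_def)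
      then show ?thesis using C2[OF that, of x] that by (simp add: extend_zero_def)
    qed
  qed
  then show ?thesis by (rule that)
qed

lemma
  fixes \<mu> :: "'a::euclidean_space measure"
  assumes "standard_kernel \<mu> m A (extend_zero s) \<alpha> K" and [measurable]: "f \<in> borel_measurable borel"
  shows conical_eq_norm2: "conical m \<mu> s f x = norm2 (standard_kernel.cone_measure \<mu> m x) (standard_kernel.T \<mu> (extend_zero s) f)"
    and vertical_eq_norm2: "vertical \<mu> s f x = norm2 (standard_kernel.ray_measure x) (standard_kernel.T \<mu> (extend_zero s) f)"
proof -
  interpret standard_kernel \<mu> m A "extend_zero s" \<alpha> K by fact
  have T_eq: "T f z = \<theta> \<mu> s (snd z) f (fst z)" if "0 < snd z" for z
    using that by (simp add: T_def \<theta>_def extend_zero_def)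
  have "(\<integral>\<^sup>+z. (ennreal (norm (T f z)))\<^sup>2 \<partial>cone_measure x)
     = (\<integral>\<^sup>+(y, t)\<in>cone_over x. ennreal ((norm (\<theta> \<mu> s t f y))\<^sup>2 / t powr (m + 1)) \<partial>(\<mu> \<Otimes>\<^sub>M lborel))"
    by (subst nn_integral_cone_measure)
      (auto intro!: nn_integral_cong simp: indicator_def mem_cone_over_iff T_eq ennreal_power ennreal_mult[symmetric])
  then show "conical m \<mu> s f x = norm2 (cone_measure x) (T f)" by (simp add: conical_def norm2_def)
  have "(\<integral>\<^sup>+z. (ennreal (norm (T f z)))\<^sup>2 \<partial>ray_measure x)
     = (\<integral>\<^sup>+t\<in>{0<..}. ennreal ((norm (\<theta> \<mu> s t f x))\<^sup>2 / t) \<partial>lborel)"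
    by (subst nn_integral_ray_measure)
      (auto intro!: nn_integral_cong simp: indicator_def T_eq ennreal_power ennreal_mult[symmetric])
  then show "vertical \<mu> s f x = norm2 (ray_measure x) (T f)" by (simp add: vertical_def norm2_def)
qed

section \<open>Bounded functions are mapped to RBMO\<close>

definition above :: "real \<Rightarrow> ('a \<times> real \<Rightarrow> complex) \<Rightarrow> 'a \<times> real \<Rightarrow> complex" where
  "above r F z = (if r < snd z then F z else 0)"

definition below :: "real \<Rightarrow> ('a \<times> real \<Rightarrow> complex) \<Rightarrow> 'a \<times> real \<Rightarrow> complex" where
  "below r F z = (if snd z \<le> r then F z else 0)"

context standard_kernel
begin

lemma above_below_measurable [measurable]:
  assumes [measurable]: "F \<in> borel_measurable (borel :: ('a \<times> real) measure)"
  shows "above r F \<in> borel_measurable borel" "below r F \<in> borel_measurable borel"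
  unfolding above_def[abs_def] below_def[abs_def] by measurable

lemma conical_sq_power2:
  assumes [measurable]: "F \<in> borel_measurable borel"
  shows "(conical.sq F x)\<^sup>2
    = (\<integral>\<^sup>+z. indicator (cone_over x) z * ennreal (1 / snd z powr (m + 1)) * (ennreal (norm (F z)))\<^sup>2 \<partial>(\<mu> \<Otimes>\<^sub>M lborel))"
  unfolding conical.sq_def norm2_power2 by (rule nn_integral_cone_measure) measurable

definition shift_const :: real where
  "shift_const = 2 powr (m + 1) * A * tail_const m 1"

lemma shift_const_pos: "0 < shift_const"
  using A_pos tail_const_pos[of 1 m] by (simp add: shift_const_def)

text \<open>Above height \<open>r\<close>, the cones over two points at distance at most \<open>c r\<close> differ by a set of finite
  measure: over \<open>y\<close> the difference is an interval of heights of length at most \<open>c r\<close>, and the weight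
  there is at most a multiple of \<open>(r + |x - y|)\<^sup>-\<^sup>m\<^sup>-\<^sup>1\<close>, which is integrable by the power bound.\<close>

lemma cone_shift:
  assumes [measurable]: "F \<in> borel_measurable borel" and r: "0 < r" and d: "dist x a \<le> c * r" and L: "0 \<le> L"
    and bound: "\<And>y t. r < t \<Longrightarrow> dist x y < t \<Longrightarrow> norm (F (y, t)) \<le> L"
  shows "(conical.sq (above r F) x)\<^sup>2 \<le> (conical.sq (above r F) a)\<^sup>2 + ennreal (L\<^sup>2 * c * shift_const)"
proof -
  let ?w = "\<lambda>z :: 'a \<times> real. ennreal (1 / snd z powr (m + 1))"
  let ?G = "\<lambda>z. (ennreal (norm (above r F z)))\<^sup>2"
  define V where "V = {z :: 'a \<times> real. r < snd z \<and> dist x (fst z) < snd z \<and> snd z \<le> dist a (fst z)}"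
  have [measurable]: "V \<in> sets borel"
  proof -
    have "{z \<in> space (borel :: ('a \<times> real) measure). r < snd z \<and> dist x (fst z) < snd z \<and> snd z \<le> dist a (fst z)} \<in> sets borel"
      by measurable
    then show ?thesis by (simp add: V_def)
  qed
  have c: "0 \<le> c" using order_trans[OF zero_le_dist d] r by (simp add: zero_le_mult_iff)
  have "(conical.sq (above r F) x)\<^sup>2 = (\<integral>\<^sup>+z. indicator (cone_over x) z * ?w z * ?G z \<partial>(\<mu> \<Otimes>\<^sub>M lborel))"
    by (rule conical_sq_power2) measurable
  also have "\<dots> \<le> (\<integral>\<^sup>+z. indicator (cone_over a) z * ?w z * ?G z + ennreal (L\<^sup>2) * (indicator V z * ?w z) \<partial>(\<mu> \<Otimes>\<^sub>M lborel))"
  proof (rule nn_integral_mono)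
    fix z :: "'a \<times> real"
    show "indicator (cone_over x) z * ?w z * ?G z \<le> indicator (cone_over a) z * ?w z * ?G z + ennreal (L\<^sup>2) * (indicator V z * ?w z)"
    proof (cases "z \<in> cone_over x \<and> r < snd z \<and> z \<notin> cone_over a")
      case True
      then have "z \<in> V" by (auto simp: V_def mem_cone_over_iff)
      moreover have "norm (F z) \<le> L" using bound[of "snd z" "fst z"] True by (simp add: mem_cone_over_iff)
      then have "?G z \<le> ennreal (L\<^sup>2)"
        using True by (simp add: above_def ennreal_power ennreal_leI power_mono)
      then have "?w z * ?G z \<le> ?w z * ennreal (L\<^sup>2)" by (rule mult_left_mono) simp
      ultimately show ?thesis using True by (simp add: mult.commute[of "ennreal (L\<^sup>2)"])
    qed (auto simp: indicator_def above_def power2_eq_square)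
  qed
  also have "\<dots> = (conical.sq (above r F) a)\<^sup>2 + ennreal (L\<^sup>2) * (\<integral>\<^sup>+z. indicator V z * ?w z \<partial>(\<mu> \<Otimes>\<^sub>M lborel))"
    by (subst nn_integral_add, simp, simp, subst nn_integral_cmult) (simp_all add: conical_sq_power2)
  also have "(\<integral>\<^sup>+z. indicator V z * ?w z \<partial>(\<mu> \<Otimes>\<^sub>M lborel)) \<le> ennreal (c * shift_const)"
  proof -
    have "(\<integral>\<^sup>+z. indicator V z * ?w z \<partial>(\<mu> \<Otimes>\<^sub>M lborel)) = (\<integral>\<^sup>+y. (\<integral>\<^sup>+t. indicator V (y, t) * ?w (y, t) \<partial>lborel) \<partial>\<mu>)"
      by (rule lborel.nn_integral_fst[symmetric]) simp
    also have "\<dots> \<le> (\<integral>\<^sup>+y. ennreal (2 powr (m + 1) * c * r) * ennreal (1 / (r + dist x y) powr (m + 1)) \<partial>\<mu>)"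
    proof (rule nn_integral_mono)
      fix y
      have "(\<integral>\<^sup>+t. indicator V (y, t) * ?w (y, t) \<partial>lborel)
          \<le> (\<integral>\<^sup>+t. ennreal (2 powr (m + 1) / (r + dist x y) powr (m + 1)) * indicator {dist x y..dist a y} t \<partial>lborel)"
      proof (rule nn_integral_mono)
        fix t :: real
        show "indicator V (y, t) * ?w (y, t) \<le> ennreal (2 powr (m + 1) / (r + dist x y) powr (m + 1)) * indicator {dist x y..dist a y} t"
        proof (cases "(y, t) \<in> V")
          case True
          then have t: "r < t" "dist x y < t" "t \<le> dist a y" by (auto simp: V_def)
          have "1 / t powr (m + 1) \<le> 2 powr (m + 1) / (r + dist x y) powr (m + 1)"
            using t r m_pos by (intro inverse_powr_le_cmult) (auto intro: add_pos_nonneg)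
          then show ?thesis using True t by (simp add: ennreal_leI)
        qed simp
      qed
      also have "\<dots> = ennreal (2 powr (m + 1) / (r + dist x y) powr (m + 1)) * emeasure lborel {dist x y..dist a y}"
        by (rule nn_integral_cmult_indicator) simp
      also have "\<dots> \<le> ennreal (2 powr (m + 1) / (r + dist x y) powr (m + 1)) * ennreal (c * r)"
      proof (intro mult_left_mono)
        have "dist a y - dist x y \<le> c * r" using d dist_triangle[of a y x] by (simp add: dist_commute)
        then show "emeasure lborel {dist x y..dist a y} \<le> ennreal (c * r)"
          by (cases "dist x y \<le> dist a y") (auto simp: ennreal_leI)
      qed simp
      also have "\<dots> = ennreal (2 powr (m + 1) * c * r) * ennreal (1 / (r + dist x y) powr (m + 1))"
        using c r by (simp add: ennreal_mult[symmetric] mult_ac)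
      finally show "(\<integral>\<^sup>+t. indicator V (y, t) * ?w (y, t) \<partial>lborel)
        \<le> ennreal (2 powr (m + 1) * c * r) * ennreal (1 / (r + dist x y) powr (m + 1))" .
    qed
    also have "\<dots> = ennreal (2 powr (m + 1) * c * r) * (\<integral>\<^sup>+y. ennreal (1 / (r + dist x y) powr (m + 1)) \<partial>\<mu>)"
      by (rule nn_integral_cmult) measurable
    also have "\<dots> \<le> ennreal (2 powr (m + 1) * c * r) * ennreal (A * tail_const m 1 * r powr (-1))"
      using r by (intro mult_left_mono tail_mu) auto
    also have "\<dots> = ennreal (c * shift_const)"
      using c r by (subst ennreal_mult'[symmetric]) (auto simp: shift_const_def powr_minus_divide mult_ac)
    finally show ?thesis .
  qed
  also have "ennreal (L\<^sup>2) * ennreal (c * shift_const) = ennreal (L\<^sup>2 * c * shift_const)"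
    using L by (simp add: ennreal_mult'[symmetric] mult.assoc)
  finally show ?thesis by (simp add: add_left_mono mult_left_mono)
qed

lemma nn_integral_inverse_le:
  assumes "0 < p"
  shows "(\<integral>\<^sup>+t\<in>{p<..q}. ennreal (1 / t) \<partial>lborel) \<le> ennreal (q / p)"
proof -
  have "(\<integral>\<^sup>+t\<in>{p<..q}. ennreal (1 / t) \<partial>lborel) \<le> (\<integral>\<^sup>+t. ennreal (1 / p) * indicator {p..q} t \<partial>lborel)"
    using assms by (intro nn_integral_mono) (auto simp: indicator_def frac_le intro!: ennreal_leI)
  also have "\<dots> = ennreal (1 / p) * emeasure lborel {p..q}" by (rule nn_integral_cmult_indicator) simp
  also have "\<dots> \<le> ennreal (q / p)"
  proof (cases "p \<le> q")
    case True
    then have "ennreal (1 / p) * emeasure lborel {p..q} = ennreal (1 / p * (q - p))"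
      using assms by (simp add: ennreal_mult[symmetric] del: times_divide_eq_left)
    also have "1 / p * (q - p) \<le> q / p" using assms by (simp add: divide_right_mono)
    finally show ?thesis by (simp add: ennreal_leI)
  qed simp
  finally show ?thesis .
qed

text \<open>Lowering the truncation height from \<open>R\<close> to \<open>r\<close> over the same centre \<open>a\<close>: up to a constant, the
  measure of the layer is the RBMO coefficient of the two balls.\<close>

lemma cone_layer:
  assumes [measurable]: "F \<in> borel_measurable borel" and r: "0 < r" "0 < R" and \<kappa>: "1 < \<kappa>" and ab: "dist a b \<le> R" and L: "0 \<le> L"
    and bound: "\<And>y t. r < t \<Longrightarrow> norm (F (y, t)) \<le> L"
  shows "(conical.sq (above r F) a)\<^sup>2 \<le> (conical.sq (above R F) a)\<^sup>2
    + ennreal (L\<^sup>2) * (ennreal (A / (\<kappa> - 1) + A / m)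
      + ennreal (1 / m) * (\<integral>\<^sup>+y\<in>ball b (\<kappa> * R) - ball a r. ennreal (1 / dist y a powr m) \<partial>\<mu>))"
proof -
  let ?w = "\<lambda>z :: 'a \<times> real. ennreal (1 / snd z powr (m + 1))"
  let ?R = "(\<kappa> - 1) * R"
  have R': "0 < ?R" using \<kappa> r by simp
  define V where "V = {z :: 'a \<times> real. r < snd z \<and> snd z \<le> ?R}"
  define U where "U = {z :: 'a \<times> real. ?R < snd z \<and> snd z \<le> R}"
  have [measurable]: "V \<in> sets borel" "U \<in> sets borel"
  proof -
    have "{z \<in> space (borel :: ('a \<times> real) measure). r < snd z \<and> snd z \<le> ?R} \<in> sets borel"
      "{z \<in> space (borel :: ('a \<times> real) measure). ?R < snd z \<and> snd z \<le> R} \<in> sets borel"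
      by measurable
    then show "V \<in> sets borel" "U \<in> sets borel" by (simp_all add: V_def U_def)
  qed
  have "(conical.sq (above r F) a)\<^sup>2 \<le> (\<integral>\<^sup>+z. (ennreal (norm (above R F z)))\<^sup>2 + ennreal (L\<^sup>2) * (indicator U z + indicator V z) \<partial>cone_measure a)"
    unfolding conical.sq_def norm2_power2
  proof (rule nn_integral_mono)
    fix z :: "'a \<times> real"
    show "(ennreal (norm (above r F z)))\<^sup>2 \<le> (ennreal (norm (above R F z)))\<^sup>2 + ennreal (L\<^sup>2) * (indicator U z + indicator V z)"
    proof (cases "r < snd z \<and> snd z \<le> R")
      case True
      then have "norm (F z) \<le> L" using bound[of "snd z" "fst z"] by simp
      then have "(ennreal (norm (above r F z)))\<^sup>2 \<le> ennreal (L\<^sup>2) * 1"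
        using True by (simp add: above_def ennreal_power ennreal_leI power_mono)
      also have "\<dots> \<le> ennreal (L\<^sup>2) * (indicator U z + indicator V z)"
        using True by (intro mult_left_mono) (auto simp: U_def V_def indicator_def)
      finally show ?thesis by (simp add: add_increasing)
    qed (auto simp: above_def power2_eq_square)
  qed
  also have "\<dots> = (conical.sq (above R F) a)\<^sup>2
      + ennreal (L\<^sup>2) * ((\<integral>\<^sup>+z. indicator U z \<partial>cone_measure a) + (\<integral>\<^sup>+z. indicator V z \<partial>cone_measure a))"
    unfolding conical.sq_def norm2_power2
    by (subst nn_integral_add, simp, simp, subst nn_integral_cmult, simp, subst nn_integral_add) auto
  also have "\<dots> \<le> (conical.sq (above R F) a)\<^sup>2 + ennreal (L\<^sup>2) * (ennreal (A / (\<kappa> - 1)) +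
      (ennreal (A / m) + ennreal (1 / m) * (\<integral>\<^sup>+y\<in>ball b (\<kappa> * R) - ball a r. ennreal (1 / dist y a powr m) \<partial>\<mu>)))"
  proof (intro add_mono order_refl mult_left_mono)
    have "(\<integral>\<^sup>+z. indicator U z \<partial>cone_measure a) = (\<integral>\<^sup>+z. indicator {?R<..R} (snd z) \<partial>cone_measure a)"
      by (intro nn_integral_cong) (auto simp: U_def indicator_def)
    also have "\<dots> \<le> ennreal A * (\<integral>\<^sup>+t\<in>{0<..}. indicator {?R<..R} t * ennreal (1 / t) \<partial>lborel)"
      by (rule conical.omega_marginal) measurable
    also have "(\<integral>\<^sup>+t\<in>{0<..}. indicator {?R<..R} t * ennreal (1 / t) \<partial>lborel) \<le> (\<integral>\<^sup>+t\<in>{?R<..R}. ennreal (1 / t) \<partial>lborel)"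
      by (intro nn_integral_mono) (auto simp: indicator_def)
    also have "\<dots> \<le> ennreal (R / ?R)" by (rule nn_integral_inverse_le[OF R'])
    also have "R / ?R = 1 / (\<kappa> - 1)" using r by simp
    also have "ennreal A * ennreal (1 / (\<kappa> - 1)) = ennreal (A / (\<kappa> - 1))"
      using A_pos by (simp add: ennreal_mult'[symmetric])
    finally show "(\<integral>\<^sup>+z. indicator U z \<partial>cone_measure a) \<le> ennreal (A / (\<kappa> - 1))" by (simp add: mult_left_mono)
  next
    have ray: "(\<integral>\<^sup>+t\<in>{u..}. ennreal (1 / t powr (m + 1)) \<partial>lborel) = ennreal (1 / m) * ennreal (1 / u powr m)" if "0 < u" for u
    proof -
      have "(\<integral>\<^sup>+t\<in>{u..}. ennreal (1 / t powr (m + 1)) \<partial>lborel) = (\<integral>\<^sup>+t\<in>{u..}. ennreal (t powr (- m - 1)) \<partial>lborel)"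
        by (intro nn_integral_cong) (auto simp: indicator_def powr_minus_divide[symmetric])
      also have "\<dots> = ennreal (1 / m) * ennreal (1 / u powr m)"
        using nn_integral_powr_to_inf[OF m_pos that] m_pos that
        by (simp add: ennreal_mult'[symmetric] powr_minus_divide mult.commute)
      finally show ?thesis .
    qed
    have "(\<integral>\<^sup>+z. indicator V z \<partial>cone_measure a)
        = (\<integral>\<^sup>+z. indicator (cone_over a) z * ?w z * indicator V z \<partial>(\<mu> \<Otimes>\<^sub>M lborel))"
      by (rule nn_integral_cone_measure) measurable
    also have "\<dots> = (\<integral>\<^sup>+y. (\<integral>\<^sup>+t. indicator (cone_over a) (y, t) * ?w (y, t) * indicator V (y, t) \<partial>lborel) \<partial>\<mu>)"
      by (rule lborel.nn_integral_fst[symmetric]) simp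
    also have "\<dots> \<le> (\<integral>\<^sup>+y. ennreal (1 / m) * (ennreal (1 / r powr m) * indicator (ball a r) y)
        + ennreal (1 / m) * (ennreal (1 / dist y a powr m) * indicator (ball b (\<kappa> * R) - ball a r) y) \<partial>\<mu>)"
    proof (rule nn_integral_mono)
      fix y
      let ?i = "\<integral>\<^sup>+t. indicator (cone_over a) (y, t) * ?w (y, t) * indicator V (y, t) \<partial>lborel"
      show "?i \<le> ennreal (1 / m) * (ennreal (1 / r powr m) * indicator (ball a r) y)
        + ennreal (1 / m) * (ennreal (1 / dist y a powr m) * indicator (ball b (\<kappa> * R) - ball a r) y)"
      proof (cases "dist a y < r")
        case True
        have "?i \<le> (\<integral>\<^sup>+t\<in>{r..}. ennreal (1 / t powr (m + 1)) \<partial>lborel)"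
          by (intro nn_integral_mono) (auto simp: indicator_def V_def)
        then show ?thesis using True ray[OF r(1)] by (simp add: add_increasing2)
      next
        case ge: False
        then have pos: "0 < dist y a" using r by (metis dist_commute less_le_trans not_less)
        show ?thesis
        proof (cases "dist a y < ?R")
          case True
          have "dist b y < \<kappa> * R"
            using True ab dist_triangle[of b y a] by (simp add: dist_commute left_diff_distrib)
          moreover have "?i \<le> (\<integral>\<^sup>+t\<in>{dist y a..}. ennreal (1 / t powr (m + 1)) \<partial>lborel)"
            by (intro nn_integral_mono) (auto simp: indicator_def V_def mem_cone_over_iff dist_commute)
          ultimately show ?thesis using ge ray[OF pos] by (simp add: add_increasing)
        next
          case False
          have "?i = (\<integral>\<^sup>+t. 0 \<partial>(lborel :: real measure))"
            using False by (intro nn_integral_cong) (auto simp: indicator_def V_def mem_cone_over_iff)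
          then show ?thesis by simp
        qed
      qed
    qed
    also have "\<dots> = ennreal (1 / m) * (ennreal (1 / r powr m) * emeasure \<mu> (ball a r))
        + ennreal (1 / m) * (\<integral>\<^sup>+y\<in>ball b (\<kappa> * R) - ball a r. ennreal (1 / dist y a powr m) \<partial>\<mu>)"
    proof -
      have "(\<integral>\<^sup>+y. c * (d * indicator S y) + e * h y \<partial>\<mu>) = c * (d * emeasure \<mu> S) + e * (\<integral>\<^sup>+y. h y \<partial>\<mu>)"
        if [measurable]: "S \<in> sets borel" "h \<in> borel_measurable borel" for c d e :: ennreal and S h
        by (simp add: nn_integral_add nn_integral_cmult nn_integral_cmult_indicator)
      then show ?thesis by this measurable
    qed
    also have "ennreal (1 / m) * (ennreal (1 / r powr m) * emeasure \<mu> (ball a r)) \<le> ennreal (1 / m) * (ennreal (1 / r powr m) * ennreal (A * r powr m))"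
      by (intro mult_left_mono growth r) auto
    also have "\<dots> = ennreal (A / m)"
      using r m_pos A_pos by (simp add: ennreal_mult'[symmetric])
    finally show "(\<integral>\<^sup>+z. indicator V z \<partial>cone_measure a)
      \<le> ennreal (A / m) + ennreal (1 / m) * (\<integral>\<^sup>+y\<in>ball b (\<kappa> * R) - ball a r. ennreal (1 / dist y a powr m) \<partial>\<mu>)"
      by (simp add: add_right_mono)
  qed simp
  finally show ?thesis using A_pos \<kappa> m_pos by (simp add: add.assoc)
qed

end

lemma ennreal_le_add_of_power2_le:
  assumes "u\<^sup>2 \<le> v\<^sup>2 + w\<^sup>2"
  shows "u \<le> v + (w :: ennreal)"
proof -
  have "v\<^sup>2 + w\<^sup>2 \<le> (v + w)\<^sup>2" by (simp add: power2_sum)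
  then have "u\<^sup>2 \<le> (v + w)\<^sup>2" using assms by simp
  then show ?thesis by (simp only: ennreal_power2_le_iff)
qed

lemma ennreal_abs_diff_le:
  assumes "0 \<le> g" "0 \<le> s" "ennreal g \<le> ennreal s + w" "ennreal s \<le> ennreal g + w"
  shows "ennreal \<bar>g - s\<bar> \<le> w"
proof (cases w)
  case (real c)
  then have "g \<le> s + c" "s \<le> g + c"
    using assms by (simp_all add: ennreal_plus[symmetric] del: ennreal_plus)
  then show ?thesis using real by (simp add: ennreal_leI)
qed simp

context standard_kernel
begin

definition T_const :: real where
  "T_const = K * tail_const m \<alpha> * A"

lemma T_const_pos: "0 < T_const"
  using K_pos A_pos tail_const_pos[OF alpha_pos, of m] by (simp add: T_const_def)

lemma bounded_average:
  assumes "\<And>y. norm (f y) \<le> L" "0 < u"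
  shows "(\<integral>\<^sup>+y\<in>ball x u. ennreal (norm (f y)) \<partial>\<mu>) \<le> ennreal (L * A * u powr m)"
proof -
  have L: "0 \<le> L" using order_trans[OF norm_ge_zero assms(1)] .
  have "(\<integral>\<^sup>+y\<in>ball x u. ennreal (norm (f y)) \<partial>\<mu>) \<le> (\<integral>\<^sup>+y. ennreal L * indicator (ball x u) y \<partial>\<mu>)"
    using assms(1) by (intro nn_integral_mono) (auto simp: indicator_def intro: ennreal_leI)
  also have "\<dots> = ennreal L * emeasure \<mu> (ball x u)" by (rule nn_integral_cmult_indicator) simp
  also have "\<dots> \<le> ennreal L * ennreal (A * u powr m)" using \<open>0 < u\<close> by (intro mult_left_mono growth) auto
  finally show ?thesis using L by (simp add: ennreal_mult'[symmetric] mult.assoc)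
qed

lemma T_bounded:
  assumes [measurable]: "f \<in> borel_measurable borel" and "\<And>y. norm (f y) \<le> L" "0 < t"
  shows "norm (T f (x, t)) \<le> T_const * L"
proof -
  have L: "0 \<le> L" using order_trans[OF norm_ge_zero assms(2)] .
  have "norm (T f (x, t)) \<le> K * tail_const m \<alpha> * (L * A)"
  proof (rule T_le)
    fix u assume "t \<le> u"
    then show "(\<integral>\<^sup>+y\<in>ball x u. ennreal (norm (f y)) \<partial>\<mu>) \<le> ennreal (L * A * u powr m)"
      using \<open>0 < t\<close> assms(2) by (intro bounded_average) auto
  qed (use assms L A_pos in auto)
  then show ?thesis by (simp add: T_const_def mult_ac)
qed

lemma kernel_mult_integrable_bounded:
  assumes [measurable]: "f \<in> borel_measurable borel" and "\<And>y. norm (f y) \<le> L" "0 < t"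
  shows "integrable \<mu> (\<lambda>y. k t x y * f y)"
proof (rule Bochner_Integration.integrable_bound)
  show "integrable \<mu> (\<lambda>y. L *\<^sub>R k t x y)" using kernel_integrable[OF \<open>0 < t\<close>, of x] by simp
  have "0 \<le> L" using order_trans[OF norm_ge_zero assms(2)] .
  then show "AE y in \<mu>. norm (k t x y * f y) \<le> norm (L *\<^sub>R k t x y)"
    using assms(2) by (intro AE_I2) (simp add: norm_mult mult.commute[of "norm (k _ _ _)"] mult_right_mono)
qed measurable

definition local_const :: "real \<Rightarrow> real" where
  "local_const \<kappa> = conical.radial_const (\<alpha> / 2) \<alpha> * (K * tail_const m (\<alpha> / 2) * 2 powr \<alpha> * (\<kappa> - 1) powr (- (\<alpha> / 2)))"

lemma local_const_pos: "1 < \<kappa> \<Longrightarrow> 0 < local_const \<kappa>"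
  using K_pos alpha_pos tail_const_pos[of "\<alpha> / 2" m] conical.radial_const_pos[of "\<alpha> / 2" \<alpha>]
  by (auto simp: local_const_def intro!: mult_pos_pos)

text \<open>At heights \<open>t \<le> r\<close> over a ball of radius \<open>r\<close>, a function that vanishes on the dilated ball is
  only seen from points with \<open>t + |y - z| \<ge> (\<kappa> - 1) r\<close>, which gives decay in \<open>t / r\<close>.\<close>

lemma sq_below_vanishing:
  assumes \<kappa>: "1 < \<kappa>" and r: "0 < r" and x: "dist a x < r"
    and [measurable]: "f \<in> borel_measurable borel" and L0: "0 \<le> L"
    and avg: "\<And>y u. 0 < u \<Longrightarrow> dist x y < u \<Longrightarrow> (\<integral>\<^sup>+z\<in>ball y u. ennreal (norm (f z)) \<partial>\<mu>) \<le> ennreal (L * u powr m)"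
    and vanish: "\<And>y. y \<in> ball a (\<kappa> * r) \<Longrightarrow> f y = 0"
  shows "conical.sq (below r (T f)) x \<le> ennreal (local_const \<kappa> * L)"
proof -
  let ?e = "(\<kappa> - 1) * r"
  let ?q = "m + \<alpha> / 2"
  let ?C = "K * ?e powr (- (\<alpha> / 2)) * (L * tail_const m (\<alpha> / 2))"
  let ?\<eta> = "density \<mu> (\<lambda>z. ennreal (norm (f z)))"
  have e: "0 < ?e" using \<kappa> r by simp
  have C: "0 \<le> ?C" using L0 K_pos tail_const_pos[of "\<alpha> / 2" m] alpha_pos by simp
  have Tle: "norm (T f (y, t)) \<le> ?C * t powr (\<alpha> / 2)" if t: "0 < t" "dist x y < t" "t \<le> r" for y t
  proof -
    have "ennreal (norm (T f (y, t))) \<le> (\<integral>\<^sup>+z. ennreal (norm (k t y z * f z)) \<partial>\<mu>)"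
      unfolding T_def using norm_integral_le_nn_integral by simp
    also have "\<dots> \<le> (\<integral>\<^sup>+z. ennreal (K * ?e powr (- (\<alpha> / 2)) * t powr \<alpha>) * (ennreal (norm (f z)) * ennreal (1 / (t + dist y z) powr ?q)) \<partial>\<mu>)"
    proof (rule nn_integral_mono)
      fix z
      show "ennreal (norm (k t y z * f z)) \<le> ennreal (K * ?e powr (- (\<alpha> / 2)) * t powr \<alpha>) * (ennreal (norm (f z)) * ennreal (1 / (t + dist y z) powr ?q))"
      proof (cases "z \<in> ball a (\<kappa> * r)")
        case False
        have "\<kappa> * r \<le> dist a x + dist x y + dist y z"
          using False dist_triangle[of a z x] dist_triangle[of x z y] by simp
        then have s: "?e \<le> t + dist y z" using x t by (simp add: left_diff_distrib)
        then have "1 / (t + dist y z) powr (\<alpha> / 2) \<le> 1 / ?e powr (\<alpha> / 2)"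
          using e alpha_pos less_le_trans[OF e s] by (intro divide_left_mono powr_mono2 mult_pos_pos) auto
        then have "1 / (t + dist y z) powr (m + \<alpha>) \<le> ?e powr (- (\<alpha> / 2)) * (1 / (t + dist y z) powr ?q)"
        proof -
          have "(t + dist y z) powr (m + \<alpha>) = (t + dist y z) powr (\<alpha> / 2) * (t + dist y z) powr ?q"
            by (simp add: powr_add[symmetric] add.commute)
          then show ?thesis
            using mult_right_mono[OF \<open>1 / (t + dist y z) powr (\<alpha> / 2) \<le> 1 / ?e powr (\<alpha> / 2)\<close>, of "1 / (t + dist y z) powr ?q"]
            by (simp add: powr_minus_divide)
        qed
        then have "K * t powr \<alpha> * (1 / (t + dist y z) powr (m + \<alpha>)) * norm (f z) \<le> K * t powr \<alpha> * (?e powr (- (\<alpha> / 2)) * (1 / (t + dist y z) powr ?q)) * norm (f z)"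
          using K_pos by (intro mult_right_mono mult_left_mono) auto
        moreover have "norm (k t y z * f z) \<le> K * t powr \<alpha> * (1 / (t + dist y z) powr (m + \<alpha>)) * norm (f z)"
          unfolding norm_mult using k_size[OF t(1), of y z] K_pos by (intro mult_mono) auto
        ultimately have "norm (k t y z * f z) \<le> K * ?e powr (- (\<alpha> / 2)) * t powr \<alpha> * (norm (f z) * (1 / (t + dist y z) powr ?q))"
          by (simp add: mult_ac)
        then show ?thesis using K_pos by (simp add: ennreal_mult'[symmetric] ennreal_leI)
      qed (simp add: vanish)
    qed
    also have "\<dots> = ennreal (K * ?e powr (- (\<alpha> / 2)) * t powr \<alpha>) * (\<integral>\<^sup>+z. ennreal (1 / (t + dist y z) powr ?q) \<partial>?\<eta>)"
      by (subst nn_integral_cmult) (auto simp: nn_integral_density)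
    also have "\<dots> \<le> ennreal (K * ?e powr (- (\<alpha> / 2)) * t powr \<alpha>) * ennreal (L * tail_const m (\<alpha> / 2) * t powr (- (\<alpha> / 2)))"
    proof (intro mult_left_mono tail_integral)
      fix u assume "t \<le> u"
      then show "emeasure ?\<eta> (ball y u) \<le> ennreal (L * u powr m)"
        using avg[of u y] t by (simp add: emeasure_density)
    qed (use t L0 m_pos alpha_pos in auto)
    also have "\<dots> = ennreal (K * ?e powr (- (\<alpha> / 2)) * t powr \<alpha> * (L * tail_const m (\<alpha> / 2) * t powr (- (\<alpha> / 2))))"
      using K_pos by (intro ennreal_mult'[symmetric]) auto
    also have "K * ?e powr (- (\<alpha> / 2)) * t powr \<alpha> * (L * tail_const m (\<alpha> / 2) * t powr (- (\<alpha> / 2))) = ?C * t powr (\<alpha> / 2)"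
      using powr_add[of t \<alpha> "- (\<alpha> / 2)"] by simp
    finally show ?thesis using C by (subst (asm) ennreal_le_iff) auto
  qed
  have "conical.sq (below r (T f)) x \<le> ennreal (conical.radial_const (\<alpha> / 2) \<alpha> * (?C * (2 * r) powr \<alpha>) * r powr (\<alpha> / 2 - \<alpha>))"
  proof (rule conical.sq_radial_le)
    fix y t assume t: "0 < t" "dist x y < t"
    show "norm (below r (T f) (y, t)) \<le> ?C * (2 * r) powr \<alpha> * (t powr (\<alpha> / 2) / (t + r) powr \<alpha>)"
    proof (cases "t \<le> r")
      case True
      have "1 \<le> (2 * r) powr \<alpha> / (t + r) powr \<alpha>" using True t r alpha_pos by (simp add: powr_mono2)
      then have "?C * t powr (\<alpha> / 2) * 1 \<le> ?C * t powr (\<alpha> / 2) * ((2 * r) powr \<alpha> / (t + r) powr \<alpha>)"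
        using C by (intro mult_left_mono) auto
      then show ?thesis using Tle[OF t True] True by (simp add: below_def mult_ac)
    next
      case False
      have "0 \<le> ?C * (2 * r) powr \<alpha> * (t powr (\<alpha> / 2) / (t + r) powr \<alpha>)"
        by (rule mult_nonneg_nonneg[OF mult_nonneg_nonneg[OF C powr_ge_zero]]) simp
      then show ?thesis using False by (simp add: below_def)
    qed
  qed (use alpha_pos r C in auto)
  also have "conical.radial_const (\<alpha> / 2) \<alpha> * (?C * (2 * r) powr \<alpha>) * r powr (\<alpha> / 2 - \<alpha>) = local_const \<kappa> * L"
  proof -
    have "?e powr (- (\<alpha> / 2)) * (2 * r) powr \<alpha> * r powr (\<alpha> / 2 - \<alpha>) = (\<kappa> - 1) powr (- (\<alpha> / 2)) * 2 powr \<alpha>"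
      using \<kappa> r powr_add[of r "- (\<alpha> / 2)" "\<alpha>"] powr_add[of r "\<alpha> / 2" "\<alpha> / 2 - \<alpha>"]
      by (simp add: powr_mult mult_ac)
    then have "conical.radial_const (\<alpha> / 2) \<alpha> * K * (L * tail_const m (\<alpha> / 2)) * (?e powr (- (\<alpha> / 2)) * (2 * r) powr \<alpha> * r powr (\<alpha> / 2 - \<alpha>))
      = conical.radial_const (\<alpha> / 2) \<alpha> * K * (L * tail_const m (\<alpha> / 2)) * ((\<kappa> - 1) powr (- (\<alpha> / 2)) * 2 powr \<alpha>)" by simp
    then show ?thesis by (simp add: local_const_def mult_ac)
  qed
  finally show ?thesis .
qed

end

locale L2_conical = standard_kernel \<mu> m A k \<alpha> K
  for \<mu> :: "'a::euclidean_space measure" and m A :: real and k \<alpha> K +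
  fixes B :: real
  assumes B_pos: "0 < B"
    and conical_L2: "\<And>g. g \<in> borel_measurable borel \<Longrightarrow> (\<integral>\<^sup>+y. (ennreal (norm (g y)))\<^sup>2 \<partial>\<mu>) < \<infinity> \<Longrightarrow>
      (\<integral>\<^sup>+x. (conical.sq (T g) x)\<^sup>2 \<partial>\<mu>) \<le> ennreal B * (\<integral>\<^sup>+y. (ennreal (norm (g y)))\<^sup>2 \<partial>\<mu>)"
begin

sublocale L2: L2_square_function \<mu> m A k \<alpha> K cone_measure A B
  using B_pos conical_L2 by unfold_locales

definition rbmo_const :: "real \<Rightarrow> real" where
  "rbmo_const \<kappa> = sqrt B + local_const \<kappa> * A + T_const * (1 + shift_const + A / (\<kappa> - 1) + A / m + 1 / m)"

text \<open>The part of \<open>f\<close> inside the dilated ball is bounded in \<open>L\<^sup>2\<close>, and the Cauchy--Schwarz inequality applies on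
  the ball. The part outside has a bounded truncated square function there.\<close>

lemma local_integral_le:
  assumes \<kappa>: "1 < \<kappa>" and r: "0 < r" and [measurable]: "f \<in> borel_measurable borel" and L: "\<And>y. norm (f y) \<le> L"
  shows "(\<integral>\<^sup>+x\<in>ball a r. conical.sq (below r (T f)) x \<partial>\<mu>) \<le> ennreal ((sqrt B + local_const \<kappa> * A) * L) * emeasure \<mu> (ball a (\<kappa> * r))"
proof -
  have L0: "0 \<le> L" using order_trans[OF norm_ge_zero L] .
  let ?R = "ball a (\<kappa> * r)"
  have BR: "ball a r \<subseteq> ?R" using \<kappa> r by (intro subset_ball) simp
  define g where "g y = (if y \<in> ?R then f y else 0)" for y
  define h where "h y = (if y \<in> ?R then 0 else f y)" for y
  have [measurable]: "g \<in> borel_measurable borel" "h \<in> borel_measurable borel" unfolding g_def h_def by measurable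
  have gL: "norm (g y) \<le> L" and hL: "norm (h y) \<le> L" for y using L[of y] L0 by (auto simp: g_def h_def)
  have split: "conical.sq (below r (T f)) x \<le> conical.sq (T g) x + conical.sq (below r (T h)) x" for x
  proof -
    have "conical.sq (below r (T f)) x = conical.sq (\<lambda>z. below r (T g) z + below r (T h) z) x"
    proof (rule conical.sq_cong_cone)
      fix z :: "'a \<times> real" assume z: "0 < snd z"
      have "T (\<lambda>y. g y + h y) z = T g z + T h z"
        using z kernel_mult_integrable_bounded[OF _ gL z] kernel_mult_integrable_bounded[OF _ hL z] by (intro L2.T_add) auto
      moreover have "f = (\<lambda>y. g y + h y)" by (auto simp: g_def h_def)
      ultimately show "below r (T f) z = below r (T g) z + below r (T h) z" by (simp add: below_def)
    qed
    also have "\<dots> \<le> conical.sq (below r (T g)) x + conical.sq (below r (T h)) x" by (rule conical.sq_triangle) measurable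
    also have "conical.sq (below r (T g)) x \<le> conical.sq (T g) x" by (rule conical.sq_mono_AE) (simp add: below_def)
    finally show ?thesis by simp
  qed
  have g2: "(\<integral>\<^sup>+y. (ennreal (norm (g y)))\<^sup>2 \<partial>\<mu>) \<le> ennreal (L\<^sup>2) * emeasure \<mu> ?R"
  proof -
    have "(\<integral>\<^sup>+y. (ennreal (norm (g y)))\<^sup>2 \<partial>\<mu>) \<le> (\<integral>\<^sup>+y. ennreal (L\<^sup>2) * indicator ?R y \<partial>\<mu>)"
      using L by (intro nn_integral_mono) (auto simp: g_def ennreal_power indicator_def intro!: ennreal_leI power_mono)
    then show ?thesis by (simp add: nn_integral_cmult_indicator)
  qed
  have near: "(\<integral>\<^sup>+x\<in>ball a r. conical.sq (T g) x \<partial>\<mu>) \<le> ennreal (sqrt B * L) * emeasure \<mu> ?R"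
  proof -
    have "(\<integral>\<^sup>+x\<in>ball a r. conical.sq (T g) x \<partial>\<mu>)\<^sup>2
        \<le> (\<integral>\<^sup>+x. (conical.sq (T g) x)\<^sup>2 \<partial>\<mu>) * (\<integral>\<^sup>+x. (indicator (ball a r) x)\<^sup>2 \<partial>\<mu>)"
      by (intro Cauchy_Schwarz_nn_integral) (auto intro!: borel_measurable_indicator)
    also have "(\<integral>\<^sup>+x. (indicator (ball a r) x)\<^sup>2 \<partial>\<mu>) = (\<integral>\<^sup>+x. indicator (ball a r) x \<partial>\<mu>)"
      by (intro nn_integral_cong) (auto simp: indicator_def)
    also have "\<dots> = emeasure \<mu> (ball a r)" by simp
    also have "(\<integral>\<^sup>+x. (conical.sq (T g) x)\<^sup>2 \<partial>\<mu>) * emeasure \<mu> (ball a r) \<le> (ennreal B * (ennreal (L\<^sup>2) * emeasure \<mu> ?R)) * emeasure \<mu> ?R"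
    proof (intro mult_mono emeasure_mono BR)
      have "(\<integral>\<^sup>+y. (ennreal (norm (g y)))\<^sup>2 \<partial>\<mu>) < \<infinity>"
        using g2 emeasure_ball_finite[of a "\<kappa> * r"] by (auto simp: ennreal_mult_less_top intro: le_less_trans)
      then have "(\<integral>\<^sup>+x. (conical.sq (T g) x)\<^sup>2 \<partial>\<mu>) \<le> ennreal B * (\<integral>\<^sup>+y. (ennreal (norm (g y)))\<^sup>2 \<partial>\<mu>)"
        by (intro conical_L2) measurable
      also have "\<dots> \<le> ennreal B * (ennreal (L\<^sup>2) * emeasure \<mu> ?R)" by (intro mult_left_mono g2) simp
      finally show "(\<integral>\<^sup>+x. (conical.sq (T g) x)\<^sup>2 \<partial>\<mu>) \<le> ennreal B * (ennreal (L\<^sup>2) * emeasure \<mu> ?R)" .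
    qed auto
    also have "\<dots> = (ennreal (sqrt B * L) * emeasure \<mu> ?R)\<^sup>2"
      using L0 B_pos by (simp add: emeasure_ball_eq ennreal_mult'[symmetric] ennreal_power power2_eq_square mult_ac)
    finally show ?thesis by (simp only: ennreal_power2_le_iff)
  qed
  have "(\<integral>\<^sup>+x\<in>ball a r. conical.sq (below r (T f)) x \<partial>\<mu>)
     \<le> (\<integral>\<^sup>+x. conical.sq (T g) x * indicator (ball a r) x + ennreal (local_const \<kappa> * A * L) * indicator ?R x \<partial>\<mu>)"
  proof (rule nn_integral_mono)
    fix x
    show "conical.sq (below r (T f)) x * indicator (ball a r) x \<le> conical.sq (T g) x * indicator (ball a r) x + ennreal (local_const \<kappa> * A * L) * indicator ?R x"
    proof (cases "x \<in> ball a r")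
      case True
      have "conical.sq (below r (T h)) x \<le> ennreal (local_const \<kappa> * (L * A))"
        using True \<kappa> r L0 A_pos bounded_average[OF hL]
        by (intro sq_below_vanishing[where a = a]) (auto simp: h_def)
      then have "conical.sq (below r (T f)) x \<le> conical.sq (T g) x + ennreal (local_const \<kappa> * A * L)"
        using split[of x] by (auto simp: mult_ac intro: order_trans add_left_mono)
      moreover have "x \<in> ?R" using True BR by blast
      ultimately show ?thesis using True by simp
    qed simp
  qed
  also have "\<dots> = (\<integral>\<^sup>+x\<in>ball a r. conical.sq (T g) x \<partial>\<mu>) + ennreal (local_const \<kappa> * A * L) * emeasure \<mu> ?R"
    by (subst nn_integral_add) (auto simp: nn_integral_cmult_indicator)
  also have "\<dots> \<le> ennreal (sqrt B * L) * emeasure \<mu> ?R + ennreal (local_const \<kappa> * A * L) * emeasure \<mu> ?R"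
    by (intro add_right_mono near)
  also have "\<dots> = ennreal ((sqrt B + local_const \<kappa> * A) * L) * emeasure \<mu> ?R"
    using L0 B_pos A_pos local_const_pos[OF \<kappa>] by (simp add: distrib_right ennreal_plus)
  finally show ?thesis .
qed

text \<open>The number that is subtracted on the ball of radius \<open>r\<close> around \<open>a\<close> is the square function at \<open>a\<close> truncated to
  heights above \<open>r\<close>. Over the ball, the part of the square function below \<open>r\<close> has bounded average, and
  the part above \<open>r\<close> hardly depends on the point. For concentric balls the difference of
  two truncations is the contribution of a layer of the cone, which is the RBMO coefficient. By the
  same comparison, if one truncation is infinite, all are.\<close>

theorem bounded_function_RBMO:
  assumes \<kappa>: "1 < \<kappa>" and [measurable]: "f \<in> borel_measurable borel" and L: "\<And>y. norm (f y) \<le> L"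
  shows "(\<forall>x. conical.sq (T f) x = \<infinity>) \<or>
    ((AE x in \<mu>. conical.sq (T f) x < \<infinity>) \<and>
     (\<forall>a r. set_integrable \<mu> (ball a r) (\<lambda>x. enn2real (conical.sq (T f) x))) \<and>
     RBMO_admissible m \<kappa> \<mu> (\<lambda>x. enn2real (conical.sq (T f) x)) (rbmo_const \<kappa> * L))"
proof -
  have L0: "0 \<le> L" using order_trans[OF norm_ge_zero L] .
  define M where "M = T_const * L"
  have M: "0 \<le> M" using T_const_pos L0 by (simp add: M_def)
  define C where "C = 1 + shift_const + A / (\<kappa> - 1) + A / m + 1 / m"
  have C1: "1 \<le> C" using shift_const_pos A_pos \<kappa> m_pos by (simp add: C_def)
  let ?F = "T f"
  let ?S = "\<lambda>r x. conical.sq (above r ?F) x"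
  let ?J = "\<lambda>a r b R. \<integral>\<^sup>+y\<in>ball b (\<kappa> * R) - ball a r. ennreal (1 / dist y a powr m) \<partial>\<mu>"
  have bound: "norm (?F (y, t)) \<le> M" if "0 < r" "r < t" for r y t
    unfolding M_def using that by (intro T_bounded L) auto
  have same: "?S r x \<le> ?S r a + ennreal (M * C)" if "0 < r" "dist x a \<le> r" for r x a
  proof (rule ennreal_le_add_of_power2_le)
    have "(?S r x)\<^sup>2 \<le> (?S r a)\<^sup>2 + ennreal (M\<^sup>2 * 1 * shift_const)"
      using that M bound by (intro cone_shift) auto
    also have "\<dots> \<le> (?S r a)\<^sup>2 + (ennreal (M * C))\<^sup>2"
    proof -
      have "shift_const \<le> C" using A_pos \<kappa> m_pos by (simp add: C_def)
      also have "C \<le> C\<^sup>2" using C1 by (simp add: power2_eq_square)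
      finally have "M\<^sup>2 * 1 * shift_const \<le> (M * C)\<^sup>2" by (simp add: power_mult_distrib mult_left_mono)
      then show ?thesis using M C1 by (simp add: ennreal_power add_left_mono ennreal_leI)
    qed
    finally show "(?S r x)\<^sup>2 \<le> (?S r a)\<^sup>2 + (ennreal (M * C))\<^sup>2" .
  qed
  have up: "?S r a \<le> ?S R b + ennreal (M * C) * (1 + ?J a r b R)" and down: "?S R b \<le> ?S r a + ennreal (M * C)"
    if sub: "ball a r \<subseteq> ball b R" and r: "0 < r" "0 < R" for a r b R
  proof -
    have ab: "dist a b + r \<le> R" using sub r by (simp add: ball_subset_ball_iff)
    then have ab': "dist a b \<le> R" "r \<le> R" using r zero_le_dist[of a b] by linarith+
    show "?S R b \<le> ?S r a + ennreal (M * C)"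
    proof -
      have "?S R b \<le> ?S R a + ennreal (M * C)" using ab' r by (intro same) (auto simp: dist_commute)
      also have "?S R a \<le> ?S r a" using ab' by (intro conical.sq_mono_AE) (auto simp: above_def)
      finally show ?thesis by simp
    qed
    show "?S r a \<le> ?S R b + ennreal (M * C) * (1 + ?J a r b R)"
    proof (rule ennreal_le_add_of_power2_le)
      let ?j = "?J a r b R"
      let ?c = "ennreal (A / (\<kappa> - 1) + A / m) + ennreal (1 / m) * ?j"
      have "(?S r a)\<^sup>2 \<le> (?S R a)\<^sup>2 + ennreal (M\<^sup>2) * ?c"
        using r \<kappa> ab' M bound[OF r(1)] by (intro cone_layer) auto
      also have "(?S R a)\<^sup>2 \<le> (?S R b)\<^sup>2 + ennreal (M\<^sup>2 * 1 * shift_const)"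
        using r M bound[OF r(2)] ab' by (intro cone_shift) auto
      also have "(?S R b)\<^sup>2 + ennreal (M\<^sup>2 * 1 * shift_const) + ennreal (M\<^sup>2) * ?c
          = (?S R b)\<^sup>2 + ennreal (M\<^sup>2) * (ennreal shift_const + ?c)"
        by (simp add: ennreal_mult' distrib_left add.assoc)
      also have "ennreal shift_const + ?c \<le> (ennreal C * (1 + ?j))\<^sup>2"
      proof -
        have "ennreal shift_const + ?c = ennreal (shift_const + (A / (\<kappa> - 1) + A / m)) + ennreal (1 / m) * ?j"
          using shift_const_pos A_pos \<kappa> m_pos by (simp add: ennreal_plus add.assoc)
        also have "\<dots> \<le> ennreal C + ennreal C * ?j"
          using shift_const_pos A_pos \<kappa> m_pos by (intro add_mono mult_right_mono ennreal_leI) (auto simp: C_def)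
        also have "\<dots> = (ennreal C * (1 + ?j)) * 1" by (simp add: distrib_left)
        also have "\<dots> \<le> (ennreal C * (1 + ?j)) * (ennreal C * (1 + ?j))"
        proof (intro mult_left_mono)
          have "1 * 1 \<le> ennreal C * (1 + ?j)" using C1 by (intro mult_mono) auto
          then show "1 \<le> ennreal C * (1 + ?j)" by simp
        qed simp
        finally show ?thesis by (simp only: power2_eq_square)
      qed
      also have "ennreal (M\<^sup>2) * (ennreal C * (1 + ?j))\<^sup>2 = (ennreal (M * C) * (1 + ?j))\<^sup>2"
        using M by (simp add: ennreal_mult' ennreal_power[symmetric] power_mult_distrib mult.assoc)
      finally show "(?S r a)\<^sup>2 \<le> (?S R b)\<^sup>2 + (ennreal (M * C) * (1 + ?j))\<^sup>2"
        by (simp add: add_left_mono mult_left_mono)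
    qed
  qed
  show ?thesis
  proof (cases "\<forall>a r. 0 < r \<longrightarrow> ?S r a < \<infinity>")
    case False
    then obtain a r where r: "0 < r" and inf: "?S r a = \<infinity>" by (auto simp: not_less top_unique)
    have "conical.sq ?F x = \<infinity>" for x
    proof -
      \<comment> \<open>A ball around \<open>a\<close> that contains the given ball and a unit ball around \<open>x\<close>: an infinite truncation
        at \<open>(a, r)\<close> is lifted to this ball and lowered again to \<open>x\<close>.\<close>
      let ?R = "r + dist a x + 1"
      have R: "0 < ?R" using r by (simp add: add_pos_nonneg)
      have sub: "ball a r \<subseteq> ball a ?R" "ball x 1 \<subseteq> ball a ?R"
        using r by (auto simp: ball_subset_ball_iff dist_commute)
      have "?J a r a ?R \<le> (\<integral>\<^sup>+y. ennreal (1 / r powr m) * indicator (ball a (\<kappa> * ?R)) y \<partial>\<mu>)"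
        using r m_pos by (intro nn_integral_mono) (auto simp: indicator_def dist_commute intro!: ennreal_leI frac_le powr_mono2)
      also have "\<dots> < \<infinity>" by (simp add: nn_integral_cmult_indicator ennreal_mult_less_top emeasure_ball_finite[unfolded infinity_ennreal_def])
      finally have "?J a r a ?R < \<infinity>" .
      then have "?S ?R a = \<infinity>"
        using up[OF sub(1) r R] inf by (auto simp: top_unique ennreal_mult_eq_top_iff)
      then have "?S 1 x = \<infinity>" using down[OF sub(2) _ R] by (auto simp: top_unique)
      moreover have "?S 1 x \<le> conical.sq ?F x" by (rule conical.sq_mono_AE) (simp add: above_def)
      ultimately show ?thesis by (simp add: top_unique)
    qed
    then show ?thesis by blast
  next
    case True
    define avg where "avg a r = enn2real (?S r a)" for a r
    let ?g = "\<lambda>x. enn2real (conical.sq ?F x)"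
    have S_eq: "?S r a = ennreal (avg a r)" if "0 < r" for a r
      using True that by (simp add: avg_def)
    have below_above: "conical.sq ?F x \<le> conical.sq (below r ?F) x + ?S r x" for r x
    proof -
      have "conical.sq ?F x = conical.sq (\<lambda>z. below r ?F z + above r ?F z) x"
        by (rule conical.sq_cong_cone) (simp add: below_def above_def)
      also have "\<dots> \<le> conical.sq (below r ?F) x + ?S r x" by (rule conical.sq_triangle) measurable
      finally show ?thesis .
    qed
    have pointwise: "ennreal \<bar>?g x - avg a r\<bar> \<le> conical.sq (below r ?F) x + ennreal (M * C)"
      if r: "0 < r" and x: "x \<in> ball a r" for a r x
    proof (cases "conical.sq ?F x = \<infinity>")
      case inf: True
      then have "conical.sq (below r ?F) x = \<infinity>"
        using below_above[of x r] S_eq[OF r, of x] by (auto simp: top_unique)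
      then show ?thesis by simp
    next
      case False
      then have g: "ennreal (?g x) = conical.sq ?F x" by (simp add: less_top)
      show ?thesis
      proof (rule ennreal_abs_diff_le)
        have "ennreal (?g x) \<le> conical.sq (below r ?F) x + (?S r a + ennreal (M * C))"
          unfolding g using below_above[of x r] same[OF r, of x a] x
          by (auto simp: dist_commute intro: order_trans add_left_mono)
        then show "ennreal (?g x) \<le> ennreal (avg a r) + (conical.sq (below r ?F) x + ennreal (M * C))"
          by (simp add: S_eq[OF r] add_ac)
        have "ennreal (avg a r) \<le> ?S r x + ennreal (M * C)"
          unfolding S_eq[OF r, symmetric] using same[OF r, of a x] x by simp
        also have "?S r x \<le> conical.sq ?F x" by (rule conical.sq_mono_AE) (simp add: above_def)
        finally have "ennreal (avg a r) \<le> conical.sq ?F x + ennreal (M * C)" by simp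
        also have "\<dots> \<le> conical.sq ?F x + (conical.sq (below r ?F) x + ennreal (M * C))"
          by (intro add_left_mono) (simp add: add_increasing)
        finally show "ennreal (avg a r) \<le> ennreal (?g x) + (conical.sq (below r ?F) x + ennreal (M * C))"
          unfolding g .
      qed (auto simp: avg_def)
    qed
    have osc: "(\<integral>\<^sup>+x\<in>ball a r. ennreal \<bar>?g x - avg a r\<bar> \<partial>\<mu>) \<le> ennreal (rbmo_const \<kappa> * L) * emeasure \<mu> (ball a (\<kappa> * r))"
      if r: "0 < r" for a r
    proof -
      have "(\<integral>\<^sup>+x\<in>ball a r. ennreal \<bar>?g x - avg a r\<bar> \<partial>\<mu>)
          \<le> (\<integral>\<^sup>+x. conical.sq (below r ?F) x * indicator (ball a r) x + ennreal (M * C) * indicator (ball a r) x \<partial>\<mu>)"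
        using pointwise[OF r] by (intro nn_integral_mono) (auto simp: indicator_def)
      also have "\<dots> = (\<integral>\<^sup>+x\<in>ball a r. conical.sq (below r ?F) x \<partial>\<mu>) + ennreal (M * C) * emeasure \<mu> (ball a r)"
        by (subst nn_integral_add) (auto simp: nn_integral_cmult_indicator)
      also have "\<dots> \<le> ennreal ((sqrt B + local_const \<kappa> * A) * L) * emeasure \<mu> (ball a (\<kappa> * r)) + ennreal (M * C) * emeasure \<mu> (ball a (\<kappa> * r))"
        using \<kappa> r L by (intro add_mono local_integral_le mult_left_mono emeasure_mono subset_ball) auto
      also have "\<dots> = ennreal (rbmo_const \<kappa> * L) * emeasure \<mu> (ball a (\<kappa> * r))"
      proof -
        have "0 \<le> (sqrt B + local_const \<kappa> * A) * L" "0 \<le> M * C"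
          using B_pos A_pos local_const_pos[OF \<kappa>] L0 M C1 by auto
        moreover have "(sqrt B + local_const \<kappa> * A) * L + M * C = rbmo_const \<kappa> * L"
          by (simp add: rbmo_const_def M_def C_def algebra_simps)
        ultimately show ?thesis by (simp add: distrib_right[symmetric] ennreal_plus[symmetric] del: ennreal_plus)
      qed
      finally show ?thesis .
    qed
    have MC: "M * C \<le> rbmo_const \<kappa> * L"
      using B_pos A_pos local_const_pos[OF \<kappa>] L0 by (simp add: rbmo_const_def M_def C_def algebra_simps)
    have "RBMO_admissible m \<kappa> \<mu> ?g (rbmo_const \<kappa> * L)"
      unfolding RBMO_admissible_def
    proof (intro conjI exI[of _ avg] allI impI osc)
      show "0 \<le> rbmo_const \<kappa> * L" using MC M C1 by (meson mult_nonneg_nonneg order_trans zero_le_one)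
      fix a b :: 'a and r R :: real assume r: "0 < r" "0 < R" and sub: "ball a r \<subseteq> ball b R"
      let ?j = "?J a r b R"
      have "ennreal \<bar>avg b R - avg a r\<bar> \<le> ennreal (M * C) * (1 + ?j)"
      proof (rule ennreal_abs_diff_le)
        have "ennreal (M * C) * 1 \<le> ennreal (M * C) * (1 + ?j)" by (intro mult_left_mono) auto
        then show "ennreal (avg b R) \<le> ennreal (avg a r) + ennreal (M * C) * (1 + ?j)"
          using down[OF sub r] r by (simp add: S_eq) (meson add_left_mono order_trans)
        show "ennreal (avg a r) \<le> ennreal (avg b R) + ennreal (M * C) * (1 + ?j)"
          using up[OF sub r] r by (simp add: S_eq)
      qed (auto simp: avg_def)
      also have "\<dots> \<le> ennreal (rbmo_const \<kappa> * L) * (1 + ?j)" using MC by (intro mult_right_mono ennreal_leI) auto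
      finally show "ennreal \<bar>avg b R - avg a r\<bar> \<le> ennreal (rbmo_const \<kappa> * L) * (1 + ?j)" .
    qed
    moreover have fin_below: "(\<integral>\<^sup>+x\<in>ball a r. conical.sq (below r ?F) x \<partial>\<mu>) < \<infinity>" if "0 < r" for a r
      using local_integral_le[where f = f and a = a, OF \<kappa> that assms(2) L] emeasure_ball_finite[of a "\<kappa> * r"]
      by (auto simp: ennreal_mult_less_top intro: le_less_trans)
    have "AE x in \<mu>. conical.sq ?F x < \<infinity>"
    proof -
      have "AE x in \<mu>. x \<in> ball 0 (real (Suc n)) \<longrightarrow> conical.sq ?F x < \<infinity>" for n
      proof -
        let ?r = "real (Suc n)"
        have "AE x in \<mu>. conical.sq (below ?r ?F) x * indicator (ball 0 ?r) x \<noteq> \<infinity>"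
          using fin_below[of ?r 0] by (intro nn_integral_PInf_AE) auto
        then show ?thesis
        proof eventually_elim
          case (elim x)
          show ?case
          proof
            assume "x \<in> ball 0 ?r"
            then have "conical.sq (below ?r ?F) x \<noteq> \<infinity>" using elim by simp
            moreover have "?S ?r x < \<infinity>" using True by simp
            ultimately show "conical.sq ?F x < \<infinity>"
              using below_above[of x ?r] by (auto simp: less_top intro: le_less_trans)
          qed
        qed
      qed
      then have "AE x in \<mu>. \<forall>n. x \<in> ball 0 (real (Suc n)) \<longrightarrow> conical.sq ?F x < \<infinity>"
        by (subst AE_all_countable) blast
      then show ?thesis
      proof eventually_elim
        case (elim x)
        obtain n where "norm x < real n" using reals_Archimedean2 by blast
        then have "x \<in> ball 0 (real (Suc n))" by simp
        with elim show ?case by blast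
      qed
    qed
    moreover have "set_integrable \<mu> (ball a r) ?g" for a r
    proof (cases "0 < r")
      case r: True
      show ?thesis
        unfolding set_integrable_def
      proof (rule integrableI_bounded)
        have "(\<integral>\<^sup>+x. ennreal (norm (indicator (ball a r) x *\<^sub>R ?g x)) \<partial>\<mu>)
            \<le> (\<integral>\<^sup>+x. ennreal \<bar>?g x - avg a r\<bar> * indicator (ball a r) x + ennreal (avg a r) * indicator (ball a r) x \<partial>\<mu>)"
        proof (rule nn_integral_mono)
          fix x
          have "0 \<le> avg a r" by (simp add: avg_def)
          then have "ennreal (?g x) \<le> ennreal \<bar>?g x - avg a r\<bar> + ennreal (avg a r)"
            by (simp add: ennreal_plus[symmetric] ennreal_leI del: ennreal_plus)
          then show "ennreal (norm (indicator (ball a r) x *\<^sub>R ?g x))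
            \<le> ennreal \<bar>?g x - avg a r\<bar> * indicator (ball a r) x + ennreal (avg a r) * indicator (ball a r) x"
            by (simp add: indicator_def)
        qed
        also have "\<dots> = (\<integral>\<^sup>+x\<in>ball a r. ennreal \<bar>?g x - avg a r\<bar> \<partial>\<mu>) + ennreal (avg a r) * emeasure \<mu> (ball a r)"
          by (subst nn_integral_add) (auto simp: nn_integral_cmult_indicator)
        also have "\<dots> < \<infinity>"
          using osc[OF r, of a] emeasure_ball_finite[of a "\<kappa> * r"] emeasure_ball_finite[of a r]
          by (auto simp: ennreal_mult_less_top intro: le_less_trans)
        finally show "(\<integral>\<^sup>+x. ennreal (norm (indicator (ball a r) x *\<^sub>R ?g x)) \<partial>\<mu>) < \<infinity>" .
      qed measurable
    next
      case False
      then show ?thesis by (simp add: ball_empty set_integrable_def)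
    qed
    ultimately show ?thesis by blast
  qed
qed

end

section \<open>A maximal function without doubling\<close>

lemma epowr_epowr:
  assumes "0 < a" shows "epowr (epowr x a) b = epowr x (a * b)"
proof (cases x)
  case (real r)
  then show ?thesis by (simp add: epowr_ennreal powr_powr)
qed (simp add: epowr_def)

lemma epowr_one [simp]: "epowr x 1 = x"
proof (cases x)
  case (real r) then show ?thesis by (simp add: epowr_ennreal)
qed (simp add: epowr_def)

lemma epowr_cmult:
  assumes "0 \<le> c" "0 < a" shows "epowr (ennreal c * x) a = ennreal (c powr a) * epowr x a"
proof (cases x)
  case (real r)
  then show ?thesis using assms by (simp add: epowr_ennreal ennreal_mult[symmetric] powr_mult)
next
  case top
  then show ?thesis using assms by (cases "c = 0") (auto simp: epowr_def ennreal_mult_top)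
qed

context growth_measure
begin

text \<open>Dividing by the measure of the dilated ball makes the maximal function of weak type (1,1) for
  every measure: in Vitali's covering lemma the selected balls are dilated by the same factor.\<close>

definition maxfun :: "('a \<Rightarrow> ennreal) \<Rightarrow> 'a \<Rightarrow> ennreal" where
  "maxfun h x = (SUP (y, r)\<in>{(y, r). 0 < r \<and> x \<in> ball y r}. (\<integral>\<^sup>+z\<in>ball y r. h z \<partial>\<mu>) / emeasure \<mu> (ball y (5 * r)))"

lemma integral_le_maxfun:
  assumes "0 < r" "x \<in> ball y r"
  shows "(\<integral>\<^sup>+z\<in>ball y r. h z \<partial>\<mu>) \<le> maxfun h x * emeasure \<mu> (ball y (5 * r))"
proof -
  let ?b = "emeasure \<mu> (ball y (5 * r))" and ?a = "\<integral>\<^sup>+z\<in>ball y r. h z \<partial>\<mu>"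
  have "?a / ?b \<le> maxfun h x"
    unfolding maxfun_def using assms by (intro SUP_upper2[of "(y, r)"]) auto
  then have "?a / ?b * ?b \<le> maxfun h x * ?b" by (rule mult_right_mono) simp
  moreover have "?a / ?b * ?b = ?a"
  proof (cases "?b = 0")
    case True
    have "ball y r \<subseteq> ball y (5 * r)" using assms by (intro subset_ball) simp
    then have "emeasure \<mu> (ball y r) = 0" using True emeasure_mono[of "ball y r" "ball y (5 * r)" \<mu>] by simp
    then have "AE z in \<mu>. h z * indicator (ball y r) z = 0"
      by (intro AE_I[of _ _ "ball y r"]) (auto simp: indicator_def)
    then have "?a = (\<integral>\<^sup>+z. 0 \<partial>\<mu>)" by (rule nn_integral_cong_AE)
    then show ?thesis by simp
  next
    case False
    have "?b < \<infinity>" by (rule emeasure_ball_finite)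
    then show ?thesis using False by (simp add: ennreal_divide_times ennreal_divide_self)
  qed
  ultimately show ?thesis by simp
qed

lemma less_maxfun_iff:
  "c < maxfun h x \<longleftrightarrow> (\<exists>y r. 0 < r \<and> x \<in> ball y r \<and> c < (\<integral>\<^sup>+z\<in>ball y r. h z \<partial>\<mu>) / emeasure \<mu> (ball y (5 * r)))"
  unfolding maxfun_def by (auto simp: less_SUP_iff)

lemma maxfun_measurable [measurable]: "maxfun h \<in> borel_measurable borel"
proof (rule borel_measurableI_greater)
  fix c
  have "{x \<in> space borel. c < maxfun h x} = (\<Union>(y, r)\<in>{(y, r). 0 < r \<and> c < (\<integral>\<^sup>+z\<in>ball y r. h z \<partial>\<mu>) / emeasure \<mu> (ball y (5 * r))}. ball y r)"
    by (auto simp: less_maxfun_iff) blast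
  also have "\<dots> \<in> sets borel" by (intro borel_open open_UN) auto
  finally show "{x \<in> space borel. c < maxfun h x} \<in> sets borel" .
qed

text \<open>Vitali's covering lemma needs bounded radii. The radii are therefore restricted to at most \<open>n\<close>, and \<open>n\<close>
  tends to infinity.\<close>

lemma maxfun_weak_type:
  assumes [measurable]: "h \<in> borel_measurable borel"
  shows "c * emeasure \<mu> {x. c < maxfun h x} \<le> (\<integral>\<^sup>+z. h z \<partial>\<mu>)"
proof -
  define K where "K n = {(y, r). 0 < r \<and> r \<le> real n \<and> c < (\<integral>\<^sup>+z\<in>ball y r. h z \<partial>\<mu>) / emeasure \<mu> (ball y (5 * r))}" for n
  define G where "G n = (\<Union>i\<in>K n. ball (fst i) (snd i))" for n
  have G_meas: "G n \<in> sets borel" for n unfolding G_def by (intro borel_open open_UN) auto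
  have le: "c * emeasure \<mu> (G n) \<le> (\<integral>\<^sup>+z. h z \<partial>\<mu>)" for n
  proof -
    have GK: "G n \<subseteq> (\<Union>i\<in>K n. ball (fst i) (snd i))" by (simp add: G_def)
    have bd: "0 < snd i \<and> snd i \<le> real n" if "i \<in> K n" for i using that by (auto simp: K_def)
    obtain C where C: "countable C" "C \<subseteq> K n"
      "pairwise (\<lambda>i j. disjnt (ball (fst i) (snd i)) (ball (fst j) (snd j))) C"
      "G n \<subseteq> (\<Union>i\<in>C. ball (fst i) (5 * snd i))"
      by (rule Vitali_covering_lemma_balls[OF GK bd]) (assumption, rule that)
    define f where "f j = (if j \<in> to_nat_on C ` C then from_nat_into C j else undefined)" for j
    have ft: "f (to_nat_on C i) = i" if "i \<in> C" for i using that C(1) by (simp add: f_def)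
    define b where "b j = (if j \<in> to_nat_on C ` C then ball (fst (f j)) (snd (f j)) else {})" for j
    define b5 where "b5 j = (if j \<in> to_nat_on C ` C then ball (fst (f j)) (5 * snd (f j)) else {})" for j
    have disj: "disjoint_family b"
      unfolding disjoint_family_on_def
    proof (intro ballI impI)
      fix j l :: nat assume "j \<noteq> l"
      show "b j \<inter> b l = {}"
      proof (cases "j \<in> to_nat_on C ` C \<and> l \<in> to_nat_on C ` C")
        case True
        then obtain i i' where i: "i \<in> C" "i' \<in> C" "j = to_nat_on C i" "l = to_nat_on C i'" by blast
        then have "disjnt (ball (fst i) (snd i)) (ball (fst i') (snd i'))"
          using C(3) \<open>j \<noteq> l\<close> by (auto simp: pairwise_def)
        moreover have "b j = ball (fst i) (snd i)" "b l = ball (fst i') (snd i')"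
          using i ft by (simp_all add: b_def)
        ultimately show ?thesis by (simp add: disjnt_def)
      qed (auto simp: b_def)
    qed
    have step: "c * emeasure \<mu> (b5 j) \<le> emeasure (density \<mu> h) (b j)" for j
    proof (cases "j \<in> to_nat_on C ` C")
      case True
      then obtain i where i: "i \<in> C" "j = to_nat_on C i" by blast
      obtain y r where yr: "i = (y, r)" by (cases i)
      have "0 < r" and c: "c < (\<integral>\<^sup>+z\<in>ball y r. h z \<partial>\<mu>) / emeasure \<mu> (ball y (5 * r))"
        using i C(2) yr by (auto simp: K_def)
      have "c * emeasure \<mu> (ball y (5 * r)) \<le> (\<integral>\<^sup>+z\<in>ball y r. h z \<partial>\<mu>)"
      proof (cases "emeasure \<mu> (ball y (5 * r)) = 0")
        case False
        have "c * emeasure \<mu> (ball y (5 * r)) \<le> (\<integral>\<^sup>+z\<in>ball y r. h z \<partial>\<mu>) / emeasure \<mu> (ball y (5 * r)) * emeasure \<mu> (ball y (5 * r))"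
          using c by (intro mult_right_mono) auto
        also have "\<dots> = (\<integral>\<^sup>+z\<in>ball y r. h z \<partial>\<mu>)"
          using False emeasure_ball_finite[of y "5 * r"] by (simp add: ennreal_divide_times ennreal_divide_self)
        finally show ?thesis .
      qed simp
      then show ?thesis using True i yr ft by (simp add: b5_def b_def emeasure_density)
    qed (simp add: b5_def)
    have b5_UN: "(\<Union>j. b5 j) \<in> sets borel"
      by (rule sets.countable_UN) (auto simp: b5_def)
    have "G n \<subseteq> (\<Union>j. b5 j)"
    proof
      fix x assume "x \<in> G n"
      then obtain i where "i \<in> C" "x \<in> ball (fst i) (5 * snd i)" using C(4) by blast
      then have "x \<in> b5 (to_nat_on C i)" using ft by (simp add: b5_def)
      then show "x \<in> (\<Union>j. b5 j)" by blast
    qed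
    then have "c * emeasure \<mu> (G n) \<le> c * emeasure \<mu> (\<Union>j. b5 j)"       by (intro mult_left_mono emeasure_mono) (simp_all add: b5_UN)
    also have "\<dots> \<le> c * (\<Sum>j. emeasure \<mu> (b5 j))"
      by (intro mult_left_mono emeasure_subadditive_countably) (auto simp: b5_def)
    also have "\<dots> = (\<Sum>j. c * emeasure \<mu> (b5 j))" by simp
    also have "\<dots> \<le> (\<Sum>j. emeasure (density \<mu> h) (b j))" by (intro suminf_le step) auto
    also have "\<dots> = emeasure (density \<mu> h) (\<Union>j. b j)" using disj by (intro suminf_emeasure) (simp add: b_def image_subset_iff, assumption)
    also have "\<dots> \<le> emeasure (density \<mu> h) UNIV" by (intro emeasure_mono) auto
    also have "\<dots> = (\<integral>\<^sup>+z. h z \<partial>\<mu>)" by (subst emeasure_density) auto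
    finally show ?thesis .
  qed
  have "{x. c < maxfun h x} = (\<Union>n. G n)"
  proof (intro equalityI subsetI)
    fix x assume "x \<in> {x. c < maxfun h x}"
    then obtain y r where yr: "0 < r" "x \<in> ball y r" "c < (\<integral>\<^sup>+z\<in>ball y r. h z \<partial>\<mu>) / emeasure \<mu> (ball y (5 * r))"
      by (auto simp: less_maxfun_iff)
    obtain n where "r \<le> real n" using real_arch_simple by blast
    then have "(y, r) \<in> K n" using yr by (simp add: K_def)
    then show "x \<in> (\<Union>n. G n)" using yr by (force simp: G_def)
  qed (auto simp: G_def K_def less_maxfun_iff)
  moreover have "incseq G"
    unfolding incseq_def G_def by (intro allI impI UN_mono) (auto simp: K_def)
  ultimately have "c * emeasure \<mu> {x. c < maxfun h x} = c * (SUP n. emeasure \<mu> (G n))"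
    using G_meas SUP_emeasure_incseq[of G \<mu>] by (simp add: image_subset_iff)
  also have "\<dots> = (SUP n. c * emeasure \<mu> (G n))" by (simp add: SUP_mult_left_ennreal)
  also have "\<dots> \<le> (\<integral>\<^sup>+z. h z \<partial>\<mu>)" by (intro SUP_least le)
  finally show ?thesis .
qed

lemma maxfun_truncation_le:
  assumes [measurable]: "h \<in> borel_measurable borel"
  shows "maxfun h x \<le> maxfun (\<lambda>z. h z * indicator {z. t < h z} z) x + t"
  unfolding maxfun_def[of h]
proof (rule SUP_least, clarify)
  fix y r assume r: "0 < r" "x \<in> ball y r"
  let ?h = "\<lambda>z. h z * indicator {z. t < h z} z"
  let ?b = "emeasure \<mu> (ball y (5 * r))"
  have "(\<integral>\<^sup>+z\<in>ball y r. h z \<partial>\<mu>) \<le> (\<integral>\<^sup>+z. ?h z * indicator (ball y r) z + t * indicator (ball y r) z \<partial>\<mu>)"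
    by (intro nn_integral_mono) (auto simp: indicator_def)
  also have "\<dots> = (\<integral>\<^sup>+z\<in>ball y r. ?h z \<partial>\<mu>) + t * emeasure \<mu> (ball y r)"
    by (subst nn_integral_add) (auto simp: nn_integral_cmult_indicator)
  also have "\<dots> \<le> (\<integral>\<^sup>+z\<in>ball y r. ?h z \<partial>\<mu>) + t * ?b"
    using r by (intro add_left_mono mult_left_mono emeasure_mono subset_ball) auto
  finally have "(\<integral>\<^sup>+z\<in>ball y r. h z \<partial>\<mu>) / ?b \<le> ((\<integral>\<^sup>+z\<in>ball y r. ?h z \<partial>\<mu>) + t * ?b) / ?b"
    by (rule divide_right_mono_ennreal)
  also have "\<dots> = (\<integral>\<^sup>+z\<in>ball y r. ?h z \<partial>\<mu>) / ?b + t * (?b / ?b)"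
    by (simp add: add_divide_distrib_ennreal ennreal_times_divide)
  also have "?b / ?b \<le> 1"
    using emeasure_ball_finite[of y "5 * r"] by (cases "?b = 0") (auto simp: ennreal_divide_self)
  also have "(\<integral>\<^sup>+z\<in>ball y r. ?h z \<partial>\<mu>) / ?b \<le> maxfun ?h x"
    unfolding maxfun_def using r by (intro SUP_upper2[of "(y, r)"]) auto
  finally show "(\<integral>\<^sup>+z\<in>ball y r. h z \<partial>\<mu>) / ?b \<le> maxfun ?h x + t"
    by (simp add: add_mono mult_left_mono)
qed

text \<open>Interpolation between the weak type and the trivial bound by the supremum: at level \<open>t\<close> only the part of
  \<open>h\<close> above \<open>t / 2\<close> matters.\<close>

lemma maxfun_strong_type:
  assumes q: "1 < q" and [measurable]: "h \<in> borel_measurable borel" and nonneg: "\<And>z. 0 \<le> h z"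
  shows "(\<integral>\<^sup>+x. epowr (maxfun (\<lambda>z. ennreal (h z)) x) q \<partial>\<mu>)
    \<le> ennreal (2 powr q * (q / (q - 1))) * (\<integral>\<^sup>+z. ennreal (h z powr q) \<partial>\<mu>)"
proof -
  let ?M = "maxfun (\<lambda>z. ennreal (h z))"
  let ?u = "\<lambda>x. ennreal (1 / 2) * ?M x"
  let ?U = "\<lambda>t. \<integral>\<^sup>+x. ennreal (h x) * indicator {x. t < h x} x \<partial>\<mu>"
  have M2: "?M x = ennreal 2 * ?u x" for x by (simp only: mult.assoc[symmetric] ennreal_mult'[symmetric]) simp
  have level: "ennreal t * emeasure \<mu> {x. ennreal t < ?u x} \<le> ?U t" if t: "0 < t" for t
  proof -
    let ?h = "\<lambda>z. ennreal (h z) * indicator {z. ennreal t < ennreal (h z)} z"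
    have "{x. ennreal t < ?u x} \<subseteq> {x. ennreal t < maxfun ?h x}"
    proof
      fix x assume x: "x \<in> {x. ennreal t < ?u x}"
      show "x \<in> {x. ennreal t < maxfun ?h x}"
      proof (rule ccontr)
        assume "\<not> ?thesis"
        then have "?M x \<le> ennreal t + ennreal t"
          using maxfun_truncation_le[of "\<lambda>z. ennreal (h z)" x "ennreal t"] by (auto simp: not_less intro: order_trans add_mono)
        also have "\<dots> = ennreal (2 * t)" using t by (simp add: ennreal_plus[symmetric] del: ennreal_plus)
        finally have "?u x \<le> ennreal (1 / 2) * ennreal (2 * t)" by (rule mult_left_mono) simp
        also have "\<dots> = ennreal t" by (subst ennreal_mult'[symmetric]) auto
        finally show False using x by simp
      qed
    qed
    then have "ennreal t * emeasure \<mu> {x. ennreal t < ?u x} \<le> ennreal t * emeasure \<mu> {x. ennreal t < maxfun ?h x}"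
      by (intro mult_left_mono emeasure_mono) auto
    also have "\<dots> \<le> (\<integral>\<^sup>+z. ?h z \<partial>\<mu>)" by (rule maxfun_weak_type) measurable
    also have "\<dots> = ?U t" using t by (intro nn_integral_cong) (auto simp: indicator_def ennreal_less_iff)
    finally show ?thesis .
  qed
  have "(\<integral>\<^sup>+x. epowr (?u x) q \<partial>\<mu>) = (\<integral>\<^sup>+t\<in>{0<..}. ennreal (q * t powr (q - 1)) * emeasure \<mu> {x. ennreal t < ?u x} \<partial>lborel)"
    using q nn_integral_epowr_eq[of q ?u] by simp
  also have "\<dots> \<le> (\<integral>\<^sup>+t. ennreal q * (ennreal (t powr (q - 2)) * ?U t * indicator {0<..} t) \<partial>lborel)"
  proof (rule nn_integral_mono)
    fix t :: real
    show "ennreal (q * t powr (q - 1)) * emeasure \<mu> {x. ennreal t < ?u x} * indicator {0<..} t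
      \<le> ennreal q * (ennreal (t powr (q - 2)) * ?U t * indicator {0<..} t)"
    proof (cases "0 < t")
      case True
      have "q * t powr (q - 1) = q * t powr (q - 2) * t" using True by (simp add: powr_diff power2_eq_square)
      then have "ennreal (q * t powr (q - 1)) * emeasure \<mu> {x. ennreal t < ?u x}
        = ennreal (q * t powr (q - 2)) * (ennreal t * emeasure \<mu> {x. ennreal t < ?u x})"
        using q by (simp add: ennreal_mult' mult.assoc)
      also have "\<dots> \<le> ennreal (q * t powr (q - 2)) * ?U t" by (intro mult_left_mono level True) simp
      finally show ?thesis using True q by (simp add: ennreal_mult' mult.assoc)
    qed simp
  qed
  also have "\<dots> = ennreal q * (\<integral>\<^sup>+t\<in>{0<..}. ennreal (t powr (q - 2)) * ?U t \<partial>lborel)"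
  proof (rule nn_integral_cmult)
    have "(\<lambda>(t, x). ennreal (h x) * indicator {x. t < h x} x) \<in> borel_measurable (borel \<Otimes>\<^sub>M \<mu>)"
      unfolding indicator_def mem_Collect_eq by measurable
    from borel_measurable_nn_integral[OF this] have [measurable]: "?U \<in> borel_measurable borel" by simp
    show "(\<lambda>t. ennreal (t powr (q - 2)) * ?U t * indicator {0<..} t) \<in> borel_measurable lborel" by measurable
  qed
  also have "\<dots> = ennreal q * (ennreal (1 / (q - 1)) * (\<integral>\<^sup>+z. ennreal (h z powr q) \<partial>\<mu>))"
    using nn_integral_upper_truncations[of q h] q nonneg by simp
  also have "\<dots> = ennreal (q / (q - 1)) * (\<integral>\<^sup>+z. ennreal (h z powr q) \<partial>\<mu>)"
    using q by (simp add: mult.assoc[symmetric] ennreal_mult'[symmetric])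
  finally have u: "(\<integral>\<^sup>+x. epowr (?u x) q \<partial>\<mu>) \<le> ennreal (q / (q - 1)) * (\<integral>\<^sup>+z. ennreal (h z powr q) \<partial>\<mu>)" .
  have "(\<integral>\<^sup>+x. epowr (?M x) q \<partial>\<mu>) = (\<integral>\<^sup>+x. ennreal (2 powr q) * epowr (?u x) q \<partial>\<mu>)"
    using q by (subst M2, subst epowr_cmult) auto
  also have "\<dots> = ennreal (2 powr q) * (\<integral>\<^sup>+x. epowr (?u x) q \<partial>\<mu>)" by (rule nn_integral_cmult) measurable
  also have "\<dots> \<le> ennreal (2 powr q) * (ennreal (q / (q - 1)) * (\<integral>\<^sup>+z. ennreal (h z powr q) \<partial>\<mu>))"
    by (intro mult_left_mono u) simp
  finally show ?thesis by (simp add: mult.assoc[symmetric] ennreal_mult'[symmetric])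
qed

end

section \<open>The good lambda inequality\<close>

context standard_kernel
begin

text \<open>The cones are open, so that \<open>conical.sq F\<close> is lower semicontinuous by Fatou's lemma.\<close>

lemma open_superlevel_conical:
  assumes [measurable]: "F \<in> borel_measurable borel"
  shows "open {x. c < conical.sq F x}"
proof -
  let ?w = "\<lambda>z :: 'a \<times> real. ennreal (1 / snd z powr (m + 1)) * (ennreal (norm (F z)))\<^sup>2"
  have eq: "(conical.sq F x)\<^sup>2 = (\<integral>\<^sup>+z. indicator (cone_over x) z * ?w z \<partial>(\<mu> \<Otimes>\<^sub>M lborel))" for x
    by (simp add: conical_sq_power2 mult.assoc)
  have "closed {x. conical.sq F x \<le> c}"
    unfolding closed_sequential_limits
  proof (intro allI impI)
    fix X l assume X: "(\<forall>n. X n \<in> {x. conical.sq F x \<le> c}) \<and> X \<longlonglongrightarrow> l"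
    have "(conical.sq F l)\<^sup>2 \<le> (\<integral>\<^sup>+z. liminf (\<lambda>n. indicator (cone_over (X n)) z * ?w z) \<partial>(\<mu> \<Otimes>\<^sub>M lborel))"
      unfolding eq
    proof (rule nn_integral_mono)
      fix z :: "'a \<times> real"
      show "indicator (cone_over l) z * ?w z \<le> liminf (\<lambda>n. indicator (cone_over (X n)) z * ?w z)"
      proof (cases "z \<in> cone_over l")
        case True
        have "(\<lambda>n. dist (X n) (fst z)) \<longlonglongrightarrow> dist l (fst z)" using X by (intro tendsto_intros) auto
        then have "\<forall>\<^sub>F n in sequentially. dist (X n) (fst z) < snd z"
          using True by (intro order_tendstoD) (auto simp: mem_cone_over_iff)
        then have "\<forall>\<^sub>F n in sequentially. ?w z \<le> indicator (cone_over (X n)) z * ?w z"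
          by eventually_elim (use True in \<open>auto simp: mem_cone_over_iff\<close>)
        then have "?w z \<le> liminf (\<lambda>n. indicator (cone_over (X n)) z * ?w z)" by (rule Liminf_bounded)
        then show ?thesis using True by simp
      qed simp
    qed
    also have "\<dots> \<le> liminf (\<lambda>n. \<integral>\<^sup>+z. indicator (cone_over (X n)) z * ?w z \<partial>(\<mu> \<Otimes>\<^sub>M lborel))"
      by (rule nn_integral_liminf) simp
    also have "\<dots> \<le> c\<^sup>2"
      unfolding eq[symmetric]
    proof (rule Liminf_le)
      show "\<forall>\<^sub>F n in sequentially. (conical.sq F (X n))\<^sup>2 \<le> c\<^sup>2"
        using X by (intro always_eventually) (auto simp: ennreal_power2_le_iff)
    qed simp
    finally show "l \<in> {x. conical.sq F x \<le> c}" by (simp add: ennreal_power2_le_iff)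
  qed
  then have "open (- {x. conical.sq F x \<le> c})" by (rule open_Compl)
  then show ?thesis by (simp add: Collect_neg_eq[symmetric] not_le)
qed

text \<open>A point where the maximal function of \<open>|f|\<^sup>2\<close> is at most \<open>G\<^sup>2\<close> controls the averages of \<open>|f|\<close> over
  all balls that contain it, by the Cauchy--Schwarz inequality.\<close>

lemma average_le_of_maxfun:
  assumes [measurable]: "f \<in> borel_measurable borel" and G: "0 \<le> G"
    and x: "maxfun (\<lambda>z. (ennreal (norm (f z)))\<^sup>2) x \<le> ennreal (G\<^sup>2)" and u: "0 < u" "dist x y < u"
  shows "(\<integral>\<^sup>+z\<in>ball y u. ennreal (norm (f z)) \<partial>\<mu>) \<le> ennreal (G * A * 5 powr m * u powr m)"
proof -
  have "(\<integral>\<^sup>+z\<in>ball y u. ennreal (norm (f z)) \<partial>\<mu>)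
      = (\<integral>\<^sup>+z. (ennreal (norm (f z)) * indicator (ball y u) z) * indicator (ball y u) z \<partial>\<mu>)"
    by (intro nn_integral_cong) (auto simp: indicator_def)
  then have "(\<integral>\<^sup>+z\<in>ball y u. ennreal (norm (f z)) \<partial>\<mu>)\<^sup>2
     = (\<integral>\<^sup>+z. (ennreal (norm (f z)) * indicator (ball y u) z) * indicator (ball y u) z \<partial>\<mu>)\<^sup>2" by simp
  also have "\<dots> \<le> (\<integral>\<^sup>+z. (ennreal (norm (f z)) * indicator (ball y u) z)\<^sup>2 \<partial>\<mu>) * (\<integral>\<^sup>+z. (indicator (ball y u) z)\<^sup>2 \<partial>\<mu>)"
    by (intro Cauchy_Schwarz_nn_integral) (auto intro!: borel_measurable_indicator borel_measurable_times_ennreal)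
  also have "(\<integral>\<^sup>+z. (ennreal (norm (f z)) * indicator (ball y u) z)\<^sup>2 \<partial>\<mu>) = (\<integral>\<^sup>+z\<in>ball y u. (ennreal (norm (f z)))\<^sup>2 \<partial>\<mu>)"
    by (intro nn_integral_cong) (auto simp: indicator_def power2_eq_square)
  also have "(\<integral>\<^sup>+z. (indicator (ball y u) z)\<^sup>2 \<partial>\<mu>) = (\<integral>\<^sup>+z. indicator (ball y u) z \<partial>\<mu>)"
    by (intro nn_integral_cong) (auto simp: indicator_def)
  also have "\<dots> = emeasure \<mu> (ball y u)" by simp
  also have "(\<integral>\<^sup>+z\<in>ball y u. (ennreal (norm (f z)))\<^sup>2 \<partial>\<mu>) * emeasure \<mu> (ball y u)
      \<le> (ennreal (G\<^sup>2) * ennreal (A * (5 * u) powr m)) * ennreal (A * (5 * u) powr m)"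
  proof (intro mult_mono)
    have "(\<integral>\<^sup>+z\<in>ball y u. (ennreal (norm (f z)))\<^sup>2 \<partial>\<mu>) \<le> maxfun (\<lambda>z. (ennreal (norm (f z)))\<^sup>2) x * emeasure \<mu> (ball y (5 * u))"
      using u by (intro integral_le_maxfun) (auto simp: dist_commute)
    also have "\<dots> \<le> ennreal (G\<^sup>2) * ennreal (A * (5 * u) powr m)" using u x by (intro mult_mono growth) auto
    finally show "(\<integral>\<^sup>+z\<in>ball y u. (ennreal (norm (f z)))\<^sup>2 \<partial>\<mu>) \<le> ennreal (G\<^sup>2) * ennreal (A * (5 * u) powr m)" .
    have "emeasure \<mu> (ball y u) \<le> emeasure \<mu> (ball y (5 * u))" using u by (intro emeasure_mono subset_ball) auto
    also have "\<dots> \<le> ennreal (A * (5 * u) powr m)" using u by (intro growth) simp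
    finally show "emeasure \<mu> (ball y u) \<le> ennreal (A * (5 * u) powr m)" .
  qed auto
  also have "\<dots> = (ennreal (G * A * 5 powr m * u powr m))\<^sup>2"
    using G A_pos u by (simp add: ennreal_mult'[symmetric] ennreal_power power2_eq_square powr_mult mult_ac)
  finally show ?thesis by (simp only: ennreal_power2_le_iff)
qed

text \<open>A continuous Whitney covering: every point of \<open>U\<close> is averaged over the Lebesgue measure of a
  ball whose radius is comparable to the distance \<open>d\<close> from the complement of \<open>\<Omega>\<close>. By the Lipschitz
  property of \<open>d\<close> the radii of neighbouring balls are comparable, so that Tonelli's theorem replaces
  the bounded overlap of Whitney balls.\<close>

lemma whitney_integral_le:
  fixes d :: "'a \<Rightarrow> real"
  assumes [measurable]: "h \<in> borel_measurable borel" and "U \<in> sets borel"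
    and lip: "\<And>x y. d x \<le> d y + dist x y" and dpos: "\<And>x. 0 < d x \<longleftrightarrow> x \<in> \<Omega>" and \<Omega>: "open \<Omega>"
    and U: "\<And>z. z \<in> U \<Longrightarrow> \<exists>x\<in>E. dist x z < 2 * (d x / 100)" and E: "E \<subseteq> \<Omega>"
    and max: "\<And>x. x \<in> E \<Longrightarrow> maxfun h x \<le> c"
  shows "(\<integral>\<^sup>+z\<in>U. h z \<partial>\<mu>) \<le> ennreal (400 ^ DIM('a)) * (c * emeasure \<mu> \<Omega>)"
proof -
  let ?n = "DIM('a)"
  note [measurable] = \<open>U \<in> sets borel\<close>
  define v where "v = unit_ball_vol (real ?n)"
  have v: "0 < v" unfolding v_def by (rule unit_ball_vol_pos) simp
  have "lipschitz_on 1 UNIV d"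
  proof (rule lipschitz_onI)
    fix x y
    show "dist (d x) (d y) \<le> 1 * dist x y"
      using lip[of x y] lip[of y x] by (simp add: dist_real_def abs_le_iff dist_commute)
  qed simp
  then have d_cont: "continuous_on UNIV d" by (rule lipschitz_on_continuous_on)
  then have [measurable]: "d \<in> borel_measurable borel" by (rule borel_measurable_continuous_onI)
  have [measurable]: "\<Omega> \<in> sets borel" using \<Omega> by simp
  have vol: "emeasure lborel (ball (x :: 'a) r) = ennreal (v * r ^ ?n)" if "0 \<le> r" for x r
    using that by (simp add: emeasure_ball v_def)
  have UO: "0 < d z" if z: "z \<in> U" for z
  proof -
    obtain x where x: "x \<in> E" "dist x z < 2 * (d x / 100)" using U[OF z] by blast
    then have "0 < d x" using E dpos by blast
    then show ?thesis using x lip[of x z] by simp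
  qed
  interpret P: pair_sigma_finite \<mu> "lborel :: 'a measure" by standard
  \<comment> \<open>The uniform density on the ball of radius \<open>d z / 100\<close> around \<open>z\<close> with respect to Lebesgue measure.\<close>
  let ?k = "\<lambda>z w. ennreal (1 / (v * (d z / 100) ^ ?n)) * (if dist z w < d z / 100 then 1 else 0)"
  have one: "(\<integral>\<^sup>+w. ?k z w \<partial>lborel) = 1" if "z \<in> U" for z
  proof -
    have "(\<integral>\<^sup>+w. ?k z w \<partial>lborel) = (\<integral>\<^sup>+w. ennreal (1 / (v * (d z / 100) ^ ?n)) * indicator (ball z (d z / 100)) w \<partial>lborel)"
      by (intro nn_integral_cong) (auto simp: indicator_def)
    also have "\<dots> = ennreal (1 / (v * (d z / 100) ^ ?n)) * ennreal (v * (d z / 100) ^ ?n)"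
      using UO[OF that] by (simp add: nn_integral_cmult_indicator vol del: ennreal_mult)
    also have "\<dots> = 1" using v UO[OF that] by (subst ennreal_mult[symmetric]) auto
    finally show ?thesis .
  qed
  have "(\<integral>\<^sup>+z\<in>U. h z \<partial>\<mu>) = (\<integral>\<^sup>+z. (\<integral>\<^sup>+w. h z * indicator U z * ?k z w \<partial>lborel) \<partial>\<mu>)"
    using one by (intro nn_integral_cong) (subst nn_integral_cmult, auto simp: indicator_def)
  also have "\<dots> = (\<integral>\<^sup>+w. (\<integral>\<^sup>+z. h z * indicator U z * ?k z w \<partial>\<mu>) \<partial>lborel)"
    by (rule P.Fubini'[symmetric]) measurable
  also have "\<dots> \<le> (\<integral>\<^sup>+w. (\<integral>\<^sup>+x. c * ennreal (200 ^ ?n / v) * (ennreal (1 / d w ^ ?n) * (if 0 < d w \<and> dist w x < d w / 2 then 1 else 0)) \<partial>\<mu>) \<partial>lborel)"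
  proof (rule nn_integral_mono)
    fix w :: 'a
    have rhs: "(\<integral>\<^sup>+x. c * ennreal (200 ^ ?n / v) * (ennreal (1 / d w ^ ?n) * (if 0 < d w \<and> dist w x < d w / 2 then 1 else 0)) \<partial>\<mu>)
        = c * ennreal (200 ^ ?n / v) * ennreal (1 / d w ^ ?n) * emeasure \<mu> (ball w (d w / 2))" if "0 < d w"
    proof -
      have "(\<integral>\<^sup>+x. c * ennreal (200 ^ ?n / v) * (ennreal (1 / d w ^ ?n) * (if 0 < d w \<and> dist w x < d w / 2 then 1 else 0)) \<partial>\<mu>)
        = (\<integral>\<^sup>+x. c * ennreal (200 ^ ?n / v) * ennreal (1 / d w ^ ?n) * indicator (ball w (d w / 2)) x \<partial>\<mu>)"
        using that by (intro nn_integral_cong) (auto simp: indicator_def)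
      then show ?thesis by (simp add: nn_integral_cmult_indicator)
    qed
    show "(\<integral>\<^sup>+z. h z * indicator U z * ?k z w \<partial>\<mu>)
      \<le> (\<integral>\<^sup>+x. c * ennreal (200 ^ ?n / v) * (ennreal (1 / d w ^ ?n) * (if 0 < d w \<and> dist w x < d w / 2 then 1 else 0)) \<partial>\<mu>)"
    proof (cases "\<exists>z\<in>U. dist z w < d z / 100")
      case True
      then obtain z where z: "z \<in> U" "dist z w < d z / 100" by blast
      obtain x where x: "x \<in> E" "dist x z < 2 * (d x / 100)" using U[OF z(1)] by blast
      have dz: "0 < d z" by (rule UO[OF z(1)])
      have dxz: "d x \<le> 2 * d z" using lip[of x z] x dz by simp
      have dzw: "d z \<le> 2 * d w" using lip[of z w] z dz by simp
      have dw: "0 < d w" using dz dzw by simp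
      \<comment> \<open>All points of \<open>U\<close> that are averaged at \<open>w\<close>, and a point \<open>x\<close> of \<open>E\<close>, lie in the ball of this radius
        around \<open>w\<close>; dilated by five, as in the maximal function, it is still well inside \<open>\<Omega>\<close>.\<close>
      let ?r = "d w / 10"
      have "dist w x < ?r"
        using dist_triangle[of w x z] z x dxz dzw by (simp add: dist_commute)
      have "(\<integral>\<^sup>+z. h z * indicator U z * ?k z w \<partial>\<mu>) \<le> (\<integral>\<^sup>+z. ennreal (200 ^ ?n / v * (1 / d w ^ ?n)) * (h z * indicator (ball w ?r) z) \<partial>\<mu>)"
      proof (rule nn_integral_mono)
        fix z'
        show "h z' * indicator U z' * ?k z' w \<le> ennreal (200 ^ ?n / v * (1 / d w ^ ?n)) * (h z' * indicator (ball w ?r) z')"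
        proof (cases "z' \<in> U \<and> dist z' w < d z' / 100")
          case True
          have d': "0 < d z'" using UO True by blast
          have le: "d z' \<le> 2 * d w" "d w \<le> 2 * d z'"
            using lip[of z' w] lip[of w z'] True d' by (simp_all add: dist_commute)
          have "dist w z' < ?r" using True le dw by (simp add: dist_commute)
          have "1 / (v * (d z' / 100) ^ ?n) = 100 ^ ?n / v * (1 / d z' ^ ?n)" by (simp add: power_divide)
          also have "\<dots> \<le> 100 ^ ?n / v * (2 ^ ?n / d w ^ ?n)"
          proof (intro mult_left_mono)
            have "d w ^ ?n \<le> (2 * d z') ^ ?n" using le dw by (intro power_mono) auto
            then show "1 / d z' ^ ?n \<le> 2 ^ ?n / d w ^ ?n" using d' dw by (simp add: field_simps)
          qed (use v in simp)
          also have "\<dots> = 200 ^ ?n / v * (1 / d w ^ ?n)"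
            using power_mult_distrib[of "100::real" 2 ?n] by simp
          finally have "?k z' w \<le> ennreal (200 ^ ?n / v * (1 / d w ^ ?n))" using True by (simp add: ennreal_leI)
          then have "h z' * ?k z' w \<le> h z' * ennreal (200 ^ ?n / v * (1 / d w ^ ?n))" by (rule mult_left_mono) simp
          then show ?thesis using True \<open>dist w z' < ?r\<close> by (simp add: mult.commute)
        qed auto
      qed
      also have "\<dots> = ennreal (200 ^ ?n / v * (1 / d w ^ ?n)) * (\<integral>\<^sup>+z\<in>ball w ?r. h z \<partial>\<mu>)"
        by (rule nn_integral_cmult) measurable
      also have "\<dots> \<le> ennreal (200 ^ ?n / v * (1 / d w ^ ?n)) * (c * emeasure \<mu> (ball w (d w / 2)))"
      proof (intro mult_left_mono)
        have "(\<integral>\<^sup>+z\<in>ball w ?r. h z \<partial>\<mu>) \<le> maxfun h x * emeasure \<mu> (ball w (5 * ?r))"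
          using \<open>dist w x < ?r\<close> dw by (intro integral_le_maxfun) auto
        also have "\<dots> \<le> c * emeasure \<mu> (ball w (d w / 2))" using max[OF x(1)] by (intro mult_mono) auto
        finally show "(\<integral>\<^sup>+z\<in>ball w ?r. h z \<partial>\<mu>) \<le> c * emeasure \<mu> (ball w (d w / 2))" .
      qed simp
      also have "ennreal (200 ^ ?n / v * (1 / d w ^ ?n)) = ennreal (200 ^ ?n / v) * ennreal (1 / d w ^ ?n)"
        using v by (intro ennreal_mult') simp
      finally show ?thesis unfolding rhs[OF dw] by (simp add: mult_ac)
    next
      case False
      then have "(\<integral>\<^sup>+z. h z * indicator U z * ?k z w \<partial>\<mu>) = (\<integral>\<^sup>+z. 0 \<partial>\<mu>)"
        by (intro nn_integral_cong) (auto simp: indicator_def)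
      then show ?thesis by simp
    qed
  qed
  also have "\<dots> = (\<integral>\<^sup>+x. (\<integral>\<^sup>+w. c * ennreal (200 ^ ?n / v) * (ennreal (1 / d w ^ ?n) * (if 0 < d w \<and> dist w x < d w / 2 then 1 else 0)) \<partial>lborel) \<partial>\<mu>)"
    by (rule P.Fubini') measurable
  also have "\<dots> \<le> (\<integral>\<^sup>+x. c * ennreal (400 ^ ?n) * indicator \<Omega> x \<partial>\<mu>)"
  proof (rule nn_integral_mono)
    fix x
    show "(\<integral>\<^sup>+w. c * ennreal (200 ^ ?n / v) * (ennreal (1 / d w ^ ?n) * (if 0 < d w \<and> dist w x < d w / 2 then 1 else 0)) \<partial>lborel)
      \<le> c * ennreal (400 ^ ?n) * indicator \<Omega> x"
    proof (cases "0 < d x")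
      case True
      have "(\<integral>\<^sup>+w. c * ennreal (200 ^ ?n / v) * (ennreal (1 / d w ^ ?n) * (if 0 < d w \<and> dist w x < d w / 2 then 1 else 0)) \<partial>lborel)
        \<le> (\<integral>\<^sup>+w. c * ennreal (200 ^ ?n / v) * ennreal (2 ^ ?n / d x ^ ?n) * indicator (ball x (d x)) w \<partial>lborel)"
      proof (rule nn_integral_mono)
        fix w
        show "c * ennreal (200 ^ ?n / v) * (ennreal (1 / d w ^ ?n) * (if 0 < d w \<and> dist w x < d w / 2 then 1 else 0))
          \<le> c * ennreal (200 ^ ?n / v) * ennreal (2 ^ ?n / d x ^ ?n) * indicator (ball x (d x)) w"
        proof (cases "0 < d w \<and> dist w x < d w / 2")
          case w: True
          have "d w \<le> 2 * d x" "d x \<le> 2 * d w" using lip[of x w] lip[of w x] w by (simp_all add: dist_commute)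
          have "d x ^ ?n \<le> (2 * d w) ^ ?n" using \<open>d x \<le> 2 * d w\<close> True by (intro power_mono) auto
          then have "1 / d w ^ ?n \<le> 2 ^ ?n / d x ^ ?n" using w True by (simp add: field_simps)
          moreover have "dist x w < d x" using w \<open>d w \<le> 2 * d x\<close> by (simp add: dist_commute)
          ultimately show ?thesis using w by (simp add: mult_left_mono ennreal_leI)
        qed auto
      qed
      also have "\<dots> = c * (ennreal (200 ^ ?n / v) * (ennreal (2 ^ ?n / d x ^ ?n) * ennreal (v * d x ^ ?n)))"
        using True by (subst nn_integral_cmult_indicator) (simp_all add: vol mult.assoc)
      also have "ennreal (200 ^ ?n / v) * (ennreal (2 ^ ?n / d x ^ ?n) * ennreal (v * d x ^ ?n)) = ennreal (400 ^ ?n)"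
      proof -
        have nn: "0 \<le> 200 ^ ?n / v" "0 \<le> 2 ^ ?n / d x ^ ?n" using v True by auto
        have "200 ^ ?n / v * (2 ^ ?n / d x ^ ?n * (v * d x ^ ?n)) = 400 ^ ?n"
          using v True power_mult_distrib[of "200::real" 2 ?n] by simp
        then show ?thesis by (simp only: ennreal_mult'[OF nn(1), symmetric] ennreal_mult'[OF nn(2), symmetric])
      qed
      finally show ?thesis using True dpos by simp
    next
      case False
      have e: "(if 0 < d w \<and> dist w x < d w / 2 then 1 else 0) = (0 :: ennreal)" for w
        using lip[of w x] False by auto
      show ?thesis unfolding e by simp
    qed
  qed
  also have "\<dots> = c * ennreal (400 ^ ?n) * emeasure \<mu> \<Omega>" by (rule nn_integral_cmult_indicator) simp
  finally show ?thesis by (simp add: mult_ac)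
qed

end

lemma epowr_liminf:
  assumes "0 < q"
  shows "epowr (liminf a) q \<le> liminf (\<lambda>n. epowr (a n) q)"
proof (rule ccontr)
  assume "\<not> ?thesis"
  let ?L = "liminf (\<lambda>n. epowr (a n) q)"
  let ?c = "epowr ?L (1 / q)"
  have inv: "epowr (epowr x q) (1 / q) = x" "epowr (epowr x (1 / q)) q = x" for x
    using assms by (simp_all add: epowr_epowr)
  have "?c < liminf a"
  proof (rule ccontr)
    assume "\<not> ?c < liminf a"
    then have "epowr (liminf a) q \<le> epowr ?c q" using assms by (intro epowr_mono) auto
    then show False using \<open>\<not> epowr (liminf a) q \<le> ?L\<close> by (simp add: inv)
  qed
  then obtain c' where c': "?c < c'" "c' < liminf a" using dense by blast
  have "\<forall>\<^sub>F n in sequentially. c' < a n" using c'(2) by (rule less_LiminfD)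
  then have "\<forall>\<^sub>F n in sequentially. epowr c' q \<le> epowr (a n) q"
    by eventually_elim (use assms in \<open>auto intro: epowr_mono\<close>)
  then have "epowr c' q \<le> ?L" by (rule Liminf_bounded)
  then have "epowr (epowr c' q) (1 / q) \<le> ?c" using assms by (intro epowr_mono) auto
  then show False using c'(1) by (simp add: inv)
qed

lemma epowr_power2: "epowr (x\<^sup>2) a = epowr x (2 * a)"
  by (simp add: epowr_two[symmetric] epowr_epowr)

lemma ennreal_absorb_half:
  assumes "J < \<infinity>" "J \<le> ennreal (1 / 2) * J + R"
  shows "J \<le> ennreal 2 * R"
proof (cases J)
  case (real j)
  show ?thesis
  proof (cases R)
    case (real r)
    have "ennreal j \<le> ennreal (1 / 2 * j + r)"
      using assms(2) \<open>J = ennreal j\<close> \<open>0 \<le> j\<close> real by (simp add: ennreal_mult'[symmetric] ennreal_plus del: ennreal_half)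
    then have "j \<le> 2 * r" using \<open>0 \<le> j\<close> real by (simp del: ennreal_plus)
    then show ?thesis using \<open>J = ennreal j\<close> real by (simp add: ennreal_mult'[symmetric] ennreal_leI del: ennreal_numeral)
  qed (simp add: ennreal_mult_top del: ennreal_numeral)
qed (use assms in auto)

context standard_kernel
begin

lemma sq_split_height:
  assumes [measurable]: "F \<in> borel_measurable borel"
  shows "(conical.sq F x)\<^sup>2 = (conical.sq (below r F) x)\<^sup>2 + (conical.sq (above r F) x)\<^sup>2"
proof -
  have "(conical.sq F x)\<^sup>2 = (\<integral>\<^sup>+z. (ennreal (norm (below r F z)))\<^sup>2 + (ennreal (norm (above r F z)))\<^sup>2 \<partial>cone_measure x)"
    unfolding conical.sq_def norm2_power2 by (intro nn_integral_cong) (auto simp: below_def above_def power2_eq_square)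
  also have "\<dots> = (conical.sq (below r F) x)\<^sup>2 + (conical.sq (above r F) x)\<^sup>2"
    unfolding conical.sq_def norm2_power2 by (rule nn_integral_add) auto
  finally show ?thesis .
qed

end

context L2_conical
begin

definition good_lambda_const :: real where
  "good_lambda_const = 400 ^ DIM('a) * B"

lemma good_lambda_const_pos: "0 < good_lambda_const"
  using B_pos by (simp add: good_lambda_const_def)

definition average_const :: real where
  "average_const = A * 5 powr m"

lemma average_const_pos: "0 < average_const"
  using A_pos by (simp add: average_const_def)

lemma global_integral_le_of_maxfun:
  assumes [measurable]: "h \<in> borel_measurable borel" and "maxfun h x \<le> c"
  shows "(\<integral>\<^sup>+z. h z \<partial>\<mu>) \<le> c * emeasure \<mu> UNIV"
proof -
  have inc: "incseq (\<lambda>n. ball x (real n))" by (auto simp: incseq_def)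
  have rng: "range (\<lambda>n. ball x (real n)) \<subseteq> sets (density \<mu> h)" by auto
  have un: "(\<Union>n. ball x (real n)) = UNIV" using reals_Archimedean2 by auto
  have "(\<integral>\<^sup>+z. h z \<partial>\<mu>) = emeasure (density \<mu> h) UNIV" by (subst emeasure_density) auto
  also have "\<dots> = (SUP n. emeasure (density \<mu> h) (ball x (real n)))"
    using SUP_emeasure_incseq[OF rng inc] un by simp
  also have "\<dots> \<le> c * emeasure \<mu> UNIV"
  proof (rule SUP_least)
    fix n :: nat
    show "emeasure (density \<mu> h) (ball x (real n)) \<le> c * emeasure \<mu> UNIV"
    proof (cases "0 < n")
      case True
      have "emeasure (density \<mu> h) (ball x (real n)) = (\<integral>\<^sup>+z\<in>ball x (real n). h z \<partial>\<mu>)" by (simp add: emeasure_density)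
      also have "\<dots> \<le> maxfun h x * emeasure \<mu> (ball x (5 * real n))" using True by (intro integral_le_maxfun) auto
      also have "\<dots> \<le> c * emeasure \<mu> UNIV" using assms by (intro mult_mono emeasure_mono) auto
      finally show ?thesis .
    qed (simp add: ball_empty)
  qed
  finally show ?thesis .
qed

text \<open>At a point \<open>x\<close> of the bad set \<open>E\<close> the part of the cone above a small multiple of the distance
  \<open>d x\<close> to the complement of \<open>\<Omega>\<close> contributes at most \<open>2 l\<^sup>2\<close> to the square, because the cone over a nearest
  point of the complement does. The lower part must therefore be large, and it only depends on \<open>f\<close>
  in a neighbourhood \<open>U\<close> of \<open>E\<close> inside \<open>\<Omega>\<close>, on which the integral of \<open>|f|\<^sup>2\<close> is small.\<close>

lemma good_lambda:
  assumes [measurable]: "f \<in> borel_measurable borel" and fin: "(\<integral>\<^sup>+y. (ennreal (norm (f y)))\<^sup>2 \<partial>\<mu>) < \<infinity>"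
    and l: "0 < l" and \<gamma>: "0 < \<gamma>"
    and small1: "(K * tail_const m \<alpha> * average_const)\<^sup>2 * \<gamma>\<^sup>2 * 100 * shift_const \<le> 1"
    and small2: "local_const 2 * average_const * \<gamma> \<le> 1 / 4"
  shows "emeasure \<mu> {x. ennreal (2 * l) < conical.sq (T f) x \<and> maxfun (\<lambda>y. (ennreal (norm (f y)))\<^sup>2) x \<le> ennreal ((\<gamma> * l)\<^sup>2)}
    \<le> ennreal (good_lambda_const * \<gamma>\<^sup>2) * emeasure \<mu> {x. ennreal l < conical.sq (T f) x}"
proof -
  let ?S = "conical.sq (T f)"
  let ?h = "\<lambda>y. (ennreal (norm (f y)))\<^sup>2"
  define G where "G = \<gamma> * l"
  have G: "0 < G" using l \<gamma> by (simp add: G_def)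
  define \<Omega> where "\<Omega> = {x. ennreal l < ?S x}"
  define E where "E = {x. ennreal (2 * l) < ?S x \<and> maxfun ?h x \<le> ennreal (G\<^sup>2)}"
  have [measurable]: "E \<in> sets borel" unfolding E_def by measurable
  have \<Omega>: "open \<Omega>" unfolding \<Omega>_def by (rule open_superlevel_conical) measurable
  have E\<Omega>: "E \<subseteq> \<Omega>"
  proof
    fix x assume "x \<in> E"
    then have "ennreal (2 * l) < ?S x" by (simp add: E_def)
    moreover have "ennreal l \<le> ennreal (2 * l)" using l by (intro ennreal_leI) simp
    ultimately show "x \<in> \<Omega>" by (simp add: \<Omega>_def)
  qed
  have main: "ennreal (l\<^sup>2) * emeasure \<mu> E \<le> ennreal B * (ennreal (400 ^ DIM('a)) * (ennreal (G\<^sup>2) * emeasure \<mu> \<Omega>))"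
  proof (cases "\<Omega> = UNIV \<or> E = {}")
    case True
    show ?thesis
    proof (cases "E = {}")
      case False
      then obtain x where x: "x \<in> E" by blast
      have "ennreal (l\<^sup>2) * emeasure \<mu> E \<le> (ennreal (2 * l))\<^sup>2 * emeasure \<mu> {x. ennreal (2 * l) < ?S x}"
        using l by (intro mult_mono emeasure_mono) (auto simp: E_def ennreal_power power_mono intro!: ennreal_leI)
      also have "\<dots> \<le> ennreal B * (\<integral>\<^sup>+y. ?h y \<partial>\<mu>)" using fin by (intro L2.weak_type_L2) auto
      also have "\<dots> \<le> ennreal B * (1 * (ennreal (G\<^sup>2) * emeasure \<mu> UNIV))"
        using x global_integral_le_of_maxfun[of ?h x] by (intro mult_left_mono) (auto simp: E_def)
      also have "\<dots> \<le> ennreal B * (ennreal (400 ^ DIM('a)) * (ennreal (G\<^sup>2) * emeasure \<mu> \<Omega>))"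
        using True False by (intro mult_left_mono mult_mono) auto
      finally show ?thesis .
    qed simp
  next
    case False
    then have ne: "- \<Omega> \<noteq> {}" and cl: "closed (- \<Omega>)" using \<Omega> by auto
    define d where "d x = infdist x (- \<Omega>)" for x
    have lip: "d x \<le> d y + dist x y" for x y unfolding d_def by (rule infdist_triangle)
    have dpos: "0 < d x \<longleftrightarrow> x \<in> \<Omega>" for x
      using in_closed_iff_infdist_zero[OF cl ne, of x] infdist_nonneg[of x "- \<Omega>"] by (auto simp: d_def less_le)
    define U where "U = (\<Union>x\<in>E. ball x (2 * (d x / 100)))"
    have [measurable]: "U \<in> sets borel" unfolding U_def by (intro borel_open open_UN) auto
    define fU where "fU y = (if y \<in> U then f y else 0)" for y
    define fV where "fV y = (if y \<in> U then 0 else f y)" for y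
    have [measurable]: "fU \<in> borel_measurable borel" "fV \<in> borel_measurable borel"
      unfolding fU_def fV_def by measurable
    have fU2: "(\<integral>\<^sup>+y. (ennreal (norm (fU y)))\<^sup>2 \<partial>\<mu>) = (\<integral>\<^sup>+y\<in>U. ?h y \<partial>\<mu>)"
      by (intro nn_integral_cong) (auto simp: fU_def indicator_def power2_eq_square)
    have fU_fin: "(\<integral>\<^sup>+y. (ennreal (norm (fU y)))\<^sup>2 \<partial>\<mu>) < \<infinity>"
      by (rule le_less_trans[OF _ fin]) (auto intro!: nn_integral_mono simp: fU_def power2_eq_square)
    have fV_fin: "(\<integral>\<^sup>+y. (ennreal (norm (fV y)))\<^sup>2 \<partial>\<mu>) < \<infinity>"
      by (rule le_less_trans[OF _ fin]) (auto intro!: nn_integral_mono simp: fV_def power2_eq_square)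
    have large: "ennreal l < conical.sq (T fU) x" if x: "x \<in> E" for x
    proof -
      let ?r = "d x / 100"
      have dx: "0 < d x" using x E\<Omega> dpos by blast
      have Gx: "maxfun ?h x \<le> ennreal (G\<^sup>2)" using x by (simp add: E_def)
      have avg: "(\<integral>\<^sup>+z\<in>ball y u. ennreal (norm (f z)) \<partial>\<mu>) \<le> ennreal (G * average_const * u powr m)" if "0 < u" "dist x y < u" for y u
        using average_le_of_maxfun[OF _ _ Gx that] G by (simp add: average_const_def mult_ac)
      obtain x' where x': "x' \<in> - \<Omega>" "d x = dist x x'"
        using infdist_attains_inf[OF cl ne, of x] by (auto simp: d_def)
      let ?M = "K * tail_const m \<alpha> * (G * average_const)"
      have M: "0 \<le> ?M" using K_pos G average_const_pos tail_const_pos[OF alpha_pos, of m] by simp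
      have "(conical.sq (above ?r (T f)) x)\<^sup>2 \<le> (conical.sq (above ?r (T f)) x')\<^sup>2 + ennreal (?M\<^sup>2 * 100 * shift_const)"
      proof (rule cone_shift)
        fix y t assume t: "?r < t" "dist x y < t"
        then have "0 < t" using dx by simp
        then show "norm (T f (y, t)) \<le> ?M"
          using t G average_const_pos by (intro T_le avg) auto
      qed (use dx x' M in auto)
      also have "\<dots> \<le> ennreal (l\<^sup>2) + ennreal (l\<^sup>2)"
      proof (rule add_mono)
        have "conical.sq (above ?r (T f)) x' \<le> ?S x'" by (rule conical.sq_mono_AE) (simp add: above_def)
        also have "\<dots> \<le> ennreal l" using x' by (simp add: \<Omega>_def not_less)
        finally have "(conical.sq (above ?r (T f)) x')\<^sup>2 \<le> (ennreal l)\<^sup>2" by (simp add: ennreal_power2_le_iff)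
        then show "(conical.sq (above ?r (T f)) x')\<^sup>2 \<le> ennreal (l\<^sup>2)" using l by (simp add: ennreal_power)
        have "?M\<^sup>2 * 100 * shift_const = ((K * tail_const m \<alpha> * average_const)\<^sup>2 * \<gamma>\<^sup>2 * 100 * shift_const) * l\<^sup>2"
          by (simp add: G_def power_mult_distrib mult_ac)
        also have "\<dots> \<le> 1 * l\<^sup>2" by (intro mult_right_mono small1) simp
        finally show "ennreal (?M\<^sup>2 * 100 * shift_const) \<le> ennreal (l\<^sup>2)" by (intro ennreal_leI) simp
      qed
      finally have upper: "(conical.sq (above ?r (T f)) x)\<^sup>2 \<le> ennreal (2 * l\<^sup>2)"
        by (simp add: ennreal_plus[symmetric] del: ennreal_plus)
      \<comment> \<open>\<open>5 / 4\<close> leaves room for the \<open>l / 4\<close> that is lost below, and its square plus \<open>2\<close> is less than \<open>4\<close>.\<close>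
      have lower: "ennreal (5 / 4 * l) < conical.sq (below ?r (T f)) x"
      proof (rule ccontr)
        assume "\<not> ?thesis"
        then have "(conical.sq (below ?r (T f)) x)\<^sup>2 \<le> (ennreal (5 / 4 * l))\<^sup>2" by (simp only: ennreal_power2_le_iff not_less)
        then have "(?S x)\<^sup>2 \<le> ennreal ((5 / 4 * l)\<^sup>2) + ennreal (2 * l\<^sup>2)"
          unfolding sq_split_height[OF T_measurable[OF assms(1)], of x ?r] using upper l
          by (intro add_mono) (simp_all add: ennreal_power)
        also have "\<dots> = ennreal (57 / 16 * l\<^sup>2)"
          by (simp add: ennreal_plus[symmetric] power_mult_distrib power_divide del: ennreal_plus)
        also have "\<dots> \<le> ennreal ((2 * l)\<^sup>2)" by (intro ennreal_leI) (simp add: power_mult_distrib)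
        also have "\<dots> = (ennreal (2 * l))\<^sup>2" using l by (simp add: ennreal_power)
        finally have "?S x \<le> ennreal (2 * l)" by (simp only: ennreal_power2_le_iff)
        then show False using x by (auto simp: E_def dest: leD)
      qed
      have "conical.sq (below ?r (T f)) x = conical.sq (\<lambda>z. below ?r (T fU) z + below ?r (T fV) z) x"
      proof (rule conical.sq_cong_cone)
        fix z :: "'a \<times> real" assume z: "0 < snd z"
        have "T (\<lambda>y. fU y + fV y) z = T fU z + T fV z"
        proof (rule L2.T_add[OF z])
          show "integrable \<mu> (\<lambda>y. k (snd z) (fst z) y * fU y)"
            using fU_fin by (intro kernel_mult_integrable[OF z, where p = 2]) (auto simp: ennreal_power)
          show "integrable \<mu> (\<lambda>y. k (snd z) (fst z) y * fV y)"
            using fV_fin by (intro kernel_mult_integrable[OF z, where p = 2]) (auto simp: ennreal_power)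
        qed
        moreover have "f = (\<lambda>y. fU y + fV y)" by (auto simp: fU_def fV_def)
        ultimately show "below ?r (T f) z = below ?r (T fU) z + below ?r (T fV) z" by (simp add: below_def)
      qed
      also have "\<dots> \<le> conical.sq (below ?r (T fU)) x + conical.sq (below ?r (T fV)) x" by (rule conical.sq_triangle) measurable
      also have "\<dots> \<le> conical.sq (T fU) x + ennreal (local_const 2 * (G * average_const))"
      proof (rule add_mono)
        show "conical.sq (below ?r (T fU)) x \<le> conical.sq (T fU) x" by (rule conical.sq_mono_AE) (simp add: below_def)
        \<comment> \<open>The neighbourhood \<open>U\<close> contains the double of the ball of radius \<open>d x / 100\<close> around \<open>x\<close>.\<close>
        show "conical.sq (below ?r (T fV)) x \<le> ennreal (local_const 2 * (G * average_const))"
        proof (rule sq_below_vanishing[where a = x])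
          fix y u assume u: "0 < (u :: real)" "dist x y < u"
          have "(\<integral>\<^sup>+z\<in>ball y u. ennreal (norm (fV z)) \<partial>\<mu>) \<le> (\<integral>\<^sup>+z\<in>ball y u. ennreal (norm (f z)) \<partial>\<mu>)"
            by (intro nn_integral_mono mult_right_mono) (auto simp: fV_def)
          then show "(\<integral>\<^sup>+z\<in>ball y u. ennreal (norm (fV z)) \<partial>\<mu>) \<le> ennreal (G * average_const * u powr m)"
            using avg[OF u] by (rule order_trans)
        next
          fix y assume "y \<in> ball x (2 * ?r)"
          then have "y \<in> U" using x by (auto simp: U_def)
          then show "fV y = 0" by (simp add: fV_def)
        qed (use dx G average_const_pos in auto)
      qed
      also have "\<dots> \<le> conical.sq (T fU) x + ennreal (l / 4)"
      proof (intro add_left_mono ennreal_leI)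
        have "local_const 2 * (G * average_const) = (local_const 2 * average_const * \<gamma>) * l" by (simp add: G_def)
        also have "\<dots> \<le> 1 / 4 * l" using l by (intro mult_right_mono small2) simp
        finally show "local_const 2 * (G * average_const) \<le> l / 4" by simp
      qed
      finally have b: "conical.sq (below ?r (T f)) x \<le> conical.sq (T fU) x + ennreal (l / 4)" .
      show ?thesis
      proof (rule ccontr)
        assume "\<not> ?thesis"
        then have "conical.sq (below ?r (T f)) x \<le> ennreal l + ennreal (l / 4)"
          using b by (auto simp: not_less intro: order_trans add_right_mono)
        also have "\<dots> = ennreal (5 / 4 * l)" using l by (simp add: ennreal_plus[symmetric] del: ennreal_plus)
        finally show False using lower by simp
      qed
    qed
    have "ennreal (l\<^sup>2) * emeasure \<mu> E \<le> (ennreal l)\<^sup>2 * emeasure \<mu> {x. ennreal l < conical.sq (T fU) x}"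
      using large l by (intro mult_mono emeasure_mono) (auto simp: ennreal_power)
    also have "\<dots> \<le> ennreal B * (\<integral>\<^sup>+y\<in>U. ?h y \<partial>\<mu>)"
      unfolding fU2[symmetric] using fU_fin by (intro L2.weak_type_L2) auto
    also have "\<dots> \<le> ennreal B * (ennreal (400 ^ DIM('a)) * (ennreal (G\<^sup>2) * emeasure \<mu> \<Omega>))"
    proof (intro mult_left_mono whitney_integral_le[where d = d and E = E])
      fix z assume "z \<in> U"
      then show "\<exists>x\<in>E. dist x z < 2 * (d x / 100)" by (auto simp: U_def)
    qed (use lip dpos \<Omega> E\<Omega> in \<open>auto simp: E_def\<close>)
    finally show ?thesis .
  qed
  have "emeasure \<mu> E = ennreal (1 / l\<^sup>2) * (ennreal (l\<^sup>2) * emeasure \<mu> E)"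
    using l by (simp add: mult.assoc[symmetric] ennreal_mult[symmetric])
  also have "\<dots> \<le> ennreal (1 / l\<^sup>2) * (ennreal B * (ennreal (400 ^ DIM('a)) * (ennreal (G\<^sup>2) * emeasure \<mu> \<Omega>)))"
    by (intro mult_left_mono main) simp
  also have "\<dots> = ennreal (good_lambda_const * \<gamma>\<^sup>2) * emeasure \<mu> \<Omega>"
  proof -
    have "1 / l\<^sup>2 * (B * (400 ^ DIM('a) * G\<^sup>2)) = good_lambda_const * \<gamma>\<^sup>2"
      using l by (simp add: good_lambda_const_def G_def power_mult_distrib)
    moreover have "ennreal (1 / l\<^sup>2) * (ennreal B * (ennreal (400 ^ DIM('a)) * ennreal (G\<^sup>2))) = ennreal (1 / l\<^sup>2 * (B * (400 ^ DIM('a) * G\<^sup>2)))"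
      using B_pos by (simp only: ennreal_mult zero_le_power zero_le_power2 mult_nonneg_nonneg zero_le_divide_1_iff less_imp_le zero_le_numeral)
    ultimately show ?thesis by (simp only: mult.assoc[symmetric])
  qed
  finally show ?thesis by (simp only: E_def \<Omega>_def G_def)
qed

text \<open>The parameter \<open>\<gamma>\<close> is chosen so small that the good part is absorbed. The exceptional part, where the
  maximal function is large, is controlled by its strong type with exponent \<open>p / 2 > 1\<close>.
  The good lambda inequality is integrated for the truncations \<open>min (S f) N\<close>, whose \<open>p\<close>-th powers
  are integrable because \<open>S f\<close> is square integrable.\<close>

lemma strong_type_above_2_L2:
  assumes p: "2 < p"
  shows "\<exists>C. 0 \<le> C \<and> (\<forall>f\<in>borel_measurable borel. (\<integral>\<^sup>+y. (ennreal (norm (f y)))\<^sup>2 \<partial>\<mu>) < \<infinity> \<longrightarrow>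
    (\<integral>\<^sup>+x. epowr (conical.sq (T f) x) p \<partial>\<mu>) \<le> ennreal C * (\<integral>\<^sup>+y. ennreal (norm (f y) powr p) \<partial>\<mu>))"
proof -
  let ?Q = "K * tail_const m \<alpha> * average_const"
  \<comment> \<open>The summands correspond to the three smallness conditions on \<open>\<gamma> = 1 / X\<close>.\<close>
  define X where "X = 1 + 100 * ?Q\<^sup>2 * shift_const + 4 * (local_const 2 * average_const) + 2 * 2 powr p * good_lambda_const"
  have pos: "0 \<le> 100 * ?Q\<^sup>2 * shift_const" "0 \<le> 4 * (local_const 2 * average_const)" "0 \<le> 2 * 2 powr p * good_lambda_const"
    using shift_const_pos local_const_pos[of 2] average_const_pos good_lambda_const_pos by auto
  have X: "1 \<le> X" using pos by (simp add: X_def)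
  define \<gamma> where "\<gamma> = 1 / X"
  have \<gamma>: "0 < \<gamma>" "\<gamma> \<le> 1" using X by (auto simp: \<gamma>_def)
  have \<gamma>2: "\<gamma>\<^sup>2 \<le> \<gamma>" using \<gamma> by (simp add: power2_eq_square mult_left_le)
  have scale: "c * \<gamma> \<le> 1" if "c \<le> X" "0 \<le> c" for c
    using that X by (simp add: \<gamma>_def)
  have small1: "?Q\<^sup>2 * \<gamma>\<^sup>2 * 100 * shift_const \<le> 1"
  proof -
    have "?Q\<^sup>2 * \<gamma>\<^sup>2 * 100 * shift_const = (100 * ?Q\<^sup>2 * shift_const) * \<gamma>\<^sup>2" by simp
    also have "\<dots> \<le> (100 * ?Q\<^sup>2 * shift_const) * \<gamma>" by (rule mult_left_mono[OF \<gamma>2 pos(1)])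
    also have "\<dots> \<le> 1" using pos by (intro scale) (auto simp: X_def)
    finally show ?thesis .
  qed
  have small2: "local_const 2 * average_const * \<gamma> \<le> 1 / 4"
    using scale[OF _ pos(2)] pos by (simp add: X_def)
  have small3: "2 powr p * (good_lambda_const * \<gamma>\<^sup>2) \<le> 1 / 2"
  proof -
    have "2 * 2 powr p * good_lambda_const * \<gamma>\<^sup>2 \<le> 2 * 2 powr p * good_lambda_const * \<gamma>" by (rule mult_left_mono[OF \<gamma>2 pos(3)])
    also have "\<dots> \<le> 1" using pos by (intro scale) (auto simp: X_def)
    finally show ?thesis by simp
  qed
  define q where "q = p / 2"
  have q: "1 < q" using p by (simp add: q_def)
  define C0 where "C0 = (1 / \<gamma>) powr p * (2 powr q * (q / (q - 1)))"
  have C0: "0 \<le> C0" using q by (simp add: C0_def)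
  show ?thesis
  proof (intro exI[of _ "2 * (2 powr p * C0)"] conjI ballI impI)
    show "0 \<le> 2 * (2 powr p * C0)" using C0 by simp
    fix f :: "'a \<Rightarrow> complex" assume [measurable]: "f \<in> borel_measurable borel"
    assume fin: "(\<integral>\<^sup>+y. (ennreal (norm (f y)))\<^sup>2 \<partial>\<mu>) < \<infinity>"
    let ?S = "conical.sq (T f)"
    let ?g = "maxfun (\<lambda>y. (ennreal (norm (f y)))\<^sup>2)"
    let ?I = "\<integral>\<^sup>+y. ennreal (norm (f y) powr p) \<partial>\<mu>"
    define w where "w x = ennreal (1 / \<gamma>) * epowr (?g x) (1 / 2)" for x
    have [measurable]: "w \<in> borel_measurable borel" unfolding w_def[abs_def] by measurable
    have w: "(\<integral>\<^sup>+x. epowr (w x) p \<partial>\<mu>) \<le> ennreal C0 * ?I"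
    proof -
      have "(\<integral>\<^sup>+x. epowr (w x) p \<partial>\<mu>) = (\<integral>\<^sup>+x. ennreal ((1 / \<gamma>) powr p) * epowr (?g x) q \<partial>\<mu>)"
        unfolding w_def using \<gamma> p by (intro nn_integral_cong) (simp add: epowr_cmult epowr_epowr q_def)
      also have "\<dots> = ennreal ((1 / \<gamma>) powr p) * (\<integral>\<^sup>+x. epowr (?g x) q \<partial>\<mu>)" by (rule nn_integral_cmult) measurable
      also have "(\<integral>\<^sup>+x. epowr (?g x) q \<partial>\<mu>) \<le> ennreal (2 powr q * (q / (q - 1))) * (\<integral>\<^sup>+z. ennreal (((norm (f z))\<^sup>2) powr q) \<partial>\<mu>)"
        using maxfun_strong_type[OF q, of "\<lambda>z. (norm (f z))\<^sup>2"] by (simp add: ennreal_power)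
      also have "(\<integral>\<^sup>+z. ennreal (((norm (f z))\<^sup>2) powr q) \<partial>\<mu>) = ?I"
      proof (rule nn_integral_cong)
        fix z
        have "((norm (f z))\<^sup>2) powr q = norm (f z) powr p"
        proof (cases "f z = 0")
          case False
          then have "(norm (f z))\<^sup>2 = norm (f z) powr 2" by simp
          then show ?thesis by (simp only: powr_powr) (simp add: q_def)
        qed (use p in simp)
        then show "ennreal (((norm (f z))\<^sup>2) powr q) = ennreal (norm (f z) powr p)" by simp
      qed
      also have "ennreal ((1 / \<gamma>) powr p) * (ennreal (2 powr q * (q / (q - 1))) * ?I) = ennreal C0 * ?I"
      proof -
        have "ennreal C0 = ennreal ((1 / \<gamma>) powr p) * ennreal (2 powr q * (q / (q - 1)))"
          unfolding C0_def by (rule ennreal_mult'[OF powr_ge_zero])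
        then show ?thesis by (simp only: mult.assoc)
      qed
      finally show ?thesis by (simp add: mult_left_mono)
    qed
    have J_le: "(\<integral>\<^sup>+x. epowr (min (?S x) (ennreal (real N))) p \<partial>\<mu>) \<le> ennreal 2 * (ennreal (2 powr p) * (ennreal C0 * ?I))" for N :: nat
    proof -
      let ?N = "ennreal (real N)"
      define J where "J = (\<integral>\<^sup>+x. epowr (min (?S x) ?N) p \<partial>\<mu>)"
      let ?u = "\<lambda>x. min (ennreal (1 / 2) * ?S x) ?N"
      have J_fin: "J < \<infinity>"
      proof -
        have "J \<le> (\<integral>\<^sup>+x. ennreal (real N powr (p - 2)) * (?S x)\<^sup>2 \<partial>\<mu>)"
          unfolding J_def
        proof (rule nn_integral_mono)
          fix x
          obtain c where c: "min (?S x) ?N = ennreal c" "0 \<le> c"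
            by (cases "min (?S x) ?N") (auto simp: min_def top_unique split: if_splits)
          have cN: "c \<le> real N" and cS: "ennreal c \<le> ?S x"
            using c min.cobounded2[of "?S x" ?N] min.cobounded1[of "?S x" ?N] by auto
          have "c powr p \<le> real N powr (p - 2) * c\<^sup>2"
          proof (cases "c = 0")
            case False
            then have "c powr p = c powr (p - 2) * c\<^sup>2" using c by (simp add: powr_diff)
            also have "\<dots> \<le> real N powr (p - 2) * c\<^sup>2" using cN c p by (intro mult_right_mono powr_mono2) auto
            finally show ?thesis .
          qed (use p in simp)
          then have "epowr (min (?S x) ?N) p \<le> ennreal (real N powr (p - 2)) * (ennreal c)\<^sup>2"
            using c by (simp add: epowr_ennreal ennreal_power ennreal_mult[symmetric] ennreal_leI)
          also have "\<dots> \<le> ennreal (real N powr (p - 2)) * (?S x)\<^sup>2" using cS by (intro mult_left_mono power_mono) auto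
          finally show "epowr (min (?S x) ?N) p \<le> ennreal (real N powr (p - 2)) * (?S x)\<^sup>2" .
        qed
        also have "\<dots> = ennreal (real N powr (p - 2)) * (\<integral>\<^sup>+x. (?S x)\<^sup>2 \<partial>\<mu>)" by (rule nn_integral_cmult) measurable
        also have "\<dots> \<le> ennreal (real N powr (p - 2)) * (ennreal B * (\<integral>\<^sup>+y. (ennreal (norm (f y)))\<^sup>2 \<partial>\<mu>))"
          using fin by (intro mult_left_mono conical_L2) auto
        also have "\<dots> < \<infinity>" using fin by (simp add: ennreal_mult_less_top)
        finally show ?thesis .
      qed
      have "J \<le> (\<integral>\<^sup>+x. ennreal (2 powr p) * epowr (?u x) p \<partial>\<mu>)"
        unfolding J_def
      proof (rule nn_integral_mono)
        fix x
        have "min (?S x) ?N \<le> ennreal 2 * ?u x"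
        proof (cases "ennreal (1 / 2) * ?S x \<le> ?N")
          case True
          have "ennreal 2 * (ennreal (1 / 2) * ?S x) = ?S x"
            by (simp only: mult.assoc[symmetric] ennreal_mult'[symmetric]) simp
          moreover have "?u x = ennreal (1 / 2) * ?S x" using True by (rule min_absorb1)
          ultimately have "?S x = ennreal 2 * ?u x" by (simp only:)
          then show ?thesis by (simp only: min.cobounded1)
        next
          case False
          then have "?N \<le> ennreal (1 / 2) * ?S x" by (meson linear)
          then have u: "?u x = ?N" by (rule min_absorb2)
          have "?N \<le> ennreal 2 * ?N" by (simp add: ennreal_mult'[symmetric] ennreal_leI del: ennreal_numeral)
          then show ?thesis unfolding u by (rule order_trans[OF min.cobounded2])
        qed
        then have "epowr (min (?S x) ?N) p \<le> epowr (ennreal 2 * ?u x) p" using p by (intro epowr_mono) auto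
        also have "\<dots> = ennreal (2 powr p) * epowr (?u x) p" using p by (intro epowr_cmult) auto
        finally show "epowr (min (?S x) ?N) p \<le> ennreal (2 powr p) * epowr (?u x) p" .
      qed
      also have "\<dots> = ennreal (2 powr p) * (\<integral>\<^sup>+x. epowr (?u x) p \<partial>\<mu>)" by (rule nn_integral_cmult) measurable
      also have "(\<integral>\<^sup>+x. epowr (?u x) p \<partial>\<mu>) \<le> ennreal (good_lambda_const * \<gamma>\<^sup>2) * J + (\<integral>\<^sup>+x. epowr (w x) p \<partial>\<mu>)"
      proof -
        let ?A = "\<lambda>t. ennreal (p * t powr (p - 1)) * emeasure \<mu> {x. ennreal t < min (?S x) ?N} * indicator {0<..} t"
        let ?B = "\<lambda>t. ennreal (p * t powr (p - 1)) * emeasure \<mu> {x. ennreal t < w x} * indicator {0<..} t"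
        have meas [measurable]: "(\<lambda>t. emeasure \<mu> {x. ennreal t < v x}) \<in> borel_measurable borel"
          if [measurable]: "v \<in> borel_measurable borel" for v
        proof -
          have "(\<lambda>(t, x). (if ennreal t < v x then 1 else 0) :: ennreal) \<in> borel_measurable (borel \<Otimes>\<^sub>M \<mu>)" by measurable
          from borel_measurable_nn_integral[OF this]
          have "(\<lambda>t. \<integral>\<^sup>+x. (if ennreal t < v x then 1 else 0) \<partial>\<mu>) \<in> borel_measurable borel" by simp
          moreover have "(\<integral>\<^sup>+x. (if ennreal t < v x then 1 else 0) \<partial>\<mu>) = emeasure \<mu> {x. ennreal t < v x}" for t
          proof -
            have "(\<integral>\<^sup>+x. (if ennreal t < v x then 1 else 0) \<partial>\<mu>) = (\<integral>\<^sup>+x. indicator {x. ennreal t < v x} x \<partial>\<mu>)"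
              by (intro nn_integral_cong) (auto simp: indicator_def)
            then show ?thesis by simp
          qed
          ultimately show ?thesis by simp
        qed
        have "(\<integral>\<^sup>+x. epowr (?u x) p \<partial>\<mu>) = (\<integral>\<^sup>+t\<in>{0<..}. ennreal (p * t powr (p - 1)) * emeasure \<mu> {x. ennreal t < ?u x} \<partial>lborel)"
          using p nn_integral_epowr_eq[of p ?u] by simp
        also have "\<dots> \<le> (\<integral>\<^sup>+t. ennreal (good_lambda_const * \<gamma>\<^sup>2) * ?A t + ?B t \<partial>lborel)"
        proof (rule nn_integral_mono)
          fix t :: real
          have key: "emeasure \<mu> {x. ennreal t < ?u x} \<le> ennreal (good_lambda_const * \<gamma>\<^sup>2) * emeasure \<mu> {x. ennreal t < min (?S x) ?N} + emeasure \<mu> {x. ennreal t < w x}"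
            if t: "0 < t"
          proof (cases "t < real N")
            case True
            then have tN: "ennreal t < ?N" using t by (simp add: ennreal_less_iff)
            let ?E = "{x. ennreal (2 * t) < ?S x \<and> ?g x \<le> ennreal ((\<gamma> * t)\<^sup>2)}"
            have "{x. ennreal t < ?u x} \<subseteq> ?E \<union> {x. ennreal t < w x}"
            proof
              fix x assume "x \<in> {x. ennreal t < ?u x}"
              then have "ennreal t < ennreal (1 / 2) * ?S x" by simp
              then have S: "ennreal (2 * t) < ?S x"
              proof (cases "?S x")
                case (real s)
                have half: "ennreal (1 / 2) * ennreal s = ennreal (1 / 2 * s)" by (rule ennreal_mult'[symmetric]) simp
                have "ennreal t < ennreal (1 / 2) * ennreal s"
                  using \<open>ennreal t < ennreal (1 / 2) * ?S x\<close> by (simp only: real)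
                then have "ennreal t < ennreal (1 / 2 * s)" by (simp only: half)
                then have "t < 1 / 2 * s" by (simp only: ennreal_less_iff[OF less_imp_le[OF t]])
                then show ?thesis using real t by (simp add: ennreal_less_iff)
              qed simp
              show "x \<in> ?E \<union> {x. ennreal t < w x}"
              proof (cases "?g x \<le> ennreal ((\<gamma> * t)\<^sup>2)")
                case False
                then have "(ennreal (\<gamma> * t))\<^sup>2 < ?g x" using \<gamma> t by (simp add: ennreal_power not_le)
                then have gt: "ennreal (\<gamma> * t) < epowr (?g x) (1 / 2)" by (simp only: less_epowr_half_iff)
                have "ennreal t < w x"
                proof (cases "epowr (?g x) (1 / 2)")
                  case (real s)
                  then have "\<gamma> * t < s" using gt \<gamma> t by (simp add: ennreal_less_iff)
                  then have "t < 1 / \<gamma> * s" using \<gamma> by (simp add: field_simps)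
                  then show ?thesis using real \<gamma> t by (simp add: w_def ennreal_mult'[symmetric] ennreal_less_iff del: times_divide_eq_left)
                qed (use \<gamma> in \<open>simp add: w_def ennreal_mult_top\<close>)
                then show ?thesis by simp
              qed (use S in simp)
            qed
            then have "emeasure \<mu> {x. ennreal t < ?u x} \<le> emeasure \<mu> (?E \<union> {x. ennreal t < w x})" by (rule emeasure_mono) measurable
            also have "\<dots> \<le> emeasure \<mu> ?E + emeasure \<mu> {x. ennreal t < w x}" by (rule emeasure_subadditive) measurable
            also have "emeasure \<mu> ?E \<le> ennreal (good_lambda_const * \<gamma>\<^sup>2) * emeasure \<mu> {x. ennreal t < ?S x}"
              using fin t \<gamma>(1) small1 small2 by (intro good_lambda) auto
            also have "{x. ennreal t < ?S x} = {x. ennreal t < min (?S x) ?N}" using tN by simp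
            finally show ?thesis by (simp add: add_right_mono)
          next
            case False
            then have "?N \<le> ennreal t" by (simp add: ennreal_leI)
            then have "{x. ennreal t < ?u x} = {}" by (auto simp: not_less[symmetric])
            then show ?thesis by (simp only: emeasure_empty zero_le)
          qed
          show "ennreal (p * t powr (p - 1)) * emeasure \<mu> {x. ennreal t < ?u x} * indicator {0<..} t \<le> ennreal (good_lambda_const * \<gamma>\<^sup>2) * ?A t + ?B t"
          proof (cases "0 < t")
            case True
            have "ennreal (p * t powr (p - 1)) * emeasure \<mu> {x. ennreal t < ?u x}
              \<le> ennreal (p * t powr (p - 1)) * (ennreal (good_lambda_const * \<gamma>\<^sup>2) * emeasure \<mu> {x. ennreal t < min (?S x) ?N} + emeasure \<mu> {x. ennreal t < w x})"
              by (intro mult_left_mono key True) simp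
            then show ?thesis using True by (simp only: distrib_left mult_ac indicator_simps greaterThan_iff mult_1_right mult_1_left)
          qed simp
        qed
        also have "\<dots> = ennreal (good_lambda_const * \<gamma>\<^sup>2) * (\<integral>\<^sup>+t. ?A t \<partial>lborel) + (\<integral>\<^sup>+t. ?B t \<partial>lborel)"
          by (subst nn_integral_add, measurable, subst nn_integral_cmult) (auto intro!: borel_measurable_times_ennreal meas borel_measurable_indicator)
        also have "(\<integral>\<^sup>+t. ?A t \<partial>lborel) = J"
          unfolding J_def using p nn_integral_epowr_eq[of p "\<lambda>x. min (?S x) ?N"] by simp
        also have "(\<integral>\<^sup>+t. ?B t \<partial>lborel) = (\<integral>\<^sup>+x. epowr (w x) p \<partial>\<mu>)"
          using p nn_integral_epowr_eq[of p w] by simp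
        finally show ?thesis .
      qed
      also have "ennreal (2 powr p) * (ennreal (good_lambda_const * \<gamma>\<^sup>2) * J + (\<integral>\<^sup>+x. epowr (w x) p \<partial>\<mu>))
          \<le> ennreal (1 / 2) * J + ennreal (2 powr p) * (ennreal C0 * ?I)"
        unfolding distrib_left
      proof (rule add_mono)
        have "ennreal (2 powr p) * (ennreal (good_lambda_const * \<gamma>\<^sup>2) * J) = ennreal (2 powr p * (good_lambda_const * \<gamma>\<^sup>2)) * J"
          by (subst ennreal_mult'[OF powr_ge_zero]) (rule mult.assoc[symmetric])
        also have "\<dots> \<le> ennreal (1 / 2) * J" by (intro mult_right_mono ennreal_leI small3) simp
        finally show "ennreal (2 powr p) * (ennreal (good_lambda_const * \<gamma>\<^sup>2) * J) \<le> ennreal (1 / 2) * J" .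
      qed (intro mult_left_mono w zero_le)
      finally have "J \<le> ennreal (1 / 2) * J + ennreal (2 powr p) * (ennreal C0 * ?I)" by (simp add: mult_left_mono)
      from ennreal_absorb_half[OF J_fin this] show ?thesis by (simp only: J_def)
    qed
    have "(\<integral>\<^sup>+x. epowr (?S x) p \<partial>\<mu>) \<le> (\<integral>\<^sup>+x. liminf (\<lambda>N. epowr (min (?S x) (ennreal (real N))) p) \<partial>\<mu>)"
    proof (rule nn_integral_mono)
      fix x
      have "(\<lambda>N. ennreal (real N)) \<longlonglongrightarrow> top"
        using of_nat_tendsto_top_ennreal by (simp only: ennreal_of_nat_eq_real_of_nat)
      then have "(\<lambda>N. min (?S x) (ennreal (real N))) \<longlonglongrightarrow> min (?S x) top" by (intro tendsto_min tendsto_const)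
      then have "liminf (\<lambda>N. min (?S x) (ennreal (real N))) = ?S x"
        using lim_imp_Liminf[OF sequentially_bot] by fastforce
      then show "epowr (?S x) p \<le> liminf (\<lambda>N. epowr (min (?S x) (ennreal (real N))) p)"
        using epowr_liminf[of p "\<lambda>N. min (?S x) (ennreal (real N))"] p by simp
    qed
    also have "\<dots> \<le> liminf (\<lambda>N. \<integral>\<^sup>+x. epowr (min (?S x) (ennreal (real N))) p \<partial>\<mu>)" by (rule nn_integral_liminf) measurable
    also have "\<dots> \<le> ennreal 2 * (ennreal (2 powr p) * (ennreal C0 * ?I))"
      by (rule Liminf_le) (auto intro!: always_eventually J_le simp del: ennreal_numeral)
    also have "\<dots> = ennreal (2 * (2 powr p * C0)) * ?I"
    proof -
      have "ennreal (2 * (2 powr p * C0)) = ennreal 2 * (ennreal (2 powr p) * ennreal C0)"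
        using C0 by (simp only: ennreal_mult zero_le_numeral powr_ge_zero mult_nonneg_nonneg)
      then show ?thesis by (simp only: mult.assoc)
    qed
    finally show "(\<integral>\<^sup>+x. epowr (?S x) p \<partial>\<mu>) \<le> ennreal (2 * (2 powr p * C0)) * ?I" .
  qed
qed

text \<open>General functions are approximated by truncating \<open>f\<close> in size and support, with Fatou's lemma in the
  cone and in the integral of the \<open>p\<close>-th power.\<close>

theorem strong_type_above_2:
  assumes p: "2 < p"
  shows "\<exists>C. 0 \<le> C \<and> (\<forall>f\<in>borel_measurable borel. (\<integral>\<^sup>+y. ennreal (norm (f y) powr p) \<partial>\<mu>) < \<infinity> \<longrightarrow>
    (\<integral>\<^sup>+x. epowr (conical.sq (T f) x) p \<partial>\<mu>) \<le> ennreal C * (\<integral>\<^sup>+y. ennreal (norm (f y) powr p) \<partial>\<mu>))"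
proof -
  obtain C where C: "0 \<le> C" and le: "\<forall>f\<in>borel_measurable borel. (\<integral>\<^sup>+y. (ennreal (norm (f y)))\<^sup>2 \<partial>\<mu>) < \<infinity> \<longrightarrow>
    (\<integral>\<^sup>+x. epowr (conical.sq (T f) x) p \<partial>\<mu>) \<le> ennreal C * (\<integral>\<^sup>+y. ennreal (norm (f y) powr p) \<partial>\<mu>)"
    using strong_type_above_2_L2[OF p] by blast
  show ?thesis
  proof (intro exI[of _ C] conjI ballI impI C)
    fix f :: "'a \<Rightarrow> complex" assume [measurable]: "f \<in> borel_measurable borel"
    let ?I = "\<integral>\<^sup>+y. ennreal (norm (f y) powr p) \<partial>\<mu>"
    assume fin: "?I < \<infinity>"
    define g where "g n y = (if norm y \<le> real n \<and> norm (f y) \<le> real n then f y else 0)" for n :: nat and y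
    have [measurable]: "g n \<in> borel_measurable borel" for n unfolding g_def[abs_def] by measurable
    have g_le: "norm (g n y) \<le> norm (f y)" for n y by (simp add: g_def)
    have g2: "(\<integral>\<^sup>+y. (ennreal (norm (g n y)))\<^sup>2 \<partial>\<mu>) < \<infinity>" for n
    proof -
      have "(\<integral>\<^sup>+y. (ennreal (norm (g n y)))\<^sup>2 \<partial>\<mu>) \<le> (\<integral>\<^sup>+y. ennreal ((real n)\<^sup>2) * indicator (ball 0 (real n + 1)) y \<partial>\<mu>)"
        by (intro nn_integral_mono) (auto simp: g_def ennreal_power power2_eq_square[of 0] intro!: ennreal_leI power_mono)
      also have "\<dots> < \<infinity>"
        using emeasure_ball_finite[of 0 "real n + 1"] by (simp add: nn_integral_cmult_indicator ennreal_mult_less_top)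
      finally show ?thesis .
    qed
    have lim: "(\<lambda>n. T (g n) z) \<longlonglongrightarrow> T f z" if z: "0 < snd z" for z
      unfolding T_def
    proof (rule integral_dominated_convergence[where w = "\<lambda>y. norm (k (snd z) (fst z) y * f y)"])
      have int: "integrable \<mu> (\<lambda>y. k (snd z) (fst z) y * f y)" using p fin by (intro kernel_mult_integrable[OF z, where p = p]) auto
      then show "integrable \<mu> (\<lambda>y. norm (k (snd z) (fst z) y * f y))" by simp
      show "(\<lambda>y. k (snd z) (fst z) y * f y) \<in> borel_measurable \<mu>" by measurable
      show "(\<lambda>y. k (snd z) (fst z) y * g n y) \<in> borel_measurable \<mu>" for n by measurable
      show "AE y in \<mu>. norm (k (snd z) (fst z) y * g n y) \<le> norm (k (snd z) (fst z) y * f y)" for n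
        using g_le by (auto simp: norm_mult mult_left_mono)
      show "AE y in \<mu>. (\<lambda>n. k (snd z) (fst z) y * g n y) \<longlonglongrightarrow> k (snd z) (fst z) y * f y"
      proof (rule AE_I2)
        fix y
        obtain N :: nat where N: "max (norm y) (norm (f y)) \<le> real N" using real_arch_simple by blast
        have "g n y = f y" if "N \<le> n" for n
        proof -
          have "real N \<le> real n" using that by simp
          then show ?thesis using N by (auto simp: g_def)
        qed
        then have "\<forall>\<^sub>F n in sequentially. k (snd z) (fst z) y * g n y = k (snd z) (fst z) y * f y"
          by (auto simp: eventually_sequentially)
        then show "(\<lambda>n. k (snd z) (fst z) y * g n y) \<longlonglongrightarrow> k (snd z) (fst z) y * f y" by (rule tendsto_eventually)
      qed
    qed
    have S_le: "(conical.sq (T f) x)\<^sup>2 \<le> liminf (\<lambda>n. (conical.sq (T (g n)) x)\<^sup>2)" for x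
    proof -
      have "(conical.sq (T f) x)\<^sup>2 = (\<integral>\<^sup>+z. liminf (\<lambda>n. (ennreal (norm (T (g n) z)))\<^sup>2) \<partial>cone_measure x)"
        unfolding conical.sq_def norm2_power2
      proof (rule nn_integral_cong_AE, rule eventually_mono[OF conical.omega_cone])
        fix z :: "'a \<times> real" assume "0 < snd z \<and> dist x (fst z) < snd z"
        then have "(\<lambda>n. ennreal ((norm (T (g n) z))\<^sup>2)) \<longlonglongrightarrow> ennreal ((norm (T f z))\<^sup>2)"
          using lim[of z] by (intro tendsto_intros) auto
        from lim_imp_Liminf[OF sequentially_bot this]
        show "(ennreal (norm (T f z)))\<^sup>2 = liminf (\<lambda>n. (ennreal (norm (T (g n) z)))\<^sup>2)" by (simp add: ennreal_power)
      qed
      also have "\<dots> \<le> liminf (\<lambda>n. (conical.sq (T (g n)) x)\<^sup>2)"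
        unfolding conical.sq_def norm2_power2 by (rule nn_integral_liminf) simp
      finally show ?thesis .
    qed
    have pw: "epowr (conical.sq (T f) x) p \<le> liminf (\<lambda>n. epowr (conical.sq (T (g n)) x) p)" for x
    proof -
      have "epowr (conical.sq (T f) x) p = epowr ((conical.sq (T f) x)\<^sup>2) (p / 2)" by (simp add: epowr_power2)
      also have "\<dots> \<le> epowr (liminf (\<lambda>n. (conical.sq (T (g n)) x)\<^sup>2)) (p / 2)" using p S_le by (intro epowr_mono) auto
      also have "\<dots> \<le> liminf (\<lambda>n. epowr ((conical.sq (T (g n)) x)\<^sup>2) (p / 2))" using p by (intro epowr_liminf) simp
      finally show ?thesis by (simp add: epowr_power2)
    qed
    have "(\<integral>\<^sup>+x. epowr (conical.sq (T f) x) p \<partial>\<mu>) \<le> (\<integral>\<^sup>+x. liminf (\<lambda>n. epowr (conical.sq (T (g n)) x) p) \<partial>\<mu>)"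
      by (intro nn_integral_mono pw)
    also have "\<dots> \<le> liminf (\<lambda>n. \<integral>\<^sup>+x. epowr (conical.sq (T (g n)) x) p \<partial>\<mu>)" by (rule nn_integral_liminf) measurable
    also have "\<dots> \<le> ennreal C * ?I"
    proof (rule Liminf_le)
      show "\<forall>\<^sub>F n in sequentially. (\<integral>\<^sup>+x. epowr (conical.sq (T (g n)) x) p \<partial>\<mu>) \<le> ennreal C * ?I"
      proof (intro always_eventually allI)
        fix n
        have "(\<integral>\<^sup>+x. epowr (conical.sq (T (g n)) x) p \<partial>\<mu>) \<le> ennreal C * (\<integral>\<^sup>+y. ennreal (norm (g n y) powr p) \<partial>\<mu>)"
          using le g2 by simp
        also have "\<dots> \<le> ennreal C * ?I"
          using p g_le by (intro mult_left_mono nn_integral_mono ennreal_leI powr_mono2) auto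
        finally show "(\<integral>\<^sup>+x. epowr (conical.sq (T (g n)) x) p \<partial>\<mu>) \<le> ennreal C * ?I" .
      qed
    qed simp
    finally show "(\<integral>\<^sup>+x. epowr (conical.sq (T f) x) p \<partial>\<mu>) \<le> ennreal C * ?I" .
  qed
qed

end

section \<open>A vertical square function that is unbounded above exponent two\<close>

text \<open>In the unit interval that starts at \<open>N\<close>, the comb has \<open>2\<^sup>N\<close> equally spaced teeth of total length \<open>1 / N\<close>.\<close>

definition comb :: "nat \<Rightarrow> real set" where
  "comb N = (\<Union>j\<in>{..<2 ^ N :: nat}. {real N + real j / 2 ^ N..<real N + real j / 2 ^ N + 1 / (real N * 2 ^ N)})"

text \<open>The gate is open over the comb at all heights between \<open>2\<^sup>-\<^sup>N\<close> and \<open>1\<close>. The logarithmic length \<open>N ln 2\<close> of this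
  interval and the density \<open>1 / N\<close> of the comb balance.\<close>

definition gate :: "(real \<times> real) set" where
  "gate = (\<Union>N\<in>{1..}. {1 / 2 ^ N<..1} \<times> comb N)"

text \<open>A tent of width \<open>t\<close>, switched on and off by the gate. The kernel is Lipschitz in \<open>y\<close>; in \<open>x\<close> it jumps.\<close>

definition gated_kernel :: "real \<Rightarrow> real \<Rightarrow> real \<Rightarrow> complex" where
  "gated_kernel t x y = (if (t, x) \<in> gate then complex_of_real (max 0 (1 - \<bar>x - y\<bar> / t) / t) else 0)"

lemma comb_measurable [measurable]: "comb N \<in> sets borel"
  by (auto simp: comb_def)

lemma gate_measurable [measurable]: "gate \<in> sets (borel \<Otimes>\<^sub>M borel)"
  unfolding gate_def by (intro sets.countable_UN'') (auto intro!: pair_measureI)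

lemma gate_pos: "(t, x) \<in> gate \<Longrightarrow> 0 < t \<and> t \<le> 1"
  by (auto simp: gate_def intro: less_trans[rotated])

lemma comb_subset: "0 < N \<Longrightarrow> comb N \<subseteq> {real N..<real N + 1}"
proof
  fix x assume N: "0 < N" and "x \<in> comb N"
  then obtain j where j: "j < 2 ^ N" "real N + real j / 2 ^ N \<le> x" "x < real N + real j / 2 ^ N + 1 / (real N * 2 ^ N)"
    by (auto simp: comb_def)
  have "1 / (real N * 2 ^ N) \<le> 1 / 2 ^ N" using N by (intro divide_left_mono) auto
  moreover have "real j + 1 \<le> 2 ^ N" using j(1) by (metis Suc_leI of_nat_Suc of_nat_le_iff of_nat_numeral of_nat_power add.commute)
  then have "(real j + 1) / 2 ^ N \<le> 1" by simp
  ultimately have "x < real N + 1" using j(3) by (simp add: add_divide_distrib)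
  moreover have "real N \<le> x" using j(2) by (rule order_trans[rotated]) simp
  ultimately show "x \<in> {real N..<real N + 1}" by simp
qed

lemma emeasure_comb:
  assumes N: "0 < N"
  shows "emeasure lborel (comb N) = ennreal (1 / N)"
proof -
  let ?I = "\<lambda>j :: nat. {real N + real j / 2 ^ N..<real N + real j / 2 ^ N + 1 / (real N * 2 ^ N)}"
  have disj: "disjoint_family_on ?I {..<2 ^ N}"
    unfolding disjoint_family_on_def
  proof (intro ballI impI)
    fix i j :: nat assume "i \<noteq> j"
    have sep: "?I i \<inter> ?I j = {}" if "i < j" for i j :: nat
    proof -
      have "1 / (real N * 2 ^ N) \<le> 1 / 2 ^ N" using N by (intro divide_left_mono) auto
      moreover have "(real i + 1) / 2 ^ N \<le> real j / 2 ^ N" using that by (intro divide_right_mono) auto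
      ultimately have "real i / 2 ^ N + 1 / (real N * 2 ^ N) \<le> real j / 2 ^ N" by (simp add: add_divide_distrib)
      then show ?thesis by auto
    qed
    then show "?I i \<inter> ?I j = {}" using \<open>i \<noteq> j\<close> sep[of i j] sep[of j i] by (cases "i < j") auto
  qed
  have "emeasure lborel (comb N) = (\<Sum>j<2 ^ N. emeasure lborel (?I j))"
    unfolding comb_def using disj by (intro sum_emeasure[symmetric]) auto
  also have "\<dots> = (\<Sum>j<(2::nat) ^ N. ennreal (1 / (real N * 2 ^ N)))" by simp
  also have "\<dots> = ennreal (\<Sum>j<(2::nat) ^ N. 1 / (real N * 2 ^ N))" by (rule sum_ennreal) simp
  also have "(\<Sum>j<(2::nat) ^ N. 1 / (real N * 2 ^ N)) = 1 / N" using N by simp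
  finally show ?thesis .
qed

text \<open>At scales \<open>t > 2\<^sup>-\<^sup>N\<close> the comb has density about \<open>1 / N\<close>: every tooth that meets the interval
  lies in a cell of length \<open>2\<^sup>-\<^sup>N\<close> inside the doubled interval, of which it occupies the fraction \<open>1 / N\<close>.\<close>

lemma emeasure_comb_ball_le:
  assumes N: "0 < N" and t: "1 / 2 ^ N < t"
  shows "emeasure lborel (comb N \<inter> ball y t) \<le> ennreal (4 * t / N)"
proof -
  let ?I = "\<lambda>j :: nat. {real N + real j / 2 ^ N..<real N + real j / 2 ^ N + 1 / (real N * 2 ^ N)}"
  let ?C = "\<lambda>j :: nat. {real N + real j / 2 ^ N..<real N + (real j + 1) / 2 ^ N}"
  define S where "S = {j. j < 2 ^ N \<and> ?I j \<inter> ball y t \<noteq> {}}"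
  have S: "finite S" by (simp add: S_def)
  have t0: "0 < t" using t by (meson less_trans zero_less_divide_1_iff zero_less_power zero_less_numeral)
  have IC: "?I j \<subseteq> ?C j" for j
  proof -
    have "1 / (real N * 2 ^ N) \<le> 1 / 2 ^ N" using N by (intro divide_left_mono) auto
    then show ?thesis by (auto simp: add_divide_distrib)
  qed
  have disj: "disjoint_family_on ?C S"
    unfolding disjoint_family_on_def
  proof (intro ballI impI)
    fix i j :: nat assume "i \<noteq> j"
    have sep: "?C i \<inter> ?C j = {}" if "i < j" for i j :: nat
    proof -
      have "(real i + 1) / 2 ^ N \<le> real j / 2 ^ N" using that by (intro divide_right_mono) auto
      then show ?thesis by auto
    qed
    then show "?C i \<inter> ?C j = {}" using \<open>i \<noteq> j\<close> sep[of i j] sep[of j i] by (cases "i < j") auto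
  qed
  have sub: "(\<Union>j\<in>S. ?C j) \<subseteq> {y - 2 * t..y + 2 * t}"
  proof
    fix x assume "x \<in> (\<Union>j\<in>S. ?C j)"
    then obtain j where j: "j \<in> S" "x \<in> ?C j" by blast
    then have "?I j \<inter> ball y t \<noteq> {}" by (simp add: S_def)
    then obtain z where "z \<in> ?I j" and zt: "z \<in> ball y t" by blast
    then have "z \<in> ?C j" using IC by blast
    then have "\<bar>x - z\<bar> \<le> 1 / 2 ^ N" using j(2) by (auto simp: add_divide_distrib)
    moreover have "\<bar>z - y\<bar> < t" using zt by (simp add: dist_real_def)
    ultimately show "x \<in> {y - 2 * t..y + 2 * t}" using t by auto
  qed
  have card: "real (card S) * (1 / 2 ^ N) \<le> 4 * t"
  proof -
    have "ennreal (real (card S) * (1 / 2 ^ N)) = (\<Sum>j\<in>S. ennreal (1 / 2 ^ N))"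
      by (subst sum_ennreal) auto
    also have "\<dots> = (\<Sum>j\<in>S. emeasure lborel (?C j))"
      by (intro sum.cong refl) (simp add: add_divide_distrib divide_right_mono)
    also have "\<dots> = emeasure lborel (\<Union>j\<in>S. ?C j)" using disj S by (intro sum_emeasure) auto
    also have "\<dots> \<le> emeasure lborel {y - 2 * t..y + 2 * t}" by (intro emeasure_mono sub) simp
    also have "\<dots> = ennreal (4 * t)" using t0 by simp
    finally show ?thesis using t0 by (subst (asm) ennreal_le_iff) auto
  qed
  have "emeasure lborel (comb N \<inter> ball y t) \<le> emeasure lborel (\<Union>j\<in>S. ?I j)"
    by (intro emeasure_mono) (auto simp: comb_def S_def)
  also have "\<dots> \<le> (\<Sum>j\<in>S. emeasure lborel (?I j))" using S by (intro emeasure_subadditive_finite) auto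
  also have "\<dots> = (\<Sum>j\<in>S. ennreal (1 / (real N * 2 ^ N)))" by simp
  also have "\<dots> = ennreal (real (card S) * (1 / 2 ^ N) / N)" by (subst sum_ennreal) auto
  also have "\<dots> \<le> ennreal (4 * t / N)" using card by (intro ennreal_leI divide_right_mono) auto
  finally show ?thesis .
qed

lemma nn_integral_inverse_eq_ln:
  assumes "0 < a" "a \<le> 1"
  shows "(\<integral>\<^sup>+t\<in>{a..1}. ennreal (1 / t) \<partial>lborel) = ennreal (- ln a)"
proof -
  have "(\<integral>\<^sup>+t\<in>{a..1}. ennreal (1 / t) \<partial>lborel) = ennreal (ln 1 - ln a)"
    using assms by (intro nn_integral_FTC_Icc) (auto intro!: derivative_eq_intros)
  then show ?thesis by simp
qed

text \<open>The gate is a Carleson set: only the at most four combs within distance two of \<open>y\<close> contribute, and each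
  of them has density \<open>1 / N\<close> on a range of heights of logarithmic length \<open>N ln 2\<close>.\<close>

lemma gate_carleson:
  "(\<integral>\<^sup>+t. ennreal (2 / t\<^sup>2) * (\<integral>\<^sup>+x. indicator gate (t, x) * (if \<bar>x - y\<bar> < t then 1 else 0) \<partial>lborel) \<partial>lborel) \<le> ennreal 32"
proof -
  define M where "M = {N :: nat. 0 < N \<and> \<bar>real N - y\<bar> < 2}"
  have Msub: "M \<subseteq> nat ` {\<lfloor>y\<rfloor> - 1..\<lfloor>y\<rfloor> + 2}"
  proof
    fix N assume "N \<in> M"
    then have "\<bar>real N - y\<bar> < 2" by (simp add: M_def)
    then have "\<lfloor>y\<rfloor> - 1 \<le> int N" "int N \<le> \<lfloor>y\<rfloor> + 2" by linarith+
    then show "N \<in> nat ` {\<lfloor>y\<rfloor> - 1..\<lfloor>y\<rfloor> + 2}" by (intro image_eqI[of _ _ "int N"]) auto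
  qed
  then have finM: "finite M" by (rule finite_subset) simp
  have "card M \<le> card (nat ` {\<lfloor>y\<rfloor> - 1..\<lfloor>y\<rfloor> + 2})" by (intro card_mono Msub) simp
  also have "\<dots> \<le> card {\<lfloor>y\<rfloor> - 1..\<lfloor>y\<rfloor> + 2}" by (rule card_image_le) simp
  finally have cardM: "card M \<le> 4" by simp
  have "(\<integral>\<^sup>+t. ennreal (2 / t\<^sup>2) * (\<integral>\<^sup>+x. indicator gate (t, x) * (if \<bar>x - y\<bar> < t then 1 else 0) \<partial>lborel) \<partial>lborel)
     \<le> (\<integral>\<^sup>+t. (\<Sum>N\<in>M. ennreal (8 / N) * (ennreal (1 / t) * indicator {1 / 2 ^ N..1} t)) \<partial>lborel)"
  proof (rule nn_integral_mono)
    fix t :: real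
    have inner: "indicator gate (t, x) * (if \<bar>x - y\<bar> < t then 1 else 0)
      \<le> (\<Sum>N\<in>M. indicator {1 / 2 ^ N<..1} t * indicator (comb N \<inter> ball y t) x :: ennreal)" for x
    proof (cases "(t, x) \<in> gate \<and> \<bar>x - y\<bar> < t")
      case True
      then obtain N where N: "0 < N" "1 / 2 ^ N < t" "t \<le> 1" "x \<in> comb N" by (auto simp: gate_def Suc_le_eq)
      then have "real N \<le> x" "x < real N + 1" using comb_subset[OF N(1)] by auto
      then have "N \<in> M" using True N by (auto simp: M_def)
      have "(1 :: ennreal) = indicator {1 / 2 ^ N<..1} t * indicator (comb N \<inter> ball y t) x"
        using N True by (simp add: dist_real_def abs_minus_commute)
      also have "\<dots> \<le> (\<Sum>N\<in>M. indicator {1 / 2 ^ N<..1} t * indicator (comb N \<inter> ball y t) x)"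
        using \<open>N \<in> M\<close> finM by (intro member_le_sum) auto
      finally show ?thesis by (simp add: indicator_def)
    qed (auto simp: indicator_def)
    have "(\<integral>\<^sup>+x. indicator gate (t, x) * (if \<bar>x - y\<bar> < t then 1 else 0) \<partial>lborel)
      \<le> (\<integral>\<^sup>+x. (\<Sum>N\<in>M. indicator {1 / 2 ^ N<..1} t * indicator (comb N \<inter> ball y t) x) \<partial>lborel)"
      by (intro nn_integral_mono inner)
    also have "\<dots> = (\<Sum>N\<in>M. indicator {1 / 2 ^ N<..1} t * emeasure lborel (comb N \<inter> ball y t))"
      by (subst nn_integral_sum) (auto simp: nn_integral_cmult_indicator)
    finally have "ennreal (2 / t\<^sup>2) * (\<integral>\<^sup>+x. indicator gate (t, x) * (if \<bar>x - y\<bar> < t then 1 else 0) \<partial>lborel)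
      \<le> ennreal (2 / t\<^sup>2) * (\<Sum>N\<in>M. indicator {1 / 2 ^ N<..1} t * emeasure lborel (comb N \<inter> ball y t))"
      by (rule mult_left_mono) simp
    also have "\<dots> = (\<Sum>N\<in>M. ennreal (2 / t\<^sup>2) * (indicator {1 / 2 ^ N<..1} t * emeasure lborel (comb N \<inter> ball y t)))"
      by (rule sum_distrib_left)
    also have "\<dots> \<le> (\<Sum>N\<in>M. ennreal (8 / N) * (ennreal (1 / t) * indicator {1 / 2 ^ N..1} t))"
    proof (rule sum_mono)
      fix N assume "N \<in> M"
      then have N: "0 < N" by (simp add: M_def)
      show "ennreal (2 / t\<^sup>2) * (indicator {1 / 2 ^ N<..1} t * emeasure lborel (comb N \<inter> ball y t))
        \<le> ennreal (8 / N) * (ennreal (1 / t) * indicator {1 / 2 ^ N..1} t)"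
      proof (cases "t \<in> {1 / 2 ^ N<..1}")
        case True
        then have t: "0 < t" "1 / 2 ^ N < t" by (auto intro: less_trans[rotated])
        have "ennreal (2 / t\<^sup>2) * emeasure lborel (comb N \<inter> ball y t) \<le> ennreal (2 / t\<^sup>2) * ennreal (4 * t / N)"
          by (intro mult_left_mono emeasure_comb_ball_le N t) simp
        also have "\<dots> = ennreal (8 / N) * ennreal (1 / t)"
          using t by (simp add: ennreal_mult'[symmetric] power2_eq_square mult.commute)
        finally show ?thesis using True by simp
      qed simp
    qed
    finally show "ennreal (2 / t\<^sup>2) * (\<integral>\<^sup>+x. indicator gate (t, x) * (if \<bar>x - y\<bar> < t then 1 else 0) \<partial>lborel)
      \<le> (\<Sum>N\<in>M. ennreal (8 / N) * (ennreal (1 / t) * indicator {1 / 2 ^ N..1} t))" .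
  qed
  also have "\<dots> = (\<Sum>N\<in>M. ennreal (8 / N) * (\<integral>\<^sup>+t\<in>{1 / 2 ^ N..1}. ennreal (1 / t) \<partial>lborel))"
    by (subst nn_integral_sum) (auto simp: nn_integral_cmult)
  also have "\<dots> \<le> (\<Sum>N\<in>M. ennreal 8)"
  proof (rule sum_mono)
    fix N assume "N \<in> M"
    then have N: "0 < N" by (simp add: M_def)
    have "(\<integral>\<^sup>+t\<in>{1 / 2 ^ N..1}. ennreal (1 / t) \<partial>lborel) = ennreal (real N * ln 2)"
      by (subst nn_integral_inverse_eq_ln) (auto simp: ln_div ln_realpow)
    also have "\<dots> \<le> ennreal (real N)" using ln_less_self[of 2] ln_2_less_1 by (intro ennreal_leI) (simp add: mult_left_le)
    finally have "ennreal (8 / N) * (\<integral>\<^sup>+t\<in>{1 / 2 ^ N..1}. ennreal (1 / t) \<partial>lborel) \<le> ennreal (8 / N) * ennreal (real N)"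
      by (rule mult_left_mono) simp
    also have "\<dots> = ennreal 8" using N by (subst ennreal_mult[symmetric]) auto
    finally show "ennreal (8 / N) * (\<integral>\<^sup>+t\<in>{1 / 2 ^ N..1}. ennreal (1 / t) \<partial>lborel) \<le> ennreal 8" .
  qed
  also have "\<dots> = ennreal (real (card M) * 8)" by (subst sum_ennreal) auto
  also have "\<dots> \<le> ennreal 32" using cardM by (intro ennreal_leI) simp
  finally show ?thesis .
qed

lemma norm_gated_kernel_le:
  "norm (gated_kernel t x y) \<le> (if (t, x) \<in> gate \<and> \<bar>x - y\<bar> < t then 1 / t else 0)"
proof (cases "(t, x) \<in> gate")
  case True
  then have t: "0 < t" using gate_pos by blast
  have "max 0 (1 - \<bar>x - y\<bar> / t) \<le> (if \<bar>x - y\<bar> < t then 1 else 0)" using t by auto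
  from divide_right_mono[OF this, of t] show ?thesis using t True by (auto simp: gated_kernel_def norm_divide)
qed (simp add: gated_kernel_def)

lemma gated_kernel_lipschitz:
  assumes "0 < t"
  shows "norm (gated_kernel t x y - gated_kernel t x z) \<le> \<bar>y - z\<bar> / t\<^sup>2"
proof (cases "(t, x) \<in> gate")
  case True
  have "\<bar>max 0 (1 - \<bar>x - y\<bar> / t) - max 0 (1 - \<bar>x - z\<bar> / t)\<bar> \<le> \<bar>(\<bar>x - z\<bar> - \<bar>x - y\<bar>) / t\<bar>"
    by (simp add: max_def diff_divide_distrib)
  also have "\<dots> \<le> \<bar>y - z\<bar> / t" using assms by (simp add: abs_divide divide_right_mono)
  finally have "\<bar>max 0 (1 - \<bar>x - y\<bar> / t) - max 0 (1 - \<bar>x - z\<bar> / t)\<bar> / t \<le> \<bar>y - z\<bar> / t / t"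
    using assms by (intro divide_right_mono) auto
  moreover have "gated_kernel t x y - gated_kernel t x z
      = complex_of_real ((max 0 (1 - \<bar>x - y\<bar> / t) - max 0 (1 - \<bar>x - z\<bar> / t)) / t)"
    using True by (simp add: gated_kernel_def diff_divide_distrib)
  ultimately show ?thesis using assms by (simp only: norm_of_real abs_divide) (simp add: power2_eq_square)
qed (use assms in \<open>simp add: gated_kernel_def\<close>)

lemma gated_kernel_measurable [measurable]:
  "(\<lambda>(t, x, y). gated_kernel t x y) \<in> borel_measurable (borel \<Otimes>\<^sub>M borel \<Otimes>\<^sub>M borel)"
proof -
  have "(\<lambda>w. if (fst w, fst (snd w)) \<in> gate then complex_of_real (max 0 (1 - \<bar>fst (snd w) - snd (snd w)\<bar> / fst w) / fst w) else 0)
    \<in> borel_measurable (borel \<Otimes>\<^sub>M borel \<Otimes>\<^sub>M (borel :: real measure))" by measurable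
  then show ?thesis by (simp add: gated_kernel_def[abs_def] case_prod_beta)
qed

text \<open>The kernel vanishes unless \<open>|x - y| < t\<close>, so that \<open>t + |x - y|\<close> is comparable to \<open>t\<close> where it matters. For
  \<open>|y - z| < t\<close> the Lipschitz bound is stronger than the Hoelder bounds of order \<open>\<beta> \<le> 1\<close>.\<close>

lemma gated_kernel_standing:
  assumes \<beta>: "0 < \<beta>" "\<beta> \<le> 1"
  shows "standing_assumptions 1 \<beta> lborel gated_kernel"
  unfolding standing_assumptions_def power_bounded_def standard_kernels_def
proof (intro conjI)
  show "\<exists>C. \<forall>x. \<forall>r>0. emeasure lborel (ball (x :: real) r) \<le> ennreal (C * r powr 1)"
    by (intro exI[of _ 2]) (simp add: ball_eq_greaterThanLessThan)
  show "set_borel_measurable borel ({0<..} \<times> UNIV) (\<lambda>(t, x, y). gated_kernel t x y)"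
  proof -
    have "(\<lambda>w. indicator ({0<..} \<times> UNIV) w *\<^sub>R (case w of (t, x, y) \<Rightarrow> gated_kernel t x y)) = (\<lambda>(t, x, y). gated_kernel t x y)"
      using gate_pos by (auto simp: fun_eq_iff indicator_def gated_kernel_def)
    then show ?thesis
      using gated_kernel_measurable by (simp add: set_borel_measurable_def borel_prod)
  qed
  show "\<exists>C. \<forall>t>0. \<forall>x y. norm (gated_kernel t x y) \<le> C * (t powr \<beta> / (t + dist x y) powr (1 + \<beta>))"
  proof (intro exI[of _ "2 powr (1 + \<beta>)"] allI impI)
    fix t x y :: real assume t: "0 < t"
    show "norm (gated_kernel t x y) \<le> 2 powr (1 + \<beta>) * (t powr \<beta> / (t + dist x y) powr (1 + \<beta>))"
    proof (cases "\<bar>x - y\<bar> < t")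
      case True
      have "1 / t = t powr \<beta> * (1 / t powr (1 + \<beta>))" using t by (simp add: powr_add)
      also have "\<dots> \<le> t powr \<beta> * (2 powr (1 + \<beta>) / (t + dist x y) powr (1 + \<beta>))"
        using t True \<beta> by (intro mult_left_mono inverse_powr_le_cmult) (auto simp: dist_real_def)
      finally show ?thesis using norm_gated_kernel_le[of t x y] t by (auto split: if_splits simp: mult_ac intro: order_trans)
    next
      case False
      then show ?thesis using norm_gated_kernel_le[of t x y] by (auto split: if_splits intro: order_trans)
    qed
  qed
  show "\<exists>C. \<forall>t>0. \<forall>x y z. dist y z < t / 2 \<longrightarrow>
      norm (gated_kernel t x y - gated_kernel t x z) \<le> C * (dist y z powr \<beta> / (t + dist x y) powr (1 + \<beta>))"
  proof (intro exI[of _ "3 powr (1 + \<beta>)"] allI impI)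
    fix t x y z :: real assume t: "0 < t" and yz: "dist y z < t / 2"
    show "norm (gated_kernel t x y - gated_kernel t x z) \<le> 3 powr (1 + \<beta>) * (dist y z powr \<beta> / (t + dist x y) powr (1 + \<beta>))"
    proof (cases "\<bar>x - y\<bar> < 2 * t")
      case True
      have "\<bar>y - z\<bar> / t\<^sup>2 = (\<bar>y - z\<bar> / t) * (1 / t)" by (simp add: power2_eq_square)
      also have "\<dots> \<le> (\<bar>y - z\<bar> / t) powr \<beta> * (1 / t)"
      proof (rule mult_right_mono)
        show "\<bar>y - z\<bar> / t \<le> (\<bar>y - z\<bar> / t) powr \<beta>"
        proof (cases "y = z")
          case False
          then have "0 < \<bar>y - z\<bar> / t" "\<bar>y - z\<bar> / t \<le> 1" using t yz by (auto simp: dist_real_def)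
          then show ?thesis using powr_mono'[of \<beta> 1 "\<bar>y - z\<bar> / t"] \<beta> t by simp
        qed simp
      qed (use t in simp)
      also have "\<dots> = \<bar>y - z\<bar> powr \<beta> * (1 / t powr (1 + \<beta>))" using t by (simp add: powr_divide powr_add)
      also have "\<dots> \<le> \<bar>y - z\<bar> powr \<beta> * (3 powr (1 + \<beta>) / (t + dist x y) powr (1 + \<beta>))"
        using t True \<beta> by (intro mult_left_mono inverse_powr_le_cmult) (auto simp: dist_real_def)
      finally show ?thesis using gated_kernel_lipschitz[OF t, of x y z] by (simp add: dist_real_def mult_ac)
    next
      case False
      moreover have "\<bar>y - z\<bar> < t / 2" using yz by (simp add: dist_real_def)
      ultimately have "\<not> \<bar>x - y\<bar> < t" "\<not> \<bar>x - z\<bar> < t" using t by linarith+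
      then have "gated_kernel t x y = 0" "gated_kernel t x z = 0"
        using norm_gated_kernel_le[of t x y] norm_gated_kernel_le[of t x z] by (auto split: if_splits)
      then show ?thesis by simp
    qed
  qed
qed (use \<beta> in auto)

lemma vertical_power2: "(vertical \<mu> s f x)\<^sup>2 = (\<integral>\<^sup>+t\<in>{0<..}. ennreal ((norm (\<theta> \<mu> s t f x))\<^sup>2 / t) \<partial>lborel)"
  by (simp add: vertical_def epowr_half_power2)

text \<open>By the Cauchy--Schwarz inequality the square of \<open>\<theta>\<^sub>t f(x)\<close> is at most \<open>2 / t\<close> times the integral of \<open>|f|\<^sup>2\<close> over
  the interval of radius \<open>t\<close> around \<open>x\<close>. Tonelli's theorem then leaves the Carleson integral of the gate at
  each \<open>y\<close>.\<close>

lemma gated_L2: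
  assumes [measurable]: "f \<in> borel_measurable borel"
  shows "(\<integral>\<^sup>+x. (vertical lborel gated_kernel f x)\<^sup>2 \<partial>lborel) \<le> ennreal 32 * (\<integral>\<^sup>+y. (ennreal (norm (f y)))\<^sup>2 \<partial>lborel)"
proof -
  let ?h = "\<lambda>y. (ennreal (norm (f y)))\<^sup>2"
  let ?b = "\<lambda>x t y. (if \<bar>x - y\<bar> < t then 1 else 0) :: ennreal"
  let ?\<Phi> = "\<lambda>x t y. indicator gate (t, x) * ennreal (2 / t\<^sup>2) * (?b x t y * ?h y)"
  have pt: "ennreal ((norm (\<theta> lborel gated_kernel t f x))\<^sup>2 / t) * indicator {0<..} t \<le> (\<integral>\<^sup>+y. ?\<Phi> x t y \<partial>lborel)" for x t :: real
  proof (cases "(t, x) \<in> gate")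
    case True
    then have t: "0 < t" using gate_pos by blast
    have "ennreal (norm (\<theta> lborel gated_kernel t f x)) \<le> (\<integral>\<^sup>+y. ennreal (norm (gated_kernel t x y * f y)) \<partial>lborel)"
      unfolding \<theta>_def by (rule norm_integral_le_nn_integral)
    also have "\<dots> \<le> (\<integral>\<^sup>+y. (ennreal (1 / t) * ?b x t y) * (?b x t y * ennreal (norm (f y))) \<partial>lborel)"
    proof (rule nn_integral_mono)
      fix y
      have "norm (gated_kernel t x y * f y) \<le> (if \<bar>x - y\<bar> < t then 1 / t else 0) * norm (f y)"
        unfolding norm_mult using norm_gated_kernel_le[of t x y] True by (intro mult_right_mono) auto
      then show "ennreal (norm (gated_kernel t x y * f y)) \<le> (ennreal (1 / t) * ?b x t y) * (?b x t y * ennreal (norm (f y)))"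
        using t by (cases "\<bar>x - y\<bar> < t") (auto simp: ennreal_mult[symmetric] intro: ennreal_leI)
    qed
    finally have "(ennreal (norm (\<theta> lborel gated_kernel t f x)))\<^sup>2
      \<le> (\<integral>\<^sup>+y. (ennreal (1 / t) * ?b x t y) * (?b x t y * ennreal (norm (f y))) \<partial>lborel)\<^sup>2" by (rule power_mono) simp
    also have "\<dots> \<le> (\<integral>\<^sup>+y. (ennreal (1 / t) * ?b x t y)\<^sup>2 \<partial>lborel) * (\<integral>\<^sup>+y. (?b x t y * ennreal (norm (f y)))\<^sup>2 \<partial>lborel)"
      by (rule Cauchy_Schwarz_nn_integral) measurable
    also have "(\<integral>\<^sup>+y. (ennreal (1 / t) * ?b x t y)\<^sup>2 \<partial>lborel) = (\<integral>\<^sup>+y. ennreal (1 / t\<^sup>2) * indicator {x - t<..<x + t} y \<partial>lborel)"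
      using t by (intro nn_integral_cong) (auto simp: indicator_def ennreal_power power_divide power2_eq_square[of 0])
    also have "\<dots> = ennreal (1 / t\<^sup>2) * ennreal (2 * t)" using t by (simp add: nn_integral_cmult_indicator)
    also have "\<dots> = ennreal (2 / t)" using t by (simp add: ennreal_mult'[symmetric] power2_eq_square)
    also have "(\<integral>\<^sup>+y. (?b x t y * ennreal (norm (f y)))\<^sup>2 \<partial>lborel) = (\<integral>\<^sup>+y. ?b x t y * ?h y \<partial>lborel)"
      by (intro nn_integral_cong) (auto simp: power2_eq_square)
    finally have sq: "(ennreal (norm (\<theta> lborel gated_kernel t f x)))\<^sup>2 \<le> ennreal (2 / t) * (\<integral>\<^sup>+y. ?b x t y * ?h y \<partial>lborel)" .
    have "ennreal ((norm (\<theta> lborel gated_kernel t f x))\<^sup>2 / t) = ennreal (1 / t) * (ennreal (norm (\<theta> lborel gated_kernel t f x)))\<^sup>2"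
      using t by (simp add: ennreal_power ennreal_mult'[symmetric])
    also have "\<dots> \<le> ennreal (1 / t) * (ennreal (2 / t) * (\<integral>\<^sup>+y. ?b x t y * ?h y \<partial>lborel))" by (intro mult_left_mono sq) simp
    also have "\<dots> = ennreal (2 / t\<^sup>2) * (\<integral>\<^sup>+y. ?b x t y * ?h y \<partial>lborel)"
      using t by (simp add: mult.assoc[symmetric] ennreal_mult'[symmetric] power2_eq_square)
    also have "\<dots> = (\<integral>\<^sup>+y. ?\<Phi> x t y \<partial>lborel)"
      using True by (subst nn_integral_cmult) auto
    finally show ?thesis using t by simp
  next
    case False
    then show ?thesis by (simp add: \<theta>_def gated_kernel_def)
  qed
  have "(\<integral>\<^sup>+x. (vertical lborel gated_kernel f x)\<^sup>2 \<partial>lborel) \<le> (\<integral>\<^sup>+x. (\<integral>\<^sup>+t. (\<integral>\<^sup>+y. ?\<Phi> x t y \<partial>lborel) \<partial>lborel) \<partial>lborel)"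
    unfolding vertical_power2 by (intro nn_integral_mono pt)
  also have "\<dots> = (\<integral>\<^sup>+t. (\<integral>\<^sup>+x. (\<integral>\<^sup>+y. ?\<Phi> x t y \<partial>lborel) \<partial>lborel) \<partial>lborel)"
    by (rule lborel_pair.Fubini'[symmetric]) measurable
  also have "\<dots> = (\<integral>\<^sup>+t. (\<integral>\<^sup>+y. (\<integral>\<^sup>+x. ?\<Phi> x t y \<partial>lborel) \<partial>lborel) \<partial>lborel)"
    by (intro nn_integral_cong lborel_pair.Fubini'[symmetric]) measurable
  also have "\<dots> = (\<integral>\<^sup>+y. (\<integral>\<^sup>+t. (\<integral>\<^sup>+x. ?\<Phi> x t y \<partial>lborel) \<partial>lborel) \<partial>lborel)"
    by (rule lborel_pair.Fubini') measurable
  also have "\<dots> = (\<integral>\<^sup>+y. ?h y * (\<integral>\<^sup>+t. ennreal (2 / t\<^sup>2) * (\<integral>\<^sup>+x. indicator gate (t, x) * ?b x t y \<partial>lborel) \<partial>lborel) \<partial>lborel)"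
  proof (rule nn_integral_cong)
    fix y :: real
    have "(\<integral>\<^sup>+x. ?\<Phi> x t y \<partial>lborel) = ?h y * (ennreal (2 / t\<^sup>2) * (\<integral>\<^sup>+x. indicator gate (t, x) * ?b x t y \<partial>lborel))" for t
    proof -
      have "(\<integral>\<^sup>+x. ?\<Phi> x t y \<partial>lborel) = (\<integral>\<^sup>+x. (?h y * ennreal (2 / t\<^sup>2)) * (indicator gate (t, x) * ?b x t y) \<partial>lborel)"
        by (intro nn_integral_cong) (simp add: mult_ac)
      also have "\<dots> = (?h y * ennreal (2 / t\<^sup>2)) * (\<integral>\<^sup>+x. indicator gate (t, x) * ?b x t y \<partial>lborel)"
        by (rule nn_integral_cmult) measurable
      finally show ?thesis by (simp only: mult.assoc)
    qed
    then have "(\<integral>\<^sup>+t. (\<integral>\<^sup>+x. ?\<Phi> x t y \<partial>lborel) \<partial>lborel)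
      = (\<integral>\<^sup>+t. ?h y * (ennreal (2 / t\<^sup>2) * (\<integral>\<^sup>+x. indicator gate (t, x) * ?b x t y \<partial>lborel)) \<partial>lborel)" by simp
    also have "\<dots> = ?h y * (\<integral>\<^sup>+t. ennreal (2 / t\<^sup>2) * (\<integral>\<^sup>+x. indicator gate (t, x) * ?b x t y \<partial>lborel) \<partial>lborel)"
      by (rule nn_integral_cmult) measurable
    finally show "(\<integral>\<^sup>+t. (\<integral>\<^sup>+x. ?\<Phi> x t y \<partial>lborel) \<partial>lborel)
      = ?h y * (\<integral>\<^sup>+t. ennreal (2 / t\<^sup>2) * (\<integral>\<^sup>+x. indicator gate (t, x) * ?b x t y \<partial>lborel) \<partial>lborel)" .
  qed
  also have "\<dots> \<le> (\<integral>\<^sup>+y. ?h y * ennreal 32 \<partial>lborel)"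
    by (intro nn_integral_mono mult_left_mono gate_carleson) simp
  also have "\<dots> = ennreal 32 * (\<integral>\<^sup>+y. ?h y \<partial>lborel)"
    by (subst mult.commute) (rule nn_integral_cmult, measurable)
  finally show ?thesis .
qed

text \<open>Over a point of the comb the kernel is switched on at all heights between \<open>2\<^sup>-\<^sup>N\<close> and \<open>1\<close>, at which it sees
  the constant one and hence averages to at least \<open>1 / 2\<close>.\<close>

lemma vertical_gated_ge:
  assumes N: "0 < N" and x: "x \<in> comb N"
  shows "ennreal (real N * ln 2 / 4) \<le> (vertical lborel gated_kernel (indicator {real N - 1..real N + 2}) x)\<^sup>2"
proof -
  let ?f = "indicator {real N - 1..real N + 2} :: real \<Rightarrow> complex"
  have xN: "real N \<le> x" "x < real N + 1" using comb_subset[OF N] x by auto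
  have \<theta>_ge: "1 / 2 \<le> norm (\<theta> lborel gated_kernel t ?f x)" if t: "1 / 2 ^ N < t" "t \<le> 1" for t
  proof -
    have t0: "0 < t" using t(1) by (meson less_trans zero_less_divide_1_iff zero_less_power zero_less_numeral)
    have g: "(t, x) \<in> gate" using N t x by (auto simp: gate_def Suc_le_eq)
    let ?F = "\<lambda>y. max 0 (1 - \<bar>x - y\<bar> / t) / t"
    have eq: "gated_kernel t x y * ?f y = complex_of_real (?F y)" for y
    proof (cases "\<bar>x - y\<bar> < t")
      case True
      then have "y \<in> {real N - 1..real N + 2}" using xN t by auto
      then show ?thesis using g by (simp add: gated_kernel_def)
    next
      case False
      then have "max 0 (1 - \<bar>x - y\<bar> / t) = 0" using t0 by (simp add: max_def)
      then show ?thesis using g by (simp add: gated_kernel_def)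
    qed
    have bnd: "0 \<le> ?F y" "?F y \<le> 1 / t * indicator {x - t..x + t} y" for y
      using t0 by (auto simp: indicator_def max_def field_simps)
    have int: "integrable lborel ?F"
    proof (rule Bochner_Integration.integrable_bound[where f = "\<lambda>y. 1 / t * indicator {x - t..x + t} y :: real"])
      show "integrable lborel (\<lambda>y. 1 / t * indicator {x - t..x + t} y :: real)"
        by (rule integrable_mult_right, rule integrable_real_indicator) (simp_all add: emeasure_lborel_Icc_eq)
      show "AE y in lborel. norm (?F y) \<le> norm (1 / t * indicator {x - t..x + t} y :: real)"
        using bnd t0 by (intro AE_I2) (simp add: abs_of_nonneg)
    qed measurable
    have "1 / 2 = (\<integral>y. 1 / (2 * t) * indicator {x - t / 2..x + t / 2} y \<partial>lborel)" using t0 by simp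
    also have "\<dots> \<le> (\<integral>y. ?F y \<partial>lborel)"
    proof (rule integral_mono)
      show "integrable lborel (\<lambda>y. 1 / (2 * t) * indicator {x - t / 2..x + t / 2} y :: real)"
        by (rule integrable_mult_right, rule integrable_real_indicator) (simp_all add: emeasure_lborel_Icc_eq)
      fix y
      show "1 / (2 * t) * indicator {x - t / 2..x + t / 2} y \<le> ?F y"
      proof (cases "y \<in> {x - t / 2..x + t / 2}")
        case True
        then have "\<bar>x - y\<bar> \<le> t / 2" unfolding atLeastAtMost_iff by linarith
        then have "\<bar>x - y\<bar> / t \<le> 1 / 2" using t0 by (simp add: field_simps)
        then have "1 / 2 / t \<le> ?F y" using t0 by (intro divide_right_mono) auto
        then show ?thesis using True by simp
      qed (use bnd in simp)
    qed (rule int)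
    finally have "1 / 2 \<le> (\<integral>y. ?F y \<partial>lborel)" .
    moreover have "\<theta> lborel gated_kernel t ?f x = complex_of_real (\<integral>y. ?F y \<partial>lborel)"
      unfolding \<theta>_def eq by (rule integral_complex_of_real)
    ultimately show ?thesis by (simp only: norm_of_real)
  qed
  have "ennreal (real N * ln 2 / 4) = ennreal (1 / 4) * ennreal (real N * ln 2)"
    by (subst ennreal_mult'[symmetric]) auto
  also have "\<dots> = ennreal (1 / 4) * (\<integral>\<^sup>+t\<in>{1 / 2 ^ N..1}. ennreal (1 / t) \<partial>lborel)"
    by (subst nn_integral_inverse_eq_ln) (auto simp: ln_div ln_realpow)
  also have "\<dots> = (\<integral>\<^sup>+t. ennreal (1 / 4) * (ennreal (1 / t) * indicator {1 / 2 ^ N..1} t) \<partial>lborel)"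
    by (rule nn_integral_cmult[symmetric]) measurable
  also have "\<dots> \<le> (\<integral>\<^sup>+t\<in>{0<..}. ennreal ((norm (\<theta> lborel gated_kernel t ?f x))\<^sup>2 / t) \<partial>lborel)"
  proof (rule nn_integral_mono_AE, rule eventually_mono[OF AE_lborel_singleton[of "1 / 2 ^ N"]])
    fix t :: real assume ne: "t \<noteq> 1 / 2 ^ N"
    show "ennreal (1 / 4) * (ennreal (1 / t) * indicator {1 / 2 ^ N..1} t)
      \<le> ennreal ((norm (\<theta> lborel gated_kernel t ?f x))\<^sup>2 / t) * indicator {0<..} t"
    proof (cases "t \<in> {1 / 2 ^ N..1}")
      case True
      then have t: "1 / 2 ^ N < t" "t \<le> 1" using ne by auto
      then have t0: "0 < t" by (meson less_trans zero_less_divide_1_iff zero_less_power zero_less_numeral)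
      have "(1 / 2)\<^sup>2 \<le> (norm (\<theta> lborel gated_kernel t ?f x))\<^sup>2" by (intro power_mono \<theta>_ge t) simp
      then have "1 / 4 * (1 / t) \<le> (norm (\<theta> lborel gated_kernel t ?f x))\<^sup>2 / t"
        using t0 by (simp add: power_divide field_simps)
      then show ?thesis using True t0 by (simp add: ennreal_mult'[symmetric] ennreal_leI del: times_divide_eq_left)
    qed simp
  qed
  finally show ?thesis by (simp add: vertical_power2)
qed

section \<open>The boundedness statements\<close>

lemma Lp_norm_finite_eq:
  assumes "p \<noteq> \<infinity>" shows "Lp_norm \<mu> p g = epowr (\<integral>\<^sup>+x. epowr (g x) (enn2real p) \<partial>\<mu>) (1 / enn2real p)"
  using assms by (simp add: Lp_norm_def)

lemma bounded_on_Lp_iff: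
  assumes "p = ennreal r" "1 \<le> r"
  shows "bounded_on_Lp p \<mu> T \<longleftrightarrow> (\<exists>C. 0 \<le> C \<and> (\<forall>f\<in>borel_measurable \<mu>. (\<integral>\<^sup>+y. ennreal (norm (f y) powr r) \<partial>\<mu>) < \<infinity> \<longrightarrow>
    (\<integral>\<^sup>+x. epowr (T f x) r \<partial>\<mu>) \<le> ennreal C * (\<integral>\<^sup>+y. ennreal (norm (f y) powr r) \<partial>\<mu>)))"
proof -
  have r: "p \<noteq> \<infinity>" "enn2real p = r" using assms by auto
  have norm_eq: "Lp_norm \<mu> p (\<lambda>x. ennreal (norm (f x))) = epowr (\<integral>\<^sup>+y. ennreal (norm (f y) powr r) \<partial>\<mu>) (1 / r)" for f :: "_ \<Rightarrow> complex"
    unfolding Lp_norm_finite_eq[OF r(1)] r(2) by (simp add: epowr_ennreal)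
  have fin: "epowr I (1 / r) < \<infinity> \<longleftrightarrow> I < \<infinity>" for I by (auto simp: epowr_def less_top)
  have inv: "epowr (epowr x (1 / r)) r = x" "epowr (epowr x r) (1 / r) = x" for x
    using assms by (simp_all add: epowr_epowr)
  have mono: "epowr x (1 / r) \<le> y \<longleftrightarrow> x \<le> epowr y r" for x y
    using epowr_mono[of "epowr x (1 / r)" y r] epowr_mono[of x "epowr y r" "1 / r"] assms by (auto simp: inv)
  have Lp: "f \<in> Lp \<mu> p \<longleftrightarrow> f \<in> borel_measurable \<mu> \<and> (\<integral>\<^sup>+y. ennreal (norm (f y) powr r) \<partial>\<mu>) < \<infinity>" for f
    unfolding Lp_def norm_eq fin by simp
  have le_iff: "Lp_norm \<mu> p (T f) \<le> ennreal C * Lp_norm \<mu> p (\<lambda>x. ennreal (norm (f x)))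
      \<longleftrightarrow> (\<integral>\<^sup>+x. epowr (T f x) r \<partial>\<mu>) \<le> ennreal (C powr r) * (\<integral>\<^sup>+y. ennreal (norm (f y) powr r) \<partial>\<mu>)"
    if "0 \<le> C" for C f
    unfolding norm_eq unfolding Lp_norm_finite_eq[OF r(1)] r(2) mono using that assms by (simp add: epowr_cmult inv)
  show ?thesis
  proof
    assume "bounded_on_Lp p \<mu> T"
    then obtain C where C: "\<And>f. f \<in> Lp \<mu> p \<Longrightarrow> Lp_norm \<mu> p (T f) \<le> ennreal C * Lp_norm \<mu> p (\<lambda>x. ennreal (norm (f x)))"
      by (auto simp: bounded_on_Lp_def)
    define C' where "C' = max C 0"
    have "ennreal C = ennreal C'" by (cases "0 \<le> C") (auto simp: C'_def max_def ennreal_neg)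
    then show "\<exists>C. 0 \<le> C \<and> (\<forall>f\<in>borel_measurable \<mu>. (\<integral>\<^sup>+y. ennreal (norm (f y) powr r) \<partial>\<mu>) < \<infinity> \<longrightarrow>
        (\<integral>\<^sup>+x. epowr (T f x) r \<partial>\<mu>) \<le> ennreal C * (\<integral>\<^sup>+y. ennreal (norm (f y) powr r) \<partial>\<mu>))"
      using C le_iff[of C'] by (intro exI[of _ "C' powr r"]) (auto simp: Lp C'_def)
  next
    assume "\<exists>C. 0 \<le> C \<and> (\<forall>f\<in>borel_measurable \<mu>. (\<integral>\<^sup>+y. ennreal (norm (f y) powr r) \<partial>\<mu>) < \<infinity> \<longrightarrow>
        (\<integral>\<^sup>+x. epowr (T f x) r \<partial>\<mu>) \<le> ennreal C * (\<integral>\<^sup>+y. ennreal (norm (f y) powr r) \<partial>\<mu>))"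
    then obtain C where C: "0 \<le> C" "\<forall>f\<in>borel_measurable \<mu>. (\<integral>\<^sup>+y. ennreal (norm (f y) powr r) \<partial>\<mu>) < \<infinity> \<longrightarrow>
        (\<integral>\<^sup>+x. epowr (T f x) r \<partial>\<mu>) \<le> ennreal C * (\<integral>\<^sup>+y. ennreal (norm (f y) powr r) \<partial>\<mu>)" by blast
    have "(C powr (1 / r)) powr r = C" using C(1) assms by (simp add: powr_powr)
    then show "bounded_on_Lp p \<mu> T"
      unfolding bounded_on_Lp_def using C le_iff[of "C powr (1 / r)"] by (intro exI[of _ "C powr (1 / r)"]) (auto simp: Lp)
  qed
qed

lemma bounded_on_L2_iff:
  "bounded_on_Lp 2 \<mu> T \<longleftrightarrow> (\<exists>C. 0 \<le> C \<and> (\<forall>f\<in>borel_measurable \<mu>. (\<integral>\<^sup>+y. (ennreal (norm (f y)))\<^sup>2 \<partial>\<mu>) < \<infinity> \<longrightarrow>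
    (\<integral>\<^sup>+x. (T f x)\<^sup>2 \<partial>\<mu>) \<le> ennreal C * (\<integral>\<^sup>+y. (ennreal (norm (f y)))\<^sup>2 \<partial>\<mu>)))"
  using bounded_on_Lp_iff[of 2 2 \<mu> T] by (simp add: epowr_two ennreal_power)

lemma bounded_L1_weak_L1I:
  assumes "\<And>f \<tau>. f \<in> borel_measurable \<mu> \<Longrightarrow> (\<integral>\<^sup>+y. ennreal (norm (f y)) \<partial>\<mu>) < \<infinity> \<Longrightarrow> 0 < \<tau> \<Longrightarrow>
    ennreal \<tau> * emeasure \<mu> {x \<in> space \<mu>. ennreal \<tau> < T f x} \<le> ennreal C * (\<integral>\<^sup>+y. ennreal (norm (f y)) \<partial>\<mu>)"
  shows "bounded_L1_weak_L1 \<mu> T"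
proof -
  have "Lp_norm \<mu> 1 (\<lambda>x. ennreal (norm (f x))) = (\<integral>\<^sup>+y. ennreal (norm (f y)) \<partial>\<mu>)" for f :: "_ \<Rightarrow> complex"
    by (simp add: Lp_norm_def epowr_ennreal)
  then show ?thesis
    unfolding bounded_L1_weak_L1_def Lp_def using assms by (intro exI[of _ C]) auto
qed

lemma (in L2_square_function) bounded_weak_and_below_2:
  assumes T_eq: "\<And>f. f \<in> borel_measurable borel \<Longrightarrow> S f = sq (T f)"
  shows "bounded_L1_weak_L1 \<mu> S" and "1 < p \<Longrightarrow> p < 2 \<Longrightarrow> bounded_on_Lp p \<mu> S"
proof -
  show "bounded_L1_weak_L1 \<mu> S"
    by (rule bounded_L1_weak_L1I[where C = weak_const]) (use weak_type_L1 T_eq in auto)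
  assume p: "1 < p" "p < 2"
  then obtain r where r: "p = ennreal r" "0 \<le> r" by (cases p) auto
  have "ennreal 1 < ennreal r" "ennreal r < ennreal 2" using p by (simp_all add: r(1))
  then have r1: "1 < r" "r < 2" using r(2) by (simp_all add: ennreal_less_iff del: ennreal_1 ennreal_numeral)
  have "0 \<le> r * (2 * weak_const / (r - 1) + 4 * B / (2 - r))"
    using r1 weak_const_pos B_pos by (intro mult_nonneg_nonneg add_nonneg_nonneg) auto
  then show "bounded_on_Lp p \<mu> S"
    unfolding bounded_on_Lp_iff[OF r(1) less_imp_le[OF r1(1)]]
    using strong_type_below_2[OF r1] T_eq by (intro exI[of _ "r * (2 * weak_const / (r - 1) + 4 * B / (2 - r))"]) auto
qed

lemma (in L2_conical) bounded_above_2: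
  assumes T_eq: "\<And>f. f \<in> borel_measurable borel \<Longrightarrow> S f = conical.sq (T f)" and p: "2 < p" "p < \<infinity>"
  shows "bounded_on_Lp p \<mu> S"
proof -
  obtain r where r: "p = ennreal r" "0 \<le> r" using p by (cases p) auto
  have "ennreal 2 < ennreal r" using p by (simp add: r(1))
  then have r2: "2 < r" by (simp add: ennreal_less_iff del: ennreal_numeral)
  then have r1: "1 \<le> r" by simp
  show ?thesis
    unfolding bounded_on_Lp_iff[OF r(1) r1] using strong_type_above_2[OF r2] T_eq by auto
qed

lemma (in L2_conical) bounded_Linf_RBMO_conical:
  assumes T_eq: "\<And>f. f \<in> borel_measurable borel \<Longrightarrow> S f = conical.sq (T f)" and \<kappa>: "1 < \<kappa>"
  shows "bounded_Linf_RBMO m \<kappa> \<mu> S"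
  unfolding bounded_Linf_RBMO_def
proof (intro exI[of _ "rbmo_const \<kappa>"] ballI)
  fix f assume "f \<in> Lp \<mu> \<infinity>"
  then have [measurable]: "f \<in> borel_measurable borel" and fin: "Lp_norm \<mu> \<infinity> (\<lambda>x. ennreal (norm (f x))) < \<infinity>"
    by (auto simp: Lp_def)
  define L where "L = enn2real (Lp_norm \<mu> \<infinity> (\<lambda>x. ennreal (norm (f x))))"
  have L: "Lp_norm \<mu> \<infinity> (\<lambda>x. ennreal (norm (f x))) = ennreal L" using fin by (simp add: L_def)
  have L0: "0 \<le> L" by (simp add: L_def)
  define g where "g y = (if norm (f y) \<le> L then f y else 0)" for y
  have [measurable]: "g \<in> borel_measurable borel" unfolding g_def[abs_def] by measurable
  have gL: "norm (g y) \<le> L" for y using L0 by (simp add: g_def)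
  have "AE y in \<mu>. ennreal (norm (f y)) \<le> ennreal L"
    using esssup_AE[of "\<lambda>x. ennreal (norm (f x))" \<mu>] L by (simp add: Lp_norm_def)
  then have fg: "AE y in \<mu>. f y = g y" by eventually_elim (use L0 in \<open>simp add: g_def\<close>)
  have "T f z = T g z" for z
    unfolding T_def
  proof (rule integral_cong_AE)
    show "(\<lambda>y. k (snd z) (fst z) y * f y) \<in> borel_measurable \<mu>"
      "(\<lambda>y. k (snd z) (fst z) y * g y) \<in> borel_measurable \<mu>" by measurable
    show "AE y in \<mu>. k (snd z) (fst z) y * f y = k (snd z) (fst z) y * g y" using fg by eventually_elim simp
  qed
  then have "T f = T g" by (rule ext)
  then have Sf: "S f = conical.sq (T g)" using T_eq[of f] by simp
  have adm: "RBMO_norm m \<kappa> \<mu> h \<le> ennreal (rbmo_const \<kappa>) * ennreal L" if "RBMO_admissible m \<kappa> \<mu> h (rbmo_const \<kappa> * L)" for h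
  proof -
    have "RBMO_norm m \<kappa> \<mu> h \<le> ennreal (rbmo_const \<kappa> * L)"
      unfolding RBMO_norm_def using that by (intro Inf_lower) auto
    also have "\<dots> = ennreal (rbmo_const \<kappa>) * ennreal L" using L0 by (rule ennreal_mult'')
    finally show ?thesis .
  qed
  show "(AE x in \<mu>. S f x = \<infinity>) \<or>
     ((AE x in \<mu>. S f x < \<infinity>) \<and> (\<lambda>x. enn2real (S f x)) \<in> RBMO m \<kappa> \<mu> \<and>
      RBMO_norm m \<kappa> \<mu> (\<lambda>x. enn2real (S f x)) \<le> ennreal (rbmo_const \<kappa>) * Lp_norm \<mu> \<infinity> (\<lambda>x. ennreal (norm (f x))))"
    using bounded_function_RBMO[OF \<kappa> \<open>g \<in> borel_measurable borel\<close> gL] unfolding L Sf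
  proof (elim disjE conjE)
    assume fin: "AE x in \<mu>. conical.sq (T g) x < \<infinity>"
      and "\<forall>a r. set_integrable \<mu> (ball a r) (\<lambda>x. enn2real (conical.sq (T g) x))"
      and rbmo: "RBMO_admissible m \<kappa> \<mu> (\<lambda>x. enn2real (conical.sq (T g) x)) (rbmo_const \<kappa> * L)"
    then have "(\<lambda>x. enn2real (conical.sq (T g) x)) \<in> RBMO m \<kappa> \<mu>" by (auto simp: RBMO_def)
    with fin adm[OF rbmo] show "(AE x in \<mu>. conical.sq (T g) x = \<infinity>) \<or>
     ((AE x in \<mu>. conical.sq (T g) x < \<infinity>) \<and> (\<lambda>x. enn2real (conical.sq (T g) x)) \<in> RBMO m \<kappa> \<mu> \<and>
      RBMO_norm m \<kappa> \<mu> (\<lambda>x. enn2real (conical.sq (T g) x)) \<le> ennreal (rbmo_const \<kappa>) * ennreal L)" by blast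
  qed auto
qed

lemma exists_power_gt:
  assumes "0 < c" "0 < (e :: real)"
  obtains N :: nat where "0 < N" "M < c * real N powr e"
proof -
  obtain N :: nat where N: "(\<bar>M\<bar> / c) powr (1 / e) + 1 < real N" using reals_Archimedean2 by blast
  have "((\<bar>M\<bar> / c) powr (1 / e)) powr e < real N powr e"
    using N assms by (intro powr_less_mono2) auto
  then have "\<bar>M\<bar> / c < real N powr e" using assms by (simp add: powr_powr)
  then have "M < c * real N powr e" using assms by (simp add: field_simps)
  moreover have "0 < N"
  proof -
    have "0 \<le> (\<bar>M\<bar> / c) powr (1 / e)" by simp
    then have "0 < real N" using N by linarith
    then show ?thesis by simp
  qed
  ultimately show ?thesis by (rule that[rotated])
qed

text \<open>On the comb of density \<open>1 / N\<close> the vertical square function of the indicator of an interval of length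
  three is at least a multiple of \<open>\<surd>N\<close>, so that its \<open>L\<^sup>p\<close> norm is at least a multiple of \<open>N\<close> to the power
  \<open>1 / 2 - 1 / p\<close>.\<close>

lemma gated_unbounded:
  assumes p: "2 < p"
  shows "\<not> bounded_on_Lp p lborel (vertical lborel gated_kernel)"
proof
  assume "bounded_on_Lp p lborel (vertical lborel gated_kernel)"
  then obtain C0 where C0: "\<And>f. f \<in> Lp lborel p \<Longrightarrow>
      Lp_norm lborel p (vertical lborel gated_kernel f) \<le> ennreal C0 * Lp_norm lborel p (\<lambda>x. ennreal (norm (f x)))"
    by (auto simp: bounded_on_Lp_def)
  define C where "C = max C0 0"
  have C: "0 \<le> C" "ennreal C0 \<le> ennreal C" by (auto simp: C_def intro: ennreal_leI)
  define e where "e = (if p = \<infinity> then 0 else 1 / enn2real p)"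
  let ?f = "\<lambda>N :: nat. indicator {real N - 1..real N + 2} :: real \<Rightarrow> complex"
  have r2: "2 < enn2real p" if "p \<noteq> \<infinity>"
  proof -
    obtain r where r: "p = ennreal r" "0 \<le> r" using \<open>p \<noteq> \<infinity>\<close> by (cases p) auto
    have "ennreal 2 < ennreal r" using p by (simp add: r(1))
    then show ?thesis using r by (simp add: ennreal_less_iff del: ennreal_numeral)
  qed
  have e: "e < 1 / 2" using r2 by (auto simp: e_def divide_simps)
  have f_norm: "Lp_norm lborel p (\<lambda>x. ennreal (norm (?f N x))) \<le> ennreal 3" for N
  proof (cases "p = \<infinity>")
    case True
    have "esssup lborel (\<lambda>x. ennreal (norm (?f N x))) \<le> ennreal 3"
      by (rule esssup_I) (auto simp: indicator_def simp del: ennreal_numeral)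
    then show ?thesis using True by (simp add: Lp_norm_def)
  next
    case False
    let ?r = "enn2real p"
    have "(\<integral>\<^sup>+x. epowr (ennreal (norm (?f N x))) ?r \<partial>lborel) = (\<integral>\<^sup>+x. indicator {real N - 1..real N + 2} x \<partial>lborel)"
      using r2[OF False] by (intro nn_integral_cong) (auto simp: indicator_def epowr_def)
    also have "\<dots> = ennreal 3" by simp
    finally have "Lp_norm lborel p (\<lambda>x. ennreal (norm (?f N x))) = ennreal (3 powr (1 / ?r))"
      by (simp add: Lp_norm_finite_eq[OF False] epowr_ennreal del: ennreal_numeral)
    moreover have "3 powr (1 / ?r) \<le> (3 :: real) powr 1" using r2[OF False] by (intro powr_mono) auto
    ultimately show ?thesis by (simp add: ennreal_leI del: ennreal_numeral)
  qed
  have f_Lp: "?f N \<in> Lp lborel p" for N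
    using f_norm[of N] by (auto simp: Lp_def intro: le_less_trans)
  have bound: "sqrt (ln 2) / 2 * real N powr (1 / 2 - e) \<le> 3 * C" if N: "0 < N" for N
  proof -
    let ?V = "vertical lborel gated_kernel (?f N)"
    define c where "c = sqrt (real N * ln 2 / 4)"
    have c: "0 < c" "c\<^sup>2 = real N * ln 2 / 4" using N by (auto simp: c_def)
    have V: "ennreal c \<le> ?V x" if "x \<in> comb N" for x
    proof -
      have "(ennreal c)\<^sup>2 \<le> (?V x)\<^sup>2" unfolding ennreal_power[OF less_imp_le[OF c(1)]] c(2) by (rule vertical_gated_ge[OF N that])
      then show ?thesis by (simp only: ennreal_power2_le_iff)
    qed
    have le: "Lp_norm lborel p ?V \<le> ennreal (3 * C)"
    proof -
      have "Lp_norm lborel p ?V \<le> ennreal C0 * Lp_norm lborel p (\<lambda>x. ennreal (norm (?f N x)))" by (rule C0[OF f_Lp])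
      also have "\<dots> \<le> ennreal C * ennreal 3" using C by (intro mult_mono f_norm) auto
      also have "\<dots> = ennreal (3 * C)" using C by (simp add: ennreal_mult'[symmetric] mult.commute del: ennreal_numeral)
      finally show ?thesis .
    qed
    have "ennreal (c * (1 / real N) powr e) \<le> Lp_norm lborel p ?V"
    proof (cases "p = \<infinity>")
      case True
      show ?thesis
      proof (rule ccontr)
        assume "\<not> ?thesis"
        then have lt: "esssup lborel ?V < ennreal c" using True N by (simp add: Lp_norm_def e_def not_le)
        have "AE x in lborel. x \<notin> comb N"
          using esssup_AE[of ?V lborel] by eventually_elim (use V lt in \<open>force dest: leD intro: order_trans\<close>)
        then have "(\<integral>\<^sup>+x. indicator (comb N) x \<partial>lborel) = (\<integral>\<^sup>+x. 0 \<partial>(lborel :: real measure))"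
          by (intro nn_integral_cong_AE) (auto elim: eventually_mono)
        then show False using emeasure_comb[OF N] N by simp
      qed
    next
      case False
      let ?r = "enn2real p"
      have r: "0 < ?r" using r2[OF False] by simp
      have "ennreal (c powr ?r * (1 / real N)) = ennreal (c powr ?r) * ennreal (1 / real N)"
        by (rule ennreal_mult') simp
      also have "\<dots> = (\<integral>\<^sup>+x. ennreal (c powr ?r) * indicator (comb N) x \<partial>lborel)"
        using emeasure_comb[OF N] by (subst nn_integral_cmult_indicator) simp_all
      also have "\<dots> \<le> (\<integral>\<^sup>+x. epowr (?V x) ?r \<partial>lborel)"
      proof (rule nn_integral_mono)
        fix x
        show "ennreal (c powr ?r) * indicator (comb N) x \<le> epowr (?V x) ?r"
        proof (cases "x \<in> comb N")
          case True
          have "ennreal (c powr ?r) = epowr (ennreal c) ?r" using c by (simp add: epowr_ennreal)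
          also have "\<dots> \<le> epowr (?V x) ?r" using V[OF True] r by (intro epowr_mono) auto
          finally show ?thesis using True by simp
        qed simp
      qed
      finally have "epowr (ennreal (c powr ?r * (1 / real N))) (1 / ?r) \<le> Lp_norm lborel p ?V"
        unfolding Lp_norm_finite_eq[OF False] using r by (intro epowr_mono) auto
      moreover have "epowr (ennreal (c powr ?r * (1 / real N))) (1 / ?r) = ennreal (c * (1 / real N) powr e)"
      proof -
        have "(c powr ?r * (1 / real N)) powr (1 / ?r) = (c powr ?r) powr (1 / ?r) * (1 / real N) powr (1 / ?r)"
          by (subst powr_mult) (use c N in auto)
        also have "(c powr ?r) powr (1 / ?r) = c" using c r by (simp add: powr_powr)
        finally show ?thesis using False by (simp add: epowr_ennreal e_def del: times_divide_eq_right)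
      qed
      ultimately show ?thesis by simp
    qed
    from order_trans[OF this le] have "c * (1 / real N) powr e \<le> 3 * C"
      by (subst (asm) ennreal_le_iff) (use C in auto)
    moreover have "c * (1 / real N) powr e = sqrt (ln 2) / 2 * real N powr (1 / 2 - e)"
    proof -
      have "c = sqrt (ln 2) / 2 * real N powr (1 / 2)"
        using N by (simp add: c_def real_sqrt_mult real_sqrt_divide powr_half_sqrt)
      moreover have "(1 / real N) powr e = real N powr (- e)" using N by (simp add: powr_divide powr_minus_divide)
      ultimately show ?thesis using powr_add[of "real N" "1 / 2" "- e"] by simp
    qed
    ultimately show ?thesis by simp
  qed
  obtain N :: nat where "0 < N" "3 * C < sqrt (ln 2) / 2 * real N powr (1 / 2 - e)"
    by (rule exists_power_gt[of "sqrt (ln 2) / 2" "1 / 2 - e" "3 * C"]) (use e in auto)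
  with bound[of N] show False by simp
qed

theorem theorem1p5:
  fixes \<mu> :: "'a::euclidean_space measure"
    and s :: "real \<Rightarrow> 'a \<Rightarrow> 'a \<Rightarrow> complex"
    and m \<alpha> \<kappa> :: real
  assumes "standing_assumptions m \<alpha> \<mu> s"
    and "1 < \<kappa>"
  shows "(bounded_on_Lp 2 \<mu> (conical m \<mu> s) \<longrightarrow>
            bounded_L1_weak_L1 \<mu> (conical m \<mu> s) \<and>
            bounded_Linf_RBMO m \<kappa> \<mu> (conical m \<mu> s) \<and>
            (\<forall>p. 1 < p \<and> p < \<infinity> \<longrightarrow> bounded_on_Lp p \<mu> (conical m \<mu> s))) \<and>
         (bounded_on_Lp 2 \<mu> (vertical \<mu> s) \<longrightarrow>
            bounded_L1_weak_L1 \<mu> (vertical \<mu> s) \<and>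
            (\<forall>p. 1 < p \<and> p \<le> 2 \<longrightarrow> bounded_on_Lp p \<mu> (vertical \<mu> s))) \<and>
         (\<forall>\<beta>. 0 < \<beta> \<and> \<beta> \<le> 1 \<longrightarrow>
            (\<exists>\<sigma> :: real \<Rightarrow> real \<Rightarrow> real \<Rightarrow> complex.
               standing_assumptions 1 \<beta> lborel \<sigma> \<and>
               bounded_on_Lp 2 lborel (vertical lborel \<sigma>) \<and>
               (\<forall>p>2. \<not> bounded_on_Lp p lborel (vertical lborel \<sigma>))))"
proof (intro conjI)
  obtain A K where kernel: "standard_kernel \<mu> m A (extend_zero s) \<alpha> K"
    using standing_assumptions_imp_standard_kernel[OF assms(1)] by blast
  then interpret standard_kernel \<mu> m A "extend_zero s" \<alpha> K .
  have con: "conical m \<mu> s f = conical.sq (T f)" and ver: "vertical \<mu> s f = vertical.sq (T f)"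
    if "f \<in> borel_measurable borel" for f
    using conical_eq_norm2[OF kernel that] vertical_eq_norm2[OF kernel that]
    by (auto simp: fun_eq_iff conical.sq_def vertical.sq_def)
  show "bounded_on_Lp 2 \<mu> (conical m \<mu> s) \<longrightarrow>
            bounded_L1_weak_L1 \<mu> (conical m \<mu> s) \<and>
            bounded_Linf_RBMO m \<kappa> \<mu> (conical m \<mu> s) \<and>
            (\<forall>p. 1 < p \<and> p < \<infinity> \<longrightarrow> bounded_on_Lp p \<mu> (conical m \<mu> s))"
  proof
    assume L2: "bounded_on_Lp 2 \<mu> (conical m \<mu> s)"
    then obtain C where C: "0 \<le> C" and le: "\<forall>f\<in>borel_measurable \<mu>. (\<integral>\<^sup>+y. (ennreal (norm (f y)))\<^sup>2 \<partial>\<mu>) < \<infinity> \<longrightarrow>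
      (\<integral>\<^sup>+x. (conical m \<mu> s f x)\<^sup>2 \<partial>\<mu>) \<le> ennreal C * (\<integral>\<^sup>+y. (ennreal (norm (f y)))\<^sup>2 \<partial>\<mu>)"
      unfolding bounded_on_L2_iff by blast
    interpret L2_conical \<mu> m A "extend_zero s" \<alpha> K "C + 1"
    proof
      fix g :: "'a \<Rightarrow> complex" assume g: "g \<in> borel_measurable borel" "(\<integral>\<^sup>+y. (ennreal (norm (g y)))\<^sup>2 \<partial>\<mu>) < \<infinity>"
      then have "(\<integral>\<^sup>+x. (conical.sq (T g) x)\<^sup>2 \<partial>\<mu>) \<le> ennreal C * (\<integral>\<^sup>+y. (ennreal (norm (g y)))\<^sup>2 \<partial>\<mu>)"
        using le con by simp
      also have "\<dots> \<le> ennreal (C + 1) * (\<integral>\<^sup>+y. (ennreal (norm (g y)))\<^sup>2 \<partial>\<mu>)" by (intro mult_right_mono ennreal_leI) auto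
      finally show "(\<integral>\<^sup>+x. (conical.sq (T g) x)\<^sup>2 \<partial>\<mu>) \<le> ennreal (C + 1) * (\<integral>\<^sup>+y. (ennreal (norm (g y)))\<^sup>2 \<partial>\<mu>)" .
    qed (use C in simp)
    show "bounded_L1_weak_L1 \<mu> (conical m \<mu> s) \<and> bounded_Linf_RBMO m \<kappa> \<mu> (conical m \<mu> s) \<and>
            (\<forall>p. 1 < p \<and> p < \<infinity> \<longrightarrow> bounded_on_Lp p \<mu> (conical m \<mu> s))"
    proof (intro conjI allI impI)
      fix p :: ennreal assume p: "1 < p \<and> p < \<infinity>"
      consider "p < 2" | "p = 2" | "2 < p" by (rule linorder_cases)
      then show "bounded_on_Lp p \<mu> (conical m \<mu> s)"
        using p L2 L2.bounded_weak_and_below_2(2)[OF con] bounded_above_2[OF con] by cases auto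
    qed (use L2.bounded_weak_and_below_2(1)[OF con] bounded_Linf_RBMO_conical[OF con assms(2)] in auto)
  qed
  show "bounded_on_Lp 2 \<mu> (vertical \<mu> s) \<longrightarrow>
            bounded_L1_weak_L1 \<mu> (vertical \<mu> s) \<and>
            (\<forall>p. 1 < p \<and> p \<le> 2 \<longrightarrow> bounded_on_Lp p \<mu> (vertical \<mu> s))"
  proof
    assume L2: "bounded_on_Lp 2 \<mu> (vertical \<mu> s)"
    then obtain C where C: "0 \<le> C" and le: "\<forall>f\<in>borel_measurable \<mu>. (\<integral>\<^sup>+y. (ennreal (norm (f y)))\<^sup>2 \<partial>\<mu>) < \<infinity> \<longrightarrow>
      (\<integral>\<^sup>+x. (vertical \<mu> s f x)\<^sup>2 \<partial>\<mu>) \<le> ennreal C * (\<integral>\<^sup>+y. (ennreal (norm (f y)))\<^sup>2 \<partial>\<mu>)"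
      unfolding bounded_on_L2_iff by blast
    interpret V: L2_square_function \<mu> m A "extend_zero s" \<alpha> K ray_measure 1 "C + 1"
    proof
      fix g :: "'a \<Rightarrow> complex" assume g: "g \<in> borel_measurable borel" "(\<integral>\<^sup>+y. (ennreal (norm (g y)))\<^sup>2 \<partial>\<mu>) < \<infinity>"
      then have "(\<integral>\<^sup>+x. (vertical.sq (T g) x)\<^sup>2 \<partial>\<mu>) \<le> ennreal C * (\<integral>\<^sup>+y. (ennreal (norm (g y)))\<^sup>2 \<partial>\<mu>)"
        using le ver by simp
      also have "\<dots> \<le> ennreal (C + 1) * (\<integral>\<^sup>+y. (ennreal (norm (g y)))\<^sup>2 \<partial>\<mu>)" by (intro mult_right_mono ennreal_leI) auto
      finally show "(\<integral>\<^sup>+x. (vertical.sq (T g) x)\<^sup>2 \<partial>\<mu>) \<le> ennreal (C + 1) * (\<integral>\<^sup>+y. (ennreal (norm (g y)))\<^sup>2 \<partial>\<mu>)" .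
    qed (use C in simp)
    show "bounded_L1_weak_L1 \<mu> (vertical \<mu> s) \<and> (\<forall>p. 1 < p \<and> p \<le> 2 \<longrightarrow> bounded_on_Lp p \<mu> (vertical \<mu> s))"
    proof (intro conjI allI impI)
      fix p :: ennreal assume p: "1 < p \<and> p \<le> 2"
      then consider "p < 2" | "p = 2" by (auto simp: le_less)
      then show "bounded_on_Lp p \<mu> (vertical \<mu> s)"
        using p L2 V.bounded_weak_and_below_2(2)[OF ver] by cases auto
    qed (use V.bounded_weak_and_below_2(1)[OF ver] in auto)
  qed
  have "bounded_on_Lp 2 lborel (vertical lborel gated_kernel)"
    unfolding bounded_on_L2_iff using gated_L2 by (intro exI[of _ 32]) auto
  then show "\<forall>\<beta>. 0 < \<beta> \<and> \<beta> \<le> 1 \<longrightarrow>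
            (\<exists>\<sigma> :: real \<Rightarrow> real \<Rightarrow> real \<Rightarrow> complex.
               standing_assumptions 1 \<beta> lborel \<sigma> \<and>
               bounded_on_Lp 2 lborel (vertical lborel \<sigma>) \<and>
               (\<forall>p>2. \<not> bounded_on_Lp p lborel (vertical lborel \<sigma>)))"
    using gated_kernel_standing gated_unbounded by blast
qed

end
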